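(* Let $0<m\le M$, $k,K\in\mathbb R$ and $N>1$. The class of covered Lorentzian pre-length spaces $(X,\mathcal U)$ described as follows is precompact with respect to Lorentzian Gromov–Hausdorff convergence: (1) $X={}^{-}\mathbb R\times_fY$ is a globally hyperbolic, timelike non-branching, regular Lorentzian length space which is a generalized cone with $m\le f\le M$, the global $\mathrm{TCBA}(k)$-condition holds, and $X$ can be equipped with a non-negative, full-support Radon measure $\mathfrak m$ such that it (and its causally reversed structure) satisfies the $\mathrm{TMCP}^e(K,N)$-condition. (2) $\mathcal U=\{U_n\}_{n\in\mathbb N}=\{I((t-n,y),(t+n,y))\}_{n\in\mathbb N}$ for some fixed $(t,y)\in X$.
   Context: **Covered spaces and Lorentzian Gromov–Hausdorff (LGH) convergence (Mondino–Sämann).** A covered Lorentzian pre-length space $(X,\mathcal U)$ is a Lorentzian pre-length space $X$ with a countable cover $\mathcal U=\{U_k\}_{k\in\mathbb N}$, $U_k\subset U_{k+1}$. For $A\subset X$, $\varepsilon>0$, an $\varepsilon$-net for $A$ is a collection of causal diamonds $\{J(p_i,q_i)\}_{i\in\Omega}$ with $\tau(p_i,q_i)\le\varepsilon$, $A\cap J(p_i,q_i)\neq\emptyset$ and $A\subset\bigcup_iJ(p_i,q_i)$; its vertex set is $V(S)=\{p_i,q_i:i\in\Omega\}$. A correspondence between sets $V,W$ is $R\subset V\times W$ with both projections surjective; for subsets of Lorentzian pre-length spaces its distortion is $\operatorname{dis}R=\sup\{|\tau_V(v,v')-\tau_W(w,w')|:(v,w),(v',w')\in R\}$. $(X_n,\mathcal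 U_n)$ converges to $(X,\mathcal U)$ if for all $k,l\in\mathbb N$ there are finite $1/l$-nets $S^{k,l}_n$ of $U_{n,k}$ in $X_n$ (for all large $n$) and $S^{k,l}$ of $U_k$ in $X$, with vertex sets increasing in $l$, and correspondences $R^{k,l}_n$ between $V(S^{k,l}_n)$ and $V(S^{k,l})$, increasing in $l$ and matching the diamonds of the nets, with $\operatorname{dis}R^{k,l}_n\to0$ as $n\to\infty$, and such that $\bigcup_lV(S^{k,l})$ is forward dense in $U_k$, i.e. each $x\in U_k$ is the limit of a sequence $v_1\le v_2\le\dots\le x$ of such vertices. A class is precompact if every sequence in it has a subsequence converging to some covered Lorentzian pre-length space (not necessarily in the class). **Generalized cones.** Let $(Y,d_Y)$ be a length space, $J\subset\mathbb R$ an open interval, $f:J\to(0,\infty)$ continuous. On $J\times Y$ put $D((t,y),(t',y'))=|t-t'|+d_Y(y,y')$. An absolutely continuous curve $\gamma=(\alpha,\beta)$ with $\alpha$ strictly monotone is timelike/null/causal if $-\dot\alpha^2+(f\circ\alpha)^2v_\beta^2$ is $<0$/$=0$/$\le0$ a.e., $v_\beta$ being the metric derivative of $\beta$; it is future directed if $\alpha$ is increasing. $x\ll x'$ (resp. $x\le x'$) iff there is a future-directed timelike (resp. causal) curve from $x$ to $x'$, and $x\le x$ always. $L(\gamma)=\int\sqrt{\dot\alpha^2-(f\circ\alpha)^2v_\beta^2}$ and $\tau(x,y)=\sup L(\gamma)$ over future-directed causal curves from $x$ to $y$ (0 if none). The Lorentzian pre-length space $(J\times Y,D,\ll,\le,\tau)$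 is ${}^{-}J\times_fY$. **Lorentzian pre-length spaces.** A Lorentzian pre-length space $(X,d,\ll,\le,\tau)$ is a set $X$ with a metric $d$, transitive relations $\ll\,\subset\,\le$ with $\le$ reflexive, and a map $\tau:X\times X\to[0,\infty]$ that is lower semicontinuous for $d$, satisfies $\tau(p,r)\ge\tau(p,q)+\tau(q,r)$ for $p\le q\le r$, and $\tau(p,q)>0\iff p\ll q$. Put $I^+(p)=\{q:p\ll q\}$, $I^-(q)=\{p:p\ll q\}$, and $J^\pm$ likewise with $\le$; $I(p,q)=I^+(p)\cap I^-(q)$ (chronological diamond), $J(p,q)=J^+(p)\cap J^-(q)$ (causal diamond). A non-constant locally Lipschitz curve $\gamma$ is future-directed causal (timelike) if $\gamma(s)\le\gamma(t)$ ($\gamma(s)\ll\gamma(t)$) for all $s<t$, and null if it is causal and no two of its points are $\ll$-related. $L_\tau(\gamma)$ is the infimum over partitions of $\sum_i\tau(\gamma(t_i),\gamma(t_{i+1}))$. A distance realiser (geodesic) from $p$ to $q$ is a future-directed causal curve from $p$ to $q$ with $L_\tau=\tau(p,q)$. **Lorentzian length spaces.** $X$ is a Lorentzian length space if it is: causally path connected ($p\ll q$, resp. $p\le q$ with $p\neq q$, are joined by a future-directed timelike, resp. causal, curve); locally causally closed (each point has a neighbourhood $U$ such that $p_n,q_n\in U$, $p_n\le q_n$, $p_n\to p\in\overline U$, $q_n\to q\in\overline U$ imply $p\le q$); intrinsic ($\tau(p,q)$ is the supremum of $L_\tau$ over future-directed causal curves from $p$ to $q$, for causally related points); and localizable: each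 $x$ has an open neighbourhood $\Omega_x$ such that (i) the $d$-lengths of causal curves in $\Omega_x$ are uniformly bounded; (ii) there is a continuous $\omega_x:\Omega_x\times\Omega_x\to[0,\infty)$ making $\Omega_x$ with restricted $d,\ll,\le$ a Lorentzian pre-length space, and $I^\pm(y)\cap\Omega_x\ne\emptyset$ for $y\in\Omega_x$; (iii) all $p\le q$, $p\ne q$, in $\Omega_x$ are joined by a future-directed causal curve $\gamma_{p,q}$ in $\Omega_x$ maximizing $L_\tau$ among such curves in $\Omega_x$, with $L_\tau(\gamma_{p,q})=\omega_x(p,q)\le\tau(p,q)$. It is regular (regularly localizable) if moreover, whenever $p\ll q$ in $\Omega_x$, $\gamma_{p,q}$ is timelike and strictly longer than any future-directed causal curve in $\Omega_x$ from $p$ to $q$ containing a null segment. $X$ is globally hyperbolic if all $J(p,q)$ are compact and for each compact set the $d$-lengths of causal curves contained in it are bounded. It is timelike non-branching if two distance realisers on $[0,\varepsilon)$ which agree on $[0,t]$ for some $t\in(0,\varepsilon)$ are equal (timelike geodesics are parametrized by $\tau$-arclength). The causally reversed structure replaces $\ll,\le$ by the opposite relations and $\tau(x,y)$ by $\tau(y,x)$. **$\mathrm{TMCP}^e(K,N)$.** For $p\in(0,1)$ and Borel probability measures $\mu,\nu$, $\ell_p(\mu,\nu)=\sup_\pi(\int\tau^p\,d\pi)^{1/p}$ over couplings $\pi$ concentrated on $\{x\le y\}$ ($-\infty$ if none). An $\ell_p$-geodesic is a curve $(\mu_t)_{t\in[0,1]}$ with $\ell_p(\mu_s,\mu_t)=(t-s)\ell_p(\mu_0,\mu_1)\in(0,\infty)$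 for $s<t$. $\mathrm{Ent}(\mu|\mathfrak m)=\int\rho\log\rho\,d\mathfrak m$ if $\mu=\rho\mathfrak m$ and $(\rho\log\rho)_+$ is integrable, $+\infty$ otherwise; $\mathrm{Dom}(\mathrm{Ent})=\{|\mathrm{Ent}|<\infty\}$; $U_N(\mu|\mathfrak m)=e^{-\mathrm{Ent}(\mu|\mathfrak m)/N}$. $\sigma^{(t)}_\kappa(\theta)=\frac{\sin(t\sqrt\kappa\theta)}{\sin(\sqrt\kappa\theta)}$ if $0<\kappa\theta^2<\pi^2$, $t$ if $\kappa\theta^2=0$, $\frac{\sinh(t\sqrt{-\kappa}\theta)}{\sinh(\sqrt{-\kappa}\theta)}$ if $\kappa\theta^2<0$, $+\infty$ if $\kappa\theta^2\ge\pi^2$. $X$ satisfies $\mathrm{TMCP}^e(K,N)$ if for every compactly supported probability $\mu_0\in\mathrm{Dom}(\mathrm{Ent})$, every $x_1$ with $x\ll x_1$ for $\mu_0$-a.e. $x$, and some (equivalently any) $p\in(0,1)$, there is an $\ell_p$-geodesic from $\mu_0$ to $\mu_1=\delta_{x_1}$ with $U_N(\mu_t|\mathfrak m)\ge\sigma^{(1-t)}_{K/N}(\|\tau(\cdot,x_1)\|_{L^2(\mu_0)})U_N(\mu_0|\mathfrak m)$ for all $t\in[0,1)$. **Global $\mathrm{TCBA}(k)$.** $D_k=\pi/\sqrt{-k}$ for $k<0$, $D_k=\infty$ otherwise. $\mathbb L^2(k)$ is the two-dimensional simply connected Lorentzian model space of constant curvature $k$: Minkowski plane $\mathbb R^2_1$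 for $k=0$; universal cover of $\{b(v,v)=1/k\}$ in $\mathbb R^3_1$ for $k>0$ and in $\mathbb R^3_2$ for $k<0$, where $\mathbb R^n_m$ has the inner product $b$ with $m$ negative directions; $\bar\tau$ is its time separation. An admissible causal triangle consists of $p_1\ll p_2\le p_3$ or $p_1\le p_2\ll p_3$ with finite mutual $\tau$, and (possibly constant) future-directed causal distance realisers as sides; a side is timelike if its endpoints are $\ll$-related. A comparison triangle in $\mathbb L^2(k)$ is an admissible causal triangle with the same side lengths; a point $q$ on a timelike side from $p_i$ to $p_j$ corresponds to $\bar q$ on the comparison side with $\bar\tau(\bar p_i,\bar q)=\tau(p_i,q)$. A globally hyperbolic Lorentzian length space satisfies global $\mathrm{TCBA}(k)$ if for every admissible causal triangle with all side lengths $<D_k$ and all $p,q$ on its timelike sides with corresponding points $\bar p,\bar q$ in a comparison triangle, $\tau(p,q)\ge\bar\tau(\bar p,\bar q)$. *)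

theory Defs
  imports "HOL-Analysis.Analysis" "HOL-Probability.Probability"
begin

text \<open>
  Conventions. Spaces are carrier-based: the points are the carrier of a value of the library type
  of metrics, and relations and functions are only meaningful on that carrier.
  Time separations and lengths are extended nonnegative reals. A supremum over the empty set is
  \<open>0\<close> in \<open>ennreal\<close> and \<open>-\<infinity>\<close> in \<open>ereal\<close>, which matches the conventions used below.
  Indices of covers, nets and exhausting diamonds are the positive integers.
  A curve between two given points is parametrized on \<open>{0..1}\<close>; as all notions involved are
  invariant under affine reparametrization, this is no loss of generality.
\<close>

section \<open>Lorentzian pre-length spaces\<close>

record 'a lorentz_space =
  met :: "'a metric"
  chron :: "'a \<Rightarrow> 'a \<Rightarrow> bool"
  caus :: "'a \<Rightarrow> 'a \<Rightarrow> bool"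
  tsep :: "'a \<Rightarrow> 'a \<Rightarrow> ennreal"

abbreviation pts :: "'a lorentz_space \<Rightarrow> 'a set" where
  "pts X \<equiv> mspace (met X)"

abbreviation ltop :: "'a lorentz_space \<Rightarrow> 'a topology" where
  "ltop X \<equiv> mtopology_of (met X)"

definition lorentzian_pre_length_space :: "'a lorentz_space \<Rightarrow> bool" where
  "lorentzian_pre_length_space X \<longleftrightarrow>
     transp_on (pts X) (chron X) \<and> transp_on (pts X) (caus X) \<and> reflp_on (pts X) (caus X) \<and>
     (\<forall>p\<in>pts X. \<forall>q\<in>pts X. chron X p q \<longrightarrow> caus X p q) \<and>
     (\<forall>c. openin (prod_topology (ltop X) (ltop X))
            {z \<in> pts X \<times> pts X. c < tsep X (fst z) (snd z)}) \<and>
     (\<forall>p\<in>pts X. \<forall>q\<in>pts X. \<forall>r\<in>pts X. caus X p q \<longrightarrow> caus X q r \<longrightarrow>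
        tsep X p q + tsep X q r \<le> tsep X p r) \<and>
     (\<forall>p\<in>pts X. \<forall>q\<in>pts X. 0 < tsep X p q \<longleftrightarrow> chron X p q)"

definition chron_future :: "'a lorentz_space \<Rightarrow> 'a \<Rightarrow> 'a set" where
  "chron_future X p = {q \<in> pts X. chron X p q}"

definition chron_past :: "'a lorentz_space \<Rightarrow> 'a \<Rightarrow> 'a set" where
  "chron_past X q = {p \<in> pts X. chron X p q}"

definition causal_future :: "'a lorentz_space \<Rightarrow> 'a \<Rightarrow> 'a set" where
  "causal_future X p = {q \<in> pts X. caus X p q}"

definition causal_past :: "'a lorentz_space \<Rightarrow> 'a \<Rightarrow> 'a set" where
  "causal_past X q = {p \<in> pts X. caus X p q}"

definition chron_diamond :: "'a lorentz_space \<Rightarrow> 'a \<Rightarrow> 'a \<Rightarrow> 'a set" where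
  "chron_diamond X p q = chron_future X p \<inter> chron_past X q"

definition causal_diamond :: "'a lorentz_space \<Rightarrow> 'a \<Rightarrow> 'a \<Rightarrow> 'a set" where
  "causal_diamond X p q = causal_future X p \<inter> causal_past X q"

definition causal_reversal :: "'a lorentz_space \<Rightarrow> 'a lorentz_space" where
  "causal_reversal X =
     \<lparr>met = met X, chron = (\<lambda>x y. chron X y x), caus = (\<lambda>x y. caus X y x),
      tsep = (\<lambda>x y. tsep X y x)\<rparr>"

section \<open>Curves and lengths\<close>

definition partition_points :: "real set \<Rightarrow> nat \<Rightarrow> (nat \<Rightarrow> real) \<Rightarrow> bool" where
  "partition_points I n t \<longleftrightarrow> (\<forall>i\<le>n. t i \<in> I) \<and> (\<forall>i<n. t i < t (Suc i))"

definition metric_length :: "'a metric \<Rightarrow> real set \<Rightarrow> (real \<Rightarrow> 'a) \<Rightarrow> ennreal" where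
  "metric_length Y I \<gamma> =
     (SUP (n, t) \<in> {(n, t). partition_points I n t}.
        \<Sum>i<n. ennreal (mdist Y (\<gamma> (t i)) (\<gamma> (t (Suc i)))))"

definition tau_length :: "'a lorentz_space \<Rightarrow> real \<Rightarrow> real \<Rightarrow> (real \<Rightarrow> 'a) \<Rightarrow> ennreal" where
  "tau_length X a b \<gamma> =
     (INF (n, t) \<in> {(n, t). partition_points {a..b} n t \<and> t 0 = a \<and> t n = b}.
        \<Sum>i<n. tsep X (\<gamma> (t i)) (\<gamma> (t (Suc i))))"

definition locally_Lipschitz_curve :: "'a metric \<Rightarrow> real set \<Rightarrow> (real \<Rightarrow> 'a) \<Rightarrow> bool" where
  "locally_Lipschitz_curve Y I \<gamma> \<longleftrightarrow>
     (\<forall>t\<in>I. \<exists>e>0. Lipschitz_continuous_map (submetric euclidean_metric (I \<inter> ball t e)) Y \<gamma>)"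

definition admissible_curve :: "'a lorentz_space \<Rightarrow> real set \<Rightarrow> (real \<Rightarrow> 'a) \<Rightarrow> bool" where
  "admissible_curve X I \<gamma> \<longleftrightarrow>
     is_interval I \<and> locally_Lipschitz_curve (met X) I \<gamma> \<and> (\<exists>s\<in>I. \<exists>t\<in>I. \<gamma> s \<noteq> \<gamma> t)"

definition future_causal_curve :: "'a lorentz_space \<Rightarrow> real set \<Rightarrow> (real \<Rightarrow> 'a) \<Rightarrow> bool" where
  "future_causal_curve X I \<gamma> \<longleftrightarrow>
     admissible_curve X I \<gamma> \<and> (\<forall>s\<in>I. \<forall>t\<in>I. s < t \<longrightarrow> caus X (\<gamma> s) (\<gamma> t))"

definition future_timelike_curve :: "'a lorentz_space \<Rightarrow> real set \<Rightarrow> (real \<Rightarrow> 'a) \<Rightarrow> bool" where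
  "future_timelike_curve X I \<gamma> \<longleftrightarrow>
     admissible_curve X I \<gamma> \<and> (\<forall>s\<in>I. \<forall>t\<in>I. s < t \<longrightarrow> chron X (\<gamma> s) (\<gamma> t))"

definition future_null_curve :: "'a lorentz_space \<Rightarrow> real set \<Rightarrow> (real \<Rightarrow> 'a) \<Rightarrow> bool" where
  "future_null_curve X I \<gamma> \<longleftrightarrow>
     future_causal_curve X I \<gamma> \<and> (\<forall>s\<in>I. \<forall>t\<in>I. s \<noteq> t \<longrightarrow> \<not> chron X (\<gamma> s) (\<gamma> t))"

text \<open>Causal curves of either time orientation.\<close>

definition causal_curve :: "'a lorentz_space \<Rightarrow> real set \<Rightarrow> (real \<Rightarrow> 'a) \<Rightarrow> bool" where
  "causal_curve X I \<gamma> \<longleftrightarrow>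
     future_causal_curve X I \<gamma> \<or> future_causal_curve (causal_reversal X) I \<gamma>"

definition causal_curves_between :: "'a lorentz_space \<Rightarrow> 'a \<Rightarrow> 'a \<Rightarrow> (real \<Rightarrow> 'a) set" where
  "causal_curves_between X p q =
     {\<gamma>. future_causal_curve X {0..1} \<gamma> \<and> \<gamma> 0 = p \<and> \<gamma> 1 = q}"

definition distance_realiser :: "'a lorentz_space \<Rightarrow> 'a \<Rightarrow> 'a \<Rightarrow> (real \<Rightarrow> 'a) \<Rightarrow> bool" where
  "distance_realiser X p q \<gamma> \<longleftrightarrow>
     \<gamma> \<in> causal_curves_between X p q \<and> tau_length X 0 1 \<gamma> = tsep X p q"

section \<open>Lorentzian length spaces\<close>

definition causally_path_connected :: "'a lorentz_space \<Rightarrow> bool" where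
  "causally_path_connected X \<longleftrightarrow>
     (\<forall>p\<in>pts X. \<forall>q\<in>pts X.
        (chron X p q \<longrightarrow> (\<exists>\<gamma>. future_timelike_curve X {0..1} \<gamma> \<and> \<gamma> 0 = p \<and> \<gamma> 1 = q)) \<and>
        (caus X p q \<and> p \<noteq> q \<longrightarrow> causal_curves_between X p q \<noteq> {}))"

definition locally_causally_closed :: "'a lorentz_space \<Rightarrow> bool" where
  "locally_causally_closed X \<longleftrightarrow>
     (\<forall>x\<in>pts X. \<exists>U. U \<subseteq> pts X \<and> x \<in> ltop X interior_of U \<and>
        (\<forall>p q p' q'.
           (\<forall>n::nat. p n \<in> U \<and> q n \<in> U \<and> caus X (p n) (q n)) \<and>
           p' \<in> ltop X closure_of U \<and> limitin (ltop X) p p' sequentially \<and>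
           q' \<in> ltop X closure_of U \<and> limitin (ltop X) q q' sequentially
           \<longrightarrow> caus X p' q'))"

definition intrinsic :: "'a lorentz_space \<Rightarrow> bool" where
  "intrinsic X \<longleftrightarrow>
     (\<forall>p\<in>pts X. \<forall>q\<in>pts X. caus X p q \<longrightarrow>
        tsep X p q = (SUP \<gamma> \<in> causal_curves_between X p q. tau_length X 0 1 \<gamma>))"

definition localizing_nbhd ::
  "'a lorentz_space \<Rightarrow> 'a \<Rightarrow> 'a set \<Rightarrow> ('a \<Rightarrow> 'a \<Rightarrow> real) \<Rightarrow> bool" where
  "localizing_nbhd X x \<Omega> \<omega> \<longleftrightarrow>
     openin (ltop X) \<Omega> \<and> x \<in> \<Omega> \<and>
     (\<exists>C::real. \<forall>I \<gamma>. causal_curve X I \<gamma> \<and> \<gamma> ` I \<subseteq> \<Omega> \<longrightarrow> metric_length (met X) I \<gamma> \<le> ennreal C) \<and>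
     (\<forall>p\<in>\<Omega>. \<forall>q\<in>\<Omega>. 0 \<le> \<omega> p q) \<and>
     continuous_map (prod_topology (subtopology (ltop X) \<Omega>) (subtopology (ltop X) \<Omega>))
       euclideanreal (\<lambda>(p, q). \<omega> p q) \<and>
     lorentzian_pre_length_space
       \<lparr>met = submetric (met X) \<Omega>, chron = chron X, caus = caus X,
        tsep = (\<lambda>p q. ennreal (\<omega> p q))\<rparr> \<and>
     (\<forall>y\<in>\<Omega>. chron_future X y \<inter> \<Omega> \<noteq> {} \<and> chron_past X y \<inter> \<Omega> \<noteq> {})"

definition local_maximiser ::
  "'a lorentz_space \<Rightarrow> 'a set \<Rightarrow> ('a \<Rightarrow> 'a \<Rightarrow> real) \<Rightarrow> 'a \<Rightarrow> 'a \<Rightarrow> (real \<Rightarrow> 'a) \<Rightarrow> bool" where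
  "local_maximiser X \<Omega> \<omega> p q \<gamma> \<longleftrightarrow>
     \<gamma> \<in> causal_curves_between X p q \<and> \<gamma> ` {0..1} \<subseteq> \<Omega> \<and>
     (\<forall>\<eta>\<in>causal_curves_between X p q. \<eta> ` {0..1} \<subseteq> \<Omega> \<longrightarrow>
        tau_length X 0 1 \<eta> \<le> tau_length X 0 1 \<gamma>) \<and>
     tau_length X 0 1 \<gamma> = ennreal (\<omega> p q) \<and> ennreal (\<omega> p q) \<le> tsep X p q"

definition contains_null_segment :: "'a lorentz_space \<Rightarrow> (real \<Rightarrow> 'a) \<Rightarrow> bool" where
  "contains_null_segment X \<gamma> \<longleftrightarrow>
     (\<exists>a b. 0 \<le> a \<and> a < b \<and> b \<le> 1 \<and> future_null_curve X {a..b} \<gamma>)"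

definition localizable :: "'a lorentz_space \<Rightarrow> bool" where
  "localizable X \<longleftrightarrow>
     (\<forall>x\<in>pts X. \<exists>\<Omega> \<omega>. localizing_nbhd X x \<Omega> \<omega> \<and>
        (\<forall>p\<in>\<Omega>. \<forall>q\<in>\<Omega>. caus X p q \<and> p \<noteq> q \<longrightarrow> (\<exists>\<gamma>. local_maximiser X \<Omega> \<omega> p q \<gamma>)))"

definition regularly_localizable :: "'a lorentz_space \<Rightarrow> bool" where
  "regularly_localizable X \<longleftrightarrow>
     (\<forall>x\<in>pts X. \<exists>\<Omega> \<omega>. localizing_nbhd X x \<Omega> \<omega> \<and>
        (\<forall>p\<in>\<Omega>. \<forall>q\<in>\<Omega>. caus X p q \<and> p \<noteq> q \<longrightarrow>
           (\<exists>\<gamma>. local_maximiser X \<Omega> \<omega> p q \<gamma> \<and>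
              (chron X p q \<longrightarrow>
                 future_timelike_curve X {0..1} \<gamma> \<and>
                 (\<forall>\<eta>\<in>causal_curves_between X p q. \<eta> ` {0..1} \<subseteq> \<Omega> \<and> contains_null_segment X \<eta> \<longrightarrow>
                    tau_length X 0 1 \<eta> < tau_length X 0 1 \<gamma>)))))"

definition lorentzian_length_space :: "'a lorentz_space \<Rightarrow> bool" where
  "lorentzian_length_space X \<longleftrightarrow>
     lorentzian_pre_length_space X \<and> causally_path_connected X \<and> locally_causally_closed X \<and>
     intrinsic X \<and> localizable X"

definition regular_lorentzian_length_space :: "'a lorentz_space \<Rightarrow> bool" where
  "regular_lorentzian_length_space X \<longleftrightarrow> lorentzian_length_space X \<and> regularly_localizable X"

definition globally_hyperbolic :: "'a lorentz_space \<Rightarrow> bool" where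
  "globally_hyperbolic X \<longleftrightarrow>
     (\<forall>p\<in>pts X. \<forall>q\<in>pts X. compactin (ltop X) (causal_diamond X p q)) \<and>
     (\<forall>K. compactin (ltop X) K \<longrightarrow>
        (\<exists>C::real. \<forall>I \<gamma>. causal_curve X I \<gamma> \<and> \<gamma> ` I \<subseteq> K \<longrightarrow>
           metric_length (met X) I \<gamma> \<le> ennreal C))"

text \<open>Timelike distance realisers on \<open>[0, \<epsilon>)\<close>, parametrized by \<open>\<tau>\<close>-arclength.\<close>

definition arclength_realiser :: "'a lorentz_space \<Rightarrow> real \<Rightarrow> (real \<Rightarrow> 'a) \<Rightarrow> bool" where
  "arclength_realiser X \<epsilon> \<gamma> \<longleftrightarrow>
     future_timelike_curve X {0..<\<epsilon>} \<gamma> \<and>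
     (\<forall>s t. 0 \<le> s \<and> s < t \<and> t < \<epsilon> \<longrightarrow>
        tau_length X s t \<gamma> = tsep X (\<gamma> s) (\<gamma> t) \<and> tau_length X s t \<gamma> = ennreal (t - s))"

definition timelike_non_branching :: "'a lorentz_space \<Rightarrow> bool" where
  "timelike_non_branching X \<longleftrightarrow>
     (\<forall>\<epsilon>>0. \<forall>\<gamma> \<eta>. arclength_realiser X \<epsilon> \<gamma> \<and> arclength_realiser X \<epsilon> \<eta> \<and>
        (\<exists>t\<in>{0<..<\<epsilon>}. \<forall>s\<in>{0..t}. \<gamma> s = \<eta> s) \<longrightarrow> (\<forall>s\<in>{0..<\<epsilon>}. \<gamma> s = \<eta> s))"

section \<open>Generalized cones\<close>

definition length_space :: "'a metric \<Rightarrow> bool" where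
  "length_space Y \<longleftrightarrow>
     (\<forall>x\<in>mspace Y. \<forall>y\<in>mspace Y.
        ennreal (mdist Y x y) =
          (INF \<gamma> \<in> {\<gamma>. continuous_map (top_of_set {0..1}) (mtopology_of Y) \<gamma> \<and> \<gamma> 0 = x \<and> \<gamma> 1 = y}.
             metric_length Y {0..1} \<gamma>))"

definition absolutely_continuous_curve :: "'a metric \<Rightarrow> (real \<Rightarrow> 'a) \<Rightarrow> bool" where
  "absolutely_continuous_curve Y \<gamma> \<longleftrightarrow>
     \<gamma> \<in> {0..1} \<rightarrow> mspace Y \<and>
     (\<forall>\<epsilon>>0. \<exists>\<delta>>0. \<forall>(n::nat) s t.
        (\<forall>i<n. 0 \<le> s i \<and> s i \<le> t i \<and> t i \<le> 1) \<and>
        disjoint_family_on (\<lambda>i. {s i<..<t i}) {..<n} \<and> (\<Sum>i<n. t i - s i) < \<delta> \<longrightarrow>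
        (\<Sum>i<n. mdist Y (\<gamma> (s i)) (\<gamma> (t i))) < \<epsilon>)"

definition metric_speed :: "'a metric \<Rightarrow> (real \<Rightarrow> 'a) \<Rightarrow> real \<Rightarrow> real" where
  "metric_speed Y \<beta> t = Lim (at t) (\<lambda>s. mdist Y (\<beta> s) (\<beta> t) / \<bar>s - t\<bar>)"

definition cone_metric :: "real set \<Rightarrow> 'a metric \<Rightarrow> (real \<times> 'a) metric" where
  "cone_metric J Y =
     metric (J \<times> mspace Y, \<lambda>(t, y) (t', y'). \<bar>t - t'\<bar> + mdist Y y y')"

lemma Metric_space_cone:
  "Metric_space (J \<times> mspace Y) (\<lambda>(t, y) (t', y'). \<bar>t - t'\<bar> + mdist Y y y')"
proof
  fix x y z :: "real \<times> 'a"
  assume "x \<in> J \<times> mspace Y" "y \<in> J \<times> mspace Y" "z \<in> J \<times> mspace Y"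
  then show "(case x of (t, y) \<Rightarrow> \<lambda>(t', y'). \<bar>t - t'\<bar> + mdist Y y y') z
    \<le> (case x of (t, y) \<Rightarrow> \<lambda>(t', y'). \<bar>t - t'\<bar> + mdist Y y y') y
      + (case y of (t, y) \<Rightarrow> \<lambda>(t', y'). \<bar>t - t'\<bar> + mdist Y y y') z"
    using mdist_triangle[of "snd x" Y "snd y" "snd z"] by (auto split: prod.splits)
qed (auto simp: mdist_commute abs_minus_commute add_nonneg_eq_0_iff split: prod.splits)

lemma mspace_cone_metric [simp]: "mspace (cone_metric J Y) = J \<times> mspace Y"
  unfolding cone_metric_def using Metric_space.mspace_metric[OF Metric_space_cone] .

lemma mdist_cone_metric [simp]:
  "mdist (cone_metric J Y) (t, y) (t', y') = \<bar>t - t'\<bar> + mdist Y y y'"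
  unfolding cone_metric_def Metric_space.mdist_metric[OF Metric_space_cone] by simp

text \<open>\<open>-\<alpha>'\<^sup>2 + (f \<circ> \<alpha>)\<^sup>2 v\<^sub>\<beta>\<^sup>2\<close> for a curve \<open>\<gamma> = (\<alpha>, \<beta>)\<close>.\<close>

definition cone_energy :: "(real \<Rightarrow> real) \<Rightarrow> 'a metric \<Rightarrow> (real \<Rightarrow> real \<times> 'a) \<Rightarrow> real \<Rightarrow> real" where
  "cone_energy f Y \<gamma> t =
     - (deriv (\<lambda>s. fst (\<gamma> s)) t)\<^sup>2 + (f (fst (\<gamma> t)))\<^sup>2 * (metric_speed Y (\<lambda>s. snd (\<gamma> s)) t)\<^sup>2"

definition cone_future_causal ::
  "real set \<Rightarrow> (real \<Rightarrow> real) \<Rightarrow> 'a metric \<Rightarrow> real \<times> 'a \<Rightarrow> real \<times> 'a \<Rightarrow> (real \<Rightarrow> real \<times> 'a) \<Rightarrow> bool" where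
  "cone_future_causal J f Y x y \<gamma> \<longleftrightarrow>
     \<gamma> 0 = x \<and> \<gamma> 1 = y \<and> absolutely_continuous_curve (cone_metric J Y) \<gamma> \<and>
     strict_mono_on {0..1} (\<lambda>t. fst (\<gamma> t)) \<and>
     (AE t in lebesgue_on {0..1}. cone_energy f Y \<gamma> t \<le> 0)"

definition cone_future_timelike ::
  "real set \<Rightarrow> (real \<Rightarrow> real) \<Rightarrow> 'a metric \<Rightarrow> real \<times> 'a \<Rightarrow> real \<times> 'a \<Rightarrow> (real \<Rightarrow> real \<times> 'a) \<Rightarrow> bool" where
  "cone_future_timelike J f Y x y \<gamma> \<longleftrightarrow>
     \<gamma> 0 = x \<and> \<gamma> 1 = y \<and> absolutely_continuous_curve (cone_metric J Y) \<gamma> \<and>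
     strict_mono_on {0..1} (\<lambda>t. fst (\<gamma> t)) \<and>
     (AE t in lebesgue_on {0..1}. cone_energy f Y \<gamma> t < 0)"

definition cone_length :: "(real \<Rightarrow> real) \<Rightarrow> 'a metric \<Rightarrow> (real \<Rightarrow> real \<times> 'a) \<Rightarrow> ennreal" where
  "cone_length f Y \<gamma> = (\<integral>\<^sup>+ t. ennreal (sqrt (- cone_energy f Y \<gamma> t)) \<partial>lebesgue_on {0..1})"

definition generalized_cone ::
  "real set \<Rightarrow> (real \<Rightarrow> real) \<Rightarrow> 'a metric \<Rightarrow> (real \<times> 'a) lorentz_space" where
  "generalized_cone J f Y =
     \<lparr>met = cone_metric J Y,
      chron = (\<lambda>x y. \<exists>\<gamma>. cone_future_timelike J f Y x y \<gamma>),
      caus = (\<lambda>x y. (x = y \<and> x \<in> J \<times> mspace Y) \<or> (\<exists>\<gamma>. cone_future_causal J f Y x y \<gamma>)),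
      tsep = (\<lambda>x y. SUP \<gamma> \<in> {\<gamma>. cone_future_causal J f Y x y \<gamma>}. cone_length f Y \<gamma>)\<rparr>"

section \<open>The model spaces and global triangle comparison\<close>

text \<open>
  The form on three-space with \<open>m\<close> negative directions, \<open>m = 1, 2\<close>, and the universal covering
  map from the plane onto the quadric \<open>b(v, v) = 1/k\<close> (for \<open>k \<noteq> 0\<close>). In both cases the first
  coordinate of the plane is a time function, whose increase fixes the time orientation.
\<close>

definition indefinite_form ::
  "nat \<Rightarrow> real \<times> real \<times> real \<Rightarrow> real \<times> real \<times> real \<Rightarrow> real" where
  "indefinite_form m v w =
     (if 1 \<le> m then -1 else 1) * (fst v * fst w) +
     (if 2 \<le> m then -1 else 1) * (fst (snd v) * fst (snd w)) +
     (if 3 \<le> m then -1 else 1) * (snd (snd v) * snd (snd w))"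

definition quadric_index :: "real \<Rightarrow> nat" where
  "quadric_index k = (if k > 0 then 1 else 2)"

definition quadric_cover :: "real \<Rightarrow> real \<times> real \<Rightarrow> real \<times> real \<times> real" where
  "quadric_cover k x =
     (let r = 1 / sqrt \<bar>k\<bar>; t = fst x; s = snd x
      in if k > 0 then (r * sinh t, r * cosh t * cos s, r * cosh t * sin s)
         else (r * cosh s * cos t, r * cosh s * sin t, r * sinh s))"

lemma indefinite_form_quadric_cover:
  assumes "k \<noteq> 0"
  shows "indefinite_form (quadric_index k) (quadric_cover k x) (quadric_cover k x) = 1 / k"
proof -
  define r where "r = 1 / sqrt \<bar>k\<bar>"
  have r2: "r * r = 1 / \<bar>k\<bar>" by (simp add: r_def)
  have h: "sinh y * sinh y = cosh y * cosh y - 1" for y :: real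
    using cosh_square_eq[of y] by (simp add: power2_eq_square)
  have c: "cos y * cos y + sin y * sin y = 1" for y :: real
    using sin_cos_squared_add2[of y] by (simp add: power2_eq_square)
  have cov: "quadric_cover k x =
    (if k > 0 then (r * sinh (fst x), r * cosh (fst x) * cos (snd x), r * cosh (fst x) * sin (snd x))
     else (r * cosh (snd x) * cos (fst x), r * cosh (snd x) * sin (fst x), r * sinh (snd x)))"
    by (simp add: quadric_cover_def r_def Let_def)
  show ?thesis
  proof (cases "k > 0")
    case True
    have "indefinite_form (quadric_index k) (quadric_cover k x) (quadric_cover k x) =
        r * r * (- (sinh (fst x) * sinh (fst x)) + cosh (fst x) * cosh (fst x) *
          (cos (snd x) * cos (snd x) + sin (snd x) * sin (snd x)))"
      using True by (simp add: indefinite_form_def quadric_index_def cov algebra_simps del: sin_cos_squared_add3)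
    then show ?thesis unfolding h c r2 using True by simp
  next
    case False
    have "indefinite_form (quadric_index k) (quadric_cover k x) (quadric_cover k x) =
        r * r * (sinh (snd x) * sinh (snd x) - cosh (snd x) * cosh (snd x) *
          (cos (fst x) * cos (fst x) + sin (fst x) * sin (fst x)))"
      using False by (simp add: indefinite_form_def quadric_index_def cov algebra_simps del: sin_cos_squared_add3)
    then show ?thesis unfolding h c r2 using False assms by simp
  qed
qed

text \<open>
  The Lorentzian metric of \<open>\<bbbL>\<^sup>2(k)\<close> on the plane: the Minkowski metric for
  \<open>k = 0\<close>, otherwise the pull-back of the ambient form under the covering map.
\<close>

definition model_form :: "real \<Rightarrow> real \<times> real \<Rightarrow> real \<times> real \<Rightarrow> real" where
  "model_form k x v =
     (if k = 0 then - (fst v)\<^sup>2 + (snd v)\<^sup>2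
      else let w = frechet_derivative (quadric_cover k) (at x) v
           in indefinite_form (quadric_index k) w w)"

abbreviation model_energy :: "real \<Rightarrow> (real \<Rightarrow> real \<times> real) \<Rightarrow> real \<Rightarrow> real" where
  "model_energy k c t \<equiv> model_form k (c t) (vector_derivative c (at t))"

definition model_future_causal ::
  "real \<Rightarrow> real \<times> real \<Rightarrow> real \<times> real \<Rightarrow> (real \<Rightarrow> real \<times> real) \<Rightarrow> bool" where
  "model_future_causal k x y c \<longleftrightarrow>
     c 0 = x \<and> c 1 = y \<and> c piecewise_C1_differentiable_on {0..1} \<and>
     (\<exists>S. finite S \<and> (\<forall>t\<in>{0..1} - S. c differentiable (at t) \<and>
        model_energy k c t \<le> 0 \<and> 0 < fst (vector_derivative c (at t))))"

definition model_future_timelike ::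
  "real \<Rightarrow> real \<times> real \<Rightarrow> real \<times> real \<Rightarrow> (real \<Rightarrow> real \<times> real) \<Rightarrow> bool" where
  "model_future_timelike k x y c \<longleftrightarrow>
     c 0 = x \<and> c 1 = y \<and> c piecewise_C1_differentiable_on {0..1} \<and>
     (\<exists>S. finite S \<and> (\<forall>t\<in>{0..1} - S. c differentiable (at t) \<and>
        model_energy k c t < 0 \<and> 0 < fst (vector_derivative c (at t))))"

definition model_length :: "real \<Rightarrow> (real \<Rightarrow> real \<times> real) \<Rightarrow> ennreal" where
  "model_length k c = (\<integral>\<^sup>+ t. ennreal (sqrt (- model_energy k c t)) \<partial>lebesgue_on {0..1})"

definition model_space :: "real \<Rightarrow> (real \<times> real) lorentz_space" where
  "model_space k =
     \<lparr>met = euclidean_metric,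
      chron = (\<lambda>x y. \<exists>c. model_future_timelike k x y c),
      caus = (\<lambda>x y. x = y \<or> (\<exists>c. model_future_causal k x y c)),
      tsep = (\<lambda>x y. SUP c \<in> {c. model_future_causal k x y c}. model_length k c)\<rparr>"

definition model_diameter :: "real \<Rightarrow> ennreal" where
  "model_diameter k = (if k < 0 then ennreal (pi / sqrt (- k)) else \<top>)"

text \<open>Vertices are indexed by \<open>1, 2, 3\<close>; \<open>\<gamma> i j\<close> is the side from \<open>p i\<close> to \<open>p j\<close>.\<close>

definition triangle_sides :: "(nat \<times> nat) set" where
  "triangle_sides = {(1, 2), (2, 3), (1, 3)}"

definition admissible_causal_triangle ::
  "'a lorentz_space \<Rightarrow> (nat \<Rightarrow> 'a) \<Rightarrow> (nat \<Rightarrow> nat \<Rightarrow> real \<Rightarrow> 'a) \<Rightarrow> bool" where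
  "admissible_causal_triangle X p \<gamma> \<longleftrightarrow>
     p 1 \<in> pts X \<and> p 2 \<in> pts X \<and> p 3 \<in> pts X \<and>
     (chron X (p 1) (p 2) \<and> caus X (p 2) (p 3) \<or> caus X (p 1) (p 2) \<and> chron X (p 2) (p 3)) \<and>
     (\<forall>(i, j)\<in>triangle_sides. tsep X (p i) (p j) < \<top> \<and>
        (distance_realiser X (p i) (p j) (\<gamma> i j) \<or>
         p i = p j \<and> (\<forall>s\<in>{0..1}. \<gamma> i j s = p i)))"

definition comparison_triangle ::
  "real \<Rightarrow> 'a lorentz_space \<Rightarrow> (nat \<Rightarrow> 'a) \<Rightarrow>
   (nat \<Rightarrow> real \<times> real) \<Rightarrow> (nat \<Rightarrow> nat \<Rightarrow> real \<Rightarrow> real \<times> real) \<Rightarrow> bool" where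
  "comparison_triangle k X p p' \<gamma>' \<longleftrightarrow>
     admissible_causal_triangle (model_space k) p' \<gamma>' \<and>
     (\<forall>(i, j)\<in>triangle_sides. tsep (model_space k) (p' i) (p' j) = tsep X (p i) (p j))"

definition corresponding_points ::
  "real \<Rightarrow> 'a lorentz_space \<Rightarrow> (nat \<Rightarrow> 'a) \<Rightarrow> (nat \<Rightarrow> nat \<Rightarrow> real \<Rightarrow> 'a) \<Rightarrow>
   (nat \<Rightarrow> real \<times> real) \<Rightarrow> (nat \<Rightarrow> nat \<Rightarrow> real \<Rightarrow> real \<times> real) \<Rightarrow>
   'a \<Rightarrow> real \<times> real \<Rightarrow> bool" where
  "corresponding_points k X p \<gamma> p' \<gamma>' q q' \<longleftrightarrow>
     (\<exists>(i, j)\<in>triangle_sides. chron X (p i) (p j) \<and>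
        q \<in> \<gamma> i j ` {0..1} \<and> q' \<in> \<gamma>' i j ` {0..1} \<and>
        tsep (model_space k) (p' i) q' = tsep X (p i) q)"

definition global_TCBA :: "real \<Rightarrow> 'a lorentz_space \<Rightarrow> bool" where
  "global_TCBA k X \<longleftrightarrow>
     (\<forall>p \<gamma> p' \<gamma>'.
        admissible_causal_triangle X p \<gamma> \<and>
        (\<forall>(i, j)\<in>triangle_sides. tsep X (p i) (p j) < model_diameter k) \<and>
        comparison_triangle k X p p' \<gamma>' \<longrightarrow>
        (\<forall>x x' y y'. corresponding_points k X p \<gamma> p' \<gamma>' x x' \<and>
           corresponding_points k X p \<gamma> p' \<gamma>' y y' \<longrightarrow>
           tsep (model_space k) x' y' \<le> tsep X x y))"

section \<open>Radon measures, optimal transport and the curvature-dimension condition\<close>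

definition borel_of :: "'a topology \<Rightarrow> 'a measure" where
  "borel_of T = sigma (topspace T) {U. openin T U}"

definition radon_measure :: "'a topology \<Rightarrow> 'a measure \<Rightarrow> bool" where
  "radon_measure T \<mm> \<longleftrightarrow>
     space \<mm> = topspace T \<and> sets \<mm> = sets (borel_of T) \<and>
     (\<forall>x\<in>topspace T. \<exists>U. openin T U \<and> x \<in> U \<and> emeasure \<mm> U < \<infinity>) \<and>
     (\<forall>A\<in>sets \<mm>. emeasure \<mm> A = (SUP C \<in> {C. compactin T C \<and> C \<in> sets \<mm> \<and> C \<subseteq> A}. emeasure \<mm> C))"

definition full_support :: "'a topology \<Rightarrow> 'a measure \<Rightarrow> bool" where
  "full_support T \<mm> \<longleftrightarrow> (\<forall>U. openin T U \<and> U \<noteq> {} \<longrightarrow> 0 < emeasure \<mm> U)"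

definition borel_probabilities :: "'a topology \<Rightarrow> 'a measure set" where
  "borel_probabilities T =
     {\<mu>. prob_space \<mu> \<and> space \<mu> = topspace T \<and> sets \<mu> = sets (borel_of T)}"

definition compactly_supported :: "'a topology \<Rightarrow> 'a measure \<Rightarrow> bool" where
  "compactly_supported T \<mu> \<longleftrightarrow> (\<exists>C. compactin T C \<and> (AE x in \<mu>. x \<in> C))"

definition causal_couplings ::
  "'a lorentz_space \<Rightarrow> 'a measure \<Rightarrow> 'a measure \<Rightarrow> ('a \<times> 'a) measure set" where
  "causal_couplings X \<mu> \<nu> =
     {\<pi> \<in> borel_probabilities (prod_topology (ltop X) (ltop X)).
        distr \<pi> (borel_of (ltop X)) fst = \<mu> \<and> distr \<pi> (borel_of (ltop X)) snd = \<nu> \<and>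
        (AE z in \<pi>. caus X (fst z) (snd z))}"

definition ennpowr :: "ennreal \<Rightarrow> real \<Rightarrow> ennreal" where
  "ennpowr x a = (if x = \<top> then \<top> else ennreal (enn2real x powr a))"

definition lp_distance :: "'a lorentz_space \<Rightarrow> real \<Rightarrow> 'a measure \<Rightarrow> 'a measure \<Rightarrow> ereal" where
  "lp_distance X p \<mu> \<nu> =
     (SUP \<pi> \<in> causal_couplings X \<mu> \<nu>.
        enn2ereal (ennpowr (\<integral>\<^sup>+ z. ennpowr (tsep X (fst z) (snd z)) p \<partial>\<pi>) (1 / p)))"

definition lp_geodesic :: "'a lorentz_space \<Rightarrow> real \<Rightarrow> (real \<Rightarrow> 'a measure) \<Rightarrow> bool" where
  "lp_geodesic X p \<mu> \<longleftrightarrow>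
     (\<forall>t\<in>{0..1}. \<mu> t \<in> borel_probabilities (ltop X)) \<and>
     (\<forall>s t. 0 \<le> s \<and> s < t \<and> t \<le> 1 \<longrightarrow>
        lp_distance X p (\<mu> s) (\<mu> t) = ereal (t - s) * lp_distance X p (\<mu> 0) (\<mu> 1) \<and>
        0 < lp_distance X p (\<mu> s) (\<mu> t) \<and> lp_distance X p (\<mu> s) (\<mu> t) < \<infinity>)"

text \<open>
  \<open>RN_deriv \<mm> \<mu>\<close> satisfies \<open>density \<mm> (RN_deriv \<mm> \<mu>) = \<mu>\<close> as soon as \<open>\<mu>\<close> has some density.
  The integral of the negative part may be infinite, so \<open>-\<infinity>\<close> is a possible value.
\<close>

definition rel_entropy :: "'a measure \<Rightarrow> 'a measure \<Rightarrow> ereal" where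
  "rel_entropy \<mm> \<mu> =
     (let \<rho> = (\<lambda>x. enn2real (RN_deriv \<mm> \<mu> x));
          pos = (\<integral>\<^sup>+ x. ennreal (\<rho> x * ln (\<rho> x)) \<partial>\<mm>);
          neg = (\<integral>\<^sup>+ x. ennreal (- (\<rho> x * ln (\<rho> x))) \<partial>\<mm>)
      in if density \<mm> (RN_deriv \<mm> \<mu>) = \<mu> \<and> pos < \<infinity> then enn2ereal pos - enn2ereal neg else \<infinity>)"

definition entropy_power :: "real \<Rightarrow> 'a measure \<Rightarrow> 'a measure \<Rightarrow> ennreal" where
  "entropy_power N \<mm> \<mu> =
     (case rel_entropy \<mm> \<mu> of ereal r \<Rightarrow> ennreal (exp (- r / N)) | PInfty \<Rightarrow> 0 | MInfty \<Rightarrow> \<top>)"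

definition distortion_coeff :: "real \<Rightarrow> real \<Rightarrow> real \<Rightarrow> ennreal" where
  "distortion_coeff \<kappa> t \<theta> =
     (if \<kappa> * \<theta>\<^sup>2 \<ge> pi\<^sup>2 then \<top>
      else if \<kappa> * \<theta>\<^sup>2 > 0 then ennreal (sin (t * sqrt \<kappa> * \<theta>) / sin (sqrt \<kappa> * \<theta>))
      else if \<kappa> * \<theta>\<^sup>2 = 0 then ennreal t
      else ennreal (sinh (t * sqrt (- \<kappa>) * \<theta>) / sinh (sqrt (- \<kappa>) * \<theta>)))"

text \<open>
  The norm of \<open>\<tau>(\<cdot>, x)\<close> in \<open>L\<^sup>2(\<mu>)\<close>, as a real number: it is finite for compactly supported \<open>\<mu>\<close> on
  globally hyperbolic Lorentzian length spaces, where \<open>\<tau>\<close> is finite and continuous.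
\<close>

definition tsep_L2 :: "'a lorentz_space \<Rightarrow> 'a measure \<Rightarrow> 'a \<Rightarrow> real" where
  "tsep_L2 X \<mu> x = sqrt (enn2real (\<integral>\<^sup>+ y. (tsep X y x)\<^sup>2 \<partial>\<mu>))"

definition TMCP_e :: "real \<Rightarrow> real \<Rightarrow> 'a lorentz_space \<Rightarrow> 'a measure \<Rightarrow> bool" where
  "TMCP_e K N X \<mm> \<longleftrightarrow>
     (\<forall>\<mu>\<^sub>0\<in>borel_probabilities (ltop X). \<forall>x\<^sub>1\<in>pts X.
        compactly_supported (ltop X) \<mu>\<^sub>0 \<and> \<bar>rel_entropy \<mm> \<mu>\<^sub>0\<bar> \<noteq> \<infinity> \<and>
        (AE x in \<mu>\<^sub>0. chron X x x\<^sub>1) \<longrightarrow>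
        (\<exists>p\<in>{0<..<1}. \<exists>\<mu>. lp_geodesic X p \<mu> \<and> \<mu> 0 = \<mu>\<^sub>0 \<and>
           \<mu> 1 = return (borel_of (ltop X)) x\<^sub>1 \<and>
           (\<forall>t\<in>{0..<1}. entropy_power N \<mm> (\<mu> t) \<ge>
              distortion_coeff (K / N) (1 - t) (tsep_L2 X \<mu>\<^sub>0 x\<^sub>1) * entropy_power N \<mm> \<mu>\<^sub>0)))"

section \<open>Covered spaces and Lorentzian Gromov--Hausdorff convergence\<close>

type_synonym 'a covered_space = "'a lorentz_space \<times> (nat \<Rightarrow> 'a set)"

definition covered_lorentzian_pre_length_space :: "'a covered_space \<Rightarrow> bool" where
  "covered_lorentzian_pre_length_space = (\<lambda>(X, U).
     lorentzian_pre_length_space X \<and> (\<Union>k\<in>{1..}. U k) = pts X \<and> (\<forall>k\<ge>1. U k \<subseteq> U (Suc k)))"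

text \<open>A net is given by the set of pairs \<open>(p, q)\<close> of endpoints of its diamonds.\<close>

definition eps_net :: "'a lorentz_space \<Rightarrow> ennreal \<Rightarrow> 'a set \<Rightarrow> ('a \<times> 'a) set \<Rightarrow> bool" where
  "eps_net X \<epsilon> A S \<longleftrightarrow>
     S \<subseteq> pts X \<times> pts X \<and>
     (\<forall>(p, q)\<in>S. tsep X p q \<le> \<epsilon> \<and> A \<inter> causal_diamond X p q \<noteq> {}) \<and>
     A \<subseteq> (\<Union>(p, q)\<in>S. causal_diamond X p q)"

definition vertices :: "('a \<times> 'a) set \<Rightarrow> 'a set" where
  "vertices S = fst ` S \<union> snd ` S"

definition correspondence :: "'a set \<Rightarrow> 'b set \<Rightarrow> ('a \<times> 'b) set \<Rightarrow> bool" where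
  "correspondence V W R \<longleftrightarrow> R \<subseteq> V \<times> W \<and> fst ` R = V \<and> snd ` R = W"

text \<open>Every diamond of either net corresponds, endpoint by endpoint, to a diamond of the other.\<close>

definition matches_diamonds ::
  "('a \<times> 'a) set \<Rightarrow> ('b \<times> 'b) set \<Rightarrow> ('a \<times> 'b) set \<Rightarrow> bool" where
  "matches_diamonds S T R \<longleftrightarrow>
     (\<forall>(p, q)\<in>S. \<exists>(p', q')\<in>T. (p, p') \<in> R \<and> (q, q') \<in> R) \<and>
     (\<forall>(p', q')\<in>T. \<exists>(p, q)\<in>S. (p, p') \<in> R \<and> (q, q') \<in> R)"

definition abs_diff :: "ennreal \<Rightarrow> ennreal \<Rightarrow> ennreal" where
  "abs_diff a b = (if a = b then 0 else max (a - b) (b - a))"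

definition distortion ::
  "'a lorentz_space \<Rightarrow> 'b lorentz_space \<Rightarrow> ('a \<times> 'b) set \<Rightarrow> ennreal" where
  "distortion X Y R =
     (SUP ((v, w), (v', w')) \<in> R \<times> R. abs_diff (tsep X v v') (tsep Y w w'))"

definition forward_dense :: "'a lorentz_space \<Rightarrow> 'a set \<Rightarrow> 'a set \<Rightarrow> bool" where
  "forward_dense X V A \<longleftrightarrow>
     (\<forall>x\<in>A. \<exists>v. (\<forall>i::nat. v i \<in> V \<and> caus X (v i) (v (Suc i)) \<and> caus X (v i) x) \<and>
        limitin (ltop X) v x sequentially)"

definition LGH_converges :: "(nat \<Rightarrow> 'a covered_space) \<Rightarrow> 'b covered_space \<Rightarrow> bool" where
  "LGH_converges Xs Z \<longleftrightarrow>
     (\<exists>(Sn :: nat \<Rightarrow> nat \<Rightarrow> nat \<Rightarrow> ('a \<times> 'a) set) (S :: nat \<Rightarrow> nat \<Rightarrow> ('b \<times> 'b) set)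
       (R :: nat \<Rightarrow> nat \<Rightarrow> nat \<Rightarrow> ('a \<times> 'b) set).
        (\<forall>k\<ge>1. \<forall>l\<ge>1.
           finite (S k l) \<and> eps_net (fst Z) (ennreal (1 / real l)) (snd Z k) (S k l) \<and>
           vertices (S k l) \<subseteq> vertices (S k (Suc l)) \<and>
           (\<forall>\<^sub>F n in sequentially.
              finite (Sn n k l) \<and>
              eps_net (fst (Xs n)) (ennreal (1 / real l)) (snd (Xs n) k) (Sn n k l) \<and>
              vertices (Sn n k l) \<subseteq> vertices (Sn n k (Suc l)) \<and>
              correspondence (vertices (Sn n k l)) (vertices (S k l)) (R n k l) \<and>
              R n k l \<subseteq> R n k (Suc l) \<and>
              matches_diamonds (Sn n k l) (S k l) (R n k l)) \<and>
           (\<lambda>n. distortion (fst (Xs n)) (fst Z) (R n k l)) \<longlonglongrightarrow> 0) \<and>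
        (\<forall>k\<ge>1. forward_dense (fst Z) (\<Union>l\<in>{1..}. vertices (S k l)) (snd Z k)))"

text \<open>
  The type of the points of the limit space cannot be quantified existentially. Taking \<open>real\<close>
  for it is no restriction: forward density makes each point of a limit space the metric limit of
  a sequence in a countable set, so a limit space has at most continuum many points, and
  it can be transported along an injection of its carrier into \<open>real\<close>.
\<close>

definition LGH_precompact :: "'a covered_space set \<Rightarrow> bool" where
  "LGH_precompact \<C> \<longleftrightarrow>
     (\<forall>Xs. (\<forall>n::nat. Xs n \<in> \<C>) \<longrightarrow>
        (\<exists>r. strict_mono r \<and> (\<exists>Z :: real covered_space.
           covered_lorentzian_pre_length_space Z \<and> LGH_converges (Xs \<circ> r) Z)))"

end

theory Submission
  imports Defs "HOL-Library.Diagonal_Subsequence"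
begin

text \<open>
  In the conformal time \<open>F = \<integral> 1 / f\<close>, the point \<open>(s, u)\<close> causally precedes \<open>(r, w)\<close> only if
  \<open>d(u, w) \<le> F r - F s\<close>, it precedes it chronologically iff this inequality is strict, and \<open>\<tau>\<close> is comparable, with the
  constants \<open>m\<close> and \<open>M\<close>, to \<open>sqrt ((F r - F s)\<^sup>2 - d(u, w)\<^sup>2)\<close>. Applying the \<open>TMCP\<close> condition to the
  normalized restriction of \<open>\<mm>\<close> to a box \<open>B\<close> and a tip \<open>x\<close>, at a time \<open>t\<close> close to \<open>1\<close>, gives a measure
  whose points almost saturate the reverse triangle inequality; by the perturbation lemma for \<open>\<tau>\<close> these points
  are close to \<open>x\<close>. Jensen's inequality then bounds the mass of a small box around \<open>x\<close> below by a
  fixed multiple of \<open>\<mm>(B)\<close>. Doing this to the future and to the past bounds the size of separated sets in balls of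
  the fibre, uniformly over the class, and products of such sets with a grid of conformal times provide nets of the
  diamonds \<open>U\<^sub>k\<close> of uniformly bounded cardinality.

  Countably many labels for the vertices of these nets, closed under choosing partners and witnesses, are
  stabilized along a diagonal subsequence. The limit is the set of labels with the limit of \<open>\<tau>\<close>, the
  eventual causal relation and the discrete metric; forward density is trivial because every label eventually is a vertex.
\<close>

text \<open>A point z between y and the tip x with small \<tau>(z, x) can still be far from x, close
  to its light cone, so an entropy estimate near x needs control of almost null segments. Hence the
  perturbation of endpoints: bending the broken path y, z, x gains more on the almost null piece
  than it loses on the timelike one. The measure of a box has no a priori bound over the class, so
  transport in one direction alone is not enough. Contracting a past box to many tips, and a large
  box back into the past box, gives two inequalities in which the measure cancels. In the limit,
  vertex sets must grow with l while diamonds shrink to size 1/l and still meet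
  \<open>U\<^sub>k\<close>. An old vertex outside \<open>U\<^sub>k\<close> must therefore remain an
  endpoint of ever smaller diamonds meeting \<open>U\<^sub>k\<close>. The nets are chosen among
  points for which such diamonds exist, and the partners provide them. The discrete metric makes
  every function lower semicontinuous, so no continuity of the limit of \<tau> has to be
  proved.\<close>

section \<open>Absolutely continuous functions\<close>

text \<open>Lebesgue differentiation by Henstock's lemma and Vitali covering. Around each point of
  \<open>S c\<close> there are arbitrarily short intervals on which G deviates from its linear
  approximation by more than c times the length. Henstock's lemma bounds the sum of such deviations
  over a fine partial division by e * c, hence the total length of disjoint ones by e.\<close>

lemma ae_derivative_of_integral:
  fixes h :: "real \<Rightarrow> real"
  assumes h: "h integrable_on {a..b}"
  shows "\<exists>S. negligible S \<and>
    (\<forall>x\<in>{a<..<b} - S. ((\<lambda>t. integral {a..t} h) has_real_derivative h x) (at x))"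
proof -
  define G where "G t = integral {a..t} h" for t
  have G: "integral {x..y} h = G y - G x" if "a \<le> x" "x \<le> y" "y \<le> b" for x y
  proof -
    have "h integrable_on {a..y}" using h that by (auto intro: integrable_subinterval_real)
    from Henstock_Kurzweil_Integration.integral_combine[OF that(1,2) this] show ?thesis
      by (simp add: G_def)
  qed
  define bad where "bad c x y \<longleftrightarrow> y \<in> {a<..<b} \<and> y \<noteq> x \<and> \<bar>G y - G x - h x * (y - x)\<bar> > c * \<bar>y - x\<bar>" for c x y
  define S where "S c = {x\<in>{a<..<b}. \<forall>d>0. \<exists>y. bad c x y \<and> \<bar>y - x\<bar> < d}" for c
  have neg: "negligible (S c)" if c: "c > 0" for c
    unfolding negligible_outer_le
  proof (intro allI impI)
    fix e :: real assume e: "e > 0"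
    then have "e * c > 0" using c by simp
    then obtain \<gamma> where \<gamma>: "gauge \<gamma>"
      and hen: "\<And>p. \<lbrakk>p tagged_partial_division_of (cbox a b); \<gamma> fine p\<rbrakk> \<Longrightarrow>
             sum (\<lambda>(x,k). norm(measure lborel k *\<^sub>R h x - integral k h)) p < e * c"
      using Henstock_lemma[of h a b "e * c"] h by (auto simp: cbox_interval)
    \<comment> \<open>The tag x is an endpoint of its interval, whereas the covering theorem speaks
      of balls; centre and radius below are those of the interval between x and y.\<close>
    define K where "K = {(x, y). x \<in> S c \<and> bad c x y \<and> {min x y..max x y} \<subseteq> \<gamma> x}"
    have cb: "cball ((x + y) / 2) (\<bar>y - x\<bar> / 2) = {min x y..max x y}" for x y :: real
      unfolding cball_eq_atLeastAtMost by (auto simp: min_def max_def abs_if field_simps)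
    have K: "0 < (\<lambda>(x, y). \<bar>y - x\<bar> / 2) i" if "i \<in> K" for i
      using that by (auto simp: K_def bad_def)
    have V: "\<exists>i. i \<in> K \<and> x \<in> cball ((\<lambda>(x, y). (x + y) / 2) i) ((\<lambda>(x, y). \<bar>y - x\<bar> / 2) i)
       \<and> (\<lambda>(x, y). \<bar>y - x\<bar> / 2) i < d" if x: "x \<in> S c" and d: "0 < d" for x d
    proof -
      obtain r where r: "r > 0" "ball x r \<subseteq> \<gamma> x"
        using \<gamma> by (meson gauge_def open_contains_ball)
      obtain y where y: "bad c x y" "\<bar>y - x\<bar> < min r d"
      proof -
        have "\<forall>d>0. \<exists>y. bad c x y \<and> \<bar>y - x\<bar> < d" using x by (simp add: S_def)
        moreover have "min r d > 0" using r d by simp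
        ultimately show ?thesis using that by blast
      qed
      have "{min x y..max x y} \<subseteq> ball x r"
        using y by (auto simp: dist_real_def min_def max_def split: if_splits)
      then have "(x, y) \<in> K" using x y r by (auto simp: K_def)
      moreover have "\<bar>y - x\<bar> / 2 < d" using y by auto
      ultimately show ?thesis
        by (intro exI[of _ "(x, y)"]) (simp only: split cb, auto)
    qed
    obtain C where C: "countable C" "C \<subseteq> K"
      and disj: "pairwise (\<lambda>i j. disjnt (cball ((\<lambda>(x, y). (x + y) / 2) i) ((\<lambda>(x, y). \<bar>y - x\<bar> / 2) i))
           (cball ((\<lambda>(x, y). (x + y) / 2) j) ((\<lambda>(x, y). \<bar>y - x\<bar> / 2) j))) C"
      and negC: "negligible (S c - (\<Union>i\<in>C. cball ((\<lambda>(x, y). (x + y) / 2) i) ((\<lambda>(x, y). \<bar>y - x\<bar> / 2) i)))"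
      by (rule Vitali_covering_theorem_cballs[where K = K and S = "S c"
            and a = "\<lambda>(x, y). (x + y) / 2" and r = "\<lambda>(x, y). \<bar>y - x\<bar> / 2", OF K V])
    define Q where "Q = (\<lambda>(x, y). {min x y..max x y :: real})"
    have Q: "cball ((\<lambda>(x, y). (x + y) / 2) i) ((\<lambda>(x, y). \<bar>y - x\<bar> / 2) i) = Q i" for i
      by (cases i) (simp only: Q_def split cb)
    note disj = disj[unfolded Q] and negC = negC[unfolded Q]
    have disjD: "disjnt (Q i) (Q j)" if "i \<in> C" "j \<in> C" "i \<noteq> j" for i j
      by (rule pairwiseD[OF disj that])
    \<comment> \<open>Finite subfamilies suffice: with their tags they form a fine partial division,
      and the bound e passes to the countable union.\<close>
    have fin: "measure lebesgue (\<Union>i\<in>F. Q i) \<le> e" if F: "F \<subseteq> C" "finite F" for F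
    proof -
      define p where "p = (\<lambda>i. (fst i, Q i)) ` F"
      have inj: "inj_on (\<lambda>i. (fst i, Q i)) F"
      proof (rule inj_onI)
        fix i j assume ij: "i \<in> F" "j \<in> F" "(fst i, Q i) = (fst j, Q j)"
        show "i = j"
        proof (rule ccontr)
          assume "i \<noteq> j"
          then have "disjnt (Q i) (Q j)" using ij F by (intro disjD) auto
          moreover have "fst i \<in> Q i" by (cases i) (auto simp: Q_def)
          ultimately show False using ij by (auto simp: disjnt_def)
        qed
      qed
      have p: "p tagged_partial_division_of (cbox a b)"
        unfolding tagged_partial_division_of_def
      proof (intro conjI allI impI)
        show "finite p" using F by (simp add: p_def)
        show "x \<in> L" "L \<subseteq> cbox a b" "\<exists>u v. L = cbox u v" if xL: "(x, L) \<in> p" for x L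
        proof -
          obtain y where y: "(x, y) \<in> F" "L = Q (x, y)" using xL unfolding p_def by auto
          then have "(x, y) \<in> K" using C F by auto
          then have "x \<in> {a<..<b}" "y \<in> {a<..<b}" by (auto simp: K_def S_def bad_def)
          with y show "x \<in> L" "L \<subseteq> cbox a b" "\<exists>u v. L = cbox u v"
            by (auto simp: Q_def cbox_interval)
        qed
        fix x1 L1 x2 L2 assume A: "(x1, L1) \<in> p \<and> (x2, L2) \<in> p \<and> (x1, L1) \<noteq> (x2, L2)"
        then obtain i j where ij: "i \<in> F" "j \<in> F" "L1 = Q i" "L2 = Q j" "i \<noteq> j" by (auto simp: p_def)
        then have "disjnt (Q i) (Q j)" using ij F by (intro disjD) auto
        then have "L1 \<inter> L2 = {}" using ij by (auto simp: disjnt_def)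
        then show "interior L1 \<inter> interior L2 = {}" using interior_subset by blast
      qed
      have fine: "\<gamma> fine p"
        unfolding fine_def p_def using C F by (fastforce simp: K_def Q_def)
      have "(\<Sum>(x,y)\<in>F. c * \<bar>y - x\<bar>) \<le> (\<Sum>i\<in>F. norm (measure lborel (Q i) *\<^sub>R h (fst i) - integral (Q i) h))"
      proof (rule sum_mono, clarify)
        fix x y assume "(x, y) \<in> F"
        then have xy: "(x, y) \<in> K" using C F by auto
        then have in_ab: "x \<in> {a<..<b}" "y \<in> {a<..<b}" by (auto simp: K_def S_def bad_def)
        have "bad c x y" using xy by (auto simp: K_def)
        then have b: "c * \<bar>y - x\<bar> < \<bar>G y - G x - h x * (y - x)\<bar>" by (auto simp: bad_def)
        have "\<bar>G y - G x - h x * (y - x)\<bar> = norm (measure lborel (Q (x, y)) *\<^sub>R h x - integral (Q (x, y)) h)"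
        proof (cases "x \<le> y")
          case True
          then show ?thesis using in_ab by (simp add: Q_def G min_def max_def abs_if algebra_simps)
        next
          case False
          then show ?thesis using in_ab by (simp add: Q_def G min_def max_def abs_if algebra_simps)
        qed
        then show "c * \<bar>y - x\<bar> \<le> norm (measure lborel (Q (x, y)) *\<^sub>R h (fst (x, y)) - integral (Q (x, y)) h)"
          using b by simp
      qed
      also have "\<dots> = (\<Sum>(x,k)\<in>p. norm (measure lborel k *\<^sub>R h x - integral k h))"
        unfolding p_def by (subst sum.reindex[OF inj]) (simp add: case_prod_unfold)
      also have "\<dots> < e * c" by (rule hen[OF p fine])
      finally have "(\<Sum>(x,y)\<in>F. \<bar>y - x\<bar>) < e"
        using c by (simp add: sum_distrib_left[symmetric] case_prod_unfold mult.commute)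
      moreover have "measure lebesgue (\<Union>i\<in>F. Q i) \<le> (\<Sum>i\<in>F. measure lebesgue (Q i))"
        using F by (intro measure_UNION_le) (auto simp: Q_def split: prod.splits)
      moreover have "(\<Sum>i\<in>F. measure lebesgue (Q i)) = (\<Sum>(x,y)\<in>F. \<bar>y - x\<bar>)"
        by (intro sum.cong) (auto simp: Q_def min_def max_def)
      ultimately show ?thesis by linarith
    qed
    have QL: "Q i \<in> lmeasurable" for i by (cases i) (simp add: Q_def lmeasurable_interval)
    have U: "(\<Union>i\<in>C. Q i) \<in> lmeasurable" "measure lebesgue (\<Union>i\<in>C. Q i) \<le> e"
      using fmeasurable_UN_bound[OF C(1) QL fin] measure_UN_bound[OF C(1) QL fin] by auto
    define T where "T = (\<Union>i\<in>C. Q i) \<union> (S c - (\<Union>i\<in>C. Q i))"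
    have "T \<in> lmeasurable" unfolding T_def
      by (intro fmeasurable.Un U negligible_imp_measurable negC)
    moreover have "measure lebesgue T \<le> e"
      using U negC unfolding T_def
      by (subst measure_Un_null_set) (auto simp: negligible_iff_null_sets)
    ultimately show "\<exists>T. S c \<subseteq> T \<and> T \<in> lmeasurable \<and> measure lebesgue T \<le> e"
      by (intro exI[of _ T]) (auto simp: T_def)
  qed
  define N where "N = (\<Union>n::nat. S (1 / real (Suc n)))"
  have "negligible N" unfolding N_def by (intro negligible_countable_Union) (auto intro!: neg)
  moreover have "(G has_real_derivative h x) (at x)" if x: "x \<in> {a<..<b} - N" for x
    unfolding has_field_derivative_def has_derivative_within_alt
  proof (intro conjI allI impI)
    show "bounded_linear ((*) (h x))" by (rule bounded_linear_mult_right)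
    fix e :: real assume "e > 0"
    then obtain n where n: "1 / real (Suc n) < e"
      using nat_approx_posE by blast
    from x have "x \<notin> S (1 / real (Suc n))" by (auto simp: N_def)
    then obtain d where d: "d > 0" "\<And>y. \<bar>y - x\<bar> < d \<Longrightarrow> \<not> bad (1 / real (Suc n)) x y"
      using x by (auto simp: S_def)
    obtain r where r: "r > 0" "ball x r \<subseteq> {a<..<b}"
      using x open_contains_ball[of "{a<..<b}"] by (metis Diff_iff open_greaterThanLessThan)
    show "\<exists>d>0. \<forall>y\<in>UNIV. norm (y - x) < d \<longrightarrow> norm (G y - G x - h x * (y - x)) \<le> e * norm (y - x)"
    proof (intro exI[of _ "min d r"] conjI ballI impI)
      show "min d r > 0" using d r by simp
      fix y assume y: "norm (y - x) < min d r"
      then have "y \<in> {a<..<b}" using r by (auto simp: dist_real_def subset_eq abs_minus_commute)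
      with y d(2)[of y] have "\<bar>G y - G x - h x * (y - x)\<bar> \<le> 1 / real (Suc n) * \<bar>y - x\<bar>"
        by (cases "y = x") (auto simp: bad_def)
      also have "\<dots> \<le> e * \<bar>y - x\<bar>" by (rule mult_right_mono[OF less_imp_le[OF n]]) simp
      finally show "norm (G y - G x - h x * (y - x)) \<le> e * norm (y - x)" by simp
    qed
  qed
  ultimately show ?thesis unfolding G_def by blast
qed

text \<open>Absolute continuity of an interval function: \<rho> may be the increment of a real
  function, of a variation, or a sum of such. Sets of intervals replace indexed families, so
  coinciding intervals, which must be degenerate, count once.\<close>

definition ac_intervals :: "(real \<Rightarrow> real \<Rightarrow> real) \<Rightarrow> bool" where
  "ac_intervals \<rho> \<longleftrightarrow> (\<forall>\<epsilon>>0. \<exists>\<delta>>0. \<forall>A. finite A \<and> (\<forall>(s, t)\<in>A. 0 \<le> s \<and> s \<le> t \<and> t \<le> 1) \<and>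
     pairwise (\<lambda>P Q. disjnt {fst P<..<snd P} {fst Q<..<snd Q}) A \<and> (\<Sum>(s, t)\<in>A. t - s) < \<delta> \<longrightarrow>
     (\<Sum>(s, t)\<in>A. \<rho> s t) < \<epsilon>)"

text \<open>The interval measure of g is absolutely continuous with respect to Lebesgue measure, so
  its Radon-Nikodym density h integrates to the increments of g. Differentiating the integral then
  identifies h as the derivative almost everywhere.\<close>

lemma ac_mono_derivative:
  fixes g :: "real \<Rightarrow> real"
  assumes mono: "mono_on {0..1} g" and ac: "ac_intervals (\<lambda>s t. g t - g s)"
  shows "\<exists>h. h \<in> borel_measurable borel \<and> (\<forall>x. 0 \<le> h x) \<and>
     (\<forall>a b. 0 \<le> a \<longrightarrow> a \<le> b \<longrightarrow> b \<le> 1 \<longrightarrow> (h has_integral (g b - g a)) {a..b}) \<and>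
     (\<exists>S. negligible S \<and> (\<forall>x\<in>{0<..<1} - S. (g has_real_derivative h x) (at x)))"
proof -
  \<comment> \<open>Clamping extends g by constants, so that \<open>interval_measure\<close> applies
    on the whole line.\<close>
  define c where "c x = max 0 (min 1 x)" for x :: real
  define G where "G x = g (c x)" for x
  have c01: "c x \<in> {0..1}" for x by (auto simp: c_def)
  have c_id: "c x = x" if "x \<in> {0..1}" for x using that by (auto simp: c_def)
  have c_mono: "x \<le> y \<Longrightarrow> c x \<le> c y" for x y by (auto simp: c_def)
  have c_lip: "c y - c x \<le> y - x" if "x \<le> y" for x y using that by (auto simp: c_def)
  have c_in: "u < x \<and> x < v" if "c u < x" "x < c v" for u v x
    using that by (auto simp: c_def max_def min_def split: if_splits)
  have G_mono: "G x \<le> G y" if "x \<le> y" for x y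
    unfolding G_def by (rule mono_onD[OF mono c01 c01 c_mono[OF that]])
  have G_cont: "continuous_on UNIV G"
    unfolding continuous_on_iff
  proof (intro ballI allI impI)
    fix x e :: real assume "0 < e"
    then obtain d where d: "d > 0" and D: "\<And>A. finite A \<Longrightarrow> \<forall>(s, t)\<in>A. 0 \<le> s \<and> s \<le> t \<and> t \<le> 1 \<Longrightarrow>
       pairwise (\<lambda>P Q. disjnt {fst P<..<snd P} {fst Q<..<snd Q}) A \<Longrightarrow> (\<Sum>(s, t)\<in>A. t - s) < d \<Longrightarrow>
       (\<Sum>(s, t)\<in>A. g t - g s) < e"
      using ac[unfolded ac_intervals_def, rule_format, of e] by blast
    have *: "G v - G u < e" if "u \<le> v" "v - u < d" for u v
    proof -
      have "c v - c u < d" using c_lip[OF that(1)] that(2) by linarith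
      then have "(\<Sum>(s, t)\<in>{(c u, c v)}. g t - g s) < e"
        using c01[of u] c01[of v] c_mono[OF that(1)] by (intro D) auto
      then show ?thesis by (simp add: G_def)
    qed
    show "\<exists>d>0. \<forall>x'\<in>UNIV. dist x' x < d \<longrightarrow> dist (G x') (G x) < e"
    proof (intro exI[of _ d] conjI ballI impI d)
      fix y assume y: "dist y x < d"
      show "dist (G y) (G x) < e"
        using *[of x y] *[of y x] G_mono[of x y] G_mono[of y x] y
        by (cases "x \<le> y") (auto simp: dist_real_def)
    qed
  qed
  have G_rc: "continuous (at_right a) G" for a
    using G_cont by (meson UNIV_I continuous_on_eq_continuous_within continuous_within_subset top_greatest)
  define \<mu> where "\<mu> = interval_measure G"
  have \<mu>_sets: "sets \<mu> = sets lborel" by (simp add: \<mu>_def)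
  have \<mu>_Icc: "emeasure \<mu> {a..b} = G b - G a" if "a \<le> b" for a b
    unfolding \<mu>_def by (rule emeasure_interval_measure_Icc[OF that G_mono G_cont])
  \<comment> \<open>A null set lies in an open set of measure less than d. That set is a countable
    union of boxes, and each finite union of boxes is rewritten as a division into intervals with
    disjoint interiors, to which \<open>ac_intervals\<close> applies.\<close>
  have abs: "absolutely_continuous (lborel :: real measure) \<mu>"
    unfolding absolutely_continuous_def
  proof
    fix N :: "real set" assume N: "N \<in> null_sets lborel"
    have eps: "emeasure \<mu> N \<le> 0 + ennreal e" if e: "e > 0" for e
    proof -
      obtain d where d: "d > 0" and D: "\<And>A. finite A \<Longrightarrow> \<forall>(s, t)\<in>A. 0 \<le> s \<and> s \<le> t \<and> t \<le> 1 \<Longrightarrow>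
         pairwise (\<lambda>P Q. disjnt {fst P<..<snd P} {fst Q<..<snd Q}) A \<Longrightarrow> (\<Sum>(s, t)\<in>A. t - s) < d \<Longrightarrow>
         (\<Sum>(s, t)\<in>A. g t - g s) < e"
        using ac[unfolded ac_intervals_def, rule_format, of e] e by blast
      have "N \<in> sets borel" using N by auto
      from outer_regular_lborel[OF this d] obtain O' where O': "open O'" "N \<subseteq> O'" "emeasure lborel (O' - N) < ennreal d"
        by blast
      have "emeasure lborel O' \<le> emeasure lborel (O' - N) + emeasure lborel N"
        using O' N by (intro order_trans[OF _ emeasure_subadditive] emeasure_mono) auto
      then have O_d: "emeasure lborel O' < ennreal d" using O' N by auto
      obtain \<D> where \<D>: "countable \<D>" "\<D> \<subseteq> Pow O'" "\<And>X. X \<in> \<D> \<Longrightarrow> \<exists>a b. X = cbox a b" "\<Union>\<D> = O'"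
        using open_countable_Union_open_cbox[OF O'(1)] by metis
      have fin: "emeasure \<mu> (\<Union>\<F>) \<le> ennreal e" if \<F>: "finite \<F>" "\<F> \<subseteq> \<D>" for \<F>
      proof -
        obtain p where p: "p division_of (\<Union>\<F>)"
          using elementary_unions_intervals[OF \<F>(1)] \<D>(3) \<F>(2) by blast
        have finp: "finite p" using p by auto
        define f where "f K = (c (Inf K), c (Sup K))" for K :: "real set"
        have pK: "K = {Inf K..Sup K} \<and> Inf K \<le> Sup K \<and> K \<subseteq> O'" if Kp: "K \<in> p" for K
        proof -
          obtain a b where ab: "K = cbox a b" using division_ofD(4)[OF p Kp] by blast
          have ne: "K \<noteq> {}" by (rule division_ofD(3)[OF p Kp])
          have "K \<subseteq> \<Union>\<F>" by (rule division_ofD(2)[OF p Kp])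
          also have "\<dots> \<subseteq> O'" using \<F>(2) \<D>(4) by blast
          finally show ?thesis using ab ne by (simp add: cbox_interval)
        qed
        have int: "interior K = {Inf K<..<Sup K}" if "K \<in> p" for K
          using pK[OF that] interior_atLeastAtMost_real by metis
        have inI: "x \<in> interior K" if "K \<in> p" "x \<in> {fst (f K)<..<snd (f K)}" for x K
          using that c_in[of "Inf K" x "Sup K"] by (auto simp: int f_def)
        define A where "A = f ` p"
        have pw: "pairwise (\<lambda>P Q. disjnt {fst P<..<snd P} {fst Q<..<snd Q}) A"
        proof (rule pairwiseI)
          fix P Q assume "P \<in> A" "Q \<in> A" "P \<noteq> Q"
          then obtain K L where KL: "K \<in> p" "L \<in> p" "P = f K" "Q = f L" "K \<noteq> L" by (auto simp: A_def)
          have "interior K \<inter> interior L = {}" using division_ofD(5)[OF p KL(1,2,5)] .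
          then show "disjnt {fst P<..<snd P} {fst Q<..<snd Q}"
            unfolding KL disjnt_def using inI[OF KL(1)] inI[OF KL(2)] by blast
        qed
        have fA: "finite A" using finp by (simp add: A_def)
        have rngA: "\<forall>(s, t)\<in>A. 0 \<le> s \<and> s \<le> t \<and> t \<le> 1"
          using pK c01 c_mono by (fastforce simp: A_def f_def)
        have "ennreal (\<Sum>(s, t)\<in>A. t - s) = (\<Sum>P\<in>A. emeasure lborel {fst P<..<snd P})"
          using rngA by (subst sum_ennreal[symmetric]) (auto intro!: sum.cong simp: case_prod_unfold)
        also have "\<dots> = emeasure lborel (\<Union>P\<in>A. {fst P<..<snd P})"
          using pw fA by (intro sum_emeasure) (auto simp: disjoint_family_on_def pairwise_def disjnt_def)
        also have "\<dots> \<le> emeasure lborel O'"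
        proof (rule emeasure_mono)
          show "(\<Union>P\<in>A. {fst P<..<snd P}) \<subseteq> O'"
          proof
            fix x assume "x \<in> (\<Union>P\<in>A. {fst P<..<snd P})"
            then obtain K where "K \<in> p" "x \<in> {fst (f K)<..<snd (f K)}" by (auto simp: A_def)
            then show "x \<in> O'" using inI[of K x] interior_subset[of K] pK[of K] by blast
          qed
        qed (use O' in auto)
        also have "\<dots> < ennreal d" by (rule O_d)
        finally have "(\<Sum>(s, t)\<in>A. t - s) < d"
        proof (subst (asm) ennreal_less_iff)
          show "0 \<le> (\<Sum>(s, t)\<in>A. t - s)" using rngA by (intro sum_nonneg) auto
        qed
        from D[OF fA rngA pw this] have sum_e: "(\<Sum>(s, t)\<in>A. g t - g s) < e" .
        have "emeasure \<mu> (\<Union>\<F>) = emeasure \<mu> (\<Union>K\<in>p. K)" using division_ofD(6)[OF p] by simp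
        also have "\<dots> \<le> (\<Sum>K\<in>p. emeasure \<mu> K)"
        proof (rule emeasure_subadditive_finite[OF finp])
          show "(\<lambda>K. K) ` p \<subseteq> sets \<mu>"          proof
            fix K assume "K \<in> (\<lambda>K. K) ` p"
            then have "K = {Inf K..Sup K}" using pK by auto
            then show "K \<in> sets \<mu>" by (metis \<mu>_sets atLeastAtMost_borel sets_lborel)
          qed
        qed
        also have "\<dots> = (\<Sum>K\<in>p. ennreal (g (snd (f K)) - g (fst (f K))))"
        proof (rule sum.cong)
          fix K assume "K \<in> p"
          with pK have K: "K = {Inf K..Sup K}" "Inf K \<le> Sup K" by auto
          show "emeasure \<mu> K = ennreal (g (snd (f K)) - g (fst (f K)))"
            using \<mu>_Icc[OF K(2)] K(1) by (simp add: G_def f_def)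
        qed simp
        also have "\<dots> = ennreal (\<Sum>K\<in>p. g (snd (f K)) - g (fst (f K)))"
          using G_mono pK by (intro sum_ennreal) (auto simp: f_def G_def)
        \<comment> \<open>Clamping may send several intervals of p to the same pair, but only to a
          degenerate one, whose increment vanishes.\<close>
        also have "(\<Sum>K\<in>p. g (snd (f K)) - g (fst (f K))) = (\<Sum>(s, t)\<in>A. g t - g s)"
          unfolding A_def case_prod_unfold
        proof (subst sum.reindex_nontrivial[OF finp])
          fix K L assume KL: "K \<in> p" "L \<in> p" "K \<noteq> L" "f K = f L"
          have "fst (f K) = snd (f K)"
          proof (rule ccontr)
            assume "fst (f K) \<noteq> snd (f K)"
            moreover have "fst (f K) \<le> snd (f K)" using KL(1) rngA by (auto simp: A_def)
            ultimately have "(fst (f K) + snd (f K)) / 2 \<in> {fst (f K)<..<snd (f K)}" by auto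
            from inI[OF KL(1) this] inI[OF KL(2) this[unfolded KL(4)]] division_ofD(5)[OF p KL(1,2,3)]
            show False unfolding KL(4) by blast
          qed
          then show "g (snd (f K)) - g (fst (f K)) = 0" by simp
        qed simp
        also have "ennreal (\<Sum>(s, t)\<in>A. g t - g s) \<le> ennreal e" using sum_e by (intro ennreal_leI) simp
        finally show ?thesis .
      qed
      have "emeasure \<mu> O' \<le> ennreal e"
      proof (cases "\<D> = {}")
        case True then show ?thesis using \<D> by simp
      next
        case False
        define W where "W n = \<Union>(from_nat_into \<D> ` {..<n::nat})" for n
        have U: "(\<Union>n. W n) = O'"
        proof -
          have "(\<Union>n. W n) = \<Union>(range (from_nat_into \<D>))" unfolding W_def by blast
          then show ?thesis using \<D>(4) range_from_nat_into[OF False \<D>(1)] by simp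
        qed
        have "incseq W" by (force simp: incseq_def W_def)
        moreover have Wm: "W n \<in> sets \<mu>" for n
          unfolding W_def \<mu>_sets
        proof (intro sets.finite_Union subsetI)
          fix X assume "X \<in> from_nat_into \<D> ` {..<n}"
          then have "X \<in> \<D>" using from_nat_into[OF False] by blast
          then obtain a b where "X = cbox a b" using \<D>(3) by blast
          then show "X \<in> sets lborel" by simp
        qed simp
        ultimately have "(SUP n. emeasure \<mu> (W n)) = emeasure \<mu> (\<Union>n. W n)"
          by (intro SUP_emeasure_incseq) auto
        moreover have "emeasure \<mu> (W n) \<le> ennreal e" for n
          unfolding W_def using from_nat_into[OF False] by (intro fin) auto
        ultimately show ?thesis unfolding U by (metis SUP_least)
      qed
      moreover have "emeasure \<mu> N \<le> emeasure \<mu> O'"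
        using O' \<mu>_sets by (intro emeasure_mono) auto
      ultimately show ?thesis by simp
    qed
    have "emeasure \<mu> N \<le> 0"
    proof (rule ennreal_le_epsilon)
      show "emeasure \<mu> N \<le> 0 + ennreal e" if "0 < e" for e by (rule eps[OF that])
    qed
    then show "N \<in> null_sets \<mu>" using N \<mu>_sets by (auto simp: null_sets_def)
  qed
  define H where "H = RN_deriv lborel \<mu>"
  have [measurable]: "H \<in> borel_measurable borel" using borel_measurable_RN_deriv[of lborel \<mu>] by (simp add: H_def)
  have dens: "density lborel H = \<mu>" unfolding H_def
    by (rule sigma_finite_measure.density_RN_deriv[OF sigma_finite_lborel abs \<mu>_sets])
  have Hfin: "AE x in lborel. H x \<noteq> \<infinity>" unfolding H_def
  proof (rule sigma_finite_measure.RN_deriv_finite[OF sigma_finite_lborel _ abs \<mu>_sets])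
    show "sigma_finite_measure \<mu>" unfolding \<mu>_def by (rule sigma_finite_interval_measure[OF G_mono G_rc])
  qed
  define h where "h x = enn2real (H x)" for x
  have hm[measurable]: "h \<in> borel_measurable borel" unfolding h_def by measurable
  have hI: "(h has_integral (g b - g a)) {a..b}" if "0 \<le> a" "a \<le> b" "b \<le> 1" for a b
  proof -
    have gab: "g a \<le> g b" using G_mono[OF that(2)] that by (simp add: G_def c_id)
    have "(\<integral>\<^sup>+x. ennreal (h x * indicator {a..b} x) \<partial>lborel) = (\<integral>\<^sup>+x. H x * indicator {a..b} x \<partial>lborel)"
      by (rule nn_integral_cong_AE) (use Hfin in \<open>auto simp: h_def indicator_def less_top\<close>)
    also have "\<dots> = emeasure (density lborel H) {a..b}" by (subst emeasure_density) auto
    also have "\<dots> = ennreal (g b - g a)" using that unfolding dens by (simp add: \<mu>_Icc G_def c_id)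
    finally have "((\<lambda>x. h x * indicator {a..b} x) has_integral (g b - g a)) UNIV"
      using gab by (intro nn_integral_has_integral) (auto simp: h_def)
    then show ?thesis using has_integral_restrict_UNIV[of "{a..b}" h "g b - g a"]
      by (simp add: indicator_times_eq_if(2))
  qed
  have "h integrable_on {0..1}" using hI[of 0 1] by (auto simp: integrable_on_def)
  from ae_derivative_of_integral[OF this] obtain S where S: "negligible S"
    "\<And>x. x \<in> {0<..<1} - S \<Longrightarrow> ((\<lambda>t. integral {0..t} h) has_real_derivative h x) (at x)" by blast
  have "(g has_real_derivative h x) (at x)" if x: "x \<in> {0<..<1} - S" for x
  proof -
    have "((\<lambda>t. integral {0..t} h + g 0) has_real_derivative h x) (at x)"
      using DERIV_add[OF S(2)[OF x] DERIV_const] by simp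
    then show ?thesis
    proof (rule has_field_derivative_transform_within_open[where S = "{0<..<1}"])
      fix t :: real assume "t \<in> {0<..<1}"
      then show "integral {0..t} h + g 0 = g t" using integral_unique[OF hI[of 0 t]] by simp
    qed (use x in auto)
  qed
  with S(1) hI hm show ?thesis by (intro exI[of _ h]) (auto simp: h_def)
qed

section \<open>Variation and metric derivative\<close>

text \<open>Repetitions are allowed, unlike in \<open>partition_points\<close>, so that clamping a
  chain and concatenating two chains give chains again.\<close>

definition weak_chain :: "real \<Rightarrow> real \<Rightarrow> nat \<Rightarrow> (nat \<Rightarrow> real) \<Rightarrow> bool" where
  "weak_chain a b n t \<longleftrightarrow> (\<forall>i\<le>n. t i \<in> {a..b}) \<and> (\<forall>i<n. t i \<le> t (Suc i))"

definition chain_length :: "'a metric \<Rightarrow> (real \<Rightarrow> 'a) \<Rightarrow> nat \<Rightarrow> (nat \<Rightarrow> real) \<Rightarrow> real" where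
  "chain_length Y \<beta> n t = (\<Sum>i<n. mdist Y (\<beta> (t i)) (\<beta> (t (Suc i))))"

definition variation :: "'a metric \<Rightarrow> (real \<Rightarrow> 'a) \<Rightarrow> real \<Rightarrow> real \<Rightarrow> ennreal" where
  "variation Y \<beta> a b = (SUP (n, t) \<in> {(n, t). weak_chain a b n t}. ennreal (chain_length Y \<beta> n t))"

lemma chain_length_nonneg [simp]: "0 \<le> chain_length Y \<beta> n t"
  by (simp add: chain_length_def sum_nonneg)

lemma variation_ge: "weak_chain a b n t \<Longrightarrow> ennreal (chain_length Y \<beta> n t) \<le> variation Y \<beta> a b"
  unfolding variation_def by (rule SUP_upper2[where i = "(n, t)"]) auto

lemma variation_le:
  "(\<And>n t. weak_chain a b n t \<Longrightarrow> ennreal (chain_length Y \<beta> n t) \<le> C) \<Longrightarrow> variation Y \<beta> a b \<le> C"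
  unfolding variation_def by (rule SUP_least) auto

lemma weak_chain_mono: "weak_chain a b n t \<Longrightarrow> i \<le> j \<Longrightarrow> j \<le> n \<Longrightarrow> t i \<le> t j"
proof (induction j)
  case (Suc j)
  show ?case
  proof (cases "i = Suc j")
    case False
    then have "t i \<le> t j" using Suc by simp
    also have "t j \<le> t (Suc j)" using Suc.prems by (simp add: weak_chain_def)
    finally show ?thesis .
  qed simp
qed auto

lemma dist_le_variation:
  assumes "a \<le> b"
  shows "ennreal (mdist Y (\<beta> a) (\<beta> b)) \<le> variation Y \<beta> a b"
proof -
  have "weak_chain a b 1 (\<lambda>i. if i = 0 then a else b)" using assms by (auto simp: weak_chain_def)
  from variation_ge[OF this, of Y \<beta>] show ?thesis by (simp add: chain_length_def)
qed

text \<open>Clamping a chain at \<open>b\<close> from both sides splits it without inserting a point.\<close>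

lemma variation_subadditive:
  assumes \<beta>: "\<beta> \<in> {0..1} \<rightarrow> mspace Y" and ab: "0 \<le> a" "a \<le> b" "b \<le> c" "c \<le> 1"
  shows "variation Y \<beta> a c \<le> variation Y \<beta> a b + variation Y \<beta> b c"
proof (rule variation_le)
  fix n t assume t: "weak_chain a c n t"
  define u where "u i = min (t i) b" for i
  define v where "v i = max (t i) b" for i
  have "weak_chain a b n u" "weak_chain b c n v"
    using t ab by (auto simp: weak_chain_def u_def v_def min_def max_def)
  note uv = variation_ge[OF this(1), of Y \<beta>] variation_ge[OF this(2), of Y \<beta>]
  have "chain_length Y \<beta> n t \<le> chain_length Y \<beta> n u + chain_length Y \<beta> n v"
    unfolding chain_length_def sum.distrib[symmetric]
  proof (rule sum_mono)
    fix i assume "i \<in> {..<n}"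
    then have i: "t i \<in> {a..c}" "t (Suc i) \<in> {a..c}" "t i \<le> t (Suc i)" using t by (auto simp: weak_chain_def)
    have m: "\<beta> x \<in> mspace Y" if "x \<in> {a..c}" for x using that \<beta> ab by auto
    show "mdist Y (\<beta> (t i)) (\<beta> (t (Suc i)))
      \<le> mdist Y (\<beta> (u i)) (\<beta> (u (Suc i))) + mdist Y (\<beta> (v i)) (\<beta> (v (Suc i)))"
      using i mdist_triangle[OF m[OF i(1)] m[of b] m[OF i(2)]] ab m[of b]
      by (auto simp: u_def v_def min_def max_def)
  qed
  then have "ennreal (chain_length Y \<beta> n t) \<le> ennreal (chain_length Y \<beta> n u) + ennreal (chain_length Y \<beta> n v)"
    by (simp add: ennreal_plus[symmetric] del: ennreal_plus)
  also have "\<dots> \<le> variation Y \<beta> a b + variation Y \<beta> b c" by (intro add_mono uv)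
  finally show "ennreal (chain_length Y \<beta> n t) \<le> variation Y \<beta> a b + variation Y \<beta> b c" .
qed

lemma variation_superadditive:
  assumes ab: "a \<le> b" "b \<le> c"
  shows "variation Y \<beta> a b + variation Y \<beta> b c \<le> variation Y \<beta> a c"
proof -
  have *: "ennreal (chain_length Y \<beta> n t) + ennreal (chain_length Y \<beta> m s) \<le> variation Y \<beta> a c"
    if t: "weak_chain a b n t" and s: "weak_chain b c m s" for n t m s
  proof -
    define r where "r i = (if i \<le> n then t i else s (i - Suc n))" for i
    have "weak_chain a c (Suc n + m) r"
      unfolding weak_chain_def
    proof (intro conjI allI impI)
      fix i assume i: "i \<le> Suc n + m"
      show "r i \<in> {a..c}"
      proof (cases "i \<le> n")
        case True
        then have "t i \<in> {a..b}" using t by (simp add: weak_chain_def)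
        then show ?thesis using True ab by (simp add: r_def)
      next
        case False
        then have "i - Suc n \<le> m" using i by simp
        then have "s (i - Suc n) \<in> {b..c}" using s by (simp add: weak_chain_def)
        then show ?thesis using False ab by (simp add: r_def)
      qed
    next
      fix i assume i: "i < Suc n + m"
      consider "i < n" | "i = n" | "n < i" by linarith
      then show "r i \<le> r (Suc i)"
      proof cases
        case 1 then show ?thesis using t by (simp add: r_def weak_chain_def)
      next
        case 2
        have "t n \<in> {a..b}" "s 0 \<in> {b..c}" using t s by (auto simp: weak_chain_def)
        then show ?thesis using 2 by (simp add: r_def)
      next
        case 3
        then obtain k where "i = Suc n + k" using less_iff_Suc_add by auto
        then show ?thesis using s i by (simp add: r_def weak_chain_def)
      qed
    qed
    from variation_ge[OF this, of Y \<beta>]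
    have h1: "ennreal (chain_length Y \<beta> (Suc n + m) r) \<le> variation Y \<beta> a c" .
    have h2: "chain_length Y \<beta> (Suc n + m) r = chain_length Y \<beta> n t + mdist Y (\<beta> (t n)) (\<beta> (s 0)) + chain_length Y \<beta> m s"
    proof -
      have split: "(\<Sum>i<k + m. F i) = (\<Sum>i<k. F i) + (\<Sum>i<m. F (k + i))" for F :: "nat \<Rightarrow> real" and k
        by (induction m) (simp_all add: add.assoc)
      show ?thesis by (simp only: chain_length_def split) (simp add: r_def)
    qed
    have "ennreal (chain_length Y \<beta> n t) + ennreal (chain_length Y \<beta> m s)
       \<le> ennreal (chain_length Y \<beta> n t + mdist Y (\<beta> (t n)) (\<beta> (s 0)) + chain_length Y \<beta> m s)"
      by (subst ennreal_plus[symmetric]) (auto intro!: ennreal_leI)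
    then show ?thesis using h1 unfolding h2 by (rule order_trans)
  qed
  have ne: "{(n, t). weak_chain a b n t} \<noteq> {}" "{(n, t). weak_chain b c n t} \<noteq> {}"
    using ab by (auto simp: weak_chain_def intro!: exI[of _ 0] exI[of _ "\<lambda>_. b"])
  show ?thesis
    unfolding variation_def[of Y \<beta> a b]
  proof (subst ennreal_SUP_add_left[symmetric, OF ne(1)], rule SUP_least, clarify)
    fix n t assume t: "weak_chain a b n t"
    show "ennreal (chain_length Y \<beta> n t) + variation Y \<beta> b c \<le> variation Y \<beta> a c"
      unfolding variation_def[of Y \<beta> b c]
    proof (subst add.commute, subst ennreal_SUP_add_left[symmetric, OF ne(2)], rule SUP_least, clarify)
      fix m s assume "weak_chain b c m s"
      from *[OF t this] show "ennreal (chain_length Y \<beta> m s) + ennreal (chain_length Y \<beta> n t) \<le> variation Y \<beta> a c"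
        by (simp add: add.commute)
    qed
  qed
qed

lemma weak_chain_disjoint:
  assumes t: "weak_chain a b n t"
  shows "disjoint_family_on (\<lambda>i. {t i<..<t (Suc i)}) {..<n}"
proof -
  have "{t i<..<t (Suc i)} \<inter> {t j<..<t (Suc j)} = {}" if "i < j" "j < n" for i j
    using weak_chain_mono[OF t, of "Suc i" j] that by auto
  then show ?thesis
    unfolding disjoint_family_on_def by (metis inf_commute lessThan_iff linorder_neqE_nat)
qed

lemma weak_chain_sum:
  assumes t: "weak_chain a b n t"
  shows "(\<Sum>i<n. t (Suc i) - t i) \<le> b - a"
proof -
  have "(\<Sum>i<n. t (Suc i) - t i) = t n - t 0" by (rule sum_lessThan_telescope)
  also have "\<dots> \<le> b - a" using t by (auto simp: weak_chain_def intro!: diff_mono)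
  finally show ?thesis .
qed

text \<open>Absolute continuity is stated for initial segments of the naturals; later families are
  indexed by pairs of an interval and a position in a chain.\<close>

lemma ac_finite_index:
  fixes s t :: "'i \<Rightarrow> real"
  assumes ac: "absolutely_continuous_curve Y \<beta>" and "\<epsilon> > 0"
  shows "\<exists>\<delta>>0. \<forall>(I :: 'i set) s t. finite I \<and> (\<forall>i\<in>I. 0 \<le> s i \<and> s i \<le> t i \<and> t i \<le> 1) \<and>
        disjoint_family_on (\<lambda>i. {s i<..<t i}) I \<and> (\<Sum>i\<in>I. t i - s i) < \<delta> \<longrightarrow>
        (\<Sum>i\<in>I. mdist Y (\<beta> (s i)) (\<beta> (t i))) < \<epsilon>"
proof -
  obtain \<delta> where \<delta>: "\<delta> > 0" and D: "\<And>(n::nat) s t.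
        (\<forall>i<n. 0 \<le> s i \<and> s i \<le> t i \<and> t i \<le> 1) \<Longrightarrow>
        disjoint_family_on (\<lambda>i. {s i<..<t i}) {..<n} \<Longrightarrow> (\<Sum>i<n. t i - s i) < \<delta> \<Longrightarrow>
        (\<Sum>i<n. mdist Y (\<beta> (s i)) (\<beta> (t i))) < \<epsilon>"
    using ac \<open>\<epsilon> > 0\<close> unfolding absolutely_continuous_curve_def by meson
  show ?thesis
  proof (intro exI[of _ \<delta>] conjI allI impI \<delta>)
    fix I :: "'i set" and s t :: "'i \<Rightarrow> real"
    assume A: "finite I \<and> (\<forall>i\<in>I. 0 \<le> s i \<and> s i \<le> t i \<and> t i \<le> 1) \<and>
        disjoint_family_on (\<lambda>i. {s i<..<t i}) I \<and> (\<Sum>i\<in>I. t i - s i) < \<delta>"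
    then obtain h where h: "bij_betw h {..<card I} I"
      using ex_bij_betw_nat_finite[of I] by (auto simp: atLeast0LessThan)
    have hI: "h i \<in> I" if "i < card I" for i using h that by (auto simp: bij_betw_def)
    have "disjoint_family_on (\<lambda>i. {s (h i)<..<t (h i)}) {..<card I}"
      using A h hI unfolding disjoint_family_on_def bij_betw_def inj_on_def by (metis lessThan_iff)
    moreover have "(\<Sum>i<card I. t (h i) - s (h i)) < \<delta>"
      using A sum.reindex_bij_betw[OF h, of "\<lambda>i. t i - s i"] by simp
    ultimately have "(\<Sum>i<card I. mdist Y (\<beta> (s (h i))) (\<beta> (t (h i)))) < \<epsilon>"
      using A hI by (intro D) auto
    then show "(\<Sum>i\<in>I. mdist Y (\<beta> (s i)) (\<beta> (t i))) < \<epsilon>"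
      using sum.reindex_bij_betw[OF h, of "\<lambda>i. mdist Y (\<beta> (s i)) (\<beta> (t i))"] by simp
  qed
qed

text \<open>Pieces shorter than the \<delta> belonging to 1 have variation at most 1, and finitely
  many of them fill the unit interval.\<close>

lemma ac_variation_finite:
  assumes ac: "absolutely_continuous_curve Y \<beta>"
  shows "variation Y \<beta> 0 1 < \<top>"
proof -
  have \<beta>: "\<beta> \<in> {0..1} \<rightarrow> mspace Y" using ac by (simp add: absolutely_continuous_curve_def)
  obtain \<delta> where \<delta>: "\<delta> > 0" and D: "\<And>(I :: nat set) s t. finite I \<and> (\<forall>i\<in>I. 0 \<le> s i \<and> s i \<le> t i \<and> t i \<le> 1) \<and>
        disjoint_family_on (\<lambda>i. {s i<..<t i}) I \<and> (\<Sum>i\<in>I. t i - s i) < \<delta> \<Longrightarrow>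
        (\<Sum>i\<in>I. mdist Y (\<beta> (s i)) (\<beta> (t i))) < 1"
    using ac_finite_index[OF ac, of 1] by auto
  have small: "variation Y \<beta> a b \<le> 1" if "0 \<le> a" "a \<le> b" "b \<le> 1" "b - a < \<delta>" for a b
  proof (rule variation_le)
    fix n t assume t: "weak_chain a b n t"
    have "chain_length Y \<beta> n t < 1"
      unfolding chain_length_def
    proof (rule D, intro conjI ballI)
      fix i assume "i \<in> {..<n}"
      then have "t i \<in> {a..b}" "t (Suc i) \<in> {a..b}" "t i \<le> t (Suc i)" using t by (auto simp: weak_chain_def)
      then show "0 \<le> t i" "t i \<le> t (Suc i)" "t (Suc i) \<le> 1" using that by auto
    next
      show "(\<Sum>i<n. t (Suc i) - t i) < \<delta>" using weak_chain_sum[OF t] that by simp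
    qed (use weak_chain_disjoint[OF t] in auto)
    then show "ennreal (chain_length Y \<beta> n t) \<le> 1" by (metis ennreal_1 ennreal_leI less_imp_le)
  qed
  obtain n :: nat where n: "1 / real (Suc n) < \<delta>" using nat_approx_posE[OF \<delta>] by blast
  have "variation Y \<beta> 0 (real k / real (Suc n)) \<le> of_nat (Suc k)" if "k \<le> Suc n" for k
    using that
  proof (induction k)
    case 0
    then show ?case using small[of 0 0] \<delta> by simp
  next
    case (Suc k)
    have le: "real k / real (Suc n) \<le> real (Suc k) / real (Suc n)" by (intro divide_right_mono) auto
    have le1: "real (Suc k) / real (Suc n) \<le> 1" using Suc by simp
    have "variation Y \<beta> 0 (real (Suc k) / real (Suc n)) \<le> variation Y \<beta> 0 (real k / real (Suc n))
       + variation Y \<beta> (real k / real (Suc n)) (real (Suc k) / real (Suc n))"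
      by (intro variation_subadditive \<beta> le le1) auto
    also have "\<dots> \<le> of_nat (Suc k) + 1"
    proof (intro add_mono small le le1)
      show "variation Y \<beta> 0 (real k / real (Suc n)) \<le> of_nat (Suc k)" using Suc by simp
      show "real (Suc k) / real (Suc n) - real k / real (Suc n) < \<delta>"
        using n by (simp add: diff_divide_distrib[symmetric])
    qed auto
    finally show ?case by (simp add: add.commute)
  qed
  from this[of "Suc n"] have "variation Y \<beta> 0 1 \<le> of_nat (Suc (Suc n))" by simp
  also have "\<dots> < \<top>" using of_nat_less_top by blast
  finally show ?thesis .
qed

text \<open>Every chain becomes a strict partition after removing repetitions.\<close>

lemma variation_le_metric_length:
  assumes \<beta>: "\<beta> \<in> {0..1} \<rightarrow> mspace Y"
  shows "variation Y \<beta> 0 1 \<le> metric_length Y {0..1} \<beta>"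
proof (rule variation_le)
  fix n t assume "weak_chain 0 1 n t"
  then have "\<exists>n' t'. partition_points {0..1} n' t' \<and> t' n' = t n \<and> chain_length Y \<beta> n t \<le> chain_length Y \<beta> n' t'"
  proof (induction n)
    case 0
    then show ?case
      by (intro exI[of _ 0] exI[of _ t]) (auto simp: partition_points_def weak_chain_def)
  next
    case (Suc n)
    then obtain n' t' where IH: "partition_points {0..1} n' t'" "t' n' = t n"
      "chain_length Y \<beta> n t \<le> chain_length Y \<beta> n' t'" by (auto simp: weak_chain_def)
    show ?case
    proof (cases "t (Suc n) = t n")
      case True
      then have "chain_length Y \<beta> (Suc n) t = chain_length Y \<beta> n t + mdist Y (\<beta> (t n)) (\<beta> (t n))"
        by (simp add: chain_length_def)
      moreover have "\<beta> (t n) \<in> mspace Y" using \<beta> Suc.prems by (auto simp: weak_chain_def)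
      ultimately have "chain_length Y \<beta> (Suc n) t = chain_length Y \<beta> n t" by (simp add: mdist_zero)
      then show ?thesis using IH True by (intro exI[of _ n'] exI[of _ t']) simp
    next
      case False
      define s where "s i = (if i \<le> n' then t' i else t (Suc n))" for i
      have "t n < t (Suc n)" "t (Suc n) \<in> {0..1}" using False Suc.prems by (auto simp: weak_chain_def less_le)
      then have "partition_points {0..1} (Suc n') s"
        using IH by (auto simp: partition_points_def s_def less_Suc_eq)
      moreover have "chain_length Y \<beta> (Suc n') s = chain_length Y \<beta> n' t' + mdist Y (\<beta> (t n)) (\<beta> (t (Suc n)))"
        using IH by (simp add: chain_length_def s_def)
      moreover have "chain_length Y \<beta> (Suc n) t = chain_length Y \<beta> n t + mdist Y (\<beta> (t n)) (\<beta> (t (Suc n)))"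
        by (simp add: chain_length_def)
      moreover have "s (Suc n') = t (Suc n)" by (simp add: s_def)
      ultimately show ?thesis using IH(3) by (intro exI[of _ "Suc n'"] exI[of _ s]) simp
    qed
  qed
  then obtain n' t' where p: "partition_points {0..1} n' t'" "chain_length Y \<beta> n t \<le> chain_length Y \<beta> n' t'" by blast
  have "ennreal (chain_length Y \<beta> n t) \<le> (\<Sum>i<n'. ennreal (mdist Y (\<beta> (t' i)) (\<beta> (t' (Suc i)))))"
    using ennreal_leI[OF p(2)] by (simp add: chain_length_def[of Y \<beta> n' t'] sum_ennreal)
  also have "\<dots> \<le> metric_length Y {0..1} \<beta>"
    unfolding metric_length_def using p(1) by (intro SUP_upper2[where i = "(n', t')"]) auto
  finally show "ennreal (chain_length Y \<beta> n t) \<le> metric_length Y {0..1} \<beta>" .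
qed

lemma variation_real:
  assumes ac: "absolutely_continuous_curve Y \<beta>" and ab: "0 \<le> a" "a \<le> b" "b \<le> 1"
  shows "variation Y \<beta> a b = ennreal (enn2real (variation Y \<beta> 0 b) - enn2real (variation Y \<beta> 0 a))"
    and "enn2real (variation Y \<beta> 0 a) \<le> enn2real (variation Y \<beta> 0 b)"
proof -
  have \<beta>: "\<beta> \<in> {0..1} \<rightarrow> mspace Y" using ac by (simp add: absolutely_continuous_curve_def)
  have fin: "variation Y \<beta> 0 c < \<top>" if "0 \<le> c" "c \<le> 1" for c
  proof -
    have "variation Y \<beta> 0 c \<le> variation Y \<beta> 0 c + variation Y \<beta> c 1" by simp
    also have "\<dots> \<le> variation Y \<beta> 0 1" by (rule variation_superadditive) (use that in auto)
    finally show ?thesis using ac_variation_finite[OF ac] by (rule le_less_trans)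
  qed
  have eq: "variation Y \<beta> 0 b = variation Y \<beta> 0 a + variation Y \<beta> a b"
    using variation_subadditive[OF \<beta>, of 0 a b] variation_superadditive[of 0 a b Y \<beta>] ab by (simp add: antisym)
  obtain x where x: "variation Y \<beta> 0 a = ennreal x" "0 \<le> x" using fin[of a] ab by (cases "variation Y \<beta> 0 a") auto
  obtain z where z: "variation Y \<beta> 0 b = ennreal z" "0 \<le> z" using fin[of b] ab by (cases "variation Y \<beta> 0 b") auto
  obtain y where y: "variation Y \<beta> a b = ennreal y" "0 \<le> y" using eq z by (cases "variation Y \<beta> a b") auto
  have "z = x + y" using eq x y z by (simp add: ennreal_plus[symmetric] del: ennreal_plus)
  then show "variation Y \<beta> a b = ennreal (enn2real (variation Y \<beta> 0 b) - enn2real (variation Y \<beta> 0 a))"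
    "enn2real (variation Y \<beta> 0 a) \<le> enn2real (variation Y \<beta> 0 b)"
    unfolding y x z enn2real_ennreal[OF x(2)] enn2real_ennreal[OF z(2)] using y by simp_all
qed

text \<open>In each interval of the family a chain almost attains the variation. The steps of all
  these chains together are disjoint intervals of no larger total length, so absolute continuity of
  the curve itself bounds the sum of their lengths.\<close>

lemma ac_variation:
  assumes ac: "absolutely_continuous_curve Y \<beta>"
  defines "lv \<equiv> \<lambda>t. enn2real (variation Y \<beta> 0 t)"
  shows "ac_intervals (\<lambda>s t. lv t - lv s)"
  unfolding ac_intervals_def
proof (intro allI impI)
  fix \<epsilon> :: real assume e: "\<epsilon> > 0"
  obtain \<delta> where \<delta>: "\<delta> > 0" and D: "\<And>(I :: ((real \<times> real) \<times> nat) set) s t. finite I \<and> (\<forall>i\<in>I. 0 \<le> s i \<and> s i \<le> t i \<and> t i \<le> 1) \<and>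
        disjoint_family_on (\<lambda>i. {s i<..<t i}) I \<and> (\<Sum>i\<in>I. t i - s i) < \<delta> \<Longrightarrow>
        (\<Sum>i\<in>I. mdist Y (\<beta> (s i)) (\<beta> (t i))) < \<epsilon> / 2"
    using ac_finite_index[OF ac, of "\<epsilon> / 2"] e by auto
  show "\<exists>\<delta>>0. \<forall>A. finite A \<and> (\<forall>(s, t)\<in>A. 0 \<le> s \<and> s \<le> t \<and> t \<le> 1) \<and>
     pairwise (\<lambda>P Q. disjnt {fst P<..<snd P} {fst Q<..<snd Q}) A \<and> (\<Sum>(s, t)\<in>A. t - s) < \<delta> \<longrightarrow>
     (\<Sum>(s, t)\<in>A. lv t - lv s) < \<epsilon>"
  proof (intro exI[of _ \<delta>] conjI allI impI \<delta>)
    fix A :: "(real \<times> real) set"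
    assume A: "finite A \<and> (\<forall>(s, t)\<in>A. 0 \<le> s \<and> s \<le> t \<and> t \<le> 1) \<and>
     pairwise (\<lambda>P Q. disjnt {fst P<..<snd P} {fst Q<..<snd Q}) A \<and> (\<Sum>(s, t)\<in>A. t - s) < \<delta>"
    \<comment> \<open>The loss \<eta> per interval adds up to at most \<epsilon> / 4, while the
      chains contribute less than \<epsilon> / 2.\<close>
    define \<eta> where "\<eta> = \<epsilon> / (4 * (real (card A) + 1))"
    have \<eta>: "\<eta> > 0" using e by (simp add: \<eta>_def)
    have P01: "0 \<le> fst P \<and> fst P \<le> snd P \<and> snd P \<le> 1" if "P \<in> A" for P using A that by auto
    have "\<exists>nt. weak_chain (fst P) (snd P) (fst nt) (snd nt) \<and> lv (snd P) - lv (fst P) - \<eta> \<le> chain_length Y \<beta> (fst nt) (snd nt)"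
      if P: "P \<in> A" for P
    proof (rule ccontr)
      assume neg: "\<not> ?thesis"
      have V: "variation Y \<beta> (fst P) (snd P) = ennreal (lv (snd P) - lv (fst P))"
        unfolding lv_def using P01[OF P] by (intro variation_real(1)[OF ac]) auto
      have "variation Y \<beta> (fst P) (snd P) \<le> ennreal (lv (snd P) - lv (fst P) - \<eta>)"
      proof (rule variation_le)
        fix n t assume "weak_chain (fst P) (snd P) n t"
        with neg have "\<not> lv (snd P) - lv (fst P) - \<eta> \<le> chain_length Y \<beta> n t" by auto
        then show "ennreal (chain_length Y \<beta> n t) \<le> ennreal (lv (snd P) - lv (fst P) - \<eta>)"
          by (intro ennreal_leI) simp
      qed
      moreover have "weak_chain (fst P) (snd P) 0 (\<lambda>_. fst P)" using P01[OF P] by (auto simp: weak_chain_def)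
      with neg have "\<not> lv (snd P) - lv (fst P) - \<eta> \<le> chain_length Y \<beta> 0 (\<lambda>_. fst P)"
        by auto
      then have "lv (snd P) - lv (fst P) - \<eta> > 0" by (simp add: chain_length_def)
      ultimately show False using V \<eta> by simp
    qed
    then obtain nt where nt: "\<And>P. P \<in> A \<Longrightarrow> weak_chain (fst P) (snd P) (fst (nt P)) (snd (nt P))"
      "\<And>P. P \<in> A \<Longrightarrow> lv (snd P) - lv (fst P) - \<eta> \<le> chain_length Y \<beta> (fst (nt P)) (snd (nt P))"
      by metis
    define I where "I = Sigma A (\<lambda>P. {..<fst (nt P)})"
    define s where "s Pi = snd (nt (fst Pi)) (snd Pi)" for Pi :: "(real \<times> real) \<times> nat"
    define t where "t Pi = snd (nt (fst Pi)) (Suc (snd Pi))" for Pi :: "(real \<times> real) \<times> nat"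
    have st: "fst P \<le> s (P, i) \<and> s (P, i) \<le> t (P, i) \<and> t (P, i) \<le> snd P" if "P \<in> A" "i < fst (nt P)" for P i
      using nt(1)[OF that(1)] that(2) by (auto simp: weak_chain_def s_def t_def)
    have fin: "finite A" "finite I" using A by (auto simp: I_def)
    have "(\<Sum>i\<in>I. mdist Y (\<beta> (s i)) (\<beta> (t i))) < \<epsilon> / 2"
    proof (rule D, intro conjI ballI)
      show "finite I" by fact
      fix i assume "i \<in> I"
      then obtain P j where P: "i = (P, j)" "P \<in> A" "j < fst (nt P)" by (auto simp: I_def)
      show "0 \<le> s i" "s i \<le> t i" "t i \<le> 1" using st[OF P(2,3)] P01[OF P(2)] P(1) by auto
    next
      show "disjoint_family_on (\<lambda>i. {s i<..<t i}) I"
        unfolding disjoint_family_on_def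
      proof (intro ballI impI)
        fix i j assume ij: "i \<in> I" "j \<in> I" "i \<noteq> j"
        obtain P a where P: "i = (P, a)" "P \<in> A" "a < fst (nt P)" using ij by (auto simp: I_def)
        obtain Q b where Q: "j = (Q, b)" "Q \<in> A" "b < fst (nt Q)" using ij by (auto simp: I_def)
        show "{s i<..<t i} \<inter> {s j<..<t j} = {}"
        proof (cases "P = Q")
          case True
          with ij P Q have "a \<noteq> b" by auto
          with weak_chain_disjoint[OF nt(1)[OF P(2)]] P Q True show ?thesis
            by (auto simp: disjoint_family_on_def s_def t_def)
        next
          case False
          then have "disjnt {fst P<..<snd P} {fst Q<..<snd Q}" using A P(2) Q(2) by (auto simp: pairwise_def)
          moreover have "{s i<..<t i} \<subseteq> {fst P<..<snd P}" "{s j<..<t j} \<subseteq> {fst Q<..<snd Q}"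
            using st[OF P(2,3)] st[OF Q(2,3)] P(1) Q(1) by auto
          ultimately show ?thesis by (auto simp only: disjnt_def)
        qed
      qed
    next
      have "(\<Sum>i\<in>I. t i - s i) = (\<Sum>P\<in>A. \<Sum>i<fst (nt P). t (P, i) - s (P, i))"
        unfolding I_def using fin by (subst sum.Sigma) auto
      also have "\<dots> \<le> (\<Sum>P\<in>A. snd P - fst P)"
        using weak_chain_sum[OF nt(1)] by (intro sum_mono) (simp add: s_def t_def)
      also have "\<dots> < \<delta>" using A by (simp add: case_prod_unfold)
      finally show "(\<Sum>i\<in>I. t i - s i) < \<delta>" .
    qed
    moreover have "(\<Sum>i\<in>I. mdist Y (\<beta> (s i)) (\<beta> (t i))) = (\<Sum>P\<in>A. chain_length Y \<beta> (fst (nt P)) (snd (nt P)))"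
    proof -
      have "(\<Sum>i\<in>I. mdist Y (\<beta> (s i)) (\<beta> (t i)))
          = (\<Sum>P\<in>A. \<Sum>i<fst (nt P). mdist Y (\<beta> (s (P, i))) (\<beta> (t (P, i))))"
        unfolding I_def using fin by (subst sum.Sigma) auto
      then show ?thesis by (simp add: chain_length_def s_def t_def)
    qed
    moreover have "(\<Sum>P\<in>A. lv (snd P) - lv (fst P) - \<eta>) \<le> (\<Sum>P\<in>A. chain_length Y \<beta> (fst (nt P)) (snd (nt P)))"
      by (intro sum_mono nt(2))
    moreover have "(\<Sum>P\<in>A. lv (snd P) - lv (fst P) - \<eta>) = (\<Sum>P\<in>A. lv (snd P) - lv (fst P)) - real (card A) * \<eta>"
      by (simp add: sum_subtractf)
    moreover have "real (card A) * \<eta> \<le> \<epsilon> / 4"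
      using e by (simp add: \<eta>_def field_simps)
    ultimately show "(\<Sum>(s, t)\<in>A. lv t - lv s) < \<epsilon>" using e by (simp add: case_prod_unfold)
  qed
qed

text \<open>The difference quotients are at most those of lv. From below, the triangle inequality
  compares them with the quotients of the distance to a fixed point \<beta> q, whose derivatives
  come arbitrarily close to v.\<close>

lemma metric_speed_tendsto:
  assumes \<beta>: "\<beta> \<in> {0..1} \<rightarrow> mspace Y" and x: "x \<in> {0<..<1}"
    and d: "\<And>s t. 0 \<le> s \<Longrightarrow> s \<le> t \<Longrightarrow> t \<le> 1 \<Longrightarrow> mdist Y (\<beta> s) (\<beta> t) \<le> lv t - lv s"
    and lv: "(lv has_real_derivative v) (at x)"
    and low: "\<And>e. e > 0 \<Longrightarrow> \<exists>q\<in>{0..1}. \<exists>w>v - e. ((\<lambda>t. mdist Y (\<beta> q) (\<beta> t)) has_real_derivative w) (at x)"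
  shows "((\<lambda>s. mdist Y (\<beta> s) (\<beta> x) / \<bar>s - x\<bar>) \<longlongrightarrow> v) (at x)"
proof -
  have lv': "((\<lambda>s. (lv s - lv x) / (s - x)) \<longlongrightarrow> v) (at x)" using lv by (simp add: DERIV_def has_field_derivative_iff)
  have ev: "eventually (\<lambda>s. s \<in> {0<..<1} \<and> s \<noteq> x) (at x)"
    using x by (intro eventually_conj eventually_at_in_open' eventually_neq_at_within) auto
  have up: "mdist Y (\<beta> s) (\<beta> x) / \<bar>s - x\<bar> \<le> (lv s - lv x) / (s - x)" if "s \<in> {0<..<1} \<and> s \<noteq> x" for s
  proof (cases "s < x")
    case True
    have "mdist Y (\<beta> s) (\<beta> x) / (x - s) \<le> (lv x - lv s) / (x - s)"
      using d[of s x] that x True by (intro divide_right_mono) auto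
    also have "\<dots> = (lv s - lv x) / (s - x)" by (metis minus_diff_eq minus_divide_divide)
    finally show ?thesis using True by simp
  next
    case False
    then show ?thesis using d[of x s] that x by (simp add: mdist_commute divide_right_mono)
  qed
  show ?thesis
  proof (rule order_tendstoI)
    fix a assume "a < v"
    then obtain q w where q: "q \<in> {0..1}" "w > v - (v - a)" and
      w: "((\<lambda>t. mdist Y (\<beta> q) (\<beta> t)) has_real_derivative w) (at x)" using low[of "v - a"] by auto
    have "((\<lambda>s. (mdist Y (\<beta> q) (\<beta> s) - mdist Y (\<beta> q) (\<beta> x)) / (s - x)) \<longlongrightarrow> w) (at x)"
      using w by (simp add: has_field_derivative_iff)
    moreover have "a < w" using q by simp
    ultimately have "eventually (\<lambda>s. a < (mdist Y (\<beta> q) (\<beta> s) - mdist Y (\<beta> q) (\<beta> x)) / (s - x)) (at x)"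
      by (rule order_tendstoD)
    with ev show "eventually (\<lambda>s. a < mdist Y (\<beta> s) (\<beta> x) / \<bar>s - x\<bar>) (at x)"
    proof eventually_elim
      case (elim s)
      have m: "\<beta> q \<in> mspace Y" "\<beta> s \<in> mspace Y" "\<beta> x \<in> mspace Y" using \<beta> q elim x by auto
      have "\<bar>mdist Y (\<beta> q) (\<beta> s) - mdist Y (\<beta> q) (\<beta> x)\<bar> \<le> mdist Y (\<beta> s) (\<beta> x)"
        using mdist_triangle[OF m(1,2,3)] mdist_triangle[OF m(1,3,2)] by (simp add: mdist_commute abs_le_iff)
      then have "\<bar>(mdist Y (\<beta> q) (\<beta> s) - mdist Y (\<beta> q) (\<beta> x)) / (s - x)\<bar> \<le> mdist Y (\<beta> s) (\<beta> x) / \<bar>s - x\<bar>"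
        unfolding abs_divide by (rule divide_right_mono) simp
      then show ?case using elim by linarith
    qed
  next
    fix a assume "v < a"
    then have "eventually (\<lambda>s. (lv s - lv x) / (s - x) < a) (at x)" by (rule order_tendstoD(2)[OF lv'])
    with ev show "eventually (\<lambda>s. mdist Y (\<beta> s) (\<beta> x) / \<bar>s - x\<bar> < a) (at x)"
      by eventually_elim (use up le_less_trans in blast)
  qed
qed

text \<open>With \<open>D\<^sub>q t\<close> the distance from \<open>\<beta> q\<close> to \<open>\<beta> t\<close>, the sum of \<open>D\<^sub>q\<close> and the variation is
  nondecreasing, so \<open>D\<^sub>q\<close> is differentiable a.e. If its derivative stayed below the derivative of the variation by
  a fixed amount on a set of positive measure for all \<open>q\<close> in the nodes of almost optimal chains, those chains
  would be too short.\<close>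

lemma ac_metric_derivative:
  assumes ac: "absolutely_continuous_curve Y \<beta>"
  shows "\<exists>lv v. lv 0 = 0 \<and> (\<forall>s t. 0 \<le> s \<longrightarrow> s \<le> t \<longrightarrow> t \<le> 1 \<longrightarrow> mdist Y (\<beta> s) (\<beta> t) \<le> lv t - lv s) \<and>
    ac_intervals (\<lambda>s t. lv t - lv s) \<and> v \<in> borel_measurable borel \<and> (\<forall>x. 0 \<le> v x) \<and>
    (\<forall>a b. 0 \<le> a \<longrightarrow> a \<le> b \<longrightarrow> b \<le> 1 \<longrightarrow> (v has_integral (lv b - lv a)) {a..b}) \<and>
    (\<exists>S. negligible S \<and> (\<forall>x\<in>{0<..<1} - S. (lv has_real_derivative v x) (at x) \<and>
      ((\<lambda>s. mdist Y (\<beta> s) (\<beta> x) / \<bar>s - x\<bar>) \<longlongrightarrow> v x) (at x)))"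
proof -
  have \<beta>: "\<beta> \<in> {0..1} \<rightarrow> mspace Y" using ac by (simp add: absolutely_continuous_curve_def)
  define lv where "lv t = enn2real (variation Y \<beta> 0 t)" for t
  have lv_mono: "lv s \<le> lv t" if "0 \<le> s" "s \<le> t" "t \<le> 1" for s t
    unfolding lv_def by (rule variation_real(2)[OF ac that])
  have d: "mdist Y (\<beta> s) (\<beta> t) \<le> lv t - lv s" if "0 \<le> s" "s \<le> t" "t \<le> 1" for s t
  proof -
    have "ennreal (mdist Y (\<beta> s) (\<beta> t)) \<le> ennreal (lv t - lv s)"
      using dist_le_variation[OF that(2), of Y \<beta>] unfolding lv_def variation_real(1)[OF ac that] .
    then show ?thesis using lv_mono[OF that] by simp
  qed
  have lv0: "lv 0 = 0"
  proof -
    have "variation Y \<beta> 0 0 = 0" using variation_real(1)[OF ac, of 0 0] by simp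
    then show ?thesis by (simp add: lv_def)
  qed
  have lv_ac: "ac_intervals (\<lambda>s t. lv t - lv s)" unfolding lv_def by (rule ac_variation[OF ac])
  have "mono_on {0..1} lv" using lv_mono by (auto intro!: mono_onI)
  from ac_mono_derivative[OF this lv_ac] obtain v S0 where v: "v \<in> borel_measurable borel" "\<And>x. 0 \<le> v x"
     "\<And>a b. 0 \<le> a \<Longrightarrow> a \<le> b \<Longrightarrow> b \<le> 1 \<Longrightarrow> (v has_integral (lv b - lv a)) {a..b}"
     "negligible S0" "\<And>x. x \<in> {0<..<1} - S0 \<Longrightarrow> (lv has_real_derivative v x) (at x)" by auto
  define D where "D q t = mdist Y (\<beta> q) (\<beta> t)" for q t
  have Dd: "\<bar>D q t - D q s\<bar> \<le> lv t - lv s" if "q \<in> {0..1}" "0 \<le> s" "s \<le> t" "t \<le> 1" for q s t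
  proof -
    have m: "\<beta> q \<in> mspace Y" "\<beta> s \<in> mspace Y" "\<beta> t \<in> mspace Y" using \<beta> that by auto
    have "\<bar>D q t - D q s\<bar> \<le> mdist Y (\<beta> s) (\<beta> t)"
      using mdist_triangle[OF m(1,2,3)] mdist_triangle[OF m(1,3,2)] by (simp add: D_def mdist_commute abs_le_iff)
    then show ?thesis using d[OF that(2-4)] by linarith
  qed
  have "\<exists>k. k \<in> borel_measurable borel \<and>
     (\<forall>a b. 0 \<le> a \<longrightarrow> a \<le> b \<longrightarrow> b \<le> 1 \<longrightarrow> (k has_integral (D q b - D q a)) {a..b}) \<and>
     (\<exists>S. negligible S \<and> (\<forall>x\<in>{0<..<1} - S. (D q has_real_derivative k x) (at x)))" if q: "q \<in> {0..1}" for q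
  proof -
    have "mono_on {0..1} (\<lambda>t. D q t + lv t)" using Dd[OF q] by (auto intro!: mono_onI simp: abs_le_iff) fastforce
    moreover have "ac_intervals (\<lambda>s t. (D q t + lv t) - (D q s + lv s))"
      unfolding ac_intervals_def
    proof (intro allI impI)
      fix e :: real assume "e > 0"
      then obtain \<delta> where \<delta>: "\<delta> > 0" and \<Delta>: "\<And>A. finite A \<and> (\<forall>(s, t)\<in>A. 0 \<le> s \<and> s \<le> t \<and> t \<le> 1) \<and>
         pairwise (\<lambda>P Q. disjnt {fst P<..<snd P} {fst Q<..<snd Q}) A \<and> (\<Sum>(s, t)\<in>A. t - s) < \<delta> \<Longrightarrow>
         (\<Sum>(s, t)\<in>A. lv t - lv s) < e / 2"
        using lv_ac[unfolded ac_intervals_def, rule_format, of "e / 2"] by auto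
      show "\<exists>\<delta>>0. \<forall>A. finite A \<and> (\<forall>(s, t)\<in>A. 0 \<le> s \<and> s \<le> t \<and> t \<le> 1) \<and>
         pairwise (\<lambda>P Q. disjnt {fst P<..<snd P} {fst Q<..<snd Q}) A \<and> (\<Sum>(s, t)\<in>A. t - s) < \<delta> \<longrightarrow>
         (\<Sum>(s, t)\<in>A. (D q t + lv t) - (D q s + lv s)) < e"
      proof (intro exI[of _ \<delta>] conjI allI impI \<delta>)
        fix A :: "(real \<times> real) set" assume A: "finite A \<and> (\<forall>(s, t)\<in>A. 0 \<le> s \<and> s \<le> t \<and> t \<le> 1) \<and>
         pairwise (\<lambda>P Q. disjnt {fst P<..<snd P} {fst Q<..<snd Q}) A \<and> (\<Sum>(s, t)\<in>A. t - s) < \<delta>"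
        have "(\<Sum>(s, t)\<in>A. (D q t + lv t) - (D q s + lv s)) \<le> (\<Sum>(s, t)\<in>A. 2 * (lv t - lv s))"
        proof (rule sum_mono, clarify)
          fix s t assume "(s, t) \<in> A"
          then have "0 \<le> s" "s \<le> t" "t \<le> 1" using A by auto
          from order_trans[OF abs_ge_self Dd[OF q this]]
          show "(D q t + lv t) - (D q s + lv s) \<le> 2 * (lv t - lv s)" by simp
        qed
        also have "\<dots> = 2 * (\<Sum>(s, t)\<in>A. lv t - lv s)" by (simp add: sum_distrib_left case_prod_unfold)
        finally show "(\<Sum>(s, t)\<in>A. (D q t + lv t) - (D q s + lv s)) < e" using \<Delta>[OF A] by linarith
      qed
    qed
    ultimately obtain k S where k: "k \<in> borel_measurable borel"
     "\<And>a b. 0 \<le> a \<Longrightarrow> a \<le> b \<Longrightarrow> b \<le> 1 \<Longrightarrow> (k has_integral ((D q b + lv b) - (D q a + lv a))) {a..b}"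
     "negligible S" "\<And>x. x \<in> {0<..<1} - S \<Longrightarrow> ((\<lambda>t. D q t + lv t) has_real_derivative k x) (at x)"
      using ac_mono_derivative[of "\<lambda>t. D q t + lv t"] by auto
    show ?thesis
    proof (intro exI[of _ "\<lambda>x. k x - v x"] conjI allI impI)
      show "(\<lambda>x. k x - v x) \<in> borel_measurable borel" using k(1) v(1) by simp
      fix a b :: real assume ab: "0 \<le> a" "a \<le> b" "b \<le> 1"
      show "((\<lambda>x. k x - v x) has_integral (D q b - D q a)) {a..b}"
        using has_integral_diff[OF k(2)[OF ab] v(3)[OF ab]] by (simp add: algebra_simps)
    next
      show "\<exists>S. negligible S \<and> (\<forall>x\<in>{0<..<1} - S. (D q has_real_derivative k x - v x) (at x))"
      proof (intro exI[of _ "S \<union> S0"] conjI ballI)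
        show "negligible (S \<union> S0)" using k v by auto
        fix x assume "x \<in> {0<..<1} - (S \<union> S0)"
        then show "(D q has_real_derivative k x - v x) (at x)"
          using DERIV_diff[OF k(4)[of x] v(5)[of x]] by simp
      qed
    qed
  qed
  then obtain w S where w: "\<And>q. q \<in> {0..1} \<Longrightarrow> w q \<in> borel_measurable borel"
     "\<And>q a b. q \<in> {0..1} \<Longrightarrow> 0 \<le> a \<Longrightarrow> a \<le> b \<Longrightarrow> b \<le> 1 \<Longrightarrow> (w q has_integral (D q b - D q a)) {a..b}"
     "\<And>q. q \<in> {0..1} \<Longrightarrow> negligible (S q)"
     "\<And>q x. q \<in> {0..1} \<Longrightarrow> x \<in> {0<..<1} - S q \<Longrightarrow> (D q has_real_derivative w q x) (at x)"
    by metis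
  have w_le: "w q x \<le> v x" if q: "q \<in> {0..1}" and x: "x \<in> {0<..<1} - (S q \<union> S0)" for q x
  proof (rule tendsto_le[OF _ _ _ _, of "at x"])
    show "((\<lambda>s. (lv s - lv x) / (s - x)) \<longlongrightarrow> v x) (at x)" using v(5)[of x] x by (simp add: has_field_derivative_iff)
    show "((\<lambda>s. (D q s - D q x) / (s - x)) \<longlongrightarrow> w q x) (at x)" using w(4)[OF q, of x] x by (simp add: has_field_derivative_iff)
    have "eventually (\<lambda>s. s \<in> {0<..<1} \<and> s \<noteq> x) (at x)"
      using x by (intro eventually_conj eventually_at_in_open' eventually_neq_at_within) auto
    then show "eventually (\<lambda>s. (D q s - D q x) / (s - x) \<le> (lv s - lv x) / (s - x)) (at x)"
    proof eventually_elim
      case (elim s)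
      then show ?case using Dd[OF q, of s x] Dd[OF q, of x s] x
        by (cases "s < x") (auto simp: divide_simps abs_le_iff)
    qed
  qed simp
  have "\<exists>n t. weak_chain 0 1 n t \<and> t 0 = 0 \<and> t n = 1 \<and> lv 1 - e \<le> chain_length Y \<beta> n t" if e: "e > 0" for e
  proof -
    have "variation Y \<beta> 0 1 = ennreal (lv 1)" using ac_variation_finite[OF ac] by (simp add: lv_def less_top)
    have "\<exists>n t. weak_chain 0 1 n t \<and> lv 1 - e \<le> chain_length Y \<beta> n t"
    proof (rule ccontr)
      assume neg: "\<not> ?thesis"
      have "weak_chain 0 1 0 (\<lambda>_. 0)" by (simp add: weak_chain_def)
      with neg have pos: "lv 1 - e > 0" by (force simp: chain_length_def)
      have "variation Y \<beta> 0 1 \<le> ennreal (lv 1 - e)"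
        by (rule variation_le, rule ennreal_leI) (use neg in force)
      with \<open>variation Y \<beta> 0 1 = ennreal (lv 1)\<close> pos e show False by simp
    qed
    then obtain n t where t: "weak_chain 0 1 n t" "lv 1 - e \<le> chain_length Y \<beta> n t" by blast
    \<comment> \<open>Prepending 0 and appending 1 does not shorten the chain, and its steps then
      fill the whole unit interval.\<close>
    define s where "s i = (if i = 0 then 0 else if i \<le> Suc n then t (i - 1) else 1)" for i
    have "weak_chain 0 1 (Suc (Suc n)) s"
      unfolding weak_chain_def
    proof (intro conjI allI impI)
      fix i show "s i \<in> {0..1}" using t(1) by (auto simp: s_def weak_chain_def)
    next
      fix i assume "i < Suc (Suc n)"
      then consider "i = 0" | j where "i = Suc j" "j < n" | "i = Suc n" by (cases i) (auto simp: less_Suc_eq)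
      then show "s i \<le> s (Suc i)" using t(1) by cases (auto simp: s_def weak_chain_def)
    qed
    moreover have "chain_length Y \<beta> n t \<le> chain_length Y \<beta> (Suc (Suc n)) s"
    proof -
      have "chain_length Y \<beta> (Suc (Suc n)) s = mdist Y (\<beta> (s 0)) (\<beta> (s 1)) + chain_length Y \<beta> (Suc n) (\<lambda>i. s (Suc i))"
        unfolding chain_length_def by (subst sum.lessThan_Suc_shift) simp
      moreover have "chain_length Y \<beta> (Suc n) (\<lambda>i. s (Suc i)) = chain_length Y \<beta> n t + mdist Y (\<beta> (t n)) (\<beta> 1)"
        by (simp add: chain_length_def s_def)
      ultimately show ?thesis by simp
    qed
    ultimately show ?thesis using t(2)
      by (intro exI[of _ "Suc (Suc n)"] exI[of _ s]) (simp add: s_def)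
  qed
  then have "\<exists>n t. weak_chain 0 1 n t \<and> t 0 = 0 \<and> t n = 1 \<and> lv 1 - 1 / real (Suc N) \<le> chain_length Y \<beta> n t" for N :: nat
    by simp
  then obtain n t where nt: "\<And>N. weak_chain 0 1 (n N) (t N)" "\<And>N. t N 0 = 0" "\<And>N. t N (n N) = 1"
     "\<And>N. lv 1 - 1 / real (Suc N) \<le> chain_length Y \<beta> (n N) (t N)" by metis
  \<comment> \<open>Only countably many base points q occur, so the union of their exceptional sets
    is negligible and \<open>bad e\<close> is a Borel set.\<close>
  define Q where "Q = (\<Union>N. (t N) ` {..n N})"
  have Qc: "countable Q" unfolding Q_def by auto
  have Q01: "q \<in> {0..1}" if "q \<in> Q" for q using that nt(1) by (auto simp: Q_def weak_chain_def)
  define Z where "Z = S0 \<union> (\<Union>q\<in>Q. S q)"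
  have Zn: "negligible Z" unfolding Z_def
    using v(4) w(3) Q01 Qc by (intro negligible_Un) (auto intro!: negligible_countable_Union)
  define bad where "bad e = {x\<in>{0<..<1}. \<forall>q\<in>Q. w q x \<le> v x - e}" for e
  have bad_neg: "negligible (bad e)" if e: "e > 0" for e
  proof -
    have "bad e = {0<..<1} \<inter> (\<Inter>q\<in>Q. {x. w q x \<le> v x - e})" by (auto simp: bad_def)
    moreover have "{x. w q x \<le> v x - e} \<in> sets borel" if "q \<in> Q" for q
      using w(1)[OF Q01[OF that]] v(1) by measurable
    ultimately have bad_b: "bad e \<in> sets borel" using Qc
      by (cases "Q = {}") (auto intro!: sets.Int sets.countable_INT')
    have bad_m: "bad e \<in> lmeasurable"
    proof (rule bounded_set_imp_lmeasurable)
      show "bounded (bad e)" by (rule bounded_subset[of "{0..1}"]) (auto simp: bad_def)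
      show "bad e \<in> sets lebesgue" using bad_b by simp
    qed
    have "(indicat_real (bad e) has_integral measure lebesgue (bad e)) UNIV"
      using bad_m lmeasurable_iff_indicator_has_integral by blast
    then have "(indicat_real (bad e) has_integral measure lebesgue (bad e)) {0..1}"
      by (subst has_integral_restrict_UNIV[symmetric], elim has_integral_eq[rotated]) (auto simp: indicator_def bad_def)
    then have int_e: "((\<lambda>x. v x - e * indicat_real (bad e) x) has_integral (lv 1 - lv 0 - e * measure lebesgue (bad e))) {0..1}"
      using v(3)[of 0 1] by (intro has_integral_diff has_integral_mult_right) auto
    have "e * measure lebesgue (bad e) \<le> 1 / real (Suc N)" for N
    proof -
      \<comment> \<open>On the step of a chain that starts at the node q, the distance from \<beta>
        q has derivative \<open>w q\<close>, which is at most v, and at most v - e on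
        \<open>bad e\<close>. Summing over the steps bounds the chain length by the integral of u.
        Since the chains approach lv 1, \<open>bad e\<close> must have measure zero.\<close>
      define u where "u x = v x - e * indicat_real (bad e) x" for x
      have ui: "u integrable_on {a..b}" if "0 \<le> a" "b \<le> 1" for a b
        using int_e integrable_subinterval_real[of _ 0 1 a b] that unfolding u_def integrable_on_def by auto
      have part: "(\<Sum>i<j. mdist Y (\<beta> (t N i)) (\<beta> (t N (Suc i)))) \<le> integral {0..t N j} u" if "j \<le> n N" for j
        using that
      proof (induction j)
        case 0 then show ?case using nt(2) by simp
      next
        case (Suc j)
        have tj: "t N j \<in> {0..1}" "t N (Suc j) \<in> {0..1}" "t N j \<le> t N (Suc j)"
          using nt(1)[of N] Suc.prems by (auto simp: weak_chain_def)
        have q: "t N j \<in> Q" unfolding Q_def using Suc.prems by (intro UN_I[of N]) auto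
        have "D (t N j) (t N (Suc j)) - D (t N j) (t N j) \<le> integral {t N j..t N (Suc j)} u"
        proof -
          \<comment> \<open>The comparison of integrals requires the inequality at every point of
            the interval, so on the exceptional set u is replaced by \<open>w\<close>
            itself.\<close>
          define u' where "u' x = (if x \<in> Z \<union> {0, 1} then w (t N j) x else u x)" for x
          have "(u has_integral integral {t N j..t N (Suc j)} u) {t N j..t N (Suc j)}"
            using tj by (intro integrable_integral ui) auto
          then have "(u' has_integral integral {t N j..t N (Suc j)} u) {t N j..t N (Suc j)}"
            by (rule has_integral_spike[rotated 2, where S = "Z \<union> {0, 1}"])
              (use Zn in \<open>auto simp: u'_def\<close>)
          moreover have "w (t N j) x \<le> u' x" if x: "x \<in> {t N j..t N (Suc j)}" for x
          proof (cases "x \<in> Z \<union> {0, 1}")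
            case False
            then have x': "x \<in> {0<..<1} - (S (t N j) \<union> S0)" using x tj q by (auto simp: Z_def)
            have "w (t N j) x \<le> v x" using w_le[OF Q01[OF q] x'] .
            moreover have "w (t N j) x \<le> v x - e" if "x \<in> bad e" using that q by (auto simp: bad_def)
            ultimately show ?thesis using False by (auto simp: u'_def u_def indicator_def)
          qed (simp add: u'_def)
          ultimately show ?thesis
            by (intro has_integral_le[OF w(2)[OF Q01[OF q]]]) (use tj in simp_all)
        qed
        moreover have "D (t N j) (t N j) = 0" unfolding D_def using funcset_mem[OF \<beta> tj(1)] by simp
        moreover have "integral {0..t N j} u + integral {t N j..t N (Suc j)} u = integral {0..t N (Suc j)} u"
          using tj by (intro Henstock_Kurzweil_Integration.integral_combine ui) auto
        ultimately show ?case using Suc by (simp add: D_def)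
      qed
      have "chain_length Y \<beta> (n N) (t N) \<le> integral {0..1} u"
        using part[of "n N"] nt(3) by (simp add: chain_length_def)
      also have "\<dots> = lv 1 - lv 0 - e * measure lebesgue (bad e)" using int_e unfolding u_def by (rule integral_unique)
      finally show ?thesis using nt(4)[of N] lv0 by simp
    qed
    then have "e * measure lebesgue (bad e) \<le> 0"
      using nat_approx_posE by (metis less_eq_real_def linorder_not_le order.strict_trans2)
    then have "measure lebesgue (bad e) \<le> 0" using e by (simp add: mult_le_0_iff)
    then have "measure lebesgue (bad e) = 0" using measure_nonneg[of lebesgue "bad e"] by linarith
    then show ?thesis using bad_m by (simp add: negligible_iff_measure)
  qed
  define B where "B = Z \<union> (\<Union>N::nat. bad (1 / real (Suc N)))"
  have "negligible B" unfolding B_def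
    using Zn by (intro negligible_Un) (auto intro!: negligible_countable_Union bad_neg)
  moreover have "(lv has_real_derivative v x) (at x) \<and>
      ((\<lambda>s. mdist Y (\<beta> s) (\<beta> x) / \<bar>s - x\<bar>) \<longlongrightarrow> v x) (at x)" if x: "x \<in> {0<..<1} - B" for x
  proof
    show lv': "(lv has_real_derivative v x) (at x)" using v(5)[of x] x by (auto simp: B_def Z_def)
    show "((\<lambda>s. mdist Y (\<beta> s) (\<beta> x) / \<bar>s - x\<bar>) \<longlongrightarrow> v x) (at x)"
    proof (rule metric_speed_tendsto[OF \<beta> _ d lv'])
      fix e :: real assume "e > 0"
      then obtain N :: nat where N: "1 / real (Suc N) < e" using nat_approx_posE by blast
      have "x \<notin> bad (1 / real (Suc N))" using x by (auto simp: B_def)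
      then obtain q where q: "q \<in> Q" "w q x > v x - 1 / real (Suc N)" using x by (auto simp: bad_def not_le)
      have "(D q has_real_derivative w q x) (at x)" using w(4)[OF Q01[OF q(1)], of x] x q(1) by (auto simp: B_def Z_def)
      then show "\<exists>q\<in>{0..1}. \<exists>w>v x - e. ((\<lambda>t. mdist Y (\<beta> q) (\<beta> t)) has_real_derivative w) (at x)"
        using q N Q01[OF q(1)] by (intro bexI[of _ q] exI[of _ "w q x"]) (auto simp: D_def[abs_def])
    qed (use x in auto)
  qed
  ultimately have "\<exists>S. negligible S \<and> (\<forall>x\<in>{0<..<1} - S. (lv has_real_derivative v x) (at x) \<and>
      ((\<lambda>s. mdist Y (\<beta> s) (\<beta> x) / \<bar>s - x\<bar>) \<longlongrightarrow> v x) (at x))"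
    by blast
  note ex = this
  show ?thesis
  proof (rule exI[of _ lv], rule exI[of _ v], intro conjI allI impI)
    show "mdist Y (\<beta> s) (\<beta> t) \<le> lv t - lv s" if "0 \<le> s" "s \<le> t" "t \<le> 1" for s t by (rule d[OF that])
    show "(v has_integral (lv b - lv a)) {a..b}" if "0 \<le> a" "a \<le> b" "b \<le> 1" for a b by (rule v(3)[OF that])
  qed (use ex lv0 lv_ac v(1,2) in simp_all)
qed

lemma openin_mball_of: "openin (mtopology_of Y) (mball_of Y x r)"
  unfolding mtopology_of_def mball_of_def by (rule Metric_space.openin_mball) simp
section \<open>Lipschitz paths in length spaces\<close>

text \<open>The domain is the whole line; the paths used are constant outside their parameter
  interval, which frees concatenation and reparametrization from domain conditions.\<close>

definition Lipschitz_path :: "'a metric \<Rightarrow> real \<Rightarrow> (real \<Rightarrow> 'a) \<Rightarrow> bool" where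
  "Lipschitz_path Y L B \<longleftrightarrow> (\<forall>s. B s \<in> mspace Y) \<and> (\<forall>s t. mdist Y (B s) (B t) \<le> L * \<bar>s - t\<bar>)"

lemma continuous_map_near:
  fixes c :: "real \<Rightarrow> 'a"
  assumes cont: "continuous_map (top_of_set {0..1}) (mtopology_of Y) c" and t: "t \<in> {0..1}" and e: "e > 0"
  shows "\<exists>\<delta>>0. \<forall>s\<in>{0..1}. \<bar>s - t\<bar> < \<delta> \<longrightarrow> mdist Y (c s) (c t) < e"
proof -
  have cm: "c t \<in> mspace Y" if "t \<in> {0..1}" for t
    using continuous_map_image_subset_topspace[OF cont] that by auto
  have c_refl: "mdist Y (c t) (c t) = 0" if "t \<in> {0..1}" for t
    using mdist_zero[OF cm[OF that] cm[OF that]] by simp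
  have "openin (mtopology_of Y) (mball_of Y (c t) e)" by (simp add: openin_mball_of)
  then have "openin (top_of_set {0..1}) {x \<in> topspace (top_of_set {0..1}). c x \<in> mball_of Y (c t) e}"
    by (rule openin_continuous_map_preimage[OF cont])
  then have "openin (top_of_set {0..1}) {x \<in> {0..1}. c x \<in> mball_of Y (c t) e}" by simp
  moreover have "mdist Y (c t) (c t) < e" using e c_refl[OF t] by linarith
  then have "t \<in> {x \<in> {0..1}. c x \<in> mball_of Y (c t) e}" using t cm[OF t] by simp
  ultimately obtain \<delta> where "\<delta> > 0" "ball t \<delta> \<inter> {0..1} \<subseteq> {x \<in> {0..1}. c x \<in> mball_of Y (c t) e}"
    unfolding openin_contains_ball by blast
  then show ?thesis
    by (intro exI[of _ \<delta>]) (auto simp: subset_eq dist_real_def mdist_commute abs_minus_commute)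
qed

text \<open>Arclength parametrization by the generalized inverse of the length function \<open>lv\<close>. On the gaps of the
  range of \<open>lv\<close> the result is constant, so \<open>lv\<close> need not be continuous.\<close>

lemma arclength_path:
  fixes lv :: "real \<Rightarrow> real"
  assumes cm: "\<And>t. t \<in> {0..1} \<Longrightarrow> c t \<in> mspace Y"
    and near: "\<And>t e. t \<in> {0..1} \<Longrightarrow> e > 0 \<Longrightarrow> \<exists>\<delta>>0. \<forall>s\<in>{0..1}. \<bar>s - t\<bar> < \<delta> \<longrightarrow> mdist Y (c s) (c t) < e"
    and d: "\<And>s t. 0 \<le> s \<Longrightarrow> s \<le> t \<Longrightarrow> t \<le> 1 \<Longrightarrow> mdist Y (c s) (c t) \<le> lv t - lv s"
    and mono: "\<And>s t. 0 \<le> s \<Longrightarrow> s \<le> t \<Longrightarrow> t \<le> 1 \<Longrightarrow> lv s \<le> lv t"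
    and lv0: "lv 0 = 0"
  shows "\<exists>B. Lipschitz_path Y 1 B \<and> (\<forall>r\<le>0. B r = c 0) \<and> (\<forall>r\<ge>lv 1. B r = c 1)"
proof -
  have c_refl: "mdist Y (c t) (c t) = 0" if "t \<in> {0..1}" for t
    using mdist_zero[OF cm[OF that] cm[OF that]] by simp
  \<comment> \<open>Admitting t = 0 unconditionally keeps the set nonempty for negative r.\<close>
  define A where "A r = {t \<in> {0..1}. t = 0 \<or> lv t \<le> r}" for r
  define \<theta> where "\<theta> r = Sup (A r)" for r
  have bdd: "bdd_above (A r)" for r by (auto simp: A_def intro!: bdd_aboveI[of _ 1])
  have A0: "0 \<in> A r" for r by (simp add: A_def)
  have \<theta>01: "\<theta> r \<in> {0..1}" for r
  proof -
    have "Sup (A r) \<le> 1"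
    proof (rule cSup_least)
      show "A r \<noteq> {}" using A0[of r] by blast
    qed (simp add: A_def)
    then show ?thesis unfolding \<theta>_def using cSup_upper[OF A0 bdd, of r] by simp
  qed
  have \<theta>_mono: "\<theta> r \<le> \<theta> r'" if "r \<le> r'" for r r'
    unfolding \<theta>_def
  proof (rule cSup_subset_mono[OF _ bdd])
    show "A r \<noteq> {}" using A0[of r] by blast
    show "A r \<subseteq> A r'" using that by (auto simp: A_def)
  qed
  have above: "r < lv t" if "\<theta> r < t" "t \<le> 1" for r t
  proof (rule ccontr)
    assume "\<not> r < lv t"
    then have "t \<in> A r" using that \<theta>01[of r] by (auto simp: A_def)
    then show False using cSup_upper[OF _ bdd, of t r] that by (simp add: \<theta>_def)
  qed
  have below: "lv t \<le> r" if r: "0 < \<theta> r" "0 \<le> t" "t < \<theta> r" for r t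
  proof -
    have "A r \<noteq> {}" using A0[of r] by blast
    from less_cSup_iff[OF this bdd, of t] obtain t' where t': "t' \<in> A r" "t < t'"
      using r(3) unfolding \<theta>_def by blast
    then show ?thesis using mono[of t t'] r by (auto simp: A_def)
  qed
  have Lip: "mdist Y (c (\<theta> r)) (c (\<theta> r')) \<le> r' - r" if rr: "r \<le> r'" for r r'
  proof (cases "\<theta> r = \<theta> r'")
    case True then show ?thesis unfolding True using rr c_refl[OF \<theta>01[of r']] by linarith
  next
    case False
    then have lt: "\<theta> r < \<theta> r'" using \<theta>_mono[OF rr] by simp
    show ?thesis
    proof (rule field_le_epsilon)
      fix e :: real assume e: "0 < e"
      obtain d1 where d1: "d1 > 0" "\<And>s. s \<in> {0..1} \<Longrightarrow> \<bar>s - \<theta> r\<bar> < d1 \<Longrightarrow> mdist Y (c s) (c (\<theta> r)) < e / 2"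
        using near[OF \<theta>01[of r], of "e / 2"] e by (metis half_gt_zero)
      obtain d2 where d2: "d2 > 0" "\<And>s. s \<in> {0..1} \<Longrightarrow> \<bar>s - \<theta> r'\<bar> < d2 \<Longrightarrow> mdist Y (c s) (c (\<theta> r')) < e / 2"
        using near[OF \<theta>01[of r'], of "e / 2"] e by (metis half_gt_zero)
      \<comment> \<open>The bounds for lv hold only strictly beyond \<theta> r and strictly before
        \<theta> r'. Both parameters are therefore moved slightly towards each other, and continuity
        of c absorbs the shift into e.\<close>
      define g where "g = (\<theta> r' - \<theta> r) / 3"
      define a where "a = \<theta> r + min (d1 / 2) g"
      define b where "b = \<theta> r' - min (d2 / 2) g"
      have g: "g > 0" using lt by (simp add: g_def)
      have ab: "\<theta> r < a" "a \<le> b" "b < \<theta> r'" using g d1 d2 by (auto simp: a_def b_def g_def min_def field_simps)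
      have in01: "a \<in> {0..1}" "b \<in> {0..1}" using ab \<theta>01[of r] \<theta>01[of r'] by auto
      have "mdist Y (c a) (c b) \<le> lv b - lv a" using d[of a b] ab in01 by auto
      moreover have "lv b \<le> r'" using below[of r' b] ab in01 \<theta>01[of r] lt by auto
      moreover have "r < lv a" using above[of r a] ab in01 by auto
      moreover have "mdist Y (c a) (c (\<theta> r)) < e / 2" using d1 g by (intro d1(2) in01) (auto simp: a_def min_def)
      moreover have "mdist Y (c b) (c (\<theta> r')) < e / 2" using d2 g by (intro d2(2) in01) (auto simp: b_def min_def)
      moreover have "mdist Y (c (\<theta> r)) (c (\<theta> r')) \<le> mdist Y (c a) (c (\<theta> r)) + mdist Y (c a) (c b) + mdist Y (c b) (c (\<theta> r'))"
        using mdist_triangle[OF cm[OF \<theta>01[of r]] cm[OF in01(1)] cm[OF \<theta>01[of r']]]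
          mdist_triangle[OF cm[OF in01(1)] cm[OF in01(2)] cm[OF \<theta>01[of r']]] by (simp add: mdist_commute)
      ultimately show "mdist Y (c (\<theta> r)) (c (\<theta> r')) \<le> r' - r + e" by linarith
    qed
  qed
  have lipB: "mdist Y (c (\<theta> s)) (c (\<theta> t)) \<le> \<bar>s - t\<bar>" for s t
    using Lip[of s t] Lip[of t s] by (cases "s \<le> t") (auto simp: mdist_commute)
  have B1: "c (\<theta> r) = c 1" if "lv 1 \<le> r" for r
  proof -
    have "1 \<in> A r" using that by (simp add: A_def)
    then have "\<theta> r \<ge> 1" unfolding \<theta>_def by (rule cSup_upper[OF _ bdd])
    then show ?thesis using \<theta>01[of r] by simp
  qed
  \<comment> \<open>The supremum for r = 0 may be positive. Then lv is at most 0 before it, so c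
    stays at c 0 there and, by continuity, also at the supremum.\<close>
  have B00: "c (\<theta> 0) = c 0"
  proof -
    have "mdist Y (c 0) (c (\<theta> 0)) \<le> 0"
    proof (cases "\<theta> 0 = 0")
      case False
      then have pos: "0 < \<theta> 0" using \<theta>01[of 0] by simp
      show ?thesis
      proof (rule field_le_epsilon)
        fix e :: real assume "0 < e"
        then obtain d1 where d1: "d1 > 0" "\<And>s. s \<in> {0..1} \<Longrightarrow> \<bar>s - \<theta> 0\<bar> < d1 \<Longrightarrow> mdist Y (c s) (c (\<theta> 0)) < e"
          using near[OF \<theta>01[of 0], of e] by metis
        define a where "a = \<theta> 0 - min (d1 / 2) (\<theta> 0 / 2)"
        have a: "0 \<le> a" "a < \<theta> 0" "a \<in> {0..1}" using pos d1 \<theta>01[of 0] by (auto simp: a_def min_def)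
        have "mdist Y (c 0) (c a) \<le> 0" using d[of 0 a] below[OF pos a(1,2)] a lv0 by auto
        moreover have "mdist Y (c a) (c (\<theta> 0)) < e" using d1 pos by (intro d1(2) a) (auto simp: a_def min_def)
        ultimately show "mdist Y (c 0) (c (\<theta> 0)) \<le> 0 + e"
          using mdist_triangle[OF cm[of 0] cm[OF a(3)] cm[OF \<theta>01[of 0]]] by simp
      qed
    qed (use c_refl[of 0] in \<open>simp only: atLeastAtMost_iff, linarith\<close>)
    then have "mdist Y (c 0) (c (\<theta> 0)) = 0" using mdist_nonneg[of Y "c 0" "c (\<theta> 0)"] by linarith
    then show ?thesis using mdist_zero[OF cm[of 0] cm[OF \<theta>01[of 0]]] by simp
  qed
  define B where "B r = c (\<theta> (max 0 r))" for r
  have "mdist Y (B s) (B t) \<le> 1 * \<bar>s - t\<bar>" for s t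
    unfolding B_def using lipB[of "max 0 s" "max 0 t"] by (auto simp: max_def split: if_splits)
  then have "Lipschitz_path Y 1 B" unfolding Lipschitz_path_def using cm[OF \<theta>01] by (simp add: B_def)
  moreover have "B r = c 0" if "r \<le> 0" for r using that B00 by (simp add: B_def)
  moreover have "B r = c 1" if "r \<ge> lv 1" for r using that mono[of 0 1] lv0 by (simp add: B_def B1)
  ultimately show ?thesis by blast
qed

text \<open>The infimum defining the distance gives a curve of length below L, whose arclength
  parametrization has ended by L. The strict inequality is essential, since shortest paths need not
  exist.\<close>

lemma length_space_path:
  assumes Y: "length_space Y" and xy: "x \<in> mspace Y" "y \<in> mspace Y" and L: "mdist Y x y < L"
  shows "\<exists>B. Lipschitz_path Y 1 B \<and> (\<forall>r\<le>0. B r = x) \<and> (\<forall>r\<ge>L. B r = y)"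
proof -
  have "(INF \<gamma> \<in> {\<gamma>. continuous_map (top_of_set {0..1}) (mtopology_of Y) \<gamma> \<and> \<gamma> 0 = x \<and> \<gamma> 1 = y}.
             metric_length Y {0..1} \<gamma>) = ennreal (mdist Y x y)"
    using Y[unfolded length_space_def, rule_format, OF xy] by (rule sym)
  also have "\<dots> < ennreal L" using L by (simp add: ennreal_less_iff)
  finally obtain c where c: "continuous_map (top_of_set {0..1}) (mtopology_of Y) c" "c 0 = x" "c 1 = y"
     "metric_length Y {0..1} c < ennreal L" unfolding INF_less_iff by auto
  have cm: "c \<in> {0..1} \<rightarrow> mspace Y"
    using continuous_map_image_subset_topspace[OF c(1)] by auto
  have V1: "variation Y c 0 1 < ennreal L" using variation_le_metric_length[OF cm] c(4) by (rule le_less_trans)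
  define lv where "lv t = enn2real (variation Y c 0 t)" for t
  have sup: "variation Y c 0 s + variation Y c s t \<le> variation Y c 0 t" if "0 \<le> s" "s \<le> t" for s t
    using variation_superadditive[OF that] .
  have fin: "variation Y c 0 t < \<top>" if "0 \<le> t" "t \<le> 1" for t
  proof -
    have "variation Y c 0 t \<le> variation Y c 0 t + variation Y c t 1" by simp
    also have "\<dots> < \<top>" using sup[OF that] V1 by (meson ennreal_less_top less_trans le_less_trans)
    finally show ?thesis .
  qed
  have lv: "variation Y c 0 t = ennreal (lv t)" "0 \<le> lv t" if "0 \<le> t" "t \<le> 1" for t
    using fin[OF that] by (simp_all add: lv_def)
  have d: "mdist Y (c s) (c t) \<le> lv t - lv s" if "0 \<le> s" "s \<le> t" "t \<le> 1" for s t
  proof -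
    have "ennreal (lv s + mdist Y (c s) (c t)) = ennreal (lv s) + ennreal (mdist Y (c s) (c t))"
      using lv(2)[of s] that by simp
    also have "\<dots> \<le> variation Y c 0 s + variation Y c s t"
      using lv(1)[of s] that dist_le_variation[OF that(2), of Y c] by (intro add_mono) auto
    also have "\<dots> \<le> ennreal (lv t)" using sup[OF that(1,2)] lv(1)[of t] that by simp
    finally show ?thesis using lv(2)[of t] that by (subst (asm) ennreal_le_iff) auto
  qed
  have mono: "lv s \<le> lv t" if "0 \<le> s" "s \<le> t" "t \<le> 1" for s t
    using d[OF that] mdist_nonneg[of Y "c s" "c t"] by linarith
  have lv1: "lv 1 \<le> L" using V1 lv[of 1] by (simp add: ennreal_less_iff)
  have "variation Y c 0 0 \<le> 0"
  proof (rule variation_le)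
    fix n t assume "weak_chain 0 0 n t"
    then have "t i = 0" if "i \<le> n" for i using that by (auto simp: weak_chain_def)
    moreover have "mdist Y (c 0) (c 0) = 0" using funcset_mem[OF cm, of 0] by simp
    ultimately have "chain_length Y c n t = 0"
      unfolding chain_length_def by (intro sum.neutral) (metis Suc_leI lessThan_iff less_imp_le)
    then show "ennreal (chain_length Y c n t) \<le> 0" by simp
  qed
  then have "lv 0 = 0" by (simp add: lv_def)
  have "\<exists>B. Lipschitz_path Y 1 B \<and> (\<forall>r\<le>0. B r = c 0) \<and> (\<forall>r\<ge>lv 1. B r = c 1)"
    by (rule arclength_path[OF funcset_mem[OF cm] continuous_map_near[OF c(1)] d mono \<open>lv 0 = 0\<close>])
  then obtain B where B: "Lipschitz_path Y 1 B" "\<forall>r\<le>0. B r = c 0" "\<forall>r\<ge>lv 1. B r = c 1" by blast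
  then show ?thesis using c(2,3) lv1 by (intro exI[of _ B]) auto
qed

lemma ac_curve_comparison:
  assumes "absolutely_continuous_curve Y \<beta>" and "\<beta>' \<in> {0..1} \<rightarrow> mspace Y'"
    and le: "\<And>s t. s \<in> {0..1} \<Longrightarrow> t \<in> {0..1} \<Longrightarrow> mdist Y' (\<beta>' s) (\<beta>' t) \<le> mdist Y (\<beta> s) (\<beta> t)"
  shows "absolutely_continuous_curve Y' \<beta>'"
  unfolding absolutely_continuous_curve_def
proof (intro conjI allI impI assms(2))
  fix \<epsilon> :: real assume "\<epsilon> > 0"
  then obtain \<delta> where \<delta>: "\<delta> > 0" "\<And>(n::nat) s t.
        (\<forall>i<n. 0 \<le> s i \<and> s i \<le> t i \<and> t i \<le> 1) \<and>
        disjoint_family_on (\<lambda>i. {s i<..<t i}) {..<n} \<and> (\<Sum>i<n. t i - s i) < \<delta> \<Longrightarrow>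
        (\<Sum>i<n. mdist Y (\<beta> (s i)) (\<beta> (t i))) < \<epsilon>"
    using assms(1) unfolding absolutely_continuous_curve_def by meson
  show "\<exists>\<delta>>0. \<forall>(n::nat) s t.
        (\<forall>i<n. 0 \<le> s i \<and> s i \<le> t i \<and> t i \<le> 1) \<and>
        disjoint_family_on (\<lambda>i. {s i<..<t i}) {..<n} \<and> (\<Sum>i<n. t i - s i) < \<delta> \<longrightarrow>
        (\<Sum>i<n. mdist Y' (\<beta>' (s i)) (\<beta>' (t i))) < \<epsilon>"
  proof (intro exI[of _ \<delta>] conjI allI impI \<delta>(1))
    fix n :: nat and s t :: "nat \<Rightarrow> real"
    assume A: "(\<forall>i<n. 0 \<le> s i \<and> s i \<le> t i \<and> t i \<le> 1) \<and>
        disjoint_family_on (\<lambda>i. {s i<..<t i}) {..<n} \<and> (\<Sum>i<n. t i - s i) < \<delta>"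
    have "(\<Sum>i<n. mdist Y' (\<beta>' (s i)) (\<beta>' (t i))) \<le> (\<Sum>i<n. mdist Y (\<beta> (s i)) (\<beta> (t i)))"
    proof (intro sum_mono le)
      fix i assume "i \<in> {..<n}"
      then have "0 \<le> s i \<and> s i \<le> t i \<and> t i \<le> 1" using A by simp
      then show "s i \<in> {0..1}" "t i \<in> {0..1}" by auto
    qed
    then show "(\<Sum>i<n. mdist Y' (\<beta>' (s i)) (\<beta>' (t i))) < \<epsilon>" using \<delta>(2)[OF A] by linarith
  qed
qed

lemma ac_curve_imp_ac_intervals:
  assumes ac: "absolutely_continuous_curve Y \<beta>"
    and le: "\<And>s t. 0 \<le> s \<Longrightarrow> s \<le> t \<Longrightarrow> t \<le> 1 \<Longrightarrow> \<rho> s t \<le> mdist Y (\<beta> s) (\<beta> t)"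
  shows "ac_intervals \<rho>"
  unfolding ac_intervals_def
proof (intro allI impI)
  fix \<epsilon> :: real assume "\<epsilon> > 0"
  from ac_finite_index[OF ac this] obtain \<delta> where \<delta>: "\<delta> > 0" "\<And>(I :: (real \<times> real) set) s t. finite I \<and> (\<forall>i\<in>I. 0 \<le> s i \<and> s i \<le> t i \<and> t i \<le> 1) \<and>
        disjoint_family_on (\<lambda>i. {s i<..<t i}) I \<and> (\<Sum>i\<in>I. t i - s i) < \<delta> \<Longrightarrow>
        (\<Sum>i\<in>I. mdist Y (\<beta> (s i)) (\<beta> (t i))) < \<epsilon>" by blast
  show "\<exists>\<delta>>0. \<forall>A. finite A \<and> (\<forall>(s, t)\<in>A. 0 \<le> s \<and> s \<le> t \<and> t \<le> 1) \<and>
     pairwise (\<lambda>P Q. disjnt {fst P<..<snd P} {fst Q<..<snd Q}) A \<and> (\<Sum>(s, t)\<in>A. t - s) < \<delta> \<longrightarrow>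
     (\<Sum>(s, t)\<in>A. \<rho> s t) < \<epsilon>"
  proof (intro exI[of _ \<delta>] conjI allI impI \<delta>(1))
    fix A :: "(real \<times> real) set"
    assume A: "finite A \<and> (\<forall>(s, t)\<in>A. 0 \<le> s \<and> s \<le> t \<and> t \<le> 1) \<and>
     pairwise (\<lambda>P Q. disjnt {fst P<..<snd P} {fst Q<..<snd Q}) A \<and> (\<Sum>(s, t)\<in>A. t - s) < \<delta>"
    have "(\<Sum>(s, t)\<in>A. \<rho> s t) \<le> (\<Sum>i\<in>A. mdist Y (\<beta> (fst i)) (\<beta> (snd i)))"
      unfolding case_prod_unfold by (intro sum_mono le) (use A in auto)
    also have "\<dots> < \<epsilon>"
    proof (rule \<delta>(2))
      show "finite A \<and> (\<forall>i\<in>A. 0 \<le> fst i \<and> fst i \<le> snd i \<and> snd i \<le> 1) \<and>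
        disjoint_family_on (\<lambda>i. {fst i<..<snd i}) A \<and> (\<Sum>i\<in>A. snd i - fst i) < \<delta>"
        using A unfolding disjoint_family_on_def pairwise_def disjnt_def case_prod_unfold by blast
    qed
    finally show "(\<Sum>(s, t)\<in>A. \<rho> s t) < \<epsilon>" .
  qed
qed

text \<open>Passing from an indexed family to the set of its intervals can only merge degenerate
  intervals, because the open intervals are disjoint; there \<rho> vanishes.\<close>

lemma ac_intervals_imp_ac_curve:
  assumes \<rho>: "ac_intervals \<rho>" and \<rho>0: "\<And>s. 0 \<le> s \<Longrightarrow> s \<le> 1 \<Longrightarrow> \<rho> s s = 0"
    and \<beta>: "\<beta> \<in> {0..1} \<rightarrow> mspace Y"
    and le: "\<And>s t. 0 \<le> s \<Longrightarrow> s \<le> t \<Longrightarrow> t \<le> 1 \<Longrightarrow> mdist Y (\<beta> s) (\<beta> t) \<le> \<rho> s t"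
  shows "absolutely_continuous_curve Y \<beta>"
  unfolding absolutely_continuous_curve_def
proof (intro conjI allI impI \<beta>)
  fix \<epsilon> :: real assume "\<epsilon> > 0"
  with \<rho> obtain \<delta> where \<delta>: "\<delta> > 0" "\<And>A. finite A \<and> (\<forall>(s, t)\<in>A. 0 \<le> s \<and> s \<le> t \<and> t \<le> 1) \<and>
     pairwise (\<lambda>P Q. disjnt {fst P<..<snd P} {fst Q<..<snd Q}) A \<and> (\<Sum>(s, t)\<in>A. t - s) < \<delta> \<Longrightarrow>
     (\<Sum>(s, t)\<in>A. \<rho> s t) < \<epsilon>" unfolding ac_intervals_def by meson
  show "\<exists>\<delta>>0. \<forall>(n::nat) s t.
        (\<forall>i<n. 0 \<le> s i \<and> s i \<le> t i \<and> t i \<le> 1) \<and>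
        disjoint_family_on (\<lambda>i. {s i<..<t i}) {..<n} \<and> (\<Sum>i<n. t i - s i) < \<delta> \<longrightarrow>
        (\<Sum>i<n. mdist Y (\<beta> (s i)) (\<beta> (t i))) < \<epsilon>"
  proof (intro exI[of _ \<delta>] conjI allI impI \<delta>(1))
    fix n :: nat and s t :: "nat \<Rightarrow> real"
    assume A: "(\<forall>i<n. 0 \<le> s i \<and> s i \<le> t i \<and> t i \<le> 1) \<and>
        disjoint_family_on (\<lambda>i. {s i<..<t i}) {..<n} \<and> (\<Sum>i<n. t i - s i) < \<delta>"
    define B where "B = (\<lambda>i. (s i, t i)) ` {..<n}"
    have deg: "s i = t i" if ij: "i < n" "j < n" "i \<noteq> j" "(s i, t i) = (s j, t j)" for i j
    proof (rule ccontr)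
      assume "s i \<noteq> t i"
      then have "(s i + t i) / 2 \<in> {s i<..<t i}" using A ij(1) by (auto simp: less_le)
      moreover have "{s i<..<t i} \<inter> {s j<..<t j} = {}" using A ij unfolding disjoint_family_on_def by blast
      ultimately show False using ij(4) by auto
    qed
    have *: "(\<Sum>(s, t)\<in>B. g s t) = (\<Sum>i<n. g (s i) (t i))" if "\<And>s. 0 \<le> s \<Longrightarrow> s \<le> 1 \<Longrightarrow> g s s = 0" for g :: "real \<Rightarrow> real \<Rightarrow> real"
      unfolding B_def
    proof (subst sum.reindex_nontrivial)
      fix i j assume ij: "i \<in> {..<n}" "j \<in> {..<n}" "i \<noteq> j" "(s i, t i) = (s j, t j)"
      have "t i = s i" "0 \<le> s i" "s i \<le> 1" using A ij(1) deg[of i j] ij by auto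
      then show "(case (s i, t i) of (s, t) \<Rightarrow> g s t) = 0" using that by simp
    qed auto
    have "(\<Sum>i<n. mdist Y (\<beta> (s i)) (\<beta> (t i))) \<le> (\<Sum>i<n. \<rho> (s i) (t i))"
      by (intro sum_mono le) (use A in auto)
    also have "\<dots> = (\<Sum>(s, t)\<in>B. \<rho> s t)" by (rule *[symmetric, OF \<rho>0])
    also have "\<dots> < \<epsilon>"
    proof (rule \<delta>(2), intro conjI)
      show "\<forall>(s, t)\<in>B. 0 \<le> s \<and> s \<le> t \<and> t \<le> 1" using A by (auto simp: B_def)
      show "(\<Sum>(s, t)\<in>B. t - s) < \<delta>" using A *[of "\<lambda>s t. t - s"] by simp
      show "pairwise (\<lambda>P Q. disjnt {fst P<..<snd P} {fst Q<..<snd Q}) B"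
      proof (rule pairwiseI)
        fix P Q assume "P \<in> B" "Q \<in> B" "P \<noteq> Q"
        then obtain i j where ij: "i < n" "j < n" "P = (s i, t i)" "Q = (s j, t j)" "i \<noteq> j" by (auto simp: B_def)
        then have "{s i<..<t i} \<inter> {s j<..<t j} = {}" using A unfolding disjoint_family_on_def by blast
        then show "disjnt {fst P<..<snd P} {fst Q<..<snd Q}" using ij by (simp add: disjnt_def)
      qed
    qed (simp add: B_def)
    finally show "(\<Sum>i<n. mdist Y (\<beta> (s i)) (\<beta> (t i))) < \<epsilon>" .
  qed
qed

lemma ac_intervals_linear:
  assumes 1: "ac_intervals \<rho>1" and 2: "ac_intervals \<rho>2"
    and c: "0 \<le> c1" "0 \<le> c2"
    and le: "\<And>s t. 0 \<le> s \<Longrightarrow> s \<le> t \<Longrightarrow> t \<le> 1 \<Longrightarrow> \<rho> s t \<le> c1 * \<rho>1 s t + c2 * \<rho>2 s t"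
  shows "ac_intervals \<rho>"
  unfolding ac_intervals_def
proof (intro allI impI)
  fix \<epsilon> :: real assume e: "\<epsilon> > 0"
  define e' where "e' = \<epsilon> / (c1 + c2 + 1)"
  have e': "e' > 0" using e c by (simp add: e'_def)
  obtain \<delta>1 where d1: "\<delta>1 > 0" "\<And>A. finite A \<and> (\<forall>(s, t)\<in>A. 0 \<le> s \<and> s \<le> t \<and> t \<le> 1) \<and>
     pairwise (\<lambda>P Q. disjnt {fst P<..<snd P} {fst Q<..<snd Q}) A \<and> (\<Sum>(s, t)\<in>A. t - s) < \<delta>1 \<Longrightarrow>
     (\<Sum>(s, t)\<in>A. \<rho>1 s t) < e'" using 1 e' unfolding ac_intervals_def by meson
  obtain \<delta>2 where d2: "\<delta>2 > 0" "\<And>A. finite A \<and> (\<forall>(s, t)\<in>A. 0 \<le> s \<and> s \<le> t \<and> t \<le> 1) \<and>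
     pairwise (\<lambda>P Q. disjnt {fst P<..<snd P} {fst Q<..<snd Q}) A \<and> (\<Sum>(s, t)\<in>A. t - s) < \<delta>2 \<Longrightarrow>
     (\<Sum>(s, t)\<in>A. \<rho>2 s t) < e'" using 2 e' unfolding ac_intervals_def by meson
  show "\<exists>\<delta>>0. \<forall>A. finite A \<and> (\<forall>(s, t)\<in>A. 0 \<le> s \<and> s \<le> t \<and> t \<le> 1) \<and>
     pairwise (\<lambda>P Q. disjnt {fst P<..<snd P} {fst Q<..<snd Q}) A \<and> (\<Sum>(s, t)\<in>A. t - s) < \<delta> \<longrightarrow>
     (\<Sum>(s, t)\<in>A. \<rho> s t) < \<epsilon>"
  proof (intro exI[of _ "min \<delta>1 \<delta>2"] conjI allI impI)
    show "0 < min \<delta>1 \<delta>2" using d1 d2 by simp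
    fix A :: "(real \<times> real) set"
    assume A: "finite A \<and> (\<forall>(s, t)\<in>A. 0 \<le> s \<and> s \<le> t \<and> t \<le> 1) \<and>
     pairwise (\<lambda>P Q. disjnt {fst P<..<snd P} {fst Q<..<snd Q}) A \<and> (\<Sum>(s, t)\<in>A. t - s) < min \<delta>1 \<delta>2"
    have "(\<Sum>(s, t)\<in>A. \<rho> s t) \<le> (\<Sum>(s, t)\<in>A. c1 * \<rho>1 s t + c2 * \<rho>2 s t)"
      unfolding case_prod_unfold by (intro sum_mono le) (use A in auto)
    also have "\<dots> = c1 * (\<Sum>(s, t)\<in>A. \<rho>1 s t) + c2 * (\<Sum>(s, t)\<in>A. \<rho>2 s t)"
      by (simp add: sum.distrib sum_distrib_left case_prod_unfold)
    also have "\<dots> \<le> c1 * e' + c2 * e'"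
      using d1(2)[of A] d2(2)[of A] A c by (intro add_mono mult_left_mono) auto
    also have "\<dots> < (c1 + c2 + 1) * e'" using e' by (simp add: algebra_simps)
    also have "\<dots> = \<epsilon>" using c by (simp add: e'_def)
    finally show "(\<Sum>(s, t)\<in>A. \<rho> s t) < \<epsilon>" .
  qed
qed

lemma ac_intervals_id: "ac_intervals (\<lambda>s t. t - s)"
  unfolding ac_intervals_def by blast

lemma Lipschitz_path_append:
  assumes P: "Lipschitz_path Y 1 P" "\<And>r. L \<le> r \<Longrightarrow> P r = y"
    and Q: "Lipschitz_path Y 1 Q" "\<And>r. r \<le> 0 \<Longrightarrow> Q r = y"
  shows "Lipschitz_path Y 1 (\<lambda>r. if r \<le> L then P r else Q (r - L))"
proof -
  have *: "mdist Y (if s \<le> L then P s else Q (s - L)) (if t \<le> L then P t else Q (t - L)) \<le> t - s"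
    if st: "s \<le> t" for s t
  proof -
    have m: "P s \<in> mspace Y" "P L \<in> mspace Y" "Q (t - L) \<in> mspace Y" using P(1) Q(1) by (auto simp: Lipschitz_path_def)
    have "mdist Y (P s) (P t) \<le> t - s" using P(1) st unfolding Lipschitz_path_def by (metis abs_minus_commute abs_of_nonneg diff_ge_0_iff_ge mult_1)
    moreover have "mdist Y (Q (s - L)) (Q (t - L)) \<le> t - s" using Q(1) st unfolding Lipschitz_path_def
      by (metis abs_minus_commute abs_of_nonneg diff_ge_0_iff_ge mult_1 diff_diff_eq2 diff_add_cancel)
    moreover have "mdist Y (P s) (Q (t - L)) \<le> t - s" if "s \<le> L" "L < t"
    proof -
      have "mdist Y (P s) (P L) \<le> \<bar>s - L\<bar>" using P(1) unfolding Lipschitz_path_def by (metis mult_1)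
      moreover have "mdist Y (Q 0) (Q (t - L)) \<le> \<bar>0 - (t - L)\<bar>" using Q(1) unfolding Lipschitz_path_def by (metis mult_1)
      moreover have "Q 0 = P L" using P(2) Q(2) by simp
      ultimately show ?thesis using that mdist_triangle[OF m] by simp
    qed
    ultimately show ?thesis using st by auto
  qed
  show ?thesis
    unfolding Lipschitz_path_def
  proof (intro conjI allI)
    fix s t
    show "(if s \<le> L then P s else Q (s - L)) \<in> mspace Y" using P(1) Q(1) by (auto simp: Lipschitz_path_def)
    show "mdist Y (if s \<le> L then P s else Q (s - L)) (if t \<le> L then P t else Q (t - L)) \<le> 1 * \<bar>s - t\<bar>"
    proof (cases "s \<le> t")
      case True then show ?thesis unfolding mult_1 using *[OF True] by linarith
    next
      case False
      then have "t \<le> s" by simp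
      from *[OF this] this show ?thesis unfolding mult_1 by (subst mdist_commute) linarith
    qed
  qed
qed

section \<open>Integrals over the unit interval up to negligible sets\<close>

lemma nn_integral_unit_le:
  fixes u g :: "real \<Rightarrow> real"
  assumes g: "(g has_integral I) {0..1}" and S: "negligible S"
    and u: "\<And>x. x \<in> {0<..<1} - S \<Longrightarrow> u x \<le> g x \<and> 0 \<le> g x"
  shows "(\<integral>\<^sup>+x. ennreal (u x) \<partial>lebesgue_on {0..1}) \<le> ennreal I"
proof -
  define h where "h x = (if x \<in> {0<..<1} - S then g x else 0)" for x
  have N: "negligible (S \<union> {0, 1})" using S by simp
  have "(h has_integral I) {0..1}"
    by (rule has_integral_spike[OF N _ g]) (auto simp: h_def)
  moreover have h0: "0 \<le> h x" for x using u by (auto simp: h_def)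
  ultimately have eq: "(\<integral>\<^sup>+x. ennreal (indicator {0..1} x * h x) \<partial>lebesgue) = ennreal I"
    unfolding nn_integral_completion by (intro nn_integral_has_integral_lebesgue)
  have ae: "AE x in lebesgue. x \<notin> S \<union> {0, 1}"
    by (rule AE_not_in) (use N in \<open>simp only: negligible_iff_null_sets\<close>)
  have "(\<integral>\<^sup>+x. ennreal (u x) \<partial>lebesgue_on {0..1}) = (\<integral>\<^sup>+x. ennreal (u x) * indicator {0..1} x \<partial>lebesgue)"
    by (subst nn_integral_restrict_space) auto
  \<comment> \<open>Monotonicity of the nonnegative integral holds for arbitrary integrands. This
    matters because the lemma is applied to \<open>cone_energy\<close>, which is built from
    \<open>deriv\<close> and \<open>Lim\<close>.\<close>
  also have "\<dots> \<le> (\<integral>\<^sup>+x. ennreal (indicator {0..1} x * h x) \<partial>lebesgue)"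
    by (rule nn_integral_mono_AE, rule AE_mp[OF ae], rule AE_I2)
      (use u in \<open>auto simp: h_def indicator_def intro!: ennreal_leI\<close>)
  finally show ?thesis unfolding eq .
qed

lemma nn_integral_unit_ge:
  fixes u g :: "real \<Rightarrow> real"
  assumes g: "(g has_integral I) {0..1}" and S: "negligible S"
    and u: "\<And>x. x \<in> {0<..<1} - S \<Longrightarrow> g x \<le> u x \<and> 0 \<le> g x"
  shows "ennreal I \<le> (\<integral>\<^sup>+x. ennreal (u x) \<partial>lebesgue_on {0..1})"
proof -
  define h where "h x = (if x \<in> {0<..<1} - S then g x else 0)" for x
  have N: "negligible (S \<union> {0, 1})" using S by simp
  have "(h has_integral I) {0..1}"
    by (rule has_integral_spike[OF N _ g]) (auto simp: h_def)
  moreover have h0: "0 \<le> h x" for x using u by (auto simp: h_def)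
  ultimately have "ennreal I = (\<integral>\<^sup>+x. ennreal (indicator {0..1} x * h x) \<partial>lebesgue)"
    unfolding nn_integral_completion by (intro nn_integral_has_integral_lebesgue[symmetric])
  also have "\<dots> \<le> (\<integral>\<^sup>+x. ennreal (u x) * indicator {0..1} x \<partial>lebesgue)"
    by (rule nn_integral_mono) (use u in \<open>auto simp: h_def indicator_def intro!: ennreal_leI\<close>)
  also have "\<dots> = (\<integral>\<^sup>+x. ennreal (u x) \<partial>lebesgue_on {0..1})"
    by (subst nn_integral_restrict_space) auto
  finally show ?thesis .
qed

lemma has_integral_le_off_negligible:
  fixes v h :: "real \<Rightarrow> real"
  assumes "(v has_integral I) {0..1}" "(h has_integral J) {0..1}" and S: "negligible S"
    and le: "\<And>x. x \<in> {0<..<1} - S \<Longrightarrow> v x \<le> h x"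
  shows "I \<le> J"
proof (rule has_integral_le)
  have N: "negligible (S \<union> {0, 1})" using S by simp
  show "((\<lambda>x. if x \<in> S \<union> {0, 1} then v x else h x) has_integral J) {0..1}"
    by (rule has_integral_spike[OF N _ assms(2)]) simp
qed (use assms(1) le in auto)

text \<open>For possibly nonmeasurable integrands: the integral is a supremum over simple functions
  below u, and multiplying these by c gives functions below c * u.\<close>

lemma nn_integral_cmult_le:
  shows "c * integral\<^sup>N M u \<le> (\<integral>\<^sup>+x. c * u x \<partial>M)"
proof -
  have "c * integral\<^sup>N M u = (SUP g \<in> {g. simple_function M g \<and> g \<le> u}. c * integral\<^sup>S M g)"
    unfolding nn_integral_def by (rule SUP_mult_left_ennreal)
  also have "\<dots> \<le> (\<integral>\<^sup>+x. c * u x \<partial>M)"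
  proof (rule SUP_least, clarify)
    fix g assume g: "simple_function M g" "g \<le> u"
    have "c * integral\<^sup>S M g = integral\<^sup>S M (\<lambda>x. c * g x)" using g by (simp add: simple_integral_mult)
    also have "\<dots> = (\<integral>\<^sup>+x. c * g x \<partial>M)" using g by (intro nn_integral_eq_simple_integral[symmetric]) auto
    also have "\<dots> \<le> (\<integral>\<^sup>+x. c * u x \<partial>M)"
      using g by (intro nn_integral_mono mult_left_mono) (auto simp: le_fun_def)
    finally show "c * integral\<^sup>S M g \<le> (\<integral>\<^sup>+x. c * u x \<partial>M)" .
  qed
  finally show ?thesis .
qed

lemma AE_unit_negligible:
  assumes "negligible S" and "\<And>x. x \<in> {0<..<1::real} - S \<Longrightarrow> P x"
  shows "AE x in lebesgue_on {0..1}. P x"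
proof -
  have "negligible (S \<union> {0, 1})" using assms by simp
  then have "AE x in lebesgue. x \<notin> S \<union> {0, 1}"
    unfolding negligible_iff_null_sets by (rule AE_not_in)
  then show ?thesis by (subst AE_restrict_space_iff) (use assms(2) in auto)
qed

lemma AE_unit_imp_negligible:
  assumes "AE x in lebesgue_on {0..1::real}. P x"
  shows "\<exists>S. negligible S \<and> (\<forall>x\<in>{0<..<1} - S. P x)"
proof -
  have "AE x in lebesgue. x \<in> {0..1} \<longrightarrow> P x" using assms by (subst (asm) AE_restrict_space_iff) auto
  then obtain S where S: "S \<in> null_sets lebesgue" "{x \<in> space lebesgue. \<not> (x \<in> {0..1} \<longrightarrow> P x)} \<subseteq> S"
    unfolding eventually_ae_filter by blast
  moreover have "P x" if "x \<in> {0<..<1} - S" for x using that subsetD[OF S(2), of x] by auto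
  ultimately show ?thesis by (auto simp: negligible_iff_null_sets)
qed

section \<open>Causality and time separation of cones\<close>

locale bounded_cone =
  fixes f :: "real \<Rightarrow> real" and Y :: "'a metric" and m M :: real
  assumes Y: "length_space Y" and f_cont: "continuous_on UNIV f"
    and m: "0 < m" and f_lower: "\<And>s. m \<le> f s" and f_upper: "\<And>s. f s \<le> M"
begin

abbreviation X :: "(real \<times> 'a) lorentz_space" where "X \<equiv> generalized_cone UNIV f Y"

lemma f_pos: "0 < f s" using m f_lower[of s] by linarith

lemma M_pos: "0 < M" using f_pos[of 0] f_upper[of 0] by linarith

text \<open>Conformal time: with respect to \<open>F\<close> the light cones are those of a product.\<close>

definition F :: "real \<Rightarrow> real" where
  "F = (SOME G. \<forall>x. (G has_real_derivative 1 / f x) (at x))"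

lemma F_deriv: "(F has_real_derivative 1 / f x) (at x)"
proof -
  have "isCont (\<lambda>x. 1 / f x) x" for x
    using f_cont f_pos by (intro continuous_intros) (auto simp: continuous_on_eq_continuous_at less_imp_neq[symmetric])
  then have "\<exists>G. \<forall>x :: real. -\<infinity> < ereal x \<longrightarrow> ereal x < \<infinity> \<longrightarrow> (G has_vector_derivative 1 / f x) (at x)"
    by (intro einterval_antiderivative) auto
  then have "\<exists>G. \<forall>x. (G has_real_derivative 1 / f x) (at x)"
    by (simp add: has_real_derivative_iff_has_vector_derivative)
  from someI_ex[OF this] show ?thesis unfolding F_def by blast
qed

lemma F_bounds:
  assumes "s \<le> t"
  shows "(t - s) / M \<le> F t - F s" and "F t - F s \<le> (t - s) / m"
proof -
  have "(t - s) / M \<le> F t - F s \<and> F t - F s \<le> (t - s) / m"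
  proof (cases "s = t")
    case False
    then have "s < t" using assms by simp
    then obtain z where z: "F t - F s = (t - s) * (1 / f z)" using MVT2[of s t F "\<lambda>x. 1 / f x"] F_deriv by blast
    have "1 / M \<le> 1 / f z" "1 / f z \<le> 1 / m"
      using f_pos[of z] f_lower[of z] f_upper[of z] m by (auto simp: frac_le)
    then have "(t - s) * (1 / M) \<le> (t - s) * (1 / f z)" "(t - s) * (1 / f z) \<le> (t - s) * (1 / m)"
      using mult_left_mono[of "1 / M" "1 / f z" "t - s"] mult_left_mono[of "1 / f z" "1 / m" "t - s"] assms by auto
    then show ?thesis using z by simp
  qed simp
  then show "(t - s) / M \<le> F t - F s" "F t - F s \<le> (t - s) / m" by auto
qed

lemma F_less_iff [simp]: "F s < F t \<longleftrightarrow> s < t"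
proof -
  have lt: "F s < F t" if "s < t" for s t
    using F_bounds(1)[of s t] that M_pos by (smt (verit) divide_pos_pos)
  show ?thesis using lt[of s t] lt[of t s] by (metis less_asym linorder_cases)
qed

lemma F_le_iff [simp]: "F s \<le> F t \<longleftrightarrow> s \<le> t"
  by (meson F_less_iff not_le)

lemma F_surj: "\<exists>s. F s = T"
proof -
  define r where "r = (\<bar>T - F 0\<bar> + 1) * M"
  have r: "r > 0" "r / M = \<bar>T - F 0\<bar> + 1" using M_pos by (auto simp: r_def intro!: mult_pos_pos)
  have "F (- r) \<le> T" "T \<le> F r" using F_bounds(1)[of "- r" 0] F_bounds(1)[of 0 r] r by auto
  moreover have "continuous_on {- r..r} F"
    using F_deriv by (meson DERIV_isCont continuous_at_imp_continuous_on)
  ultimately show ?thesis using IVT'[of F "- r" T r] r by auto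
qed

text \<open>Reads a causal curve in conformal time. Here h is the derivative of F along the curve,
  the chain rule gives a = f * h, and v is both the metric speed of the fibre part and the
  derivative of its arclength lv. The energy becomes a conformal factor times v^2 - h^2, so
  causality means v <= h.\<close>

lemma causal_curve_data:
  assumes "cone_future_causal UNIV f Y x y \<gamma>"
  defines "\<alpha> \<equiv> \<lambda>t. fst (\<gamma> t)" and "\<beta> \<equiv> \<lambda>t. snd (\<gamma> t)"
  shows "\<exists>a h lv v S. lv 0 = 0 \<and> (\<forall>s t. 0 \<le> s \<longrightarrow> s \<le> t \<longrightarrow> t \<le> 1 \<longrightarrow> mdist Y (\<beta> s) (\<beta> t) \<le> lv t - lv s) \<and>
    ac_intervals (\<lambda>s t. lv t - lv s) \<and> ac_intervals (\<lambda>s t. \<alpha> t - \<alpha> s) \<and>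
    ac_intervals (\<lambda>s t. F (\<alpha> t) - F (\<alpha> s)) \<and>
    (a has_integral (\<alpha> 1 - \<alpha> 0)) {0..1} \<and> (h has_integral (F (\<alpha> 1) - F (\<alpha> 0))) {0..1} \<and>
    (v has_integral lv 1) {0..1} \<and> negligible S \<and>
    (\<forall>x\<in>{0<..<1} - S. (\<alpha> has_real_derivative a x) (at x) \<and> (lv has_real_derivative v x) (at x) \<and>
       a x = f (\<alpha> x) * h x \<and> 0 \<le> v x \<and> v x \<le> h x \<and>
       cone_energy f Y \<gamma> x = (f (\<alpha> x))\<^sup>2 * ((v x)\<^sup>2 - (h x)\<^sup>2))"
proof -
  have ac: "absolutely_continuous_curve (cone_metric UNIV Y) \<gamma>"
    and mono: "strict_mono_on {0..1} \<alpha>"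
    and en: "AE t in lebesgue_on {0..1}. cone_energy f Y \<gamma> t \<le> 0"
    using assms(1) unfolding cone_future_causal_def \<alpha>_def by auto
  have \<gamma>m: "snd (\<gamma> t) \<in> mspace Y" if "t \<in> {0..1}" for t
    using ac that unfolding absolutely_continuous_curve_def by (auto simp: Pi_iff mem_Times_iff)
  have cd: "mdist (cone_metric UNIV Y) (\<gamma> s) (\<gamma> t) = \<bar>\<alpha> s - \<alpha> t\<bar> + mdist Y (\<beta> s) (\<beta> t)" for s t
    unfolding \<alpha>_def \<beta>_def by (metis mdist_cone_metric prod.collapse)
  have acY: "absolutely_continuous_curve Y \<beta>"
    by (rule ac_curve_comparison[OF ac]) (use \<gamma>m cd in \<open>auto simp: \<beta>_def\<close>)
  have \<alpha>_mono: "\<alpha> s \<le> \<alpha> t" if "0 \<le> s" "s \<le> t" "t \<le> 1" for s t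
    using strict_mono_on_leD[OF mono] that by auto
  have ac\<alpha>: "ac_intervals (\<lambda>s t. \<alpha> t - \<alpha> s)"
    by (rule ac_curve_imp_ac_intervals[OF ac]) (use \<alpha>_mono in \<open>auto simp: cd\<close>)
  have acF: "ac_intervals (\<lambda>s t. F (\<alpha> t) - F (\<alpha> s))"
  proof (rule ac_intervals_linear[OF ac\<alpha> ac\<alpha>, of "1 / m" 0])
    fix s t :: real assume "0 \<le> s" "s \<le> t" "t \<le> 1"
    from F_bounds(2)[OF \<alpha>_mono[OF this]]
    show "F (\<alpha> t) - F (\<alpha> s) \<le> 1 / m * (\<alpha> t - \<alpha> s) + 0 * (\<alpha> t - \<alpha> s)" by simp
  qed (use m in auto)
  have "mono_on {0..1} \<alpha>" by (auto intro!: mono_onI \<alpha>_mono)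
  from ac_mono_derivative[OF this ac\<alpha>] obtain a Sa where a: "\<And>s t. 0 \<le> s \<Longrightarrow> s \<le> t \<Longrightarrow> t \<le> 1 \<Longrightarrow> (a has_integral (\<alpha> t - \<alpha> s)) {s..t}"
    "negligible Sa" "\<And>x. x \<in> {0<..<1} - Sa \<Longrightarrow> (\<alpha> has_real_derivative a x) (at x)" "\<And>x. 0 \<le> a x" by blast
  have "mono_on {0..1} (\<lambda>t. F (\<alpha> t))" by (auto intro!: mono_onI \<alpha>_mono)
  from ac_mono_derivative[OF this acF] obtain h Sh where h: "\<And>s t. 0 \<le> s \<Longrightarrow> s \<le> t \<Longrightarrow> t \<le> 1 \<Longrightarrow> (h has_integral (F (\<alpha> t) - F (\<alpha> s))) {s..t}"
    "negligible Sh" "\<And>x. x \<in> {0<..<1} - Sh \<Longrightarrow> ((\<lambda>t. F (\<alpha> t)) has_real_derivative h x) (at x)" "\<And>x. 0 \<le> h x" by blast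
  from ac_metric_derivative[OF acY] obtain lv v Sv where v: "lv 0 = 0"
    "\<And>s t. 0 \<le> s \<Longrightarrow> s \<le> t \<Longrightarrow> t \<le> 1 \<Longrightarrow> mdist Y (\<beta> s) (\<beta> t) \<le> lv t - lv s"
    "ac_intervals (\<lambda>s t. lv t - lv s)" "\<And>x. 0 \<le> v x"
    "\<And>a b. 0 \<le> a \<Longrightarrow> a \<le> b \<Longrightarrow> b \<le> 1 \<Longrightarrow> (v has_integral (lv b - lv a)) {a..b}" "negligible Sv"
    "\<And>x. x \<in> {0<..<1} - Sv \<Longrightarrow> (lv has_real_derivative v x) (at x) \<and>
      ((\<lambda>s. mdist Y (\<beta> s) (\<beta> x) / \<bar>s - x\<bar>) \<longlongrightarrow> v x) (at x)" by blast
  from AE_unit_imp_negligible[OF en] obtain Se where e: "negligible Se" "\<And>x. x \<in> {0<..<1} - Se \<Longrightarrow> cone_energy f Y \<gamma> x \<le> 0" by blast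
  define S where "S = Sa \<union> Sh \<union> Sv \<union> Se"
  have pt: "(\<alpha> has_real_derivative a x) (at x) \<and> (lv has_real_derivative v x) (at x) \<and>
       a x = f (\<alpha> x) * h x \<and> 0 \<le> v x \<and> v x \<le> h x \<and>
       cone_energy f Y \<gamma> x = (f (\<alpha> x))\<^sup>2 * ((v x)\<^sup>2 - (h x)\<^sup>2)" if x: "x \<in> {0<..<1} - S" for x
  proof -
    have da: "(\<alpha> has_real_derivative a x) (at x)" using a(3) x by (auto simp: S_def)
    have "((\<lambda>t. F (\<alpha> t)) has_real_derivative 1 / f (\<alpha> x) * a x) (at x)"
      by (rule DERIV_chain2[OF F_deriv da])
    moreover have "((\<lambda>t. F (\<alpha> t)) has_real_derivative h x) (at x)" using h(3) x by (auto simp: S_def)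
    ultimately have "h x = 1 / f (\<alpha> x) * a x" by (rule DERIV_unique[symmetric])
    then have ah: "a x = f (\<alpha> x) * h x" using f_pos[of "\<alpha> x"] by simp
    have dv: "(lv has_real_derivative v x) (at x)" "((\<lambda>s. mdist Y (\<beta> s) (\<beta> x) / \<bar>s - x\<bar>) \<longlongrightarrow> v x) (at x)"
      using v(7) x by (auto simp: S_def)
    have sp: "metric_speed Y (\<lambda>s. snd (\<gamma> s)) x = v x"
      using dv(2) unfolding metric_speed_def \<beta>_def by (intro tendsto_Lim) auto
    have dl: "deriv (\<lambda>s. fst (\<gamma> s)) x = a x" using DERIV_imp_deriv[OF da] by (simp add: \<alpha>_def)
    have ce: "cone_energy f Y \<gamma> x = (f (\<alpha> x))\<^sup>2 * ((v x)\<^sup>2 - (h x)\<^sup>2)"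
      unfolding cone_energy_def sp dl ah by (simp add: power_mult_distrib algebra_simps \<alpha>_def)
    have "cone_energy f Y \<gamma> x \<le> 0" using e(2) x by (auto simp: S_def)
    then have "(v x)\<^sup>2 \<le> (h x)\<^sup>2" unfolding ce using f_pos[of "\<alpha> x"] by (simp add: mult_le_0_iff not_le)
    then have "v x \<le> h x" using h(4)[of x] by (rule power2_le_imp_le)
    with da dv ah ce v(4) show ?thesis by blast
  qed
  have Sn: "negligible S" using a h v e by (simp add: S_def)
  have v1: "(v has_integral lv 1) {0..1}" using v(5)[of 0 1] v(1) by simp
  show ?thesis
  proof (rule exI[of _ a], rule exI[of _ h], rule exI[of _ lv], rule exI[of _ v], rule exI[of _ S], intro conjI allI impI)
    show "mdist Y (\<beta> s) (\<beta> t) \<le> lv t - lv s" if "0 \<le> s" "s \<le> t" "t \<le> 1" for s t by (rule v(2)[OF that])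
    show "\<forall>x\<in>{0<..<1} - S. (\<alpha> has_real_derivative a x) (at x) \<and> (lv has_real_derivative v x) (at x) \<and>
       a x = f (\<alpha> x) * h x \<and> 0 \<le> v x \<and> v x \<le> h x \<and>
       cone_energy f Y \<gamma> x = (f (\<alpha> x))\<^sup>2 * ((v x)\<^sup>2 - (h x)\<^sup>2)" using pt by blast
  qed (use Sn v1 v(1,3) a(1)[of 0 1] h(1)[of 0 1] ac\<alpha> acF in simp_all)
qed

text \<open>Reverse Cauchy-Schwarz inequality: a hyperbolic angle \<open>e\<close> linearizes the square root.\<close>

lemma sqrt_hyperbolic_le:
  fixes h v e :: real
  assumes "0 \<le> v" "v \<le> h" "0 \<le> e" "e < 1"
  shows "sqrt (h\<^sup>2 - v\<^sup>2) \<le> (h - e * v) / sqrt (1 - e\<^sup>2)"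
proof -
  have e2: "e\<^sup>2 < 1" using assms by (simp add: power_less_one_iff abs_square_less_1)
  have "(h\<^sup>2 - v\<^sup>2) * (1 - e\<^sup>2) = (h - e * v)\<^sup>2 - (v - e * h)\<^sup>2" by (simp add: power2_eq_square algebra_simps)
  then have "(h\<^sup>2 - v\<^sup>2) * (1 - e\<^sup>2) \<le> (h - e * v)\<^sup>2" by simp
  then have "sqrt ((h\<^sup>2 - v\<^sup>2) * (1 - e\<^sup>2)) \<le> sqrt ((h - e * v)\<^sup>2)" by (rule real_sqrt_le_mono)
  moreover have "e * v \<le> h"
  proof -
    have "e * v \<le> 1 * v" using assms by (intro mult_right_mono) auto
    then show ?thesis using assms by simp
  qed
  ultimately have "sqrt (h\<^sup>2 - v\<^sup>2) * sqrt (1 - e\<^sup>2) \<le> h - e * v" by (simp add: real_sqrt_mult)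
  then show ?thesis using e2 by (simp add: pos_le_divide_eq)
qed

text \<open>The integral of sqrt (h^2 - v^2) is at most the same expression in the integrals H and
  l: a constant hyperbolic angle makes the pointwise bound linear, so that it can be integrated and
  then optimized.\<close>

lemma cone_length_le:
  assumes lv: "0 \<le> l" "l \<le> H" and h: "(h has_integral H) {0..1}" and v: "(v has_integral l) {0..1}"
    and S: "negligible S" and pt: "\<And>x. x \<in> {0<..<1} - S \<Longrightarrow> 0 \<le> v x \<and> v x \<le> h x \<and>
       cone_energy f Y \<gamma> x = (f (fst (\<gamma> x)))\<^sup>2 * ((v x)\<^sup>2 - (h x)\<^sup>2)"
  shows "cone_length f Y \<gamma> \<le> ennreal (M * sqrt (H\<^sup>2 - l\<^sup>2))"
proof -
  have main: "cone_length f Y \<gamma> \<le> ennreal (M * ((H - e * l) / sqrt (1 - e\<^sup>2)))" if e: "0 \<le> e" "e < 1" for e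
    unfolding cone_length_def
  proof (rule nn_integral_unit_le[OF _ S])
    show "((\<lambda>x. M * ((h x - e * v x) / sqrt (1 - e\<^sup>2))) has_integral M * ((H - e * l) / sqrt (1 - e\<^sup>2))) {0..1}"
      by (intro has_integral_mult_right has_integral_divide has_integral_diff h v)
    fix x assume x: "x \<in> {0<..<1} - S"
    note p = pt[OF x]
    have "- cone_energy f Y \<gamma> x = (f (fst (\<gamma> x)))\<^sup>2 * ((h x)\<^sup>2 - (v x)\<^sup>2)" using p by (simp add: algebra_simps)
    then have "sqrt (- cone_energy f Y \<gamma> x) = f (fst (\<gamma> x)) * sqrt ((h x)\<^sup>2 - (v x)\<^sup>2)"
      using f_pos[of "fst (\<gamma> x)"] by (simp add: real_sqrt_mult)
    also have "\<dots> \<le> M * ((h x - e * v x) / sqrt (1 - e\<^sup>2))"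
      using p e f_upper f_pos[of "fst (\<gamma> x)"] M_pos by (intro mult_mono sqrt_hyperbolic_le) (auto simp: power_mono)
    finally show "sqrt (- cone_energy f Y \<gamma> x) \<le> M * ((h x - e * v x) / sqrt (1 - e\<^sup>2)) \<and>
      0 \<le> M * ((h x - e * v x) / sqrt (1 - e\<^sup>2))"
      using \<open>sqrt (- cone_energy f Y \<gamma> x) = _\<close> f_pos[of "fst (\<gamma> x)"] p
      by (smt (verit) mult_nonneg_nonneg power_mono real_sqrt_ge_zero)
  qed
  show ?thesis
  proof (cases "l = H")
    case False
    then have H: "l < H" "0 < H" using lv by auto
    \<comment> \<open>This angle turns (H - e l) / sqrt (1 - e^2) into sqrt (H^2 - l^2).\<close>
    define e where "e = l / H"
    have e: "0 \<le> e" "e < 1" using H lv by (auto simp: e_def)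
    have 1: "1 - e\<^sup>2 = (H\<^sup>2 - l\<^sup>2) / H\<^sup>2" using H by (simp add: e_def power_divide diff_divide_distrib)
    have 2: "H - e * l = (H\<^sup>2 - l\<^sup>2) / H" using H by (simp add: e_def power2_eq_square diff_divide_distrib)
    have pos: "0 < H\<^sup>2 - l\<^sup>2" using H lv by (simp add: power_strict_mono)
    have "(H - e * l) / sqrt (1 - e\<^sup>2) = (H\<^sup>2 - l\<^sup>2) / sqrt (H\<^sup>2 - l\<^sup>2)"
      unfolding 1 2 using H by (simp add: real_sqrt_divide)
    also have "\<dots> = sqrt (H\<^sup>2 - l\<^sup>2)" using pos by (simp add: real_div_sqrt)
    finally show ?thesis using main[OF e] by simp
  next
    case True
    have "cone_length f Y \<gamma> \<le> ennreal z" if z: "z > 0" for z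
    proof -
      \<comment> \<open>In the null case the optimal angle would be the excluded value 1. With e = 1
        - d the bound is at most M * H * sqrt d, and d is chosen to push it below z.\<close>
      define d where "d = min 1 ((z / (M * (H + 1)))\<^sup>2)"
      have MH: "M * (H + 1) > 0" using M_pos lv by simp
      have d: "0 < d" "d \<le> 1" using z MH by (auto simp: d_def)
      define e where "e = 1 - d"
      have e: "0 \<le> e" "e < 1" using d by (auto simp: e_def)
      have "1 - e\<^sup>2 = d * (2 - d)" by (simp add: e_def power2_eq_square algebra_simps)
      moreover have "d * 1 \<le> d * (2 - d)" using d by (intro mult_left_mono) auto
      ultimately have "d \<le> 1 - e\<^sup>2" by simp
      have "(H - e * l) / sqrt (1 - e\<^sup>2) = H * d / sqrt (1 - e\<^sup>2)" using True by (simp add: e_def algebra_simps)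
      also have "\<dots> \<le> H * d / sqrt d"
        using d lv \<open>d \<le> 1 - e\<^sup>2\<close> by (intro divide_left_mono) auto
      also have "\<dots> = H * sqrt d" using real_div_sqrt[of d] d by (metis less_imp_le times_divide_eq_right)
      also have "\<dots> \<le> H * (z / (M * (H + 1)))"
      proof (intro mult_left_mono)
        have "sqrt d \<le> sqrt ((z / (M * (H + 1)))\<^sup>2)" unfolding d_def by (intro real_sqrt_le_mono) simp
        then show "sqrt d \<le> z / (M * (H + 1))" using z MH by simp
      qed (use lv in simp)
      finally have "M * ((H - e * l) / sqrt (1 - e\<^sup>2)) \<le> M * (H * (z / (M * (H + 1))))"
        using M_pos by (intro mult_left_mono) auto
      also have "\<dots> = (M * (H * z)) / (M * (H + 1))" by simp
      also have "\<dots> = z * (H / (H + 1))" using M_pos by (subst mult_divide_mult_cancel_left) auto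
      also have "\<dots> \<le> z * 1" using lv z by (intro mult_left_mono) auto
      also have "\<dots> = z" by simp
      finally show ?thesis using main[OF e] by (meson ennreal_leI order_trans)
    qed
    then have "cone_length f Y \<gamma> \<le> 0"
      using ennreal_le_epsilon[of 0 "cone_length f Y \<gamma>"] by simp
    then show ?thesis by simp
  qed
qed

lemma causal_curve_bounds:
  assumes c: "cone_future_causal UNIV f Y (s, u) (s', u') \<gamma>"
  shows "s < s'" "u \<in> mspace Y" "u' \<in> mspace Y" "mdist Y u u' \<le> F s' - F s"
    "cone_length f Y \<gamma> \<le> ennreal (M * sqrt ((F s' - F s)\<^sup>2 - (mdist Y u u')\<^sup>2))"
proof -
  have ends: "\<gamma> 0 = (s, u)" "\<gamma> 1 = (s', u')" using c by (auto simp: cone_future_causal_def)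
  show "s < s'" using c ends strict_mono_onD[of "{0..1}" "\<lambda>t. fst (\<gamma> t)" 0 1] by (auto simp: cone_future_causal_def)
  have "\<gamma> t \<in> UNIV \<times> mspace Y" if "t \<in> {0..1}" for t
    using c that unfolding cone_future_causal_def absolutely_continuous_curve_def by (auto simp: Pi_iff)
  from this[of 0] this[of 1] show "u \<in> mspace Y" "u' \<in> mspace Y" by (auto simp: ends)
  from causal_curve_data[OF c] obtain a h lv v S where D: "lv 0 = 0"
    "\<And>s t. 0 \<le> s \<Longrightarrow> s \<le> t \<Longrightarrow> t \<le> 1 \<Longrightarrow> mdist Y (snd (\<gamma> s)) (snd (\<gamma> t)) \<le> lv t - lv s"
    "(h has_integral (F (fst (\<gamma> 1)) - F (fst (\<gamma> 0)))) {0..1}" "(v has_integral lv 1) {0..1}" "negligible S"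
    "\<And>x. x \<in> {0<..<1} - S \<Longrightarrow> 0 \<le> v x \<and> v x \<le> h x \<and>
       cone_energy f Y \<gamma> x = (f (fst (\<gamma> x)))\<^sup>2 * ((v x)\<^sup>2 - (h x)\<^sup>2)" by blast
  have d: "mdist Y u u' \<le> lv 1" using D(2)[of 0 1] D(1) ends by simp
  have "lv 1 \<le> F s' - F s"
    using has_integral_le_off_negligible[OF D(4) D(3) D(5)] D(6) ends by simp
  with d show "mdist Y u u' \<le> F s' - F s" by linarith
  have l0: "0 \<le> lv 1" using d mdist_nonneg[of Y u u'] by linarith
  have "cone_length f Y \<gamma> \<le> ennreal (M * sqrt ((F s' - F s)\<^sup>2 - (lv 1)\<^sup>2))"
    using cone_length_le[OF l0 \<open>lv 1 \<le> F s' - F s\<close> _ D(4,5,6)] D(3) ends by simp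
  also have "\<dots> \<le> ennreal (M * sqrt ((F s' - F s)\<^sup>2 - (mdist Y u u')\<^sup>2))"
    using d M_pos by (intro ennreal_leI mult_left_mono real_sqrt_le_mono diff_left_mono power_mono) auto
  finally show "cone_length f Y \<gamma> \<le> ennreal (M * sqrt ((F s' - F s)\<^sup>2 - (mdist Y u u')\<^sup>2))" .
qed

section \<open>Construction of causal curves and bounds for \<tau>\<close>

lemma cone_curve:
  assumes P: "Lipschitz_path Y 1 P"
    and mono: "strict_mono_on {0..1} \<alpha>" and ac\<alpha>: "ac_intervals (\<lambda>s t. \<alpha> t - \<alpha> s)"
    and mono\<phi>: "mono_on {0..1} \<phi>" and ac\<phi>: "ac_intervals (\<lambda>s t. \<phi> t - \<phi> s)" and S: "negligible S"
    and pt: "\<And>x. x \<in> {0<..<1} - S \<Longrightarrow> (\<alpha> has_real_derivative a x) (at x) \<and> (\<phi> has_real_derivative b x) (at x) \<and>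
      f (\<alpha> x) * b x \<le> a x"
  defines "\<gamma> \<equiv> \<lambda>t. (\<alpha> t, P (\<phi> t))"
  shows "cone_future_causal UNIV f Y (\<gamma> 0) (\<gamma> 1) \<gamma>"
    and "\<exists>S'. negligible S' \<and> S \<subseteq> S' \<and>
      (\<forall>x\<in>{0<..<1} - S'. cone_energy f Y \<gamma> x \<le> (f (\<alpha> x) * b x)\<^sup>2 - (a x)\<^sup>2)"
proof -
  have Pm: "P r \<in> mspace Y" and PL: "mdist Y (P r) (P r') \<le> \<bar>r - r'\<bar>" for r r'
    using P unfolding Lipschitz_path_def by simp_all
  have \<alpha>_mono: "\<alpha> s \<le> \<alpha> t" if "0 \<le> s" "s \<le> t" "t \<le> 1" for s t
    using strict_mono_on_leD[OF mono] that by auto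
  have \<phi>_mono: "\<phi> s \<le> \<phi> t" if "0 \<le> s" "s \<le> t" "t \<le> 1" for s t
    using mono_onD[OF mono\<phi>] that by auto
  have ac: "absolutely_continuous_curve (cone_metric UNIV Y) \<gamma>"
  proof (rule ac_intervals_imp_ac_curve)
    show "ac_intervals (\<lambda>s t. (\<alpha> t - \<alpha> s) + (\<phi> t - \<phi> s))"
      by (rule ac_intervals_linear[OF ac\<alpha> ac\<phi>, of 1 1]) auto
    show "\<gamma> \<in> {0..1} \<rightarrow> mspace (cone_metric UNIV Y)" using Pm by (auto simp: \<gamma>_def)
    fix s t :: real assume st: "0 \<le> s" "s \<le> t" "t \<le> 1"
    show "mdist (cone_metric UNIV Y) (\<gamma> s) (\<gamma> t) \<le> (\<alpha> t - \<alpha> s) + (\<phi> t - \<phi> s)"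
      using \<alpha>_mono[OF st] \<phi>_mono[OF st] PL[of "\<phi> s" "\<phi> t"] by (simp add: \<gamma>_def)
  qed simp
  define \<beta> where "\<beta> = (\<lambda>t. P (\<phi> t))"
  have acY: "absolutely_continuous_curve Y \<beta>"
  proof (rule ac_intervals_imp_ac_curve[OF ac\<phi>])
    show "\<beta> \<in> {0..1} \<rightarrow> mspace Y" using Pm by (auto simp: \<beta>_def)
    fix s t :: real assume st: "0 \<le> s" "s \<le> t" "t \<le> 1"
    show "mdist Y (\<beta> s) (\<beta> t) \<le> \<phi> t - \<phi> s"
      using \<phi>_mono[OF st] PL[of "\<phi> s" "\<phi> t"] by (simp add: \<beta>_def)
  qed simp
  from ac_metric_derivative[OF acY] obtain v Sv where v: "\<And>x. 0 \<le> v x" "negligible Sv"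
    "\<And>x. x \<in> {0<..<1} - Sv \<Longrightarrow> ((\<lambda>s. mdist Y (\<beta> s) (\<beta> x) / \<bar>s - x\<bar>) \<longlongrightarrow> v x) (at x)" by blast
  have en: "cone_energy f Y \<gamma> x \<le> (f (\<alpha> x) * b x)\<^sup>2 - (a x)\<^sup>2" if x: "x \<in> {0<..<1} - (S \<union> Sv)" for x
  proof -
    have dv: "((\<lambda>s. mdist Y (\<beta> s) (\<beta> x) / \<bar>s - x\<bar>) \<longlongrightarrow> v x) (at x)" using v x by auto
    have db: "((\<lambda>s. (\<phi> s - \<phi> x) / (s - x)) \<longlongrightarrow> b x) (at x)" using pt[of x] x by (auto simp: has_field_derivative_iff)
    \<comment> \<open>Only an inequality: P is 1-Lipschitz but need not have unit speed, so the
      derivative b of \<phi> bounds the metric speed from above.\<close>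
    have "v x \<le> b x"
    proof (rule tendsto_le[OF _ db dv])
      have "eventually (\<lambda>s. s \<in> {0<..<1} \<and> s \<noteq> x) (at x)"
        using x by (intro eventually_conj eventually_at_in_open' eventually_neq_at_within) auto
      then show "eventually (\<lambda>s. mdist Y (\<beta> s) (\<beta> x) / \<bar>s - x\<bar> \<le> (\<phi> s - \<phi> x) / (s - x)) (at x)"
      proof eventually_elim
        case (elim s)
        have "mdist Y (\<beta> s) (\<beta> x) / \<bar>s - x\<bar> \<le> \<bar>\<phi> s - \<phi> x\<bar> / \<bar>s - x\<bar>"
          using PL[of "\<phi> s" "\<phi> x"] by (intro divide_right_mono) (auto simp: \<beta>_def)
        also have "\<dots> = \<bar>(\<phi> s - \<phi> x) / (s - x)\<bar>" by (rule abs_divide[symmetric])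
        also have "(\<phi> s - \<phi> x) / (s - x) \<ge> 0"
          using \<phi>_mono[of s x] \<phi>_mono[of x s] elim x
          by (cases "s < x") (auto intro: divide_nonpos_nonpos divide_nonneg_nonneg)
        then have "\<bar>(\<phi> s - \<phi> x) / (s - x)\<bar> = (\<phi> s - \<phi> x) / (s - x)" by (rule abs_of_nonneg)
        finally show ?case .
      qed
    qed simp
    then have "(f (\<alpha> x) * v x)\<^sup>2 \<le> (f (\<alpha> x) * b x)\<^sup>2"
      using v(1)[of x] f_pos[of "\<alpha> x"] by (intro power_mono mult_left_mono) auto
    moreover have "metric_speed Y (\<lambda>s. snd (\<gamma> s)) x = v x"
      using dv unfolding metric_speed_def \<beta>_def \<gamma>_def by (intro tendsto_Lim) auto
    moreover have "deriv (\<lambda>s. fst (\<gamma> s)) x = a x" using pt[of x] x DERIV_imp_deriv by (auto simp: \<gamma>_def)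
    ultimately show ?thesis by (simp add: cone_energy_def power_mult_distrib \<gamma>_def)
  qed
  have Sn: "negligible (S \<union> Sv)" using S v by simp
  show "cone_future_causal UNIV f Y (\<gamma> 0) (\<gamma> 1) \<gamma>"
    unfolding cone_future_causal_def
  proof (intro conjI ac)
    show "strict_mono_on {0..1} (\<lambda>t. fst (\<gamma> t))" using mono by (simp add: \<gamma>_def)
    show "AE t in lebesgue_on {0..1}. cone_energy f Y \<gamma> t \<le> 0"
    proof (rule AE_unit_negligible[OF Sn])
      fix x assume x: "x \<in> {0<..<1} - (S \<union> Sv)"
      have "0 \<le> b x"
      proof (rule tendsto_lowerbound)
        show "((\<lambda>s. (\<phi> s - \<phi> x) / (s - x)) \<longlongrightarrow> b x) (at x)" using pt[of x] x by (auto simp: has_field_derivative_iff)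
        have "eventually (\<lambda>s. s \<in> {0<..<1} \<and> s \<noteq> x) (at x)"
          using x by (intro eventually_conj eventually_at_in_open' eventually_neq_at_within) auto
        then show "eventually (\<lambda>s. 0 \<le> (\<phi> s - \<phi> x) / (s - x)) (at x)"
        proof eventually_elim
          case (elim s) then show ?case
            using \<phi>_mono[of s x] \<phi>_mono[of x s] x
            by (cases "s < x") (auto intro: divide_nonpos_nonpos divide_nonneg_nonneg)
        qed
      qed simp
      then have "(f (\<alpha> x) * b x)\<^sup>2 \<le> (a x)\<^sup>2" using pt[of x] x f_pos[of "\<alpha> x"] by (intro power_mono) auto
      then show "cone_energy f Y \<gamma> x \<le> 0" using en[OF x] by linarith
    qed
  qed auto
  show "\<exists>S'. negligible S' \<and> S \<subseteq> S' \<and>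
      (\<forall>x\<in>{0<..<1} - S'. cone_energy f Y \<gamma> x \<le> (f (\<alpha> x) * b x)\<^sup>2 - (a x)\<^sup>2)"
    using Sn en by (intro exI[of _ "S \<union> Sv"]) auto
qed

lemma tsep_ge_cone_length:
  "cone_future_causal UNIV f Y p q \<gamma> \<Longrightarrow> cone_length f Y \<gamma> \<le> tsep X p q"
  unfolding generalized_cone_def by (auto intro: SUP_upper)

text \<open>The fibre path is run at the constant fraction r = D / H of the speed of light while
  time grows affinely, so the energy is bounded by an explicit negative constant. D exceeds the
  fibre distance because a path realizing the distance may not exist; D is sent to the distance
  afterwards.\<close>

lemma chron_lower_aux:
  assumes u: "u \<in> mspace Y" "u' \<in> mspace Y" and D: "mdist Y u u' < D" "D < F s' - F s"
  shows "chron X (s, u) (s', u')" "ennreal (m * sqrt ((F s' - F s)\<^sup>2 - D\<^sup>2)) \<le> tsep X (s, u) (s', u')"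
proof -
  define H where "H = F s' - F s"
  have D0: "0 < D" using D mdist_nonneg[of Y u u'] by linarith
  have "D < H" using D(2) by (simp only: H_def)
  moreover from this D0 have "0 < H" by linarith
  ultimately have H: "0 < H" "D < H" by auto
  have "F s < F s'" using H by (simp add: H_def)
  then have ss: "s < s'" by simp
  define r where "r = D / H"
  have r: "0 < r" "r < 1" "D = r * H" using H D0 by (auto simp: r_def)
  obtain P where P: "Lipschitz_path Y 1 P" "\<And>z. z \<le> 0 \<Longrightarrow> P z = u" "\<And>z. z \<ge> D \<Longrightarrow> P z = u'"
    using length_space_path[OF Y u D(1)] by blast
  define \<alpha> where "\<alpha> t = s + t * (s' - s)" for t
  define \<phi> where "\<phi> t = r * (F (\<alpha> t) - F s)" for t
  define b where "b x = r * (1 / f (\<alpha> x) * (s' - s))" for x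
  define \<gamma> where "\<gamma> t = (\<alpha> t, P (\<phi> t))" for t
  have \<alpha>_mono: "\<alpha> x \<le> \<alpha> y" if "x \<le> y" for x y using that ss by (auto simp: \<alpha>_def intro!: mult_right_mono)
  have d\<alpha>: "(\<alpha> has_real_derivative (s' - s)) (at x)" for x
    unfolding \<alpha>_def[abs_def] by (auto intro!: derivative_eq_intros)
  have d\<phi>: "(\<phi> has_real_derivative b x) (at x)" for x
  proof -
    have "((\<lambda>t. F (\<alpha> t)) has_real_derivative 1 / f (\<alpha> x) * (s' - s)) (at x)"
      by (rule DERIV_chain2[OF F_deriv d\<alpha>])
    from DERIV_cmult[OF DERIV_diff[OF this DERIV_const[of "F s"]], of r]
    show ?thesis unfolding \<phi>_def[abs_def] b_def by simp
  qed
  have smono: "strict_mono_on {0..1} \<alpha>" using ss by (auto intro!: strict_mono_onI simp: \<alpha>_def)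
  have ac\<alpha>: "ac_intervals (\<lambda>x y. \<alpha> y - \<alpha> x)"
    by (rule ac_intervals_linear[OF ac_intervals_id ac_intervals_id, of "s' - s" 0]) (use ss in \<open>auto simp: \<alpha>_def algebra_simps\<close>)
  have mono\<phi>: "mono_on {0..1} \<phi>"
    using \<alpha>_mono r unfolding \<phi>_def by (intro mono_onI mult_left_mono diff_right_mono) auto
  have ac\<phi>: "ac_intervals (\<lambda>x y. \<phi> y - \<phi> x)"
  proof (rule ac_intervals_linear[OF ac\<alpha> ac\<alpha>, of "r * (1 / m)" 0])
    fix x y :: real assume "x \<le> y"
    then have "r * (F (\<alpha> y) - F (\<alpha> x)) \<le> r * ((\<alpha> y - \<alpha> x) / m)"
      using F_bounds(2)[OF \<alpha>_mono] r by (intro mult_left_mono) auto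
    moreover have "\<phi> y - \<phi> x = r * (F (\<alpha> y) - F (\<alpha> x))" by (simp add: \<phi>_def algebra_simps)
    ultimately show "\<phi> y - \<phi> x \<le> r * (1 / m) * (\<alpha> y - \<alpha> x) + 0 * (\<alpha> y - \<alpha> x)" by simp
  qed (use m r in auto)
  have fb: "f (\<alpha> x) * b x = r * (s' - s)" for x using f_pos[of "\<alpha> x"] by (simp add: b_def)
  have "r * (s' - s) \<le> 1 * (s' - s)" using r ss by (intro mult_right_mono) auto
  then have pt: "(\<alpha> has_real_derivative (s' - s)) (at x) \<and> (\<phi> has_real_derivative b x) (at x) \<and> f (\<alpha> x) * b x \<le> s' - s" for x
    using d\<alpha> d\<phi> fb by simp
  have ends: "\<gamma> 0 = (s, u)" "\<gamma> 1 = (s', u')"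
    using P(2)[of 0] P(3)[of D] r(3) by (auto simp: \<gamma>_def \<alpha>_def \<phi>_def H_def[symmetric])
  note C = cone_curve[OF P(1) smono ac\<alpha> mono\<phi> ac\<phi> negligible_empty pt]
  have caus: "cone_future_causal UNIV f Y (s, u) (s', u') \<gamma>" using C(1) ends by (simp add: \<gamma>_def[abs_def])
  obtain S' where S': "negligible S'" "\<And>x. x \<in> {0<..<1} - S' \<Longrightarrow> cone_energy f Y \<gamma> x \<le> (r * (s' - s))\<^sup>2 - (s' - s)\<^sup>2"
    using C(2) unfolding fb \<gamma>_def[abs_def, symmetric] by blast
  have eq: "(s' - s)\<^sup>2 - (r * (s' - s))\<^sup>2 = ((s' - s) / H)\<^sup>2 * (H\<^sup>2 - D\<^sup>2)"
  proof -
    define z where "z = (s' - s) / H"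
    have "s' - s = z * H" using H by (simp add: z_def)
    then show ?thesis unfolding r(3) z_def[symmetric] by (simp add: power2_eq_square algebra_simps)
  qed
  have pos: "0 < H\<^sup>2 - D\<^sup>2" using H D0 by (simp add: power_strict_mono)
  have "0 < (s' - s) / H" using ss H by simp
  then have neg: "0 < (s' - s)\<^sup>2 - (r * (s' - s))\<^sup>2" unfolding eq using pos by (intro mult_pos_pos) auto
  have "cone_future_timelike UNIV f Y (s, u) (s', u') \<gamma>"
    using caus unfolding cone_future_causal_def cone_future_timelike_def
  proof (elim conjE, intro conjI)
    show "AE t in lebesgue_on {0..1}. cone_energy f Y \<gamma> t < 0"
      by (rule AE_unit_negligible[OF S'(1)]) (use S'(2) neg in force)
  qed
  then show "chron X (s, u) (s', u')" unfolding generalized_cone_def by auto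
  have "m * sqrt (H\<^sup>2 - D\<^sup>2) \<le> (s' - s) / H * sqrt (H\<^sup>2 - D\<^sup>2)"
  proof (rule mult_right_mono)
    have "m * H \<le> s' - s" using F_bounds(2)[of s s'] ss m by (simp add: H_def field_simps)
    then show "m \<le> (s' - s) / H" using H by (simp add: field_simps)
  qed (use pos in simp)
  also have "\<dots> = sqrt ((s' - s)\<^sup>2 - (r * (s' - s))\<^sup>2)"
    unfolding eq using ss H by (simp add: real_sqrt_mult)
  finally have "ennreal (m * sqrt (H\<^sup>2 - D\<^sup>2)) \<le> ennreal (sqrt ((s' - s)\<^sup>2 - (r * (s' - s))\<^sup>2))" by (rule ennreal_leI)
  also have "\<dots> \<le> cone_length f Y \<gamma>"
    unfolding cone_length_def
  proof (rule nn_integral_unit_ge[OF _ S'(1)])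
    show "((\<lambda>x::real. sqrt ((s' - s)\<^sup>2 - (r * (s' - s))\<^sup>2)) has_integral sqrt ((s' - s)\<^sup>2 - (r * (s' - s))\<^sup>2)) {0..1}"
      using has_integral_const_real[where c = "sqrt ((s' - s)\<^sup>2 - (r * (s' - s))\<^sup>2)" and a = 0 and b = 1]
      by (simp only: content_real zero_le_one diff_zero scaleR_one)
    fix x assume x: "x \<in> {0<..<1} - S'"
    show "sqrt ((s' - s)\<^sup>2 - (r * (s' - s))\<^sup>2) \<le> sqrt (- cone_energy f Y \<gamma> x) \<and> 0 \<le> sqrt ((s' - s)\<^sup>2 - (r * (s' - s))\<^sup>2)"
    proof
      show "sqrt ((s' - s)\<^sup>2 - (r * (s' - s))\<^sup>2) \<le> sqrt (- cone_energy f Y \<gamma> x)"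
        using S'(2)[OF x] by (intro real_sqrt_le_mono) linarith
      show "0 \<le> sqrt ((s' - s)\<^sup>2 - (r * (s' - s))\<^sup>2)" using neg by (intro real_sqrt_ge_zero) linarith
    qed
  qed
  also have "\<dots> \<le> tsep X (s, u) (s', u')" by (rule tsep_ge_cone_length[OF caus])
  finally show "ennreal (m * sqrt ((F s' - F s)\<^sup>2 - D\<^sup>2)) \<le> tsep X (s, u) (s', u')" by (simp add: H_def)
qed

lemma chron_lower:
  assumes u: "u \<in> mspace Y" "u' \<in> mspace Y" and d: "mdist Y u u' < F s' - F s"
  shows "chron X (s, u) (s', u')" "ennreal (m * sqrt ((F s' - F s)\<^sup>2 - (mdist Y u u')\<^sup>2)) \<le> tsep X (s, u) (s', u')"
proof -
  obtain D where "mdist Y u u' < D" "D < F s' - F s" using d dense by blast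
  then show "chron X (s, u) (s', u')" by (rule chron_lower_aux[OF u])
  show "ennreal (m * sqrt ((F s' - F s)\<^sup>2 - (mdist Y u u')\<^sup>2)) \<le> tsep X (s, u) (s', u')"
  proof (rule tendsto_upperbound)
    show "((\<lambda>D. ennreal (m * sqrt ((F s' - F s)\<^sup>2 - D\<^sup>2))) \<longlongrightarrow> ennreal (m * sqrt ((F s' - F s)\<^sup>2 - (mdist Y u u')\<^sup>2))) (at_right (mdist Y u u'))"
      by (intro tendsto_intros)
    show "eventually (\<lambda>D. ennreal (m * sqrt ((F s' - F s)\<^sup>2 - D\<^sup>2)) \<le> tsep X (s, u) (s', u')) (at_right (mdist Y u u'))"
      unfolding eventually_at_right[OF d] using d chron_lower_aux(2)[OF u] by blast
  qed simp
qed

lemma caus_upper: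
  assumes "caus X (s, u) (s', u')"
  shows "s \<le> s'" "u \<in> mspace Y" "u' \<in> mspace Y" "mdist Y u u' \<le> F s' - F s"
proof -
  from assms consider "s = s'" "u = u'" "u \<in> mspace Y" | \<gamma> where "cone_future_causal UNIV f Y (s, u) (s', u') \<gamma>"
    unfolding generalized_cone_def by auto
  then have "s \<le> s' \<and> u \<in> mspace Y \<and> u' \<in> mspace Y \<and> mdist Y u u' \<le> F s' - F s"
  proof cases
    case 1
    then have "mdist Y u u' = 0" using mdist_zero[of u Y u'] by blast
    with 1 show ?thesis by (simp del: mdist_zero)
  next
    case 2 then show ?thesis using causal_curve_bounds[OF 2] by auto
  qed
  then show "s \<le> s'" "u \<in> mspace Y" "u' \<in> mspace Y" "mdist Y u u' \<le> F s' - F s" by auto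
qed

lemma tsep_upper:
  "tsep X (s, u) (s', u') \<le> ennreal (M * sqrt ((F s' - F s)\<^sup>2 - (mdist Y u u')\<^sup>2))"
  unfolding generalized_cone_def using causal_curve_bounds(5) by (auto intro!: SUP_least)

lemma tsep_self: "tsep X p p = 0"
proof -
  have "\<not> cone_future_causal UNIV f Y p p \<gamma>" for \<gamma>
    using causal_curve_bounds(1)[of "fst p" "snd p" "fst p" "snd p"] by auto
  then have "{\<gamma>. cone_future_causal UNIV f Y p p \<gamma>} = {}" by blast
  then show ?thesis unfolding generalized_cone_def by (simp only: lorentz_space.select_convs) (simp add: bot_ennreal)
qed
end

lemma ac_curve_near:
  assumes ac: "absolutely_continuous_curve Y \<beta>" and t: "t \<in> {0..1}" and e: "e > 0"
  shows "\<exists>\<delta>>0. \<forall>s\<in>{0..1}. \<bar>s - t\<bar> < \<delta> \<longrightarrow> mdist Y (\<beta> s) (\<beta> t) < e"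
proof -
  obtain \<delta> where d: "\<delta> > 0" and D: "\<And>(n::nat) s t.
        (\<forall>i<n. 0 \<le> s i \<and> s i \<le> t i \<and> t i \<le> 1) \<and>
        disjoint_family_on (\<lambda>i. {s i<..<t i}) {..<n} \<and> (\<Sum>i<n. t i - s i) < \<delta> \<Longrightarrow>
        (\<Sum>i<n. mdist Y (\<beta> (s i)) (\<beta> (t i))) < e"
    using ac e unfolding absolutely_continuous_curve_def by meson
  show ?thesis
  proof (intro exI[of _ \<delta>] conjI ballI impI d)
    fix s :: real assume s: "s \<in> {0..1}" "\<bar>s - t\<bar> < \<delta>"
    have "(\<Sum>i<(1::nat). mdist Y (\<beta> (min s t)) (\<beta> (max s t))) < e"
      by (rule D[of 1 "\<lambda>_. min s t" "\<lambda>_. max s t"]) (use s t in \<open>auto simp: disjoint_family_on_def min_def max_def abs_if split: if_splits\<close>)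
    then show "mdist Y (\<beta> s) (\<beta> t) < e" by (simp add: min_def max_def mdist_commute split: if_splits)
  qed
qed

context bounded_cone
begin

text \<open>The fibre part of an almost optimal curve is traversed with a speed closer to the speed of light; the arclength
  gained in this way pays for moving the endpoints.\<close>

lemma tsep_perturb:
  assumes mem: "u' \<in> mspace Y" "w' \<in> mspace Y"
    and A: "0 < A" "ennreal A < tsep X (s, u) (c, w)" and lm: "0 \<le> lm" "lm \<le> 1"
    and small: "(mdist Y u' u + mdist Y w w') * (2 * M\<^sup>2 * (F c - F s)) < lm * A\<^sup>2"
  shows "caus X (s, u') (c, w')" and "ennreal ((1 - lm) * A) \<le> tsep X (s, u') (c, w')"
proof -
  define H where "H = F c - F s"
  obtain \<gamma> where \<gamma>: "cone_future_causal UNIV f Y (s, u) (c, w) \<gamma>" "ennreal A < cone_length f Y \<gamma>"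
    using A(2) unfolding generalized_cone_def by (auto simp: less_SUP_iff)
  have mem': "u \<in> mspace Y" "w \<in> mspace Y" and sc: "s < c" using causal_curve_bounds[OF \<gamma>(1)] by auto
  have H: "0 < H" using sc by (simp add: H_def)
  have ends: "\<gamma> 0 = (s, u)" "\<gamma> 1 = (c, w)" using \<gamma>(1) by (auto simp: cone_future_causal_def)
  define \<alpha> where "\<alpha> t = fst (\<gamma> t)" for t
  define \<beta> where "\<beta> t = snd (\<gamma> t)" for t
  have \<alpha>01: "\<alpha> 0 = s" "\<alpha> 1 = c" and \<beta>01: "\<beta> 0 = u" "\<beta> 1 = w" using ends by (auto simp: \<alpha>_def \<beta>_def)
  from causal_curve_data[OF \<gamma>(1)] obtain a h lv v S where D: "lv 0 = 0"
    "\<And>s t. 0 \<le> s \<Longrightarrow> s \<le> t \<Longrightarrow> t \<le> 1 \<Longrightarrow> mdist Y (\<beta> s) (\<beta> t) \<le> lv t - lv s"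
    "ac_intervals (\<lambda>s t. lv t - lv s)" "ac_intervals (\<lambda>s t. \<alpha> t - \<alpha> s)"
    "ac_intervals (\<lambda>s t. F (\<alpha> t) - F (\<alpha> s))"
    "(h has_integral H) {0..1}" "(v has_integral lv 1) {0..1}" "negligible S"
    and pt: "\<And>x. x \<in> {0<..<1} - S \<Longrightarrow> (\<alpha> has_real_derivative a x) (at x) \<and> (lv has_real_derivative v x) (at x) \<and>
       a x = f (\<alpha> x) * h x \<and> 0 \<le> v x \<and> v x \<le> h x \<and>
       cone_energy f Y \<gamma> x = (f (\<alpha> x))\<^sup>2 * ((v x)\<^sup>2 - (h x)\<^sup>2)"
    unfolding \<alpha>_def[symmetric] \<beta>_def[symmetric] \<alpha>01 H_def by blast
  have lv_mono: "lv x \<le> lv y" if "0 \<le> x" "x \<le> y" "y \<le> 1" for x y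
    using D(2)[OF that] mdist_nonneg[of Y "\<beta> x" "\<beta> y"] by linarith
  have l0: "0 \<le> lv 1" using lv_mono[of 0 1] D(1) by simp
  have lH: "lv 1 \<le> H" using has_integral_le_off_negligible[OF D(7) D(6) D(8)] pt by simp
  have "cone_length f Y \<gamma> \<le> ennreal (M * sqrt (H\<^sup>2 - (lv 1)\<^sup>2))"
    by (rule cone_length_le[OF l0 lH D(6,7,8)]) (use pt in \<open>simp add: \<alpha>_def\<close>)
  with \<gamma>(2) have "ennreal A < ennreal (M * sqrt (H\<^sup>2 - (lv 1)\<^sup>2))" by (rule less_le_trans)
  then have A_lt: "A < M * sqrt (H\<^sup>2 - (lv 1)\<^sup>2)" using A(1) by (simp add: ennreal_less_iff)
  have Hl: "0 \<le> H\<^sup>2 - (lv 1)\<^sup>2" using l0 lH by (simp add: power_mono)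
  \<comment> \<open>The square of the length is at most 2 M^2 H (H - lv 1). The margin H - lv 1 of
    the fibre length below the light cone is thus at least A^2 / (2 M^2 H), and the fraction lm of
    it exceeds both displacements together.\<close>
  have "A\<^sup>2 \<le> (M * sqrt (H\<^sup>2 - (lv 1)\<^sup>2))\<^sup>2" using A_lt A(1) by (intro power_mono) auto
  also have "\<dots> = M\<^sup>2 * ((H + lv 1) * (H - lv 1))" using Hl by (simp add: power_mult_distrib power2_eq_square algebra_simps)
  also have "\<dots> \<le> M\<^sup>2 * ((2 * H) * (H - lv 1))" using lH by (intro mult_left_mono mult_right_mono) auto
  finally have "lm * A\<^sup>2 \<le> lm * (M\<^sup>2 * ((2 * H) * (H - lv 1)))" using lm(1) by (rule mult_left_mono)
  with small have "(mdist Y u' u + mdist Y w w') * (2 * M\<^sup>2 * H) < (lm * (H - lv 1)) * (2 * M\<^sup>2 * H)"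
    by (simp add: H_def algebra_simps)
  moreover have "0 < 2 * M\<^sup>2 * H" using M_pos H by simp
  ultimately have dd: "mdist Y u' u + mdist Y w w' < lm * (H - lv 1)" by (meson mult_less_cancel_right_disj not_less_iff_gr_or_eq)
  \<comment> \<open>The surplus is split equally, so that L1 + L2 is exactly lm * (H - lv
    1).\<close>
  define \<eta> where "\<eta> = (lm * (H - lv 1) - (mdist Y u' u + mdist Y w w')) / 2"
  define L1 where "L1 = mdist Y u' u + \<eta>"
  define L2 where "L2 = mdist Y w w' + \<eta>"
  have \<eta>: "\<eta> > 0" using dd by (simp add: \<eta>_def)
  have L12: "mdist Y u' u < L1" "mdist Y w w' < L2" "L1 + L2 = lm * (H - lv 1)" "0 < L1"
  proof -
    show "mdist Y u' u < L1" "mdist Y w w' < L2" "0 < L1"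
      using \<eta> mdist_nonneg[of Y u' u] unfolding L1_def L2_def by linarith+
    have "L1 + L2 = mdist Y u' u + mdist Y w w' + 2 * \<eta>" by (simp add: L1_def L2_def)
    also have "2 * \<eta> = lm * (H - lv 1) - (mdist Y u' u + mdist Y w w')" by (simp only: \<eta>_def times_divide_eq_right nonzero_mult_div_cancel_left zero_neq_numeral not_False_eq_True)
    finally show "L1 + L2 = lm * (H - lv 1)" by simp
  qed
  obtain P1 where P1: "Lipschitz_path Y 1 P1" "\<And>r. r \<le> 0 \<Longrightarrow> P1 r = u'" "\<And>r. r \<ge> L1 \<Longrightarrow> P1 r = u"
    using length_space_path[OF Y mem(1) mem'(1) L12(1)] by blast
  obtain P2 where P2: "Lipschitz_path Y 1 P2" "\<And>r. r \<le> 0 \<Longrightarrow> P2 r = w" "\<And>r. r \<ge> L2 \<Longrightarrow> P2 r = w'"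
    using length_space_path[OF Y mem'(2) mem(2) L12(2)] by blast
  have ac: "absolutely_continuous_curve (cone_metric UNIV Y) \<gamma>" using \<gamma>(1) by (simp add: cone_future_causal_def)
  have \<beta>m: "\<beta> t \<in> mspace Y" if "t \<in> {0..1}" for t
    using ac that unfolding absolutely_continuous_curve_def \<beta>_def by (auto simp: Pi_iff mem_Times_iff)
  have cd: "mdist (cone_metric UNIV Y) (\<gamma> s) (\<gamma> t) = \<bar>\<alpha> s - \<alpha> t\<bar> + mdist Y (\<beta> s) (\<beta> t)" for s t
    unfolding \<alpha>_def \<beta>_def by (metis mdist_cone_metric prod.collapse)
  have acY: "absolutely_continuous_curve Y \<beta>"
    by (rule ac_curve_comparison[OF ac]) (use \<beta>m cd in auto)
  obtain B where B: "Lipschitz_path Y 1 B" "\<And>r. r \<le> 0 \<Longrightarrow> B r = u" "\<And>r. r \<ge> lv 1 \<Longrightarrow> B r = w"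
    using arclength_path[OF \<beta>m ac_curve_near[OF acY] D(2) lv_mono D(1)] \<beta>01 by auto
  define Q where "Q r = (if r \<le> L1 then P1 r else B (r - L1))" for r
  have Q: "Lipschitz_path Y 1 Q" unfolding Q_def[abs_def]
    by (rule Lipschitz_path_append[OF P1(1,3) B(1,2)])
  have Q0: "Q r = u'" if "r \<le> 0" for r using that L12 P1(2) by (simp add: Q_def)
  have Q1: "Q r = w" if "r \<ge> L1 + lv 1" for r
    using that B(3)[of "r - L1"] l0 P1(3)[of r] B(2)[of 0] B(3)[of 0] by (auto simp: Q_def)
  define P where "P r = (if r \<le> L1 + lv 1 then Q r else P2 (r - (L1 + lv 1)))" for r
  have P: "Lipschitz_path Y 1 P" unfolding P_def[abs_def]
    by (rule Lipschitz_path_append[OF Q Q1 P2(1,2)])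
  have P0: "P 0 = u'" using Q0[of 0] L12 l0 by (simp add: P_def)
  have P1': "P r = w'" if "r \<ge> L1 + lv 1 + L2" for r
  proof -
    have "0 < L2" using L12(2) mdist_nonneg[of Y w w'] by linarith
    then have "\<not> r \<le> L1 + lv 1" using that by linarith
    then show ?thesis using that P2(3)[of "r - (L1 + lv 1)"] by (simp add: P_def)
  qed
  \<comment> \<open>An interpolation between the old arclength and conformal time: the speed moves
    towards that of light by the fraction lm. The total increase of \<phi> is L1 + lv 1 + L2, which
    is where P reaches w'.\<close>
  define \<phi> where "\<phi> t = (1 - lm) * lv t + lm * (F (\<alpha> t) - F s)" for t
  define b where "b x = (1 - lm) * v x + lm * h x" for x
  define \<gamma>' where "\<gamma>' t = (\<alpha> t, P (\<phi> t))" for t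
  have smono: "strict_mono_on {0..1} \<alpha>" using \<gamma>(1) by (simp add: cone_future_causal_def \<alpha>_def[abs_def])
  have F\<alpha>_mono: "F (\<alpha> x) \<le> F (\<alpha> y)" if "0 \<le> x" "x \<le> y" "y \<le> 1" for x y
    using strict_mono_on_leD[OF smono] that by auto
  have mono\<phi>: "mono_on {0..1} \<phi>"
    unfolding \<phi>_def using lm lv_mono F\<alpha>_mono by (intro mono_onI add_mono mult_left_mono diff_right_mono) auto
  have ac\<phi>: "ac_intervals (\<lambda>x y. \<phi> y - \<phi> x)"
    by (rule ac_intervals_linear[OF D(3) D(5), of "1 - lm" lm]) (use lm in \<open>auto simp: \<phi>_def algebra_simps\<close>)
  have dpt: "(\<alpha> has_real_derivative a x) (at x) \<and> (\<phi> has_real_derivative b x) (at x) \<and> f (\<alpha> x) * b x \<le> a x"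
    if x: "x \<in> {0<..<1} - S" for x
  proof (intro conjI)
    show da: "(\<alpha> has_real_derivative a x) (at x)" using pt[OF x] by blast
    have "((\<lambda>t. F (\<alpha> t)) has_real_derivative 1 / f (\<alpha> x) * a x) (at x)" by (rule DERIV_chain2[OF F_deriv da])
    also have "1 / f (\<alpha> x) * a x = h x" using pt[OF x] f_pos[of "\<alpha> x"] by simp
    finally have dF: "((\<lambda>t. F (\<alpha> t)) has_real_derivative h x) (at x)" .
    have dl: "(lv has_real_derivative v x) (at x)" using pt[OF x] by blast
    show "(\<phi> has_real_derivative b x) (at x)"
      using DERIV_add[OF DERIV_cmult[OF dl, of "1 - lm"] DERIV_cmult[OF DERIV_diff[OF dF DERIV_const[of "F s"]], of lm]]
      by (simp add: \<phi>_def[abs_def] b_def)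
    have "b x \<le> (1 - lm) * h x + lm * h x" unfolding b_def using pt[OF x] lm by (intro add_mono mult_left_mono) auto
    then have "b x \<le> h x" by (simp add: algebra_simps)
    then have "f (\<alpha> x) * b x \<le> f (\<alpha> x) * h x" using f_pos[of "\<alpha> x"] by (intro mult_left_mono) auto
    then show "f (\<alpha> x) * b x \<le> a x" using pt[OF x] by simp
  qed
  note C = cone_curve[OF P smono D(4) mono\<phi> ac\<phi> D(8) dpt]
  have ends': "\<gamma>' 0 = (s, u')" "\<gamma>' 1 = (c, w')"
  proof -
    show "\<gamma>' 0 = (s, u')" using P0 D(1) \<alpha>01 by (simp add: \<gamma>'_def \<phi>_def)
    have "\<phi> 1 = lv 1 + lm * (H - lv 1)" using \<alpha>01 by (simp add: \<phi>_def H_def algebra_simps)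
    then have "P (\<phi> 1) = w'" using L12(3) by (intro P1') simp
    then show "\<gamma>' 1 = (c, w')" using \<alpha>01 by (simp add: \<gamma>'_def)
  qed
  have caus: "cone_future_causal UNIV f Y (s, u') (c, w') \<gamma>'" using C(1) ends' by (simp add: \<gamma>'_def[abs_def])
  then show "caus X (s, u') (c, w')" unfolding generalized_cone_def by auto
  obtain S' where S': "negligible S'" "S \<subseteq> S'"
    "\<And>x. x \<in> {0<..<1} - S' \<Longrightarrow> cone_energy f Y \<gamma>' x \<le> (f (\<alpha> x) * b x)\<^sup>2 - (a x)\<^sup>2"
    using C(2) unfolding \<gamma>'_def[abs_def, symmetric] by blast
  have len: "(1 - lm) * sqrt (- cone_energy f Y \<gamma> x) \<le> sqrt (- cone_energy f Y \<gamma>' x)" if x: "x \<in> {0<..<1} - S'" for x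
  proof -
    have x': "x \<in> {0<..<1} - S" using x S' by auto
    note p = pt[OF x']
    \<comment> \<open>Replacing v by b shrinks h - v exactly by the factor 1 - lm and does not
      decrease h + v, so the integrand of the length loses at most the factor 1 - lm.\<close>
    have b: "h x - b x = (1 - lm) * (h x - v x)" "v x \<le> b x"
    proof -
      show "h x - b x = (1 - lm) * (h x - v x)" by (simp add: b_def algebra_simps)
      have "0 \<le> lm * (h x - v x)" using p lm by simp
      then show "v x \<le> b x" by (simp add: b_def algebra_simps)
    qed
    have "(1 - lm)\<^sup>2 * ((h x)\<^sup>2 - (v x)\<^sup>2) \<le> (h x)\<^sup>2 - (b x)\<^sup>2"
    proof -
      have "(1 - lm)\<^sup>2 * ((h x)\<^sup>2 - (v x)\<^sup>2) = (1 - lm) * ((1 - lm) * (h x - v x) * (h x + v x))"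
        by (simp add: power2_eq_square algebra_simps)
      also have "\<dots> \<le> 1 * ((1 - lm) * (h x - v x) * (h x + v x))"
        using p lm by (intro mult_right_mono mult_nonneg_nonneg) auto
      also have "\<dots> \<le> (1 - lm) * (h x - v x) * (h x + b x)"
        using p lm b(2) by (simp only: mult_1, intro mult_left_mono mult_nonneg_nonneg) auto
      also have "\<dots> = (h x)\<^sup>2 - (b x)\<^sup>2" unfolding b(1)[symmetric] by (simp add: power2_eq_square algebra_simps)
      finally show ?thesis .
    qed
    then have "(f (\<alpha> x))\<^sup>2 * ((1 - lm)\<^sup>2 * ((h x)\<^sup>2 - (v x)\<^sup>2)) \<le> (f (\<alpha> x))\<^sup>2 * ((h x)\<^sup>2 - (b x)\<^sup>2)"
      by (rule mult_left_mono) simp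
    also have "\<dots> \<le> - cone_energy f Y \<gamma>' x" using S'(3)[OF x] p by (simp add: power_mult_distrib algebra_simps)
    finally have fin: "(f (\<alpha> x))\<^sup>2 * ((1 - lm)\<^sup>2 * ((h x)\<^sup>2 - (v x)\<^sup>2)) \<le> - cone_energy f Y \<gamma>' x" .
    have "(1 - lm)\<^sup>2 * (- cone_energy f Y \<gamma> x) \<le> - cone_energy f Y \<gamma>' x"
    proof -
      have "- cone_energy f Y \<gamma> x = (f (\<alpha> x))\<^sup>2 * ((h x)\<^sup>2 - (v x)\<^sup>2)" using p by (simp add: right_diff_distrib)
      then have "(1 - lm)\<^sup>2 * (- cone_energy f Y \<gamma> x) = (f (\<alpha> x))\<^sup>2 * ((1 - lm)\<^sup>2 * ((h x)\<^sup>2 - (v x)\<^sup>2))"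
        by (metis mult.left_commute)
      then show ?thesis using fin by linarith
    qed
    then have "sqrt ((1 - lm)\<^sup>2 * (- cone_energy f Y \<gamma> x)) \<le> sqrt (- cone_energy f Y \<gamma>' x)" by (rule real_sqrt_le_mono)
    moreover have "sqrt ((1 - lm)\<^sup>2 * (- cone_energy f Y \<gamma> x)) = (1 - lm) * sqrt (- cone_energy f Y \<gamma> x)"
      unfolding real_sqrt_mult using lm by simp
    ultimately show ?thesis by linarith
  qed
  have "ennreal ((1 - lm) * A) = ennreal (1 - lm) * ennreal A" using lm A by (simp add: ennreal_mult)
  also have "\<dots> \<le> ennreal (1 - lm) * cone_length f Y \<gamma>" using \<gamma>(2) by (intro mult_left_mono) auto
  also have "\<dots> \<le> (\<integral>\<^sup>+t. ennreal (1 - lm) * ennreal (sqrt (- cone_energy f Y \<gamma> t)) \<partial>lebesgue_on {0..1})"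
    unfolding cone_length_def by (rule nn_integral_cmult_le)
  also have "\<dots> \<le> cone_length f Y \<gamma>'"
    unfolding cone_length_def
  proof (rule nn_integral_mono_AE, rule AE_unit_negligible[OF S'(1)])
    fix x assume "x \<in> {0<..<1} - S'"
    from len[OF this] show "ennreal (1 - lm) * ennreal (sqrt (- cone_energy f Y \<gamma> x)) \<le> ennreal (sqrt (- cone_energy f Y \<gamma>' x))"
      using lm by (simp add: ennreal_mult'[symmetric] ennreal_leI)
  qed
  also have "\<dots> \<le> tsep X (s, u') (c, w')" by (rule tsep_ge_cone_length[OF caus])
  finally show "ennreal ((1 - lm) * A) \<le> tsep X (s, u') (c, w')" .
qed
end

section \<open>Entropy and transport to a Dirac measure\<close>

lemma borel_of_sets: "openin T U \<Longrightarrow> U \<in> sets (borel_of T)"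
  unfolding borel_of_def by (auto dest: openin_subset)

lemma space_borel_of [simp]: "space (borel_of T) = topspace T"
  unfolding borel_of_def by (rule space_measure_of) (auto dest: openin_subset)

lemma closedin_borel_of: "closedin T C \<Longrightarrow> C \<in> sets (borel_of T)"
proof -
  assume C: "closedin T C"
  then have "topspace T - C \<in> sets (borel_of T)" by (intro borel_of_sets) (auto simp: closedin_def)
  then have "space (borel_of T) - (topspace T - C) \<in> sets (borel_of T)" by (rule sets.compl_sets)
  moreover have "space (borel_of T) - (topspace T - C) = C" using closedin_subset[OF C] by auto
  ultimately show ?thesis by simp
qed

lemma continuous_map_borel_of:
  assumes "continuous_map S T g"
  shows "g \<in> borel_of S \<rightarrow>\<^sub>M borel_of T"
proof -
  have "g \<in> borel_of S \<rightarrow>\<^sub>M sigma (topspace T) {U. openin T U}"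
  proof (rule measurable_measure_of)
    show "{U. openin T U} \<subseteq> Pow (topspace T)" by (auto dest: openin_subset)
    show "g \<in> space (borel_of S) \<rightarrow> topspace T" using continuous_map_image_subset_topspace[OF assms] by auto
    fix U assume "U \<in> {U. openin T U}"
    then have "openin S {x \<in> topspace S. g x \<in> U}" using assms by (auto intro: openin_continuous_map_preimage)
    moreover have "{x \<in> topspace S. g x \<in> U} = g -` U \<inter> space (borel_of S)" by auto
    ultimately show "g -` U \<inter> space (borel_of S) \<in> sets (borel_of S)" by (metis borel_of_sets)
  qed
  then show ?thesis by (simp add: borel_of_def)
qed

lemma entropy_power_uniform:
  assumes sf: "sigma_finite_measure \<mm>" and B: "B \<in> sets \<mm>" "0 < emeasure \<mm> B" "emeasure \<mm> B < \<infinity>" and N: "0 < N"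
  shows "\<bar>rel_entropy \<mm> (uniform_measure \<mm> B)\<bar> \<noteq> \<infinity>"
    and "entropy_power N \<mm> (uniform_measure \<mm> B) = ennreal (measure \<mm> B powr (1 / N))"
proof -
  interpret sigma_finite_measure \<mm> by fact
  define c where "c = measure \<mm> B"
  have ec: "emeasure \<mm> B = ennreal c" using B by (simp add: c_def emeasure_eq_ennreal_measure)
  have c: "0 < c" using B ec by (simp add: c_def)
  define \<mu> where "\<mu> = uniform_measure \<mm> B"
  define u where "u x = indicator B x / emeasure \<mm> B" for x
  have um: "u \<in> borel_measurable \<mm>" unfolding u_def using B by measurable
  have \<mu>: "density \<mm> u = \<mu>" by (simp add: \<mu>_def uniform_measure_def u_def[abs_def])
  have dens: "density \<mm> (RN_deriv \<mm> \<mu>) = \<mu>" by (rule RN_derivI[OF um \<mu>])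
  have ae: "AE x in \<mm>. u x = RN_deriv \<mm> \<mu> x" by (rule RN_deriv_unique[OF um \<mu>])
  define \<rho> where "\<rho> x = enn2real (RN_deriv \<mm> \<mu> x)" for x
  have u_eq: "u x = ennreal (indicator B x / c)" for x
    unfolding u_def ec using c by (auto simp: indicator_def ennreal_1[symmetric] divide_ennreal simp del: ennreal_1)
  have \<rho>_eq: "AE x in \<mm>. \<rho> x * ln (\<rho> x) = - ln c / c * indicator B x"
    using ae
  proof eventually_elim
    case (elim x)
    have "\<rho> x = indicator B x / c" unfolding \<rho>_def elim[symmetric] u_eq using c by simp
    then show ?case using c by (auto simp: indicator_def ln_div)
  qed
  \<comment> \<open>The values s = 1 and s = -1 give the positive and the negative part of the
    entropy at once.\<close>
  have int: "(\<integral>\<^sup>+x. ennreal (s * (\<rho> x * ln (\<rho> x))) \<partial>\<mm>) = ennreal (- (s * ln c))" for s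
  proof -
    have "(\<integral>\<^sup>+x. ennreal (s * (\<rho> x * ln (\<rho> x))) \<partial>\<mm>) = (\<integral>\<^sup>+x. ennreal (- (s * ln c) / c) * indicator B x \<partial>\<mm>)"
    proof (rule nn_integral_cong_AE)
      show "AE x in \<mm>. ennreal (s * (\<rho> x * ln (\<rho> x))) = ennreal (- (s * ln c) / c) * indicator B x"
        using \<rho>_eq by eventually_elim (auto simp: indicator_def)
    qed
    also have "\<dots> = ennreal (- (s * ln c) / c) * ennreal c" using B by (simp add: nn_integral_cmult_indicator ec)
    also have "\<dots> = ennreal (- (s * ln c))" using c by (simp add: ennreal_mult''[symmetric])
    finally show ?thesis .
  qed
  have ent: "rel_entropy \<mm> \<mu> = ereal (- ln c)"
  proof -
    have "rel_entropy \<mm> \<mu> = enn2ereal (ennreal (- ln c)) - enn2ereal (ennreal (ln c))"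
      using int[of 1] int[of "-1"] dens unfolding rel_entropy_def Let_def \<rho>_def by simp
    also have "\<dots> = ereal (- ln c)"
      by (cases "ln c \<ge> 0") (auto simp: ennreal_neg enn2ereal_ennreal zero_ennreal.rep_eq zero_ereal_def)
    finally show ?thesis .
  qed
  show "\<bar>rel_entropy \<mm> (uniform_measure \<mm> B)\<bar> \<noteq> \<infinity>" using ent by (simp add: \<mu>_def)
  have "exp (ln c / N) = c powr (1 / N)" using c by (simp add: powr_def)
  then show "entropy_power N \<mm> (uniform_measure \<mm> B) = ennreal (measure \<mm> B powr (1 / N))"
    unfolding entropy_power_def using ent by (simp add: \<mu>_def c_def)
qed

text \<open>Jensen's inequality, in the form of the tangent of \<open>x ln x\<close> at the average density \<open>1 / \<mm>(E)\<close>.\<close>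

lemma entropy_power_le:
  assumes E: "E \<in> sets \<mm>" "emeasure \<mm> E < \<infinity>" and \<mu>: "prob_space \<mu>" "sets \<mu> = sets \<mm>"
    and conc: "AE x in \<mu>. x \<in> E" and N: "0 < N"
  shows "entropy_power N \<mm> \<mu> \<le> ennreal (measure \<mm> E powr (1 / N))"
proof (cases "rel_entropy \<mm> \<mu> = \<infinity>")
  case True
  then show ?thesis by (simp add: entropy_power_def)
next
  case False
  interpret \<mu>: prob_space \<mu> by fact
  define R where "R = RN_deriv \<mm> \<mu>"
  define \<rho> where "\<rho> x = enn2real (R x)" for x
  define g where "g x = \<rho> x * ln (\<rho> x)" for x
  define pos where "pos = (\<integral>\<^sup>+x. ennreal (g x) \<partial>\<mm>)"
  define neg where "neg = (\<integral>\<^sup>+x. ennreal (- g x) \<partial>\<mm>)"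
  have dens: "density \<mm> R = \<mu>" and pos: "pos < \<infinity>" and ent: "rel_entropy \<mm> \<mu> = enn2ereal pos - enn2ereal neg"
    using False unfolding rel_entropy_def Let_def R_def \<rho>_def g_def pos_def neg_def by (auto split: if_splits)
  have Rm [measurable]: "R \<in> borel_measurable \<mm>" by (simp add: R_def)
  have gm [measurable]: "g \<in> borel_measurable \<mm>" unfolding g_def \<rho>_def by measurable
  have \<rho>m [measurable]: "\<rho> \<in> borel_measurable \<mm>" unfolding \<rho>_def by measurable
  have sp: "space \<mu> = space \<mm>" using \<mu>(2) by (rule sets_eq_imp_space_eq)
  have "(\<integral>\<^sup>+x. R x \<partial>\<mm>) = emeasure (density \<mm> R) (space \<mm>)"
    by (subst emeasure_density) (auto intro!: nn_integral_cong simp: indicator_def)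
  also have "\<dots> = 1" unfolding dens sp[symmetric] by (rule \<mu>.emeasure_space_1)
  finally have intR: "(\<integral>\<^sup>+x. R x \<partial>\<mm>) = 1" .
  then have finR: "AE x in \<mm>. R x \<noteq> \<infinity>" by (intro nn_integral_noteq_infinite) auto
  then have R\<rho>: "AE x in \<mm>. R x = ennreal (\<rho> x)" by eventually_elim (simp add: \<rho>_def less_top)
  have off: "AE x in \<mm>. x \<notin> E \<longrightarrow> R x = 0"
  proof -
    have "AE x in density \<mm> R. x \<in> E" by (subst dens) (rule conc)
    then have "AE x in \<mm>. 0 < R x \<longrightarrow> x \<in> E" by (simp add: AE_density)
    then show ?thesis by eventually_elim (auto simp: zero_less_iff_neq_zero)
  qed
  define c where "c = measure \<mm> E"
  have ec: "emeasure \<mm> E = ennreal c" using E by (simp add: c_def emeasure_eq_ennreal_measure)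
  have "c \<noteq> 0"
  proof
    assume "c = 0"
    then have "AE x in \<mm>. x \<notin> E" using E ec by (intro AE_not_in) (simp add: null_sets_def)
    with off have "AE x in \<mm>. R x = 0" by eventually_elim auto
    then have "(\<integral>\<^sup>+x. R x \<partial>\<mm>) = 0" by (simp add: nn_integral_0_iff_AE)
    with intR show False by simp
  qed
  then have c: "0 < c" by (simp add: c_def zero_less_measure_iff)
  have iE: "integrable \<mm> (indicat_real E)" "integral\<^sup>L \<mm> (indicat_real E) = c"
    using E by (auto simp: c_def)
  have int\<rho>: "(\<integral>\<^sup>+x. ennreal (\<rho> x) \<partial>\<mm>) = 1"
    using intR nn_integral_cong_AE[OF R\<rho>] by simp
  have \<rho>0: "0 \<le> \<rho> x" for x by (simp add: \<rho>_def)
  have i\<rho>: "integrable \<mm> \<rho>" by (rule integrableI_nonneg) (use \<rho>0 int\<rho> in auto)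
  have I\<rho>: "integral\<^sup>L \<mm> \<rho> = 1"
    using integral_eq_nn_integral[of \<rho> \<mm>] \<rho>0 int\<rho> by simp
  \<comment> \<open>Used twice: d = 1 shows that the negative part is integrable over E, and for d =
    c the right-hand side, with its constant supported on E, integrates to - ln c.\<close>
  have tangent: "x * ln x \<ge> - ln d * x + x - 1 / d" if "0 \<le> x" "0 < d" for x d :: real
  proof (cases "x = 0")
    case False
    then have x: "0 < x" using that by simp
    have "ln (1 / (d * x)) \<le> 1 / (d * x) - 1" using x that by (intro ln_le_minus_one) auto
    then have "x * ln (1 / (d * x)) \<le> x * (1 / (d * x) - 1)" using x by (intro mult_left_mono) auto
    also have "\<dots> = 1 / d - x" using x that by (simp add: field_simps)
    finally show ?thesis using x that by (simp add: ln_div ln_mult algebra_simps)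
  qed (use that in simp)
  have "neg \<le> (\<integral>\<^sup>+x. indicator E x \<partial>\<mm>)"
    unfolding neg_def
  proof (rule nn_integral_mono_AE)
    show "AE x in \<mm>. ennreal (- g x) \<le> indicator E x"
      using off
    proof eventually_elim
      case (elim x)
      show ?case
      proof (cases "x \<in> E")
        case True
        have "- g x \<le> 1" using tangent[of "\<rho> x" 1] \<rho>0[of x] by (simp add: g_def)
        then show ?thesis using True by (simp add: ennreal_le_1)
      next
        case False
        then show ?thesis using elim by (simp add: g_def \<rho>_def)
      qed
    qed
  qed
  also have "\<dots> < \<infinity>" using E by simp
  finally have neg: "neg < \<infinity>" .
  have ig: "integrable \<mm> g"
    unfolding real_integrable_def using pos neg gm by (auto simp: pos_def neg_def)
  have Ig: "integral\<^sup>L \<mm> g = enn2real pos - enn2real neg"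
    using real_lebesgue_integral_def[OF ig] by (simp add: pos_def neg_def)
  have "integral\<^sup>L \<mm> (\<lambda>x. - ln c * \<rho> x + \<rho> x - 1 / c * indicat_real E x) \<le> integral\<^sup>L \<mm> g"
  proof (rule integral_mono_AE)
    show "integrable \<mm> (\<lambda>x. - ln c * \<rho> x + \<rho> x - 1 / c * indicat_real E x)" using i\<rho> iE by auto
    show "AE x in \<mm>. - ln c * \<rho> x + \<rho> x - 1 / c * indicat_real E x \<le> g x"
      using off
    proof eventually_elim
      case (elim x)
      then show ?case using tangent[of "\<rho> x" c] \<rho>0[of x] c by (cases "x \<in> E") (auto simp: g_def \<rho>_def)
    qed
  qed (rule ig)
  moreover have "integral\<^sup>L \<mm> (\<lambda>x. - ln c * \<rho> x + \<rho> x - 1 / c * indicat_real E x) = - ln c"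
    using i\<rho> iE I\<rho> c by simp
  ultimately have ge: "- ln c \<le> enn2real pos - enn2real neg" using Ig by simp
  have "rel_entropy \<mm> \<mu> = ereal (enn2real pos - enn2real neg)"
    unfolding ent using pos neg by (cases pos; cases neg) (auto simp: enn2ereal_ennreal)
  then have "entropy_power N \<mm> \<mu> = ennreal (exp (- (enn2real pos - enn2real neg) / N))"
    by (simp add: entropy_power_def)
  also have "\<dots> \<le> ennreal (exp (ln c / N))"
    using ge N by (intro ennreal_leI) (auto intro!: divide_right_mono)
  also have "exp (ln c / N) = c powr (1 / N)" using c by (simp add: powr_def)
  finally show ?thesis by (simp add: c_def)
qed

text \<open>A bound irrespective of the sign of \<kappa>. For positive \<kappa>, concavity of sin on
  [0, pi] gives at least s. For negative \<kappa>, sinh (s x) >= s x and sinh x <= x cosh x give s /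
  cosh x.\<close>

lemma distortion_coeff_ge:
  assumes \<theta>: "0 \<le> \<theta>" "\<theta> \<le> D" and s: "0 < s" "s < 1"
  shows "ennreal (s / cosh (sqrt \<bar>\<kappa>\<bar> * D)) \<le> distortion_coeff \<kappa> s \<theta>"
proof -
  have cosh1: "1 \<le> cosh z" for z :: real by (rule cosh_real_ge_1)
  have le_s: "s / cosh (sqrt \<bar>\<kappa>\<bar> * D) \<le> s"   proof -
    have "s / cosh (sqrt \<bar>\<kappa>\<bar> * D) \<le> s / 1"
      using s cosh1[of "sqrt \<bar>\<kappa>\<bar> * D"] by (intro divide_left_mono) auto
    then show ?thesis by simp
  qed
  consider "\<kappa> * \<theta>\<^sup>2 \<ge> pi\<^sup>2" | "\<kappa> * \<theta>\<^sup>2 < pi\<^sup>2" "\<kappa> * \<theta>\<^sup>2 > 0" | "\<kappa> * \<theta>\<^sup>2 = 0" | "\<kappa> * \<theta>\<^sup>2 < 0" by linarith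
  then show ?thesis
  proof cases
    case 1 then show ?thesis by (simp add: distortion_coeff_def)
  next
    case 2
    then have k: "\<kappa> > 0" "\<theta> > 0" using \<theta> by (auto simp: zero_less_mult_iff)
    define x where "x = sqrt \<kappa> * \<theta>"
    have x0: "0 < x" using k by (simp add: x_def)
    have "x\<^sup>2 = \<kappa> * \<theta>\<^sup>2" using k by (simp add: x_def power_mult_distrib)
    then have "x < pi" using 2 by (metis pi_ge_zero power2_less_imp_less)
    have "concave_on {0..pi} (sin :: real \<Rightarrow> real)"
    proof (rule f''_le0_imp_concave)
      show "(sin has_real_derivative cos z) (at z)" for z :: real by (rule DERIV_sin)
      show "(cos has_real_derivative - sin z) (at z)" for z :: real by (rule DERIV_cos)
      show "- sin z \<le> 0" if "z \<in> {0..pi}" for z :: real using that sin_ge_zero[of z] by simp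
    qed simp
    from concave_onD[OF this, of s 0 x] have "s * sin x \<le> sin (s * x)" using s x0 \<open>x < pi\<close> by simp
    moreover have "0 < sin x" using x0 \<open>x < pi\<close> by (rule sin_gt_zero)
    ultimately have "s \<le> sin (s * x) / sin x" by (simp add: pos_le_divide_eq)
    then have "ennreal (s / cosh (sqrt \<bar>\<kappa>\<bar> * D)) \<le> ennreal (sin (s * x) / sin x)" using le_s by (intro ennreal_leI) linarith
    then show ?thesis using 2 by (simp add: distortion_coeff_def x_def mult.assoc)
  next
    case 3
    show ?thesis using le_s unfolding distortion_coeff_def 3 by (simp add: ennreal_leI)
  next
    case 4
    then have k: "\<kappa> < 0" "\<theta> > 0" using \<theta> by (auto simp: mult_less_0_iff)
    define x where "x = sqrt (- \<kappa>) * \<theta>"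
    have x0: "0 < x" using k by (simp add: x_def)
    have xD: "x \<le> sqrt \<bar>\<kappa>\<bar> * D" using k \<theta> by (simp add: x_def mult_left_mono)
    have sinh_ge: "z \<le> sinh z" if "0 \<le> z" for z :: real
    proof -
      have "sinh 0 - 0 \<le> sinh z - z"
      proof (rule DERIV_nonneg_imp_nondecreasing[OF that])
        fix y :: real
        show "\<exists>d. ((\<lambda>z. sinh z - z) has_real_derivative d) (at y) \<and> 0 \<le> d"
          using cosh1[of y] by (intro exI[of _ "cosh y - 1"]) (auto intro!: derivative_eq_intros)
      qed
      then show ?thesis by simp
    qed
    have "0 * cosh 0 - sinh 0 \<le> x * cosh x - sinh x"
    proof (rule DERIV_nonneg_imp_nondecreasing[of 0 x])
      fix y :: real assume "0 \<le> y"
      then show "\<exists>d. ((\<lambda>z. z * cosh z - sinh z) has_real_derivative d) (at y) \<and> 0 \<le> d"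
        by (intro exI[of _ "y * sinh y"]) (auto intro!: derivative_eq_intros simp: mult.commute)
    qed (use x0 in simp)
    then have "s * sinh x \<le> s * (x * cosh x)" using s by (intro mult_left_mono) auto
    also have "\<dots> = cosh x * (s * x)" by simp
    also have "\<dots> \<le> cosh x * sinh (s * x)" using s x0 cosh1[of x] by (intro mult_left_mono sinh_ge) auto
    finally have "s * sinh x \<le> cosh x * sinh (s * x)" .
    then have "s / cosh x \<le> sinh (s * x) / sinh x" using x0 cosh1[of x] by (simp add: field_simps)
    moreover have "s / cosh (sqrt \<bar>\<kappa>\<bar> * D) \<le> s / cosh x"
      using s xD x0 cosh1[of x] by (intro divide_left_mono) (auto simp: cosh_real_nonneg_le_iff)
    ultimately have "ennreal (s / cosh (sqrt \<bar>\<kappa>\<bar> * D)) \<le> ennreal (sinh (s * x) / sinh x)" by (intro ennreal_leI) linarith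
    then show ?thesis using 4 k by (simp add: distortion_coeff_def x_def mult.assoc)
  qed
qed

section \<open>Strict concavity of the power r powr p\<close>

lemma powr_less_tangent:
  fixes p r :: real
  assumes p: "0 < p" "p < 1" and r: "0 \<le> r" "r \<noteq> 1"
  shows "r powr p < 1 + p * (r - 1)"
proof (cases "r = 0")
  case False
  define u where "u = ln r"
  have ru: "r = exp u" and u: "u \<noteq> 0" using False r by (auto simp: u_def)
  have e: "1 + v < exp v" if "v \<noteq> 0" for v :: real
  proof (cases "0 \<le> 1 + v / 2")
    case True
    have "(1 + v / 2)\<^sup>2 \<le> (exp (v / 2))\<^sup>2" using True exp_ge_add_one_self[of "v / 2"] by (intro power_mono) auto
    also have "(exp (v / 2))\<^sup>2 = exp v" by (simp add: power2_eq_square exp_add[symmetric])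
    finally have "1 + v + v\<^sup>2 / 4 \<le> exp v" by (simp add: power2_eq_square algebra_simps)
    then show ?thesis using that by (smt (verit) zero_less_power2 divide_pos_pos)
  next
    case False
    then show ?thesis using exp_gt_zero[of v] by (smt (verit) field_sum_of_halves)
  qed
  \<comment> \<open>The inequality 1 + v < exp v is taken at - p u and at (1 - p) u with weights 1 -
    p and p. The linear parts cancel, and multiplication by exp (p u) gives the claim.\<close>
  have "(1 - p) * (1 + - (p * u)) < (1 - p) * exp (- (p * u))"
    using e[of "- (p * u)"] p u by (intro mult_strict_left_mono) auto
  moreover have "p * (1 + (1 - p) * u) < p * exp ((1 - p) * u)"
    using e[of "(1 - p) * u"] p u by (intro mult_strict_left_mono) auto
  moreover have "(1 - p) * (1 + - (p * u)) + p * (1 + (1 - p) * u) = 1" by (simp add: algebra_simps)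
  ultimately have "1 < (1 - p) * exp (- (p * u)) + p * exp ((1 - p) * u)" by linarith
  then have "exp (p * u) * 1 < exp (p * u) * ((1 - p) * exp (- (p * u)) + p * exp ((1 - p) * u))"
    by (intro mult_strict_left_mono) auto
  also have "\<dots> = (1 - p) * (exp (p * u) * exp (- (p * u))) + p * (exp (p * u) * exp ((1 - p) * u))" by (simp add: algebra_simps)
  also have "\<dots> = (1 - p) + p * exp u" by (simp add: exp_add[symmetric] algebra_simps)
  finally show ?thesis using ru False by (simp add: powr_def algebra_simps)
qed (use p in simp)

text \<open>Concavity of the power with weights t and 1 - t at the points a / t and b / (1 - t).
  Equality forces both to equal a + b; in particular b must be the fraction 1 - t of the
  sum.\<close>

lemma powr_split_le:
  fixes a b p t :: real
  assumes p: "0 < p" "p < 1" and t: "0 < t" "t < 1" and ab: "0 \<le> a" "0 \<le> b"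
  shows "t powr (1 - p) * a powr p + (1 - t) powr (1 - p) * b powr p \<le> (a + b) powr p"
    and "b \<noteq> (1 - t) * (a + b) \<Longrightarrow>
      t powr (1 - p) * a powr p + (1 - t) powr (1 - p) * b powr p < (a + b) powr p"
proof -
  have T: "r powr p \<le> 1 + p * (r - 1)" if "0 \<le> r" for r
    using powr_less_tangent[OF p that] by (cases "r = 1") auto
  define w where "w = a + b"
  have scale: "s powr (1 - p) * x powr p = s * w powr p * (x / (s * w)) powr p" if "0 < s" "0 \<le> x" "0 < w" for s x
  proof -
    have "s * w powr p * (x / (s * w)) powr p = s * (w powr p * (x powr p / (s powr p * w powr p)))"
      using that by (simp add: powr_divide powr_mult)
    also have "\<dots> = s / s powr p * x powr p" using that by simp
    also have "s / s powr p = s powr (1 - p)" using that by (simp add: powr_diff)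
    finally show ?thesis ..
  qed
  have main: "t powr (1 - p) * a powr p + (1 - t) powr (1 - p) * b powr p
     \<le> w powr p * (t * (1 + p * (a / (t * w) - 1)) + (1 - t) * ((b / ((1 - t) * w)) powr p))" if w: "0 < w"
  proof -
    have "t * w powr p * (a / (t * w)) powr p \<le> t * w powr p * (1 + p * (a / (t * w) - 1))"
      using t ab w by (intro mult_left_mono T) auto
    then show ?thesis using scale[of t a] scale[of "1 - t" b] t ab w by (simp add: algebra_simps)
  qed
  have sum1: "t * (1 + p * (a / (t * w) - 1)) + (1 - t) * (1 + p * (b / ((1 - t) * w) - 1)) = 1" if w: "0 < w"
  proof -
    have "t * (a / (t * w)) = a / w" "(1 - t) * (b / ((1 - t) * w)) = b / w" using t by auto
    moreover have "a / w + b / w = 1" using w by (simp add: w_def add_divide_distrib[symmetric])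
    moreover have "s * (1 + p * (z - 1)) = s + p * (s * z) - p * s" for s z :: real by (simp add: algebra_simps)
    ultimately have "t * (1 + p * (a / (t * w) - 1)) + (1 - t) * (1 + p * (b / ((1 - t) * w) - 1))
       = t + p * (a / w) - p * t + ((1 - t) + p * (b / w) - p * (1 - t))" by simp
    also have "\<dots> = 1 - p + p * (a / w + b / w)" by (simp add: algebra_simps)
    finally show ?thesis using \<open>a / w + b / w = 1\<close> by simp
  qed
  show "t powr (1 - p) * a powr p + (1 - t) powr (1 - p) * b powr p \<le> (a + b) powr p"
  proof (cases "w = 0")
    case True
    then have "a = 0" "b = 0" using ab by (auto simp: w_def)
    then show ?thesis by simp
  next
    case False
    then have w: "0 < w" using ab by (simp add: w_def)
    have "(b / ((1 - t) * w)) powr p \<le> 1 + p * (b / ((1 - t) * w) - 1)" using ab t w by (intro T) auto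
    then have "(1 - t) * ((b / ((1 - t) * w)) powr p) \<le> (1 - t) * (1 + p * (b / ((1 - t) * w) - 1))" using t by (intro mult_left_mono) auto
    then have "t * (1 + p * (a / (t * w) - 1)) + (1 - t) * ((b / ((1 - t) * w)) powr p) \<le> 1" using sum1[OF w] by linarith
    then have "w powr p * (t * (1 + p * (a / (t * w) - 1)) + (1 - t) * ((b / ((1 - t) * w)) powr p)) \<le> w powr p * 1"
      by (intro mult_left_mono) auto
    then show ?thesis using main[OF w] by (simp add: w_def)
  qed
  assume ne: "b \<noteq> (1 - t) * (a + b)"
  have w: "0 < w" using ab ne by (cases "w = 0") (auto simp: w_def)
  have "b / ((1 - t) * w) \<noteq> 1" using ne t w by (auto simp: w_def)
  then have "(b / ((1 - t) * w)) powr p < 1 + p * (b / ((1 - t) * w) - 1)"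
    using ab t w by (intro powr_less_tangent p) auto
  then have "(1 - t) * ((b / ((1 - t) * w)) powr p) < (1 - t) * (1 + p * (b / ((1 - t) * w) - 1))" using t by (intro mult_strict_left_mono) auto
  then have "t * (1 + p * (a / (t * w) - 1)) + (1 - t) * ((b / ((1 - t) * w)) powr p) < 1" using sum1[OF w] by linarith
  then have "w powr p * (t * (1 + p * (a / (t * w) - 1)) + (1 - t) * ((b / ((1 - t) * w)) powr p)) < w powr p * 1"
    using w by (intro mult_strict_left_mono) auto
  then show "t powr (1 - p) * a powr p + (1 - t) powr (1 - p) * b powr p < (a + b) powr p"
    using main[OF w] by (simp add: w_def)
qed

text \<open>Compactness of the set of triples turns strictness into a uniform gap, both for triples
  that miss the reverse triangle equality by \<delta> and for those whose second part is too long by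
  \<delta>.\<close>

lemma powr_split_gap:
  fixes p t \<delta> D :: real
  assumes p: "0 < p" "p < 1" and t: "0 < t" "t < 1" and \<delta>: "0 < \<delta>"
  shows "\<exists>\<eta>>0. \<forall>g a b. 0 \<le> a \<and> 0 \<le> b \<and> a + b \<le> g \<and> g \<le> D \<and> (a + b \<le> g - \<delta> \<or> (1 - t) * g + \<delta> \<le> b) \<longrightarrow>
     t powr (1 - p) * a powr p + (1 - t) powr (1 - p) * b powr p + \<eta> \<le> g powr p"
proof -
  define K where "K = {(g, a, b). 0 \<le> a \<and> 0 \<le> b \<and> a + b \<le> g \<and> g \<le> D \<and> (a + b \<le> g - \<delta> \<or> (1 - t) * g + \<delta> \<le> b)}"
  define \<Phi> where "\<Phi> = (\<lambda>(g, a, b). g powr p - (t powr (1 - p) * a powr p + (1 - t) powr (1 - p) * b powr p))"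
  have "closed K"
  proof -
    have "K = {x. 0 \<le> fst (snd x)} \<inter> {x. 0 \<le> snd (snd x)} \<inter> {x. fst (snd x) + snd (snd x) \<le> fst x} \<inter> {x. fst x \<le> D} \<inter>
      ({x. fst (snd x) + snd (snd x) \<le> fst x - \<delta>} \<union> {x. (1 - t) * fst x + \<delta> \<le> snd (snd x)})"
      by (auto simp: K_def)
    then show ?thesis by (simp only:) (intro closed_Int closed_Un closed_Collect_le continuous_intros)
  qed
  moreover have "bounded K"
    by (rule bounded_subset[of "{0..D} \<times> {0..D} \<times> {0..D}"]) (auto simp: K_def intro!: bounded_Times)
  ultimately have "compact K" by (simp add: compact_eq_bounded_closed)
  moreover have cp: "continuous_on K (\<lambda>x. h x powr p)" if "continuous_on K h" "\<And>x. x \<in> K \<Longrightarrow> 0 \<le> h x" for h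
    by (rule continuous_on_powr'[OF that(1) continuous_on_const]) (use that p in auto)
  have "continuous_on K \<Phi>"
    unfolding \<Phi>_def case_prod_unfold
  proof (intro continuous_on_diff continuous_on_add continuous_on_mult continuous_on_const cp)
    show "continuous_on K (\<lambda>x. fst x)" "continuous_on K (\<lambda>x. fst (snd x))" "continuous_on K (\<lambda>x. snd (snd x))"
      by (intro continuous_intros)+
  qed (auto simp: K_def)
  moreover have pos: "0 < \<Phi> x" if "x \<in> K" for x
  proof -
    obtain g a b where x: "x = (g, a, b)" by (cases x)
    with that have k: "0 \<le> a" "0 \<le> b" "a + b \<le> g" "g \<le> D" "a + b \<le> g - \<delta> \<or> (1 - t) * g + \<delta> \<le> b" by (auto simp: K_def)
    have mono: "(a + b) powr p \<le> g powr p" using k p by (intro powr_mono2) auto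
    show ?thesis
    proof (cases "a + b \<le> g - \<delta>")
      case True
      then have "(a + b) powr p < g powr p" using k p \<delta> by (intro powr_less_mono2) auto
      then show ?thesis using powr_split_le(1)[OF p t k(1,2)] by (simp add: \<Phi>_def x)
    next
      case False
      then have "(1 - t) * g + \<delta> \<le> b" using k by simp
      moreover have "(1 - t) * (a + b) \<le> (1 - t) * g" using k t by (intro mult_left_mono) auto
      ultimately have "b \<noteq> (1 - t) * (a + b)" using \<delta> by linarith
      from powr_split_le(2)[OF p t k(1,2) this] mono show ?thesis by (simp add: \<Phi>_def x)
    qed
  qed
  show ?thesis
  proof (cases "K = {}")
    case True
    then show ?thesis by (intro exI[of _ 1]) (auto simp: K_def)
  next
    case False
    then obtain x where x: "x \<in> K" "\<And>y. y \<in> K \<Longrightarrow> \<Phi> x \<le> \<Phi> y"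
      using continuous_attains_inf[OF \<open>compact K\<close> _ \<open>continuous_on K \<Phi>\<close>] by blast
    show ?thesis
    proof (intro exI[of _ "\<Phi> x"] conjI allI impI pos x(1))
      fix g a b assume "0 \<le> a \<and> 0 \<le> b \<and> a + b \<le> g \<and> g \<le> D \<and> (a + b \<le> g - \<delta> \<or> (1 - t) * g + \<delta> \<le> b)"
      then have "(g, a, b) \<in> K" by (simp add: K_def)
      from x(2)[OF this] show "t powr (1 - p) * a powr p + (1 - t) powr (1 - p) * b powr p + \<Phi> x \<le> g powr p"
        by (simp add: \<Phi>_def)
    qed
  qed
qed

section \<open>Measurability of \<tau>, couplings and costs\<close>

lemma borel_measurable_lower_semicontinuous:
  fixes g :: "'a \<Rightarrow> ennreal"
  assumes "\<And>c. openin T {x \<in> topspace T. c < g x}"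
  shows "g \<in> borel_measurable (borel_of T)"
  by (rule borel_measurableI_greater) (use assms borel_of_sets in auto)

lemma ennpowr_measurable [measurable]: "(\<lambda>x. ennpowr x a) \<in> borel_measurable borel"
  unfolding ennpowr_def by measurable

lemma ennpowr_ennreal: "0 \<le> r \<Longrightarrow> ennpowr (ennreal r) a = ennreal (r powr a)"
  by (simp add: ennpowr_def)

lemma ennpowr_inverse:
  assumes p: "0 < p" and eq: "ennpowr G (1 / p) = ennreal l" and l: "0 < l"
  shows "G = ennreal (l powr p)"
proof (cases G)
  case (real r)
  then have "r powr (1 / p) = l" using eq l by (simp add: ennpowr_ennreal)
  then have "l powr p = r powr (1 / p * p)" using powr_powr[of r "1 / p" p] by simp
  then show ?thesis using real p l by (cases "r = 0") auto
qed (use eq in \<open>simp add: ennpowr_def\<close>)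

lemma
  assumes X: "lorentzian_pre_length_space X"
  shows tsep_measurable: "(\<lambda>z. tsep X (fst z) (snd z)) \<in> borel_measurable (borel_of (prod_topology (ltop X) (ltop X)))"
    and tsep_left_measurable: "x \<in> pts X \<Longrightarrow> (\<lambda>z. tsep X z x) \<in> borel_measurable (borel_of (ltop X))"
proof -
  have op: "openin (prod_topology (ltop X) (ltop X)) {z \<in> pts X \<times> pts X. c < tsep X (fst z) (snd z)}" for c
    using X unfolding lorentzian_pre_length_space_def by blast
  show 1: "(\<lambda>z. tsep X (fst z) (snd z)) \<in> borel_measurable (borel_of (prod_topology (ltop X) (ltop X)))"
    by (rule borel_measurable_lower_semicontinuous) (use op in simp)
  assume x: "x \<in> pts X"
  have "continuous_map (ltop X) (prod_topology (ltop X) (ltop X)) (\<lambda>z. (z, x))"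
    using x by (intro continuous_intros) auto
  from measurable_compose[OF continuous_map_borel_of[OF this] 1]
  show "(\<lambda>z. tsep X z x) \<in> borel_measurable (borel_of (ltop X))" by simp
qed

lemma singleton_borel_of_metric: "x \<in> mspace Y \<Longrightarrow> {x} \<in> sets (borel_of (mtopology_of Y))"
proof (rule closedin_borel_of)
  assume x: "x \<in> mspace Y"
  have "Hausdorff_space (mtopology_of Y)"
    unfolding mtopology_of_def by (rule Metric_space.Hausdorff_space_mtopology) simp
  then show "closedin (mtopology_of Y) {x}" using x by (simp add: closedin_Hausdorff_sing_eq)
qed

lemma AE_distr_mem:
  assumes f: "f \<in> M \<rightarrow>\<^sub>M N" and A: "A \<in> sets N"
  shows "(AE x in distr M N f. x \<in> A) \<longleftrightarrow> (AE z in M. f z \<in> A)"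
proof (rule AE_distr_iff[OF f])
  have "{x \<in> space N. x \<in> A} = A" using sets.sets_into_space[OF A] by auto
  then show "{x \<in> space N. x \<in> A} \<in> sets N" using A by simp
qed

context
  fixes X :: "'a lorentz_space" and \<mu> \<nu> :: "'a measure" and \<pi>
  assumes \<pi>: "\<pi> \<in> causal_couplings X \<mu> \<nu>"
begin

lemma coupling_sets: "sets \<pi> = sets (borel_of (prod_topology (ltop X) (ltop X)))"
  using \<pi> by (simp add: causal_couplings_def borel_probabilities_def)

lemma coupling_space: "space \<pi> = pts X \<times> pts X"
  using \<pi> by (simp add: causal_couplings_def borel_probabilities_def)

lemma coupling_measurable [measurable]:
  "fst \<in> \<pi> \<rightarrow>\<^sub>M borel_of (ltop X)" "snd \<in> \<pi> \<rightarrow>\<^sub>M borel_of (ltop X)"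
proof -
  have "fst \<in> borel_of (prod_topology (ltop X) (ltop X)) \<rightarrow>\<^sub>M borel_of (ltop X)"
    "snd \<in> borel_of (prod_topology (ltop X) (ltop X)) \<rightarrow>\<^sub>M borel_of (ltop X)"
    by (intro continuous_map_borel_of continuous_map_fst continuous_map_snd)+
  then show "fst \<in> \<pi> \<rightarrow>\<^sub>M borel_of (ltop X)" "snd \<in> \<pi> \<rightarrow>\<^sub>M borel_of (ltop X)"
    using coupling_sets by (simp_all cong: measurable_cong_sets)
qed

lemma coupling_marginals:
  "distr \<pi> (borel_of (ltop X)) fst = \<mu>" "distr \<pi> (borel_of (ltop X)) snd = \<nu>"
  using \<pi> by (auto simp: causal_couplings_def)

lemma coupling_caus: "AE z in \<pi>. caus X (fst z) (snd z)"
  using \<pi> by (simp add: causal_couplings_def)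

lemma coupling_nn_integral_fst:
  "g \<in> borel_measurable (borel_of (ltop X)) \<Longrightarrow> (\<integral>\<^sup>+z. g (fst z) \<partial>\<pi>) = (\<integral>\<^sup>+x. g x \<partial>\<mu>)"
  by (subst coupling_marginals(1)[symmetric], subst nn_integral_distr[OF coupling_measurable(1)]) auto

lemma coupling_nn_integral_snd:
  "g \<in> borel_measurable (borel_of (ltop X)) \<Longrightarrow> (\<integral>\<^sup>+z. g (snd z) \<partial>\<pi>) = (\<integral>\<^sup>+x. g x \<partial>\<nu>)"
  by (subst coupling_marginals(2)[symmetric], subst nn_integral_distr[OF coupling_measurable(2)]) auto

lemma coupling_AE_fst:
  assumes A: "A \<in> sets (borel_of (ltop X))" and ae: "AE x in \<mu>. x \<in> A"
  shows "AE z in \<pi>. fst z \<in> A"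
  using ae unfolding coupling_marginals(1)[symmetric] AE_distr_mem[OF coupling_measurable(1) A] .

lemma coupling_AE_snd:
  assumes A: "A \<in> sets (borel_of (ltop X))" and ae: "AE x in \<nu>. x \<in> A"
  shows "AE z in \<pi>. snd z \<in> A"
  using ae unfolding coupling_marginals(2)[symmetric] AE_distr_mem[OF coupling_measurable(2) A] .

end

text \<open>All couplings with a Dirac measure give the same cost.\<close>

lemma lp_distance_dirac:
  assumes X: "lorentzian_pre_length_space X" and x: "x \<in> pts X"
    and pos: "0 < lp_distance X p \<mu> (return (borel_of (ltop X)) x)"
  shows "lp_distance X p \<mu> (return (borel_of (ltop X)) x)
      = enn2ereal (ennpowr (\<integral>\<^sup>+ z. ennpowr (tsep X z x) p \<partial>\<mu>) (1 / p))"
    and "causal_past X x \<in> sets (borel_of (ltop X)) \<Longrightarrow> sets \<mu> = sets (borel_of (ltop X)) \<Longrightarrow> AE z in \<mu>. z \<in> causal_past X x"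
proof -
  let ?\<nu> = "return (borel_of (ltop X)) x"
  have ne: "causal_couplings X \<mu> ?\<nu> \<noteq> {}"
    using pos unfolding lp_distance_def by (auto simp: bot_ereal_def)
  have x1: "AE z in \<pi>. snd z = x" if \<pi>: "\<pi> \<in> causal_couplings X \<mu> ?\<nu>" for \<pi>
  proof -
    have "AE z in ?\<nu>. z \<in> {x}" using x singleton_borel_of_metric[OF x] by (subst AE_return) auto
    from coupling_AE_snd[OF \<pi> singleton_borel_of_metric[OF x] this] show ?thesis by simp
  qed
  have "(\<integral>\<^sup>+ z. ennpowr (tsep X (fst z) (snd z)) p \<partial>\<pi>) = (\<integral>\<^sup>+ z. ennpowr (tsep X z x) p \<partial>\<mu>)"
    if \<pi>: "\<pi> \<in> causal_couplings X \<mu> ?\<nu>" for \<pi>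
  proof -
    have "(\<integral>\<^sup>+ z. ennpowr (tsep X (fst z) (snd z)) p \<partial>\<pi>) = (\<integral>\<^sup>+ z. ennpowr (tsep X (fst z) x) p \<partial>\<pi>)"
      by (rule nn_integral_cong_AE) (use x1[OF \<pi>] in eventually_elim, simp)
    also have "\<dots> = (\<integral>\<^sup>+ z. ennpowr (tsep X z x) p \<partial>\<mu>)"
      by (rule coupling_nn_integral_fst[OF \<pi>]) (rule measurable_compose[OF tsep_left_measurable[OF X x] ennpowr_measurable])
    finally show ?thesis .
  qed
  then show "lp_distance X p \<mu> ?\<nu> = enn2ereal (ennpowr (\<integral>\<^sup>+ z. ennpowr (tsep X z x) p \<partial>\<mu>) (1 / p))"
    unfolding lp_distance_def using ne by simp
  assume J: "causal_past X x \<in> sets (borel_of (ltop X))" and s: "sets \<mu> = sets (borel_of (ltop X))"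
  obtain \<pi> where \<pi>: "\<pi> \<in> causal_couplings X \<mu> ?\<nu>" using ne by blast
  have "AE z in \<pi>. fst z \<in> causal_past X x"
    using x1[OF \<pi>] coupling_caus[OF \<pi>] AE_space
  proof eventually_elim
    case (elim z)
    then have "fst z \<in> pts X" using coupling_space[OF \<pi>] by (cases z) simp
    moreover have "caus X (fst z) x" using elim(1,2) by simp
    ultimately show ?case by (simp add: causal_past_def)
  qed
  then have "AE z in distr \<pi> (borel_of (ltop X)) fst. z \<in> causal_past X x"
    using AE_distr_mem[OF coupling_measurable(1)[OF \<pi>] J] by simp
  then show "AE z in \<mu>. z \<in> causal_past X x" unfolding coupling_marginals(1)[OF \<pi>] .
qed

text \<open>An intermediate measure only charges points that almost saturate the reverse triangle inequality
  in the right proportion: the deficit in concavity of \<open>r\<^sup>p\<close> has integral at most \<open>\<epsilon>\<close> for all \<open>\<epsilon>\<close>.\<close>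

lemma lp_geodesic_concentrated:
  assumes X: "lorentzian_pre_length_space X" and x: "x \<in> pts X" and p: "0 < p" "p < 1" and t: "0 < t" "t < 1"
    and geo: "lp_geodesic X p \<mu>" and \<mu>1: "\<mu> 1 = return (borel_of (ltop X)) x"
    and B: "B \<in> sets (borel_of (ltop X))" "AE y in \<mu> 0. y \<in> B"
    and BD: "\<And>y. y \<in> B \<Longrightarrow> tsep X y x \<le> ennreal D"
    and J: "causal_past X x \<in> sets (borel_of (ltop X))" and E: "E \<in> sets (borel_of (ltop X))" and \<delta>: "0 < \<delta>"
    and near: "\<And>y z. y \<in> B \<Longrightarrow> z \<in> pts X \<Longrightarrow> caus X y z \<Longrightarrow> caus X z x \<Longrightarrow>
       enn2real (tsep X y x) - \<delta> \<le> enn2real (tsep X y z) + enn2real (tsep X z x) \<Longrightarrow>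
       enn2real (tsep X z x) \<le> (1 - t) * enn2real (tsep X y x) + \<delta> \<Longrightarrow> z \<in> E"
  shows "AE z in \<mu> t. z \<in> E"
proof -
  let ?T = "borel_of (ltop X)"
  let ?\<tau> = "\<lambda>x y. enn2real (tsep X x y)"
  have m01: "\<mu> s \<in> borel_probabilities (ltop X)" if "s \<in> {0..1}" for s
    using geo that by (auto simp: lp_geodesic_def)
  have ms: "sets (\<mu> s) = sets ?T" if "s \<in> {0..1}" for s using m01[OF that] by (simp add: borel_probabilities_def)
  have G: "lp_distance X p (\<mu> r) (\<mu> s) = ereal (s - r) * lp_distance X p (\<mu> 0) (\<mu> 1)"
    "0 < lp_distance X p (\<mu> r) (\<mu> s)" "lp_distance X p (\<mu> r) (\<mu> s) < \<infinity>" if "0 \<le> r" "r < s" "s \<le> 1" for r s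
    using geo that unfolding lp_geodesic_def by blast+
  obtain l where l: "lp_distance X p (\<mu> 0) (\<mu> 1) = ereal l" "0 < l"
    using G(2,3)[of 0 1] by (cases "lp_distance X p (\<mu> 0) (\<mu> 1)") auto
  \<comment> \<open>The geodesic identity prescribes the cost from \<mu> s to the Dirac measure, and
    that cost is an integral of \<tau> to x. Hence the p-th moments are known exactly.\<close>
  have to_x: "(\<integral>\<^sup>+ z. ennpowr (tsep X z x) p \<partial>\<mu> s) = ennreal (((1 - s) * l) powr p)" if s: "0 \<le> s" "s < 1" for s
  proof (rule ennpowr_inverse[OF p(1)])
    have "enn2ereal (ennpowr (\<integral>\<^sup>+ z. ennpowr (tsep X z x) p \<partial>\<mu> s) (1 / p)) = ereal ((1 - s) * l)"
      using lp_distance_dirac(1)[OF X x, of p "\<mu> s"] G[of s 1] s l \<mu>1 by simp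
    also have "\<dots> = enn2ereal (ennreal ((1 - s) * l))" using s l by (simp add: enn2ereal_ennreal)
    finally show "ennpowr (\<integral>\<^sup>+ z. ennpowr (tsep X z x) p \<partial>\<mu> s) (1 / p) = ennreal ((1 - s) * l)"
      by (simp only: enn2ereal_inject)
    show "0 < (1 - s) * l" using s l by simp
  qed
  have pastx: "AE z in \<mu> t. z \<in> causal_past X x"
    using lp_distance_dirac(2)[OF X x, of p "\<mu> t"] G[of t 1] t J ms[of t] \<mu>1 by simp
  obtain \<eta> where \<eta>: "\<eta> > 0" and gap: "\<And>g a b. 0 \<le> a \<Longrightarrow> 0 \<le> b \<Longrightarrow> a + b \<le> g \<Longrightarrow> g \<le> D \<Longrightarrow>
     (a + b \<le> g - \<delta> \<or> (1 - t) * g + \<delta> \<le> b) \<Longrightarrow>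
     t powr (1 - p) * a powr p + (1 - t) powr (1 - p) * b powr p + \<eta> \<le> g powr p"
    using powr_split_gap[OF p t \<delta>, of D] by blast
  have tri: "tsep X y z + tsep X z x \<le> tsep X y x" if "y \<in> pts X" "z \<in> pts X" "caus X y z" "caus X z x" for y z
    using X x that unfolding lorentzian_pre_length_space_def by blast
  have point: "t powr (1 - p) * ?\<tau> y z powr p + (1 - t) powr (1 - p) * ?\<tau> z x powr p + \<eta> * indicator (pts X - E) z
       \<le> ?\<tau> y x powr p \<and> tsep X y z = ennreal (?\<tau> y z) \<and> tsep X z x = ennreal (?\<tau> z x) \<and> tsep X y x = ennreal (?\<tau> y x)"
    if yz: "y \<in> B" "y \<in> pts X" "z \<in> pts X" "caus X y z" "caus X z x" for y z
  proof -
    \<comment> \<open>A negative D is possible here; \<open>ennreal D\<close> is then 0.\<close>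
    have D0: "0 \<le> D \<or> tsep X y x = 0" using BD[OF yz(1)] by (cases "0 \<le> D") (auto simp: ennreal_neg)
    have fin: "tsep X y x < \<top>" using BD[OF yz(1)] by (rule le_less_trans) simp
    have fin2: "tsep X y z < \<top>" "tsep X z x < \<top>"
      using tri[OF yz(2-5)] fin by (auto intro: le_less_trans[rotated] simp: add_increasing add_increasing2 less_top top_unique) 
    have eqs: "tsep X y z = ennreal (?\<tau> y z)" "tsep X z x = ennreal (?\<tau> z x)" "tsep X y x = ennreal (?\<tau> y x)"
      using fin fin2 by simp_all
    have "ennreal (?\<tau> y z + ?\<tau> z x) = tsep X y z + tsep X z x"
      using eqs by (metis ennreal_plus enn2real_nonneg)
    then have "ennreal (?\<tau> y z + ?\<tau> z x) \<le> ennreal (?\<tau> y x)" using tri[OF yz(2-5)] eqs(3) by simp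
    then have sum: "?\<tau> y z + ?\<tau> z x \<le> ?\<tau> y x" by (subst (asm) ennreal_le_iff) auto
    have "t powr (1 - p) * ?\<tau> y z powr p + (1 - t) powr (1 - p) * ?\<tau> z x powr p + \<eta> * indicator (pts X - E) z \<le> ?\<tau> y x powr p"
    proof (cases "z \<in> E")
      case True
      have "t powr (1 - p) * ?\<tau> y z powr p + (1 - t) powr (1 - p) * ?\<tau> z x powr p \<le> (?\<tau> y z + ?\<tau> z x) powr p"
        by (rule powr_split_le[OF p t]) auto
      also have "\<dots> \<le> ?\<tau> y x powr p" using sum p by (intro powr_mono2) auto
      finally show ?thesis using True by simp
    next
      case False
      then have n: "\<not> (?\<tau> y x - \<delta> \<le> ?\<tau> y z + ?\<tau> z x \<and> ?\<tau> z x \<le> (1 - t) * ?\<tau> y x + \<delta>)"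
        using near[OF yz(1,3-5)] by blast
      show ?thesis
      proof (cases "0 \<le> D")
        case True
        have "?\<tau> y x \<le> D" using BD[OF yz(1)] eqs(3) True by (metis ennreal_le_iff)
        then show ?thesis using gap[of "?\<tau> y z" "?\<tau> z x" "?\<tau> y x"] sum n False yz(3) by (auto simp: not_le indicator_def)
      next
        case False
        then have "?\<tau> y x = 0" using D0 by simp
        moreover have "0 \<le> ?\<tau> y z" "0 \<le> ?\<tau> z x" by auto
        ultimately have "?\<tau> z x = 0" "?\<tau> y z = 0" using sum by linarith+
        then show ?thesis using n \<delta> \<open>?\<tau> y x = 0\<close> by simp
      qed
    qed
    then show ?thesis using eqs by blast
  qed
  have Ec: "pts X - E \<in> sets ?T" using sets.compl_sets[OF E] by simp
  \<comment> \<open>The supremum over couplings need not be attained, hence the defect e.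
    Integrating the pointwise inequality over a coupling that is optimal up to e, the moments to x
    contribute (1 - t) * l powr p and l powr p. What remains bounds \<eta> times the mass outside E,
    and it vanishes as e tends to 0.\<close>
  have small: "ennreal (\<eta> * measure (\<mu> t) (pts X - E)) \<le> ennreal (t * l powr p - t powr (1 - p) * (t * l - e) powr p)"
    if e: "0 < e" "e < t * l" for e
  proof -
    have "ereal (t * l - e) < lp_distance X p (\<mu> 0) (\<mu> t)" using G(1)[of 0 t] t l e by simp
    then obtain \<pi> where \<pi>: "\<pi> \<in> causal_couplings X (\<mu> 0) (\<mu> t)"
      and big: "ereal (t * l - e) < enn2ereal (ennpowr (\<integral>\<^sup>+ z. ennpowr (tsep X (fst z) (snd z)) p \<partial>\<pi>) (1 / p))"
      unfolding lp_distance_def less_SUP_iff by blast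
    define I where "I = (\<integral>\<^sup>+ z. ennpowr (tsep X (fst z) (snd z)) p \<partial>\<pi>)"
    have I_ge: "ennreal ((t * l - e) powr p) \<le> I"
    proof (cases I)
      case (real r)
      then have "t * l - e < r powr (1 / p)" using big unfolding I_def[symmetric] by (simp add: ennpowr_ennreal enn2ereal_ennreal)
      then have "(t * l - e) powr p \<le> (r powr (1 / p)) powr p" using e p by (intro powr_mono2) auto
      also have "\<dots> = r" using real p by (cases "r = 0") (auto simp: powr_powr)
      finally show ?thesis using real by (simp add: ennreal_leI)
    qed simp
    have [measurable]: "(\<lambda>z. tsep X (fst z) (snd z)) \<in> borel_measurable \<pi>"
      using tsep_measurable[OF X] coupling_sets[OF \<pi>] by (simp cong: measurable_cong_sets)
    have tx [measurable]: "(\<lambda>z. tsep X z x) \<in> borel_measurable ?T" by (rule tsep_left_measurable[OF X x])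
    have tp: "(\<lambda>z. ennpowr (tsep X z x) p) \<in> borel_measurable ?T" by (rule measurable_compose[OF tx ennpowr_measurable])
    note cm[measurable] = coupling_measurable[OF \<pi>]
    have sndE: "snd -` (pts X - E) \<inter> space \<pi> \<in> sets \<pi>" by (rule measurable_sets[OF cm(2) Ec])
    have ae: "AE z in \<pi>. ennreal (t powr (1 - p)) * ennpowr (tsep X (fst z) (snd z)) p +
          ennreal ((1 - t) powr (1 - p)) * ennpowr (tsep X (snd z) x) p + ennreal \<eta> * indicator (pts X - E) (snd z)
        \<le> ennpowr (tsep X (fst z) x) p"
      using coupling_caus[OF \<pi>] coupling_AE_fst[OF \<pi> B] coupling_AE_snd[OF \<pi> J pastx] AE_space
    proof eventually_elim
      case (elim z)
      have "fst z \<in> pts X" "snd z \<in> pts X" using elim(4) coupling_space[OF \<pi>] by (cases z, simp)+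
      moreover have "caus X (snd z) x" using elim(3) by (simp add: causal_past_def)
      ultimately have "fst z \<in> pts X" "snd z \<in> pts X" "caus X (snd z) x" by blast+
      note P = point[OF elim(2) this(1,2) elim(1) this(3)]
      let ?a = "?\<tau> (fst z) (snd z)" and ?b = "?\<tau> (snd z) x" and ?g = "?\<tau> (fst z) x"
      have e1: "ennpowr (tsep X (fst z) (snd z)) p = ennreal (?a powr p)" using P by (metis ennpowr_ennreal enn2real_nonneg)
      have e2: "ennpowr (tsep X (snd z) x) p = ennreal (?b powr p)" using P by (metis ennpowr_ennreal enn2real_nonneg)
      have e3: "ennpowr (tsep X (fst z) x) p = ennreal (?g powr p)" using P by (metis ennpowr_ennreal enn2real_nonneg)
      have e4: "ennreal \<eta> * indicator (pts X - E) (snd z) = ennreal (\<eta> * indicator (pts X - E) (snd z))"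
        by (simp add: indicator_def)
      have "ennreal (t powr (1 - p) * ?a powr p + (1 - t) powr (1 - p) * ?b powr p + \<eta> * indicator (pts X - E) (snd z)) \<le> ennreal (?g powr p)"
        using P by (intro ennreal_leI) blast
      then show ?case unfolding e1 e2 e3 e4 using \<eta> by (simp add: ennreal_mult ennreal_plus)
    qed
    have I1: "ennreal (t powr (1 - p)) * I + ennreal ((1 - t) powr (1 - p)) * (\<integral>\<^sup>+ z. ennpowr (tsep X z x) p \<partial>\<mu> t)
        + ennreal \<eta> * emeasure (\<mu> t) (pts X - E) \<le> (\<integral>\<^sup>+ y. ennpowr (tsep X y x) p \<partial>\<mu> 0)"
    proof -
      have c1: "(\<integral>\<^sup>+ z. ennpowr (tsep X (snd z) x) p \<partial>\<pi>) = (\<integral>\<^sup>+ z. ennpowr (tsep X z x) p \<partial>\<mu> t)"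
        by (rule coupling_nn_integral_snd[OF \<pi> tp])
      have c2: "(\<integral>\<^sup>+ z. ennpowr (tsep X (fst z) x) p \<partial>\<pi>) = (\<integral>\<^sup>+ y. ennpowr (tsep X y x) p \<partial>\<mu> 0)"
        by (rule coupling_nn_integral_fst[OF \<pi> tp])
      have im: "(indicator (pts X - E) :: 'a \<Rightarrow> ennreal) \<in> borel_measurable ?T" using Ec by measurable
      have c3: "(\<integral>\<^sup>+ z. indicator (pts X - E) (snd z) \<partial>\<pi>) = emeasure (\<mu> t) (pts X - E)"
        using coupling_nn_integral_snd[OF \<pi> im] Ec ms[of t] t by simp
      have im': "(\<lambda>z. indicator (pts X - E) (snd z) :: ennreal) \<in> borel_measurable \<pi>"
        by (rule measurable_compose[OF cm(2) im])
      have "ennreal (t powr (1 - p)) * I + ennreal ((1 - t) powr (1 - p)) * (\<integral>\<^sup>+ z. ennpowr (tsep X z x) p \<partial>\<mu> t)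
        + ennreal \<eta> * emeasure (\<mu> t) (pts X - E) = (\<integral>\<^sup>+z. ennreal (t powr (1 - p)) * ennpowr (tsep X (fst z) (snd z)) p +
          ennreal ((1 - t) powr (1 - p)) * ennpowr (tsep X (snd z) x) p + ennreal \<eta> * indicator (pts X - E) (snd z) \<partial>\<pi>)"
        unfolding c1[symmetric] c3[symmetric] I_def using im' by (simp add: nn_integral_add nn_integral_cmult)
      also have "\<dots> \<le> (\<integral>\<^sup>+ z. ennpowr (tsep X (fst z) x) p \<partial>\<pi>)" by (rule nn_integral_mono_AE[OF ae])
      finally show ?thesis unfolding c2 .
    qed
    have I2: "ennreal (t powr (1 - p)) * ennreal ((t * l - e) powr p) \<le> ennreal (t powr (1 - p)) * I"
      using I_ge by (rule mult_left_mono) simp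
    have I3: "emeasure (\<mu> t) (pts X - E) = ennreal (measure (\<mu> t) (pts X - E))"
      using m01[of t] t by (simp add: borel_probabilities_def prob_space_def finite_measure.emeasure_eq_measure)
    have I4: "(\<integral>\<^sup>+ y. ennpowr (tsep X y x) p \<partial>\<mu> 0) = ennreal (l powr p)" using to_x[of 0] by simp
    have I5: "(\<integral>\<^sup>+ z. ennpowr (tsep X z x) p \<partial>\<mu> t) = ennreal (((1 - t) * l) powr p)" using to_x[of t] t by simp
    have "ennreal (t powr (1 - p)) * ennreal ((t * l - e) powr p) + ennreal ((1 - t) powr (1 - p)) * ennreal (((1 - t) * l) powr p)
        + ennreal \<eta> * ennreal (measure (\<mu> t) (pts X - E)) \<le> ennreal (l powr p)"
      by (rule order_trans[OF _ I1[unfolded I3 I4 I5]]) (intro add_right_mono I2)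
    then have "ennreal (t powr (1 - p) * (t * l - e) powr p + (1 - t) powr (1 - p) * ((1 - t) * l) powr p
        + \<eta> * measure (\<mu> t) (pts X - E)) \<le> ennreal (l powr p)" using \<eta> by (simp add: ennreal_mult ennreal_plus)
    then have "t powr (1 - p) * (t * l - e) powr p + (1 - t) powr (1 - p) * ((1 - t) * l) powr p
        + \<eta> * measure (\<mu> t) (pts X - E) \<le> l powr p" by simp
    moreover have "(1 - t) powr (1 - p) * ((1 - t) * l) powr p = (1 - t) * l powr p"
      using t l by (simp add: powr_mult powr_add[symmetric] mult.assoc[symmetric])
    ultimately show ?thesis by (intro ennreal_leI) (simp add: algebra_simps)
  qed
  have "measure (\<mu> t) (pts X - E) = 0"
  proof -
    have "((\<lambda>e. t * l powr p - t powr (1 - p) * (t * l - e) powr p) \<longlongrightarrow> t * l powr p - t powr (1 - p) * (t * l - 0) powr p) (at_right 0)"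
      using t l by (intro tendsto_intros) auto
    also have "t * l powr p - t powr (1 - p) * (t * l - 0) powr p = 0"
      using t l by (simp add: powr_mult powr_add[symmetric] mult.assoc[symmetric])
    finally have lim: "((\<lambda>e. t * l powr p - t powr (1 - p) * (t * l - e) powr p) \<longlongrightarrow> 0) (at_right 0)" .
    have "\<eta> * measure (\<mu> t) (pts X - E) \<le> 0"
    proof (rule tendsto_lowerbound[OF lim])
      have ev: "eventually (\<lambda>e. 0 < e \<and> e < t * l) (at_right 0)"
        using t l by (auto simp: eventually_at_right_field intro!: exI[of _ "t * l"])
      then show "eventually (\<lambda>e. \<eta> * measure (\<mu> t) (pts X - E) \<le> t * l powr p - t powr (1 - p) * (t * l - e) powr p) (at_right 0)"
      proof eventually_elim
        case (elim e)
        have "t powr (1 - p) * (t * l - e) powr p \<le> t powr (1 - p) * (t * l) powr p"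
          using elim p by (intro mult_left_mono powr_mono2) auto
        also have "\<dots> = t * l powr p" using t l by (simp add: powr_mult powr_add[symmetric] mult.assoc[symmetric])
        finally show ?case using small[of e] elim by simp
      qed
    qed simp
    then show ?thesis using \<eta> measure_nonneg[of "\<mu> t" "pts X - E"] by (simp add: mult_le_0_iff)
  qed
  moreover have "prob_space (\<mu> t)" "space (\<mu> t) = pts X" using m01[of t] t by (auto simp: borel_probabilities_def)
  ultimately have "pts X - E \<in> null_sets (\<mu> t)"
    using Ec ms[of t] t by (auto simp: null_sets_def prob_space_def finite_measure.emeasure_eq_measure)
  from AE_not_in[OF this] show ?thesis using AE_space
    by eventually_elim (use \<open>space (\<mu> t) = pts X\<close> in auto)
qed

text \<open>The entropy power of the uniform measure on B is a power of the measure of B. At time t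
  the transported measure lives in E, so Jensen bounds its entropy power by the same power of the
  measure of E. The geometry enters only through \<open>near\<close>, which asks E to contain every
  point that almost saturates the reverse triangle inequality close to x.\<close>

lemma TMCP_contraction:
  assumes X: "lorentzian_pre_length_space X" and tmcp: "TMCP_e K N X \<mm>" and N: "0 < N"
    and mm: "space \<mm> = pts X" "sets \<mm> = sets (borel_of (ltop X))" "sigma_finite_measure \<mm>"
    and x: "x \<in> pts X" and t: "0 < t" "t < 1"
    and B: "compactin (ltop X) B" "B \<in> sets \<mm>" "0 < emeasure \<mm> B" "emeasure \<mm> B < \<infinity>"
    and BD: "\<And>y. y \<in> B \<Longrightarrow> 0 < tsep X y x \<and> tsep X y x \<le> ennreal D" and D: "0 \<le> D"
    and J: "causal_past X x \<in> sets \<mm>" and E: "E \<in> sets \<mm>" "emeasure \<mm> E < \<infinity>" and \<delta>: "0 < \<delta>"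
    and near: "\<And>y z. y \<in> B \<Longrightarrow> z \<in> pts X \<Longrightarrow> caus X y z \<Longrightarrow> caus X z x \<Longrightarrow>
       enn2real (tsep X y x) - \<delta> \<le> enn2real (tsep X y z) + enn2real (tsep X z x) \<Longrightarrow>
       enn2real (tsep X z x) \<le> (1 - t) * enn2real (tsep X y x) + \<delta> \<Longrightarrow> z \<in> E"
  shows "((1 - t) / cosh (sqrt \<bar>K / N\<bar> * D)) powr N * measure \<mm> B \<le> measure \<mm> E"
proof -
  define \<mu>0 where "\<mu>0 = uniform_measure \<mm> B"
  have B0: "emeasure \<mm> B \<noteq> 0" "emeasure \<mm> B \<noteq> \<infinity>" using B by auto
  have prob: "prob_space \<mu>0" unfolding \<mu>0_def by (rule prob_space_uniform_measure[OF B0])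
  have aeB: "AE y in \<mu>0. y \<in> B" unfolding \<mu>0_def
    using B by (intro AE_uniform_measureI) auto
  have bp: "\<mu>0 \<in> borel_probabilities (ltop X)" using prob mm by (simp add: borel_probabilities_def \<mu>0_def)
  have chr: "AE y in \<mu>0. chron X y x"
    using aeB AE_space
  proof eventually_elim
    case (elim y)
    then have "y \<in> pts X" "0 < tsep X y x" using BD mm by (auto simp: \<mu>0_def)
    then show ?case using X x unfolding lorentzian_pre_length_space_def by blast
  qed
  have "compactly_supported (ltop X) \<mu>0" unfolding compactly_supported_def using B(1) aeB by blast
  moreover have "\<bar>rel_entropy \<mm> \<mu>0\<bar> \<noteq> \<infinity>" unfolding \<mu>0_def by (rule entropy_power_uniform(1)[OF mm(3) B(2-4) N])
  ultimately obtain p \<mu> where p: "0 < p" "p < 1" and geo: "lp_geodesic X p \<mu>" and \<mu>: "\<mu> 0 = \<mu>0"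
    "\<mu> 1 = return (borel_of (ltop X)) x" and ent: "\<And>t. t \<in> {0..<1} \<Longrightarrow>
      distortion_coeff (K / N) (1 - t) (tsep_L2 X \<mu>0 x) * entropy_power N \<mm> \<mu>0 \<le> entropy_power N \<mm> (\<mu> t)"
    using tmcp bp x chr unfolding TMCP_e_def by (metis greaterThanLessThan_iff)
  have conc: "AE z in \<mu> t. z \<in> E"
    by (rule lp_geodesic_concentrated[OF X x p t geo \<mu>(2), where B = B and D = D and \<delta> = \<delta>])
      (use B(2) mm aeB \<mu> BD J E \<delta> near in auto)
  have mt: "prob_space (\<mu> t)" "sets (\<mu> t) = sets \<mm>"
    using geo t mm unfolding lp_geodesic_def borel_probabilities_def by auto
  have up: "entropy_power N \<mm> (\<mu> t) \<le> ennreal (measure \<mm> E powr (1 / N))"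
    by (rule entropy_power_le[OF E mt conc N])
  have L2: "tsep_L2 X \<mu>0 x \<le> D"
  proof -
    have "(\<integral>\<^sup>+ y. (tsep X y x)\<^sup>2 \<partial>\<mu>0) \<le> (\<integral>\<^sup>+ y. ennreal (D\<^sup>2) \<partial>\<mu>0)"
    proof (rule nn_integral_mono_AE)
      show "AE y in \<mu>0. (tsep X y x)\<^sup>2 \<le> ennreal (D\<^sup>2)"
        using aeB
      proof eventually_elim
        case (elim y)
        then have "(tsep X y x)\<^sup>2 \<le> (ennreal D)\<^sup>2" using BD by (intro power_mono) auto
        then show ?case using D by (simp add: ennreal_power)
      qed
    qed
    also have "\<dots> = ennreal (D\<^sup>2)" using prob_space.emeasure_space_1[OF prob] by simp
    finally have "enn2real (\<integral>\<^sup>+ y. (tsep X y x)\<^sup>2 \<partial>\<mu>0) \<le> D\<^sup>2" by (rule enn2real_leI[rotated]) simp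
    then have "tsep_L2 X \<mu>0 x \<le> sqrt (D\<^sup>2)" unfolding tsep_L2_def by (rule real_sqrt_le_mono)
    then show ?thesis using D by simp
  qed
  define c where "c = (1 - t) / cosh (sqrt \<bar>K / N\<bar> * D)"
  have c: "0 < c" using t by (simp add: c_def)
  have "emeasure \<mm> B = ennreal (measure \<mm> B)" using B0 by (intro emeasure_eq_ennreal_measure) simp
  with B(3) have mB: "0 < measure \<mm> B" by simp
  have "ennreal (c * measure \<mm> B powr (1 / N)) = ennreal c * entropy_power N \<mm> \<mu>0"
    unfolding \<mu>0_def entropy_power_uniform(2)[OF mm(3) B(2-4) N] using c by (simp add: ennreal_mult)
  also have "\<dots> \<le> distortion_coeff (K / N) (1 - t) (tsep_L2 X \<mu>0 x) * entropy_power N \<mm> \<mu>0"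
    unfolding c_def by (rule mult_right_mono[OF distortion_coeff_ge[OF _ L2]]) (use t in \<open>simp_all add: tsep_L2_def\<close>)
  also have "\<dots> \<le> ennreal (measure \<mm> E powr (1 / N))" by (rule order_trans[OF ent up]) (use t in simp)
  finally have "c * measure \<mm> B powr (1 / N) \<le> measure \<mm> E powr (1 / N)" by simp
  then have "(c * measure \<mm> B powr (1 / N)) powr N \<le> (measure \<mm> E powr (1 / N)) powr N"
    using N c by (intro powr_mono2) auto
  moreover have "(c * measure \<mm> B powr (1 / N)) powr N = c powr N * measure \<mm> B"
    using N c mB by (simp add: powr_mult powr_powr)
  moreover have "(measure \<mm> E powr (1 / N)) powr N = measure \<mm> E"
    using N by (cases "measure \<mm> E = 0") (auto simp: powr_powr)
  ultimately show ?thesis by (simp add: c_def)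
qed

section \<open>Contraction to a tip\<close>

text \<open>Instantiated by a cone and by its causal reversal, with \<open>T\<close> the conformal time or its negative, \<open>d\<close> the
  distance of the fibre components and \<open>rt\<close> the real-valued time separation.\<close>

locale conelike =
  fixes P :: "'b set" and cs :: "'b \<Rightarrow> 'b \<Rightarrow> bool" and rt d :: "'b \<Rightarrow> 'b \<Rightarrow> real" and T :: "'b \<Rightarrow> real"
    and m M :: real
  assumes mM: "0 < m" "0 < M"
    and d_nonneg: "0 \<le> d x y"
    and cs_d: "x \<in> P \<Longrightarrow> y \<in> P \<Longrightarrow> cs x y \<Longrightarrow> d x y \<le> T y - T x"
    and rt_upper: "x \<in> P \<Longrightarrow> y \<in> P \<Longrightarrow> cs x y \<Longrightarrow> rt x y \<le> M * sqrt ((T y - T x)\<^sup>2 - (d x y)\<^sup>2)"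
    and cs_lower: "x \<in> P \<Longrightarrow> y \<in> P \<Longrightarrow> d x y < T y - T x \<Longrightarrow> cs x y"
    and rt_lower: "x \<in> P \<Longrightarrow> y \<in> P \<Longrightarrow> d x y < T y - T x \<Longrightarrow> m * sqrt ((T y - T x)\<^sup>2 - (d x y)\<^sup>2) \<le> rt x y"
    and perturb: "y \<in> P \<Longrightarrow> z \<in> P \<Longrightarrow> z' \<in> P \<Longrightarrow> 0 < A \<Longrightarrow> A < rt y z \<Longrightarrow> T z' = T z \<Longrightarrow> 0 \<le> l \<Longrightarrow> l \<le> 1 \<Longrightarrow>
      d z z' * (2 * M\<^sup>2 * (T z - T y)) < l * A\<^sup>2 \<Longrightarrow> cs y z' \<and> (1 - l) * A \<le> rt y z'"
    and path: "z \<in> P \<Longrightarrow> x \<in> P \<Longrightarrow> d z x < D \<Longrightarrow> 0 \<le> h \<Longrightarrow> h \<le> 1 \<Longrightarrow>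
      \<exists>z'\<in>P. T z' = T z \<and> d z z' \<le> h * D \<and> d z' x \<le> (1 - h) * D"
    and tri: "x \<in> P \<Longrightarrow> y \<in> P \<Longrightarrow> z \<in> P \<Longrightarrow> cs x y \<Longrightarrow> cs y z \<Longrightarrow> rt x y + rt y z \<le> rt x z"

text \<open>The fraction \<eta> by which a point is moved towards the axis of the tip. The move
  shifts it by at most 4 \<eta> \<Delta>, and perturbation then costs the relative loss l = c \<eta>
  \<Delta>: the number 160 is 16 * 10, where 10 exceeds the product 4 * 2 from the shift and the
  perturbation lemma, and 16 comes from the length bound \<tau> / 4. The three terms of the minimum
  ensure \<eta> <= 1/2, l <= 1, and a loss of at most half the gain.\<close>

definition tip_angle :: "real \<Rightarrow> real \<Rightarrow> real \<Rightarrow> real \<Rightarrow> real" where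
  "tip_angle m M \<tau> H = (let c = 160 * M\<^sup>2 * H / \<tau>\<^sup>2 in min (1 / 2) (min (1 / (c * H)) ((m / (2 * c * M * H))\<^sup>2)))"

text \<open>The first term keeps the segment from y to z longer than \<tau> / 2. By the second, two
  tolerances are at most half the gain m * sqrt \<eta> * \<epsilon>.\<close>

definition tip_tolerance :: "real \<Rightarrow> real \<Rightarrow> real \<Rightarrow> real \<Rightarrow> real \<Rightarrow> real" where
  "tip_tolerance m M \<tau> H \<epsilon> = min (\<tau> / 4) (\<epsilon> * m * sqrt (tip_angle m M \<tau> H) / 4)"

lemma tip_angle:
  assumes "0 < m" "0 < M" "0 < \<tau>" "0 < H"
  defines "c \<equiv> 160 * M\<^sup>2 * H / \<tau>\<^sup>2" and "\<eta> \<equiv> tip_angle m M \<tau> H"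
  shows "0 < \<eta>" "\<eta> \<le> 1 / 2" "\<eta> * (c * H) \<le> 1" "c * M * H * \<eta> \<le> m / 2 * sqrt \<eta>"
proof -
  have c: "0 < c" using assms by (simp add: c_def)
  show \<eta>: "0 < \<eta>" using assms c unfolding \<eta>_def tip_angle_def Let_def c_def[symmetric] by simp
  have le: "\<eta> \<le> 1 / 2" "\<eta> \<le> 1 / (c * H)" "\<eta> \<le> (m / (2 * c * M * H))\<^sup>2"
    unfolding \<eta>_def tip_angle_def Let_def c_def[symmetric] by linarith+
  show "\<eta> \<le> 1 / 2" by (rule le)
  show "\<eta> * (c * H) \<le> 1" using le(2) c assms by (simp add: pos_le_divide_eq)
  have "sqrt \<eta> \<le> sqrt ((m / (2 * c * M * H))\<^sup>2)" using le(3) by (rule real_sqrt_le_mono)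
  then have "sqrt \<eta> \<le> m / (2 * c * M * H)" using assms c by simp
  moreover have "0 < 2 * c * M * H" using c assms(2,4) by simp
  ultimately have "sqrt \<eta> * (2 * c * M * H) \<le> m" by (simp only: pos_le_divide_eq)
  then have "sqrt \<eta> * (sqrt \<eta> * (2 * c * M * H)) \<le> sqrt \<eta> * m" using \<eta> by (intro mult_left_mono) auto
  moreover have "sqrt \<eta> * (sqrt \<eta> * (2 * c * M * H)) = \<eta> * (2 * c * M * H)" using \<eta> by (simp add: mult.assoc[symmetric])
  moreover have "\<eta> * (2 * c * M * H) = 2 * (c * M * H * \<eta>)" by simp
  moreover have "sqrt \<eta> * m = 2 * (m / 2 * sqrt \<eta>)" by simp
  ultimately show "c * M * H * \<eta> \<le> m / 2 * sqrt \<eta>" by linarith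
qed

lemma tip_tolerance_pos:
  "0 < m \<Longrightarrow> 0 < M \<Longrightarrow> 0 < \<tau> \<Longrightarrow> 0 < H \<Longrightarrow> 0 < \<epsilon> \<Longrightarrow> 0 < tip_tolerance m M \<tau> H \<epsilon>"
  using tip_angle(1)[of m M \<tau> H] by (simp add: tip_tolerance_def)

text \<open>If \<open>z\<close> were far from the tip \<open>x\<close> while \<open>rt z x\<close> is small, the segment from \<open>z\<close> to \<open>x\<close> would be almost null.
  Moving \<open>z\<close> towards the axis of \<open>x\<close> by a small fraction \<open>\<eta>\<close> gains a multiple of \<open>sqrt \<eta>\<close> there, and
  costs a multiple of \<open>\<eta>\<close> on the uniformly timelike segment from \<open>y\<close> to \<open>z\<close>.\<close>

lemma (in conelike) near_tip:
  assumes mem: "y \<in> P" "z \<in> P" "x \<in> P" and pos: "0 < \<tau>" "0 < H" "0 < \<epsilon>"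
    and cs: "cs y z" "cs z x" and far: "\<tau> \<le> rt y x" "T x - T y \<le> H"
    and sat: "rt y x - tip_tolerance m M \<tau> H \<epsilon> \<le> rt y z + rt z x" and small: "rt z x \<le> tip_tolerance m M \<tau> H \<epsilon>"
  shows "T x - T z \<le> \<epsilon>"
proof (rule ccontr)
  assume "\<not> T x - T z \<le> \<epsilon>"
  define \<Delta> where "\<Delta> = T x - T z"
  have \<Delta>: "\<epsilon> < \<Delta>" "0 < \<Delta>" using \<open>\<not> T x - T z \<le> \<epsilon>\<close> pos by (auto simp: \<Delta>_def)
  define c where "c = 160 * M\<^sup>2 * H / \<tau>\<^sup>2"
  define \<eta> where "\<eta> = tip_angle m M \<tau> H"
  define \<kappa> where "\<kappa> = tip_tolerance m M \<tau> H \<epsilon>"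
  note ta = tip_angle[OF mM pos(1,2), folded c_def \<eta>_def]
  have c: "0 < c" using mM pos by (simp add: c_def)
  have \<kappa>: "\<kappa> \<le> \<tau> / 4" "\<kappa> \<le> \<epsilon> * m * sqrt \<eta> / 4" by (auto simp: \<kappa>_def \<eta>_def tip_tolerance_def)
  have Tyz: "0 \<le> T z - T y" using cs_d[OF mem(1,2) cs(1)] d_nonneg[of y z] by linarith
  have Tz: "T z - T y \<le> H" "\<Delta> \<le> H" using Tyz far(2) \<Delta> by (auto simp: \<Delta>_def)
  define a where "a = rt y z"
  have a: "\<tau> / 2 \<le> a" using sat small far(1) \<kappa>(1) by (simp add: a_def \<kappa>_def)
  have a0: "0 < a" using a pos by linarith
  have "a \<le> M * sqrt ((T z - T y)\<^sup>2 - (d y z)\<^sup>2)" unfolding a_def by (rule rt_upper[OF mem(1,2) cs(1)])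
  also have "\<dots> \<le> M * sqrt ((T z - T y)\<^sup>2)" using mM by (intro mult_left_mono real_sqrt_le_mono) auto
  also have "\<dots> \<le> M * H" using mM Tyz Tz by (intro mult_left_mono) auto
  finally have aMH: "a \<le> M * H" .
  have dzx: "d z x \<le> \<Delta>" using cs_d[OF mem(2,3) cs(2)] by (simp add: \<Delta>_def)
  also have "\<dots> < (1 + \<eta>) * \<Delta>" using \<Delta> ta(1) by simp
  \<comment> \<open>The length (1 + \<eta>) \<Delta> replaces \<Delta> because \<open>path\<close>
    needs strict inequality. Moving by the fraction 2 \<eta> compensates for this: (1 - 2 \<eta>) (1
    + \<eta>) <= 1 - \<eta>.\<close>
  finally obtain z' where z': "z' \<in> P" "T z' = T z" "d z z' \<le> 2 * \<eta> * ((1 + \<eta>) * \<Delta>)" "d z' x \<le> (1 - 2 * \<eta>) * ((1 + \<eta>) * \<Delta>)"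
    using path[OF mem(2,3), of "(1 + \<eta>) * \<Delta>" "2 * \<eta>"] ta(1,2) by auto
  have "2 * \<eta> * ((1 + \<eta>) * \<Delta>) \<le> 2 * \<eta> * (2 * \<Delta>)" using ta \<Delta> by (intro mult_left_mono mult_right_mono) auto
  also have "2 * \<eta> * (2 * \<Delta>) = 4 * \<eta> * \<Delta>" by simp
  finally have dzz: "d z z' \<le> 4 * \<eta> * \<Delta>" using z'(3) by linarith
  define l where "l = c * \<eta> * \<Delta>"
  have l0: "0 \<le> l" using c ta(1) \<Delta> by (simp add: l_def)
  have "l \<le> c * \<eta> * H" unfolding l_def using c ta(1) Tz by (intro mult_left_mono) auto
  then have l1: "l \<le> 1" using ta(3) by (simp add: algebra_simps)
  have pert: "cs y z' \<and> (1 - l) * A \<le> rt y z'" if A: "a / 2 \<le> A" "A < a" for A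
  proof (rule perturb[OF mem(1,2) z'(1) _ _ z'(2) l0 l1])
    show A0: "0 < A" using A a0 by linarith
    show "A < rt y z" using A by (simp add: a_def)
    have "\<tau> / 4 \<le> A" using A a by linarith
    then have A2: "(\<tau> / 4)\<^sup>2 \<le> A\<^sup>2" using pos by (intro power_mono) auto
    have "d z z' * (2 * M\<^sup>2 * (T z - T y)) \<le> (4 * \<eta> * \<Delta>) * (2 * M\<^sup>2 * H)"
      using dzz Tyz Tz ta(1) \<Delta> d_nonneg by (intro mult_mono) auto
    also have "\<dots> = 8 * (M\<^sup>2 * H * \<eta> * \<Delta>)" by simp
    also have "\<dots> < 10 * (M\<^sup>2 * H * \<eta> * \<Delta>)" using mM pos ta(1) \<Delta> by simp
    also have "\<dots> = l * (\<tau> / 4)\<^sup>2" using pos by (simp add: l_def c_def power_divide)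
    also have "\<dots> \<le> l * A\<^sup>2" using A2 l0 by (rule mult_left_mono)
    finally show "d z z' * (2 * M\<^sup>2 * (T z - T y)) < l * A\<^sup>2" .
  qed
  have csz: "cs y z'" using pert[of "a / 2"] a0 by simp
  \<comment> \<open>The perturbation lemma is available only for A < a, so the bound at a is
    obtained by letting A increase to a.\<close>
  have "(1 - l) * a \<le> rt y z'"
  proof (rule ccontr)
    assume n: "\<not> (1 - l) * a \<le> rt y z'"
    show False
    proof (cases "l = 1")
      case True
      then show False using n pert[of "a / 2"] a0 by simp
    next
      case False
      then have l: "0 < 1 - l" using l1 by simp
      then have "rt y z' / (1 - l) < a" using n by (simp add: pos_divide_less_eq mult.commute)
      then obtain A where A: "max (a / 2) (rt y z' / (1 - l)) < A" "A < a" using dense[of "max (a / 2) (rt y z' / (1 - l))" a] a0 by auto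
      then have "rt y z' < (1 - l) * A" using l by (simp add: pos_divide_less_eq mult.commute)
      then show False using pert[of A] A by simp
    qed
  qed
  moreover have "l * a \<le> l * (M * H)" using aMH l0 by (rule mult_left_mono)
  moreover have "l * (M * H) = (c * M * H * \<eta>) * \<Delta>" by (simp add: l_def)
  moreover have "(c * M * H * \<eta>) * \<Delta> \<le> (m / 2 * sqrt \<eta>) * \<Delta>" using ta(4) \<Delta> by (intro mult_right_mono) auto
  moreover have "(1 - l) * a = a - l * a" by (simp add: left_diff_distrib)
  ultimately have r1: "a - (m / 2 * sqrt \<eta>) * \<Delta> \<le> rt y z'" by linarith
  have "(1 - 2 * \<eta>) * ((1 + \<eta>) * \<Delta>) = (1 - \<eta>) * \<Delta> - 2 * \<eta>\<^sup>2 * \<Delta>" by (simp add: power2_eq_square algebra_simps)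
  then have dz'x: "d z' x \<le> (1 - \<eta>) * \<Delta>" using z'(4) ta(1) \<Delta> by (smt (verit) mult_nonneg_nonneg zero_le_power2)
  have lt: "d z' x < T x - T z'"
  proof -
    have "(1 - \<eta>) * \<Delta> < 1 * \<Delta>" using ta(1) \<Delta> by (intro mult_strict_right_mono) auto
    then show ?thesis using dz'x z'(2) by (simp add: \<Delta>_def)
  qed
  have "\<eta> * \<Delta>\<^sup>2 \<le> \<Delta>\<^sup>2 - (d z' x)\<^sup>2"
  proof -
    have "(d z' x)\<^sup>2 \<le> ((1 - \<eta>) * \<Delta>)\<^sup>2" using dz'x d_nonneg by (intro power_mono) auto
    also have "\<dots> = (1 - \<eta>)\<^sup>2 * \<Delta>\<^sup>2" by (simp add: power_mult_distrib)
    also have "(1 - \<eta>)\<^sup>2 \<le> 1 - \<eta>" using ta(1,2) by (simp add: power2_eq_square mult_left_le_one_le)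
    then have "(1 - \<eta>)\<^sup>2 * \<Delta>\<^sup>2 \<le> (1 - \<eta>) * \<Delta>\<^sup>2" by (rule mult_right_mono) simp
    finally show ?thesis by (simp add: algebra_simps)
  qed
  then have "sqrt (\<eta> * \<Delta>\<^sup>2) \<le> sqrt ((T x - T z')\<^sup>2 - (d z' x)\<^sup>2)" using z'(2) by (simp add: \<Delta>_def)
  then have "sqrt \<eta> * \<Delta> \<le> sqrt ((T x - T z')\<^sup>2 - (d z' x)\<^sup>2)" using \<Delta> by (simp add: real_sqrt_mult)
  then have "m * (sqrt \<eta> * \<Delta>) \<le> m * sqrt ((T x - T z')\<^sup>2 - (d z' x)\<^sup>2)" using mM by (intro mult_left_mono) auto
  also have "\<dots> \<le> rt z' x" by (rule rt_lower[OF z'(1) mem(3) lt])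
  finally have r2: "m * (sqrt \<eta> * \<Delta>) \<le> rt z' x" .
  have "rt y z' + rt z' x \<le> rt y x" by (rule tri[OF mem(1) z'(1) mem(3) csz cs_lower[OF z'(1) mem(3) lt]])
  \<comment> \<open>The detour through z' gains m * sqrt \<eta> * \<Delta> after z' and loses at
    most half of that before it, while saturation and smallness leave room for only two
    tolerances.\<close>
  with r1 r2 sat small have "m / 2 * sqrt \<eta> * \<Delta> \<le> 2 * \<kappa>" by (simp add: a_def \<kappa>_def algebra_simps)
  also have "\<dots> \<le> m / 2 * sqrt \<eta> * \<epsilon>" using \<kappa>(2) by (simp add: algebra_simps)
  finally have "\<Delta> \<le> \<epsilon>" using mM ta(1) by simp
  then show False using \<Delta> by simp
qed

text \<open>On B the conformal height to x is at least twice the fibre distance bound \<rho>, so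
  \<tau> to the tip lies between m * \<rho> and M * H. These two bounds feed \<open>near_tip\<close>
  and the distortion coefficient, and the resulting factor depends on nothing else of the
  space.\<close>

lemma conelike_contraction:
  fixes X :: "'b lorentz_space"
  assumes cl: "conelike (pts X) (caus X) (\<lambda>x y. enn2real (tsep X x y)) d T m M"
    and X: "lorentzian_pre_length_space X" and fin: "\<And>x y. tsep X x y < \<top>"
    and tmcp: "TMCP_e K N X \<mm>" and N: "0 < N"
    and mm: "space \<mm> = pts X" "sets \<mm> = sets (borel_of (ltop X))" "sigma_finite_measure \<mm>"
    and x: "x \<in> pts X" and B: "compactin (ltop X) B" "B \<in> sets \<mm>" "0 < emeasure \<mm> B" "emeasure \<mm> B < \<infinity>"
    and BH: "\<And>y. y \<in> B \<Longrightarrow> 2 * \<rho> \<le> T x - T y \<and> T x - T y \<le> H \<and> d y x \<le> \<rho>" and \<rho>: "0 < \<rho>" "0 < H" and \<epsilon>: "0 < \<epsilon>"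
    and J: "causal_past X x \<in> sets \<mm>" and E: "E \<in> sets \<mm>" "emeasure \<mm> E < \<infinity>"
    and near: "\<And>z. z \<in> pts X \<Longrightarrow> 0 \<le> T x - T z \<Longrightarrow> T x - T z \<le> \<epsilon> \<Longrightarrow> d z x \<le> \<epsilon> \<Longrightarrow> z \<in> E"
  defines "\<kappa> \<equiv> tip_tolerance m M (m * \<rho>) H \<epsilon>"
  shows "(min (1 / 2) (\<kappa> / (2 * (M * H))) / cosh (sqrt \<bar>K / N\<bar> * (M * H))) powr N * measure \<mm> B \<le> measure \<mm> E"
proof -
  interpret conelike "pts X" "caus X" "\<lambda>x y. enn2real (tsep X x y)" d T m M by (rule cl)
  have \<kappa>: "0 < \<kappa>" unfolding \<kappa>_def using mM \<rho> \<epsilon> by (intro tip_tolerance_pos) auto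
  have MH: "0 < M * H" using mM \<rho> by simp
  \<comment> \<open>Then (1 - t) * \<tau>(y, x) is at most \<kappa> / 2. With the defect \<kappa> /
    2 allowed in the contraction lemma, the distance to the tip stays within the tolerance
    \<kappa>.\<close>
  define t where "t = 1 - min (1 / 2) (\<kappa> / (2 * (M * H)))"
  have t: "0 < t" "t < 1" using \<kappa> MH by (auto simp: t_def)
  have tt: "1 - t = min (1 / 2) (\<kappa> / (2 * (M * H)))" by (simp add: t_def)
  have Bp: "y \<in> pts X" if "y \<in> B" for y using compactin_subset_topspace[OF B(1)] that by auto
  have By: "m * \<rho> \<le> enn2real (tsep X y x)" "enn2real (tsep X y x) \<le> M * H" if y: "y \<in> B" for y
  proof -
    have lt: "d y x < T x - T y" using BH[OF y] \<rho> by linarith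
    have dn: "0 \<le> d y x" by (rule d_nonneg)
    have T0: "0 \<le> T x - T y" using lt dn by linarith
    have "\<rho>\<^sup>2 \<le> (T x - T y)\<^sup>2 - (d y x)\<^sup>2"
    proof -
      have "(2 * \<rho>)\<^sup>2 \<le> (T x - T y)\<^sup>2" using BH[OF y] \<rho> by (intro power_mono) auto
      moreover have "(d y x)\<^sup>2 \<le> \<rho>\<^sup>2" using BH[OF y] dn by (intro power_mono) auto
      moreover have "(2 * \<rho>)\<^sup>2 = 4 * \<rho>\<^sup>2" by (simp add: power2_eq_square)
      moreover have "0 \<le> \<rho>\<^sup>2" by simp
      ultimately show ?thesis by linarith
    qed
    then have "sqrt (\<rho>\<^sup>2) \<le> sqrt ((T x - T y)\<^sup>2 - (d y x)\<^sup>2)" by (rule real_sqrt_le_mono)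
    then have "m * \<rho> \<le> m * sqrt ((T x - T y)\<^sup>2 - (d y x)\<^sup>2)" using mM \<rho> by (intro mult_left_mono) auto
    also have "\<dots> \<le> enn2real (tsep X y x)" by (rule rt_lower[OF Bp[OF y] x lt])
    finally show "m * \<rho> \<le> enn2real (tsep X y x)" .
    have "enn2real (tsep X y x) \<le> M * sqrt ((T x - T y)\<^sup>2 - (d y x)\<^sup>2)"
      by (rule rt_upper[OF Bp[OF y] x cs_lower[OF Bp[OF y] x lt]])
    also have "\<dots> \<le> M * sqrt ((T x - T y)\<^sup>2)" using mM by (intro mult_left_mono real_sqrt_le_mono) auto
    also have "\<dots> \<le> M * H" using mM T0 BH[OF y] by (intro mult_left_mono) auto
    finally show "enn2real (tsep X y x) \<le> M * H" .
  qed
  have eq: "tsep X y z = ennreal (enn2real (tsep X y z))" for y z using fin[of y z] by simp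
  have "((1 - t) / cosh (sqrt \<bar>K / N\<bar> * (M * H))) powr N * measure \<mm> B \<le> measure \<mm> E"
  proof (rule TMCP_contraction[OF X tmcp N mm x t B _ _ J E, where \<delta> = "\<kappa> / 2"])
    fix y assume y: "y \<in> B"
    have "0 < m * \<rho>" using mM \<rho> by simp
    then have "0 < enn2real (tsep X y x)" using By(1)[OF y] by linarith
    then have "0 < tsep X y x" by (simp add: enn2real_positive_iff)
    moreover have "tsep X y x \<le> ennreal (M * H)" using By(2)[OF y] by (subst eq) (rule ennreal_leI)
    ultimately show "0 < tsep X y x \<and> tsep X y x \<le> ennreal (M * H)" ..
  next
    fix y z assume yz: "y \<in> B" "z \<in> pts X" "caus X y z" "caus X z x"
      and s: "enn2real (tsep X y x) - \<kappa> / 2 \<le> enn2real (tsep X y z) + enn2real (tsep X z x)"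
        "enn2real (tsep X z x) \<le> (1 - t) * enn2real (tsep X y x) + \<kappa> / 2"
    have "(1 - t) * enn2real (tsep X y x) \<le> (1 - t) * (M * H)" using By(2)[OF yz(1)] t by (intro mult_left_mono) auto
    also have "\<dots> \<le> \<kappa> / (2 * (M * H)) * (M * H)" unfolding tt using MH by (intro mult_right_mono) auto
    also have "\<kappa> / (2 * q) * q = \<kappa> / 2" if "0 < q" for q using that by simp
    note this[OF MH]
    finally have sm: "enn2real (tsep X z x) \<le> \<kappa>" using s(2) by linarith
    have "T x - T z \<le> \<epsilon>"
    proof (rule near_tip[OF Bp[OF yz(1)] yz(2) x _ _ _ yz(3,4)])
      show "0 < m * \<rho>" using mM \<rho> by simp
      show "m * \<rho> \<le> enn2real (tsep X y x)" by (rule By[OF yz(1)])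
      show "T x - T y \<le> H" using BH[OF yz(1)] by simp
      show "enn2real (tsep X y x) - tip_tolerance m M (m * \<rho>) H \<epsilon> \<le> enn2real (tsep X y z) + enn2real (tsep X z x)"
        using s(1) \<kappa> unfolding \<kappa>_def[symmetric] by linarith
      show "enn2real (tsep X z x) \<le> tip_tolerance m M (m * \<rho>) H \<epsilon>" using sm by (simp add: \<kappa>_def)
    qed (use \<rho> \<epsilon> in auto)
    moreover have "d z x \<le> T x - T z" by (rule cs_d[OF yz(2) x yz(4)])
    ultimately show "z \<in> E" using d_nonneg[of z x] by (intro near[OF yz(2)]) auto
  qed (use \<kappa> MH in auto)
  then show ?thesis unfolding tt .
qed

section \<open>Cones and their reversals as instances of the contraction argument\<close>

locale lorentzian_cone = bounded_cone f Y m M for f :: "real \<Rightarrow> real" and Y :: "'a metric" and m M :: real +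
  assumes pre: "lorentzian_pre_length_space (generalized_cone UNIV f Y)"
    and hyperbolic: "globally_hyperbolic (generalized_cone UNIV f Y)"
begin

lemma met_X [simp]: "met X = cone_metric UNIV Y"
  by (simp add: generalized_cone_def)

lemma tsep_finite: "tsep X p q < \<top>"
proof -
  have "tsep X (fst p, snd p) (fst q, snd q) < \<top>" by (rule le_less_trans[OF tsep_upper]) simp
  then show ?thesis by simp
qed

lemma tsep_real: "tsep X p q = ennreal (enn2real (tsep X p q))"
  using tsep_finite[of p q] by simp

lemma tsep_triangle:
  "p \<in> pts X \<Longrightarrow> q \<in> pts X \<Longrightarrow> r \<in> pts X \<Longrightarrow> caus X p q \<Longrightarrow> caus X q r \<Longrightarrow> tsep X p q + tsep X q r \<le> tsep X p r"
  using pre unfolding lorentzian_pre_length_space_def by blast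

lemma tsep_real_triangle:
  assumes "p \<in> pts X" "q \<in> pts X" "r \<in> pts X" "caus X p q" "caus X q r"
  shows "enn2real (tsep X p q) + enn2real (tsep X q r) \<le> enn2real (tsep X p r)"
proof -
  have "ennreal (enn2real (tsep X p q) + enn2real (tsep X q r)) \<le> ennreal (enn2real (tsep X p r))"
    using tsep_triangle[OF assms] tsep_real[of p q] tsep_real[of q r] tsep_real[of p r] by (metis ennreal_plus enn2real_nonneg)
  then show ?thesis by (subst (asm) ennreal_le_iff) auto
qed

lemma chron_imp_caus: "p \<in> pts X \<Longrightarrow> q \<in> pts X \<Longrightarrow> chron X p q \<Longrightarrow> caus X p q"
  using pre unfolding lorentzian_pre_length_space_def by blast

lemma caus_trans: "p \<in> pts X \<Longrightarrow> q \<in> pts X \<Longrightarrow> r \<in> pts X \<Longrightarrow> caus X p q \<Longrightarrow> caus X q r \<Longrightarrow> caus X p r"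
  using pre unfolding lorentzian_pre_length_space_def transp_on_def by blast

lemma real_tsep_upper:
  assumes "caus X p q"
  shows "enn2real (tsep X p q) \<le> M * sqrt ((F (fst q) - F (fst p))\<^sup>2 - (mdist Y (snd p) (snd q))\<^sup>2)"
proof -
  have c: "caus X (fst p, snd p) (fst q, snd q)" using assms by simp
  have "0 \<le> (F (fst q) - F (fst p))\<^sup>2 - (mdist Y (snd p) (snd q))\<^sup>2"
    using caus_upper(4)[OF c] by (simp add: power_mono)
  moreover have "tsep X p q \<le> ennreal (M * sqrt ((F (fst q) - F (fst p))\<^sup>2 - (mdist Y (snd p) (snd q))\<^sup>2))"
    using tsep_upper[of "fst p" "snd p" "fst q" "snd q"] by simp
  ultimately show ?thesis using M_pos by (intro enn2real_leI) auto
qed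

lemma chron_real_lower:
  assumes p: "p \<in> pts X" "q \<in> pts X" and d: "mdist Y (snd p) (snd q) < F (fst q) - F (fst p)"
  shows "chron X p q" "caus X p q" "m * sqrt ((F (fst q) - F (fst p))\<^sup>2 - (mdist Y (snd p) (snd q))\<^sup>2) \<le> enn2real (tsep X p q)"
proof -
  have mem: "snd p \<in> mspace Y" "snd q \<in> mspace Y" using p by auto
  show c: "chron X p q" using chron_lower(1)[OF mem d] by simp
  show "caus X p q" by (rule chron_imp_caus[OF p c])
  have "ennreal (m * sqrt ((F (fst q) - F (fst p))\<^sup>2 - (mdist Y (snd p) (snd q))\<^sup>2)) \<le> ennreal (enn2real (tsep X p q))"
    using chron_lower(2)[OF mem d] tsep_real[of p q] by simp
  then show "m * sqrt ((F (fst q) - F (fst p))\<^sup>2 - (mdist Y (snd p) (snd q))\<^sup>2) \<le> enn2real (tsep X p q)"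
    by (subst (asm) ennreal_le_iff) auto
qed

lemma fibre_path:
  assumes "w \<in> mspace Y" "u \<in> mspace Y" "mdist Y w u < D" "0 \<le> h" "h \<le> 1"
  shows "\<exists>w'\<in>mspace Y. mdist Y w w' \<le> h * D \<and> mdist Y w' u \<le> (1 - h) * D"
proof -
  obtain B where B: "Lipschitz_path Y 1 B" "\<And>r. r \<le> 0 \<Longrightarrow> B r = w" "\<And>r. r \<ge> D \<Longrightarrow> B r = u"
    using length_space_path[OF Y assms(1-3)] by blast
  have D: "0 \<le> D" using assms(3) mdist_nonneg[of Y w u] by linarith
  have "mdist Y (B 0) (B (h * D)) \<le> 1 * \<bar>0 - h * D\<bar>" "mdist Y (B (h * D)) (B D) \<le> 1 * \<bar>h * D - D\<bar>"
    using B(1) unfolding Lipschitz_path_def by blast+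
  moreover have "\<bar>h * D - D\<bar> = (1 - h) * D"
  proof -
    have "h * D \<le> 1 * D" using D assms by (intro mult_right_mono) auto
    then show ?thesis by (simp add: left_diff_distrib)
  qed
  ultimately show ?thesis using B D assms unfolding Lipschitz_path_def by (intro bexI[of _ "B (h * D)"]) auto
qed

lemma conelike_forward:
  "conelike (pts X) (caus X) (\<lambda>x y. enn2real (tsep X x y)) (\<lambda>p q. mdist Y (snd p) (snd q)) (\<lambda>p. F (fst p)) m M"
proof
  fix y z z' :: "real \<times> 'a" and A l :: real
  assume mem: "y \<in> pts X" "z \<in> pts X" "z' \<in> pts X" and A: "0 < A" "A < enn2real (tsep X y z)"
    and T: "F (fst z') = F (fst z)" and l: "0 \<le> l" "l \<le> 1"
    and s: "mdist Y (snd z) (snd z') * (2 * M\<^sup>2 * (F (fst z) - F (fst y))) < l * A\<^sup>2"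
  have mY: "snd y \<in> mspace Y" "snd z' \<in> mspace Y" using mem by auto
  have "ennreal A < ennreal (enn2real (tsep X y z))" using A by (simp add: ennreal_less_iff)
  then have A': "ennreal A < tsep X (fst y, snd y) (fst z, snd z)" using tsep_real[of y z] by simp
  have "mdist Y (snd y) (snd y) = 0" using mdist_zero[OF mY(1) mY(1)] by blast
  then have s': "(mdist Y (snd y) (snd y) + mdist Y (snd z) (snd z')) * (2 * M\<^sup>2 * (F (fst z) - F (fst y))) < l * A\<^sup>2"
    using s by (simp only: add_0)
  have "fst z' = fst z" using T F_le_iff by (metis order_antisym order_refl)
  then have z': "(fst z, snd z') = z'" by (metis prod.collapse)
  note P = tsep_perturb[OF mY A(1) A' l s', unfolded z' prod.collapse]
  have "ennreal ((1 - l) * A) \<le> ennreal (enn2real (tsep X y z'))" using P(2) tsep_real[of y z'] by simp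
  then have "(1 - l) * A \<le> enn2real (tsep X y z')" by (subst (asm) ennreal_le_iff) auto
  with P(1) show "caus X y z' \<and> (1 - l) * A \<le> enn2real (tsep X y z')" by blast
next
  fix z x :: "real \<times> 'a" and D h :: real
  assume "z \<in> pts X" "x \<in> pts X" "mdist Y (snd z) (snd x) < D" "0 \<le> h" "h \<le> 1"
  with fibre_path[of "snd z" "snd x" D h] obtain w where "w \<in> mspace Y" "mdist Y (snd z) w \<le> h * D" "mdist Y w (snd x) \<le> (1 - h) * D"
    by auto
  then show "\<exists>z'\<in>pts X. F (fst z') = F (fst z) \<and> mdist Y (snd z) (snd z') \<le> h * D \<and> mdist Y (snd z') (snd x) \<le> (1 - h) * D"
    by (intro bexI[of _ "(fst z, w)"]) auto
next
  fix x y :: "real \<times> 'a" assume "caus X x y"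
  then show "mdist Y (snd x) (snd y) \<le> F (fst y) - F (fst x)" using caus_upper(4)[of "fst x" "snd x" "fst y" "snd y"] by simp
qed (use m M_pos real_tsep_upper chron_real_lower tsep_real_triangle in auto)

text \<open>After reversal the moved endpoint is the earlier one; \<open>tsep_perturb\<close> allows
  both endpoints to move for this reason.\<close>

lemma conelike_backward:
  "conelike (pts (causal_reversal X)) (caus (causal_reversal X)) (\<lambda>x y. enn2real (tsep (causal_reversal X) x y))
    (\<lambda>p q. mdist Y (snd p) (snd q)) (\<lambda>p. - F (fst p)) m M"
proof -
  have r: "pts (causal_reversal X) = pts X" "caus (causal_reversal X) = (\<lambda>x y. caus X y x)"
    "tsep (causal_reversal X) = (\<lambda>x y. tsep X y x)" by (simp_all add: causal_reversal_def)
  show ?thesis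
    unfolding r
  proof
    fix y z z' :: "real \<times> 'a" and A l :: real
    assume mem: "y \<in> pts X" "z \<in> pts X" "z' \<in> pts X" and A: "0 < A" "A < enn2real (tsep X z y)"
      and T: "- F (fst z') = - F (fst z)" and l: "0 \<le> l" "l \<le> 1"
      and s: "mdist Y (snd z) (snd z') * (2 * M\<^sup>2 * (- F (fst z) - - F (fst y))) < l * A\<^sup>2"
    have mY: "snd z' \<in> mspace Y" "snd y \<in> mspace Y" using mem by auto
    have "ennreal A < ennreal (enn2real (tsep X z y))" using A by (simp add: ennreal_less_iff)
    then have A': "ennreal A < tsep X (fst z, snd z) (fst y, snd y)" using tsep_real[of z y] by simp
    have "mdist Y (snd y) (snd y) = 0" using mdist_zero[OF mY(2) mY(2)] by blast
    then have s': "(mdist Y (snd z') (snd z) + mdist Y (snd y) (snd y)) * (2 * M\<^sup>2 * (F (fst y) - F (fst z))) < l * A\<^sup>2"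
      using s by (simp only: add_0_right mdist_commute[of Y "snd z'"]) simp
    have "fst z' = fst z" using T F_le_iff by (metis add.inverse_inverse order_antisym order_refl)
    then have z': "(fst z, snd z') = z'" by (metis prod.collapse)
    note P = tsep_perturb[OF mY A(1) A' l s', unfolded z' prod.collapse]
    have "ennreal ((1 - l) * A) \<le> ennreal (enn2real (tsep X z' y))" using P(2) tsep_real[of z' y] by simp
    then have "(1 - l) * A \<le> enn2real (tsep X z' y)" by (subst (asm) ennreal_le_iff) auto
    with P(1) show "caus X z' y \<and> (1 - l) * A \<le> enn2real (tsep X z' y)" by blast
  next
    fix z x :: "real \<times> 'a" and D h :: real
    assume "z \<in> pts X" "x \<in> pts X" "mdist Y (snd z) (snd x) < D" "0 \<le> h" "h \<le> 1"
    with fibre_path[of "snd z" "snd x" D h] obtain w where "w \<in> mspace Y" "mdist Y (snd z) w \<le> h * D" "mdist Y w (snd x) \<le> (1 - h) * D"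
      by auto
    then show "\<exists>z'\<in>pts X. - F (fst z') = - F (fst z) \<and> mdist Y (snd z) (snd z') \<le> h * D \<and> mdist Y (snd z') (snd x) \<le> (1 - h) * D"
      by (intro bexI[of _ "(fst z, w)"]) auto
  next
    fix x y :: "real \<times> 'a" assume c: "caus X y x"
    then show "mdist Y (snd x) (snd y) \<le> - F (fst y) - - F (fst x)"
      using caus_upper(4)[of "fst y" "snd y" "fst x" "snd x"] by (simp add: mdist_commute)
    show "enn2real (tsep X y x) \<le> M * sqrt ((- F (fst y) - - F (fst x))\<^sup>2 - (mdist Y (snd x) (snd y))\<^sup>2)"
      using real_tsep_upper[OF c] by (simp add: mdist_commute)
  next
    fix x y :: "real \<times> 'a" assume xy: "x \<in> pts X" "y \<in> pts X" "mdist Y (snd x) (snd y) < - F (fst y) - - F (fst x)"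
    then have lt: "mdist Y (snd y) (snd x) < F (fst x) - F (fst y)" by (simp add: mdist_commute)
    show "caus X y x" by (rule chron_real_lower(2)[OF xy(2,1) lt])
    show "m * sqrt ((- F (fst y) - - F (fst x))\<^sup>2 - (mdist Y (snd x) (snd y))\<^sup>2) \<le> enn2real (tsep X y x)"
      using chron_real_lower(3)[OF xy(2,1) lt] by (simp add: mdist_commute)
  next
    fix x y z assume "x \<in> pts X" "y \<in> pts X" "z \<in> pts X" "caus X y x" "caus X z y"
    then show "enn2real (tsep X y x) + enn2real (tsep X z y) \<le> enn2real (tsep X z x)"
      using tsep_real_triangle[of z y x] by simp
  qed (use m M_pos in auto)
qed
end

lemma openin_mtopology_of_iff:
  "openin (mtopology_of Z) U \<longleftrightarrow> U \<subseteq> mspace Z \<and> (\<forall>x\<in>U. \<exists>r>0. \<forall>y\<in>mspace Z. mdist Z x y < r \<longrightarrow> y \<in> U)"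
proof -
  have "Metric_space (mspace Z) (mdist Z)" by simp
  then have *: "openin (mtopology_of Z) U \<longleftrightarrow> U \<subseteq> mspace Z \<and> (\<forall>x\<in>U. \<exists>r>0. Metric_space.mball (mspace Z) (mdist Z) x r \<subseteq> U)"
    unfolding mtopology_of_def by (auto simp: Metric_space.openin_mtopology)
  have "Metric_space.mball (mspace Z) (mdist Z) x r = {y. x \<in> mspace Z \<and> y \<in> mspace Z \<and> mdist Z x y < r}" for x r
    by (auto simp: Metric_space.in_mball)
  then show ?thesis unfolding * by (intro conj_cong refl ball_cong ex_cong) auto
qed

lemma lorentzian_pre_length_space_reversal:
  assumes pre: "lorentzian_pre_length_space X"
  shows "lorentzian_pre_length_space (causal_reversal X)"
proof -
  have sw: "openin (prod_topology (ltop X) (ltop X)) {z \<in> pts X \<times> pts X. c < tsep X (snd z) (fst z)}" for c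
  proof -
    have "openin (prod_topology (ltop X) (ltop X)) {z \<in> pts X \<times> pts X. c < tsep X (fst z) (snd z)}"
      using pre unfolding lorentzian_pre_length_space_def by blast
    moreover have "continuous_map (prod_topology (ltop X) (ltop X)) (prod_topology (ltop X) (ltop X)) (\<lambda>z. (snd z, fst z))"
      by (intro continuous_map_pairedI continuous_map_fst continuous_map_snd)
    ultimately have "openin (prod_topology (ltop X) (ltop X)) {z \<in> topspace (prod_topology (ltop X) (ltop X)).
        (snd z, fst z) \<in> {z \<in> pts X \<times> pts X. c < tsep X (fst z) (snd z)}}" by (rule openin_continuous_map_preimage[rotated])
    moreover have "{z \<in> topspace (prod_topology (ltop X) (ltop X)). (snd z, fst z) \<in> {z \<in> pts X \<times> pts X. c < tsep X (fst z) (snd z)}}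
      = {z \<in> pts X \<times> pts X. c < tsep X (snd z) (fst z)}" by auto
    ultimately show ?thesis by simp
  qed
  have r: "pts (causal_reversal X) = pts X" "caus (causal_reversal X) p q = caus X q p" "met (causal_reversal X) = met X"
    "chron (causal_reversal X) p q = chron X q p" "tsep (causal_reversal X) p q = tsep X q p" for p q
    by (simp_all add: causal_reversal_def)
  note P = pre[unfolded lorentzian_pre_length_space_def transp_on_def reflp_on_def]
  note P1 = conjunct1[OF P] and P2 = conjunct1[OF conjunct2[OF P]]
    and P6 = conjunct1[OF conjunct2[OF conjunct2[OF conjunct2[OF conjunct2[OF conjunct2[OF P]]]]]]
  show ?thesis
    unfolding lorentzian_pre_length_space_def transp_on_def reflp_on_def r
  proof (intro conjI ballI impI allI)
    fix x y z assume xyz: "x \<in> pts X" "y \<in> pts X" "z \<in> pts X"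
    show "chron X z x" if "chron X y x" "chron X z y" using P1 xyz that by blast
    show "caus X z x" if "caus X y x" "caus X z y" using P2 xyz that by blast
    show "tsep X y x + tsep X z y \<le> tsep X z x" if "caus X y x" "caus X z y"
      unfolding add.commute[of "tsep X y x"] using P6 xyz that by blast
  next
    show "openin (prod_topology (ltop X) (ltop X)) {z \<in> pts X \<times> pts X. c < tsep X (snd z) (fst z)}" for c by (rule sw)
  qed (use P in blast)+
qed

section \<open>Boxes, diamonds and their Borel measurability\<close>

context lorentzian_cone
begin

definition box :: "real \<Rightarrow> 'a \<Rightarrow> real \<Rightarrow> real \<Rightarrow> (real \<times> 'a) set" where
  "box t u a b = {(s, w). w \<in> mspace Y \<and> \<bar>s - t\<bar> \<le> a \<and> mdist Y u w \<le> b}"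

lemma closedin_box:
  assumes u: "u \<in> mspace Y"
  shows "closedin (ltop X) (box t u a b)"
proof -
  have "openin (ltop X) (pts X - box t u a b)"
    unfolding openin_mtopology_of_iff
  proof (intro conjI ballI)
    fix p assume p: "p \<in> pts X - box t u a b"
    obtain s w where sw: "p = (s, w)" "w \<in> mspace Y" using p by auto
    consider "a < \<bar>s - t\<bar>" | "b < mdist Y u w" using p sw by (auto simp: box_def not_le)
    then show "\<exists>r>0. \<forall>q\<in>mspace (met X). mdist (met X) p q < r \<longrightarrow> q \<in> pts X - box t u a b"
    proof cases
      case 1
      show ?thesis
      proof (intro exI[of _ "\<bar>s - t\<bar> - a"] conjI ballI impI)
        fix q assume q: "q \<in> mspace (met X)" "mdist (met X) p q < \<bar>s - t\<bar> - a"
        obtain s' w' where q': "q = (s', w')" by (cases q)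
        have "\<bar>s - s'\<bar> + mdist Y w w' < \<bar>s - t\<bar> - a" using q sw q' by simp
        then have "a < \<bar>s' - t\<bar>" using mdist_nonneg[of Y w w'] by linarith
        then show "q \<in> pts X - box t u a b" using q q' by (auto simp: box_def)
      qed (use 1 in simp)
    next
      case 2
      show ?thesis
      proof (intro exI[of _ "mdist Y u w - b"] conjI ballI impI)
        fix q assume q: "q \<in> mspace (met X)" "mdist (met X) p q < mdist Y u w - b"
        obtain s' w' where q': "q = (s', w')" "w' \<in> mspace Y" using q by auto
        have "mdist Y w w' < mdist Y u w - b" using q sw q' by simp
        then have "b < mdist Y u w'" using mdist_triangle[OF u q'(2) sw(2)] by (simp add: mdist_commute)
        then show "q \<in> pts X - box t u a b" using q q' by (auto simp: box_def)
      qed (use 2 in simp)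
    qed
  qed auto
  moreover have "box t u a b \<subseteq> pts X" by (auto simp: box_def)
  ultimately show ?thesis by (simp add: closedin_def)
qed

lemma compactin_diamond: "p \<in> pts X \<Longrightarrow> q \<in> pts X \<Longrightarrow> compactin (ltop X) (causal_diamond X p q)"
  using hyperbolic unfolding globally_hyperbolic_def by blast

lemma below_far:
  assumes "u \<in> mspace Y" "y \<in> mspace Y"
  shows "mdist Y u y * M < s - s' \<Longrightarrow> chron X (s', y) (s, u) \<and> caus X (s', y) (s, u)"
    and "mdist Y u y * M < s' - s \<Longrightarrow> chron X (s, u) (s', y) \<and> caus X (s, u) (s', y)"
proof -
  assume h: "mdist Y u y * M < s - s'"
  have "s' \<le> s" using h M_pos mdist_nonneg[of Y u y] by (smt (verit) mult_nonneg_nonneg)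
  then have "mdist Y u y < F s - F s'" using F_bounds(1)[of s' s] h M_pos by (smt (verit) pos_less_divide_eq)
  then show "chron X (s', y) (s, u) \<and> caus X (s', y) (s, u)"
    using chron_real_lower(1,2)[of "(s', y)" "(s, u)"] assms by (simp add: mdist_commute)
next
  assume h: "mdist Y u y * M < s' - s"
  have "s \<le> s'" using h M_pos mdist_nonneg[of Y u y] by (smt (verit) mult_nonneg_nonneg)
  then have "mdist Y u y < F s' - F s" using F_bounds(1)[of s s'] h M_pos by (smt (verit) pos_less_divide_eq)
  then show "chron X (s, u) (s', y) \<and> caus X (s, u) (s', y)"
    using chron_real_lower(1,2)[of "(s, u)" "(s', y)"] assms by simp
qed

text \<open>A box is a closed subset of a causal diamond, so its compactness comes from global
  hyperbolicity and not from any compactness of balls of the fibre.\<close>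

lemma compactin_box:
  assumes u: "u \<in> mspace Y"
  shows "compactin (ltop X) (box t u a b)"
proof -
  \<comment> \<open>Time b * M suffices to cross the fibre distance b, a is the half height of the
    box, and 1 gives strict inequalities.\<close>
  define r where "r = a + b * M + 1"
  have "box t u a b \<subseteq> causal_diamond X (t - r, u) (t + r, u)"
  proof
    fix p assume "p \<in> box t u a b"
    then obtain s w where p: "p = (s, w)" "w \<in> mspace Y" "\<bar>s - t\<bar> \<le> a" "mdist Y u w \<le> b" by (auto simp: box_def)
    have "mdist Y w u * M \<le> b * M" using p M_pos by (simp add: mdist_commute)
    then have "mdist Y w u * M < s - (t - r)" "mdist Y w u * M < (t + r) - s" using p(3) by (auto simp: r_def)
    then show "p \<in> causal_diamond X (t - r, u) (t + r, u)"
      using below_far[OF p(2) u] p u by (auto simp: causal_diamond_def causal_future_def causal_past_def)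
  qed
  then show ?thesis using closed_compactin[OF compactin_diamond _ closedin_box[OF u]] u by auto
qed

lemma closedin_diamond: "p \<in> pts X \<Longrightarrow> q \<in> pts X \<Longrightarrow> closedin (ltop X) (causal_diamond X p q)"
proof (rule compactin_imp_closedin[OF _ compactin_diamond])
  show "Hausdorff_space (ltop X)"
    unfolding mtopology_of_def by (rule Metric_space.Hausdorff_space_mtopology[OF Metric_space_mspace_mdist])
qed



text \<open>The past is a countable union of diamonds with lower tips below x on the same fibre
  point; these are compact, hence closed.\<close>

lemma causal_past_borel:
  assumes x: "x \<in> pts X"
  shows "causal_past X x \<in> sets (borel_of (ltop X))"
proof -
  have "causal_past X x = (\<Union>n::nat. causal_diamond X (fst x - real n, snd x) x)"
  proof (intro equalityI subsetI)
    fix p assume p: "p \<in> causal_past X x"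
    then have pm: "p \<in> pts X" "caus X p x" by (auto simp: causal_past_def)
    obtain n :: nat where n: "mdist Y (snd p) (snd x) * M - fst p + fst x < real n" using reals_Archimedean2 by blast
    have "caus X (fst x - real n, snd x) (fst p, snd p)"
      by (rule conjunct2[OF below_far(1)]) (use n pm x in auto)
    then show "p \<in> (\<Union>n::nat. causal_diamond X (fst x - real n, snd x) x)"
      using pm by (auto simp: causal_diamond_def causal_future_def causal_past_def)
  qed (auto simp: causal_diamond_def)
  moreover have "causal_diamond X (fst x - real n, snd x) x \<in> sets (borel_of (ltop X))" for n :: nat
    by (rule closedin_borel_of[OF closedin_diamond]) (use x in auto)
  ultimately show ?thesis by auto
qed

lemma causal_future_borel:
  assumes x: "x \<in> pts X"
  shows "causal_future X x \<in> sets (borel_of (ltop X))"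
proof -
  have "causal_future X x = (\<Union>n::nat. causal_diamond X x (fst x + real n, snd x))"
  proof (intro equalityI subsetI)
    fix p assume p: "p \<in> causal_future X x"
    then have pm: "p \<in> pts X" "caus X x p" by (auto simp: causal_future_def)
    obtain n :: nat where n: "mdist Y (snd p) (snd x) * M + fst p - fst x < real n" using reals_Archimedean2 by blast
    have "caus X (fst p, snd p) (fst x + real n, snd x)"
      by (rule conjunct2[OF below_far(2)]) (use n pm x in auto)
    then show "p \<in> (\<Union>n::nat. causal_diamond X x (fst x + real n, snd x))"
      using pm by (auto simp: causal_diamond_def causal_future_def causal_past_def)
  qed (auto simp: causal_diamond_def)
  moreover have "causal_diamond X x (fst x + real n, snd x) \<in> sets (borel_of (ltop X))" for n :: nat
    by (rule closedin_borel_of[OF closedin_diamond]) (use x in auto)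
  ultimately show ?thesis by auto
qed
end

section \<open>Volume comparison of boxes and the packing bound\<close>

lemma radon_compact_finite:
  assumes r: "radon_measure T \<mm>" and C: "compactin T C" and cl: "closedin T C"
  shows "emeasure \<mm> C < \<infinity>"
proof -
  have sets: "sets \<mm> = sets (borel_of T)" using r by (simp add: radon_measure_def)
  define \<U> where "\<U> = {U. openin T U \<and> emeasure \<mm> U < \<infinity>}"
  have "C \<subseteq> \<Union>\<U>"
    using compactin_subset_topspace[OF C] r unfolding radon_measure_def \<U>_def by blast
  then obtain \<F> where \<F>: "finite \<F>" "\<F> \<subseteq> \<U>" "C \<subseteq> \<Union>\<F>"
    using compactinD[OF C, of \<U>] unfolding \<U>_def by blast
  have m: "U \<in> sets \<mm>" if "U \<in> \<F>" for U using that \<F>(2) sets borel_of_sets by (auto simp: \<U>_def)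
  have "emeasure \<mm> C \<le> emeasure \<mm> (\<Union>U\<in>\<F>. U)"
    using \<F> m sets closedin_borel_of[OF cl] by (intro emeasure_mono) auto
  also have "\<dots> \<le> (\<Sum>U\<in>\<F>. emeasure \<mm> U)" using \<F>(1) m by (intro emeasure_subadditive_finite) auto
  also have "\<dots> < \<infinity>" using \<F>(1,2) by (auto simp: \<U>_def less_top)
  finally show ?thesis .
qed

locale TMCP_cone = lorentzian_cone f Y m M for f :: "real \<Rightarrow> real" and Y :: "'a metric" and m M :: real +
  fixes \<mm> :: "(real \<times> 'a) measure" and K N :: real
  assumes radon: "radon_measure (ltop X) \<mm>" and support: "full_support (ltop X) \<mm>"
    and N: "0 < N" and tmcp: "TMCP_e K N X \<mm>" "TMCP_e K N (causal_reversal X) \<mm>"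
begin

lemma mm: "space \<mm> = pts X" "sets \<mm> = sets (borel_of (ltop X))"
  using radon by (auto simp: radon_measure_def)

lemma box_sets: "u \<in> mspace Y \<Longrightarrow> box t u a b \<in> sets \<mm>"
  unfolding mm by (rule closedin_borel_of[OF closedin_box])

lemma box_finite: "u \<in> mspace Y \<Longrightarrow> emeasure \<mm> (box t u a b) < \<infinity>"
  by (rule radon_compact_finite[OF radon compactin_box closedin_box])

lemma box_positive:
  assumes u: "u \<in> mspace Y" and ab: "0 < a" "0 < b"
  shows "0 < emeasure \<mm> (box t u a b)"
proof -
  let ?U = "mball_of (met X) (t, u) (min a b)"
  have c: "(t, u) \<in> pts X" using u by simp
  have z: "mdist Y u u = 0" using mdist_zero[OF u u] by blast
  have "openin (ltop X) ?U" by (rule openin_mball_of)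
  moreover have "(t, u) \<in> ?U" using c ab z by (simp del: mdist_zero)
  ultimately have "0 < emeasure \<mm> ?U" using support unfolding full_support_def by blast
  also have "\<dots> \<le> emeasure \<mm> (box t u a b)"
  proof (rule emeasure_mono)
    show "?U \<subseteq> box t u a b"
    proof
      fix p assume "p \<in> ?U"
      then obtain s w where p: "p = (s, w)" "w \<in> mspace Y" "\<bar>t - s\<bar> + mdist Y u w < min a b" by (cases p) auto
      have "\<bar>s - t\<bar> \<le> a" "mdist Y u w \<le> b" using p(3) mdist_nonneg[of Y u w] by linarith+
      then show "p \<in> box t u a b" using p by (simp add: box_def)
    qed
  qed (rule box_sets[OF u])
  finally show ?thesis .
qed

lemma sigma_finite: "sigma_finite_measure \<mm>"
proof (cases "mspace Y = {}")
  case True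
  then have "space \<mm> = {}" using mm by simp
  then show ?thesis by (intro sigma_finite_measure.intro) (auto intro!: exI[of _ "{}"])
next
  case False
  then obtain u where u: "u \<in> mspace Y" by blast
  show ?thesis
  proof (rule sigma_finite_measure.intro, intro exI[of _ "range (\<lambda>n::nat. box 0 u (real n) (real n))"] conjI ballI)
    show "\<Union>(range (\<lambda>n::nat. box 0 u (real n) (real n))) = space \<mm>"
    proof (intro equalityI subsetI)
      fix p assume "p \<in> space \<mm>"
      then obtain s w where p: "p = (s, w)" "w \<in> mspace Y" using mm by auto
      obtain n :: nat where "max \<bar>s\<bar> (mdist Y u w) < real n" using reals_Archimedean2 by blast
      then have "p \<in> box 0 u (real n) (real n)" using p by (simp add: box_def)
      then show "p \<in> \<Union>(range (\<lambda>n::nat. box 0 u (real n) (real n)))" by blast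
    qed (auto simp: mm box_def)
    show "emeasure \<mm> a \<noteq> \<infinity>" if "a \<in> range (\<lambda>n::nat. box 0 u (real n) (real n))" for a
      using that less_imp_neq[OF box_finite[OF u]] by (metis (no_types, lifting) imageE)
  qed (use box_sets[OF u] in auto)
qed

text \<open>The volume ratio of \<open>conelike_contraction\<close> for the lower bound m * \<rho>
  of \<tau>. It is placed outside the locale because it must be common to all cones of the
  class.\<close>

definition (in -) packing_factor :: "real \<Rightarrow> real \<Rightarrow> real \<Rightarrow> real \<Rightarrow> real \<Rightarrow> real \<Rightarrow> real" where
  "packing_factor m M K N \<rho> \<epsilon> = (let H = (2 + 2 * M * \<rho>) / m; \<kappa> = tip_tolerance m M (m * \<rho>) H \<epsilon>
     in (min (1 / 2) (\<kappa> / (2 * (M * H))) / cosh (sqrt \<bar>K / N\<bar> * (M * H))) powr N)"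

lemma packing_factor_pos: "0 < \<rho> \<Longrightarrow> 0 < \<epsilon> \<Longrightarrow> 0 < packing_factor m M K N \<rho> \<epsilon>"
proof -
  assume \<rho>: "0 < \<rho>" "0 < \<epsilon>"
  define H where "H = (2 + 2 * M * \<rho>) / m"
  have H: "0 < H" using m M_pos \<rho> by (simp add: H_def add_pos_pos)
  have \<kappa>: "0 < tip_tolerance m M (m * \<rho>) H \<epsilon>"
    by (rule tip_tolerance_pos) (use m M_pos \<rho> H in auto)
  define c where "c = min (1 / 2) (tip_tolerance m M (m * \<rho>) H \<epsilon> / (2 * (M * H)))"
  have "0 < c" using \<kappa> H M_pos by (simp add: c_def)
  then have "0 < (c / cosh (sqrt \<bar>K / N\<bar> * (M * H))) powr N" by simp
  then show "0 < packing_factor m M K N \<rho> \<epsilon>" unfolding packing_factor_def Let_def H_def[symmetric] c_def .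
qed

text \<open>All points of the box have a time distance between \<open>2 M \<rho>\<close> and \<open>2 + 2 M \<rho>\<close> to the tip \<open>(t, u)\<close>, whence
  the choice of \<open>H\<close> in \<open>packing_factor\<close>.\<close>

lemma contraction_forward:
  assumes mem: "u \<in> mspace Y" "y \<in> mspace Y" and \<rho>: "0 < \<rho>" and \<epsilon>: "0 < \<epsilon>" "M * \<epsilon> \<le> \<eta>"
    and d: "\<And>w. w \<in> mspace Y \<Longrightarrow> mdist Y y w \<le> b \<Longrightarrow> mdist Y w u \<le> \<rho>" and b: "0 < b" and s: "t - s = 1 + 2 * M * \<rho>"
  shows "packing_factor m M K N \<rho> \<epsilon> * measure \<mm> (box s y 1 b) \<le> measure \<mm> (box t u \<eta> \<epsilon>)"
proof -
  define H where "H = (2 + 2 * M * \<rho>) / m"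
  have H: "0 < H" using m M_pos \<rho> by (simp add: H_def add_pos_pos)
  have "(min (1 / 2) (tip_tolerance m M (m * \<rho>) H \<epsilon> / (2 * (M * H))) / cosh (sqrt \<bar>K / N\<bar> * (M * H))) powr N
      * measure \<mm> (box s y 1 b) \<le> measure \<mm> (box t u \<eta> \<epsilon>)"
  proof (rule conelike_contraction[OF conelike_forward pre tsep_finite tmcp(1) N mm sigma_finite, where x = "(t, u)" and \<rho> = \<rho>])
    fix p assume "p \<in> box s y 1 b"
    then obtain r w where p: "p = (r, w)" "w \<in> mspace Y" "\<bar>r - s\<bar> \<le> 1" "mdist Y y w \<le> b" by (auto simp: box_def)
    have tr: "2 * M * \<rho> \<le> t - r" "t - r \<le> 2 + 2 * M * \<rho>" using p(3) s by linarith+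
    have "0 \<le> 2 * M * \<rho>" using M_pos \<rho> by simp
    then have "r \<le> t" using tr by linarith
    note Fb = F_bounds[OF this]
    have "2 * \<rho> = 2 * M * \<rho> / M" using M_pos by simp
    also have "\<dots> \<le> (t - r) / M" using tr M_pos by (intro divide_right_mono) auto
    finally have 1: "2 * \<rho> \<le> F t - F r" using Fb(1) by linarith
    have "(t - r) / m \<le> H" unfolding H_def using tr m by (intro divide_right_mono) auto
    then have 2: "F t - F r \<le> H" using Fb(2) by linarith
    show "2 * \<rho> \<le> F (fst (t, u)) - F (fst p) \<and> F (fst (t, u)) - F (fst p) \<le> H \<and> mdist Y (snd p) (snd (t, u)) \<le> \<rho>"
      using 1 2 d[OF p(2,4)] p(1) by simp
  next
    fix z assume z: "z \<in> pts X" "0 \<le> F (fst (t, u)) - F (fst z)" "F (fst (t, u)) - F (fst z) \<le> \<epsilon>" "mdist Y (snd z) (snd (t, u)) \<le> \<epsilon>"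
    then have le: "fst z \<le> t" by simp
    have "(t - fst z) / M \<le> \<epsilon>" using F_bounds(1)[OF le] z(3) by simp
    then have "t - fst z \<le> M * \<epsilon>" using M_pos by (simp add: divide_le_eq mult.commute)
    then show "z \<in> box t u \<eta> \<epsilon>" using z le \<epsilon> by (cases z) (auto simp: box_def mdist_commute)
  qed (use mem compactin_box box_sets box_finite box_positive causal_past_borel \<rho> H \<epsilon> b mm in auto)
  then show ?thesis by (simp add: packing_factor_def Let_def H_def)
qed

lemma contraction_backward:
  assumes mem: "u \<in> mspace Y" "y \<in> mspace Y" and \<rho>: "0 < \<rho>" and \<epsilon>: "0 < \<epsilon>" "M * \<epsilon> \<le> \<eta>"
    and d: "\<And>w. w \<in> mspace Y \<Longrightarrow> mdist Y y w \<le> b \<Longrightarrow> mdist Y w u \<le> \<rho>" and b: "0 < b" and s: "s - t = 1 + 2 * M * \<rho>"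
  shows "packing_factor m M K N \<rho> \<epsilon> * measure \<mm> (box s y 1 b) \<le> measure \<mm> (box t u \<eta> \<epsilon>)"
proof -
  let ?X = "causal_reversal X"
  have r: "pts ?X = pts X" "ltop ?X = ltop X" "caus ?X = (\<lambda>x y. caus X y x)" "chron ?X = (\<lambda>x y. chron X y x)"
    "tsep ?X = (\<lambda>x y. tsep X y x)" "met ?X = met X" by (simp_all add: causal_reversal_def)
  note pre' = lorentzian_pre_length_space_reversal[OF pre]
  define H where "H = (2 + 2 * M * \<rho>) / m"
  have H: "0 < H" using m M_pos \<rho> by (simp add: H_def add_pos_pos)
  have "(min (1 / 2) (tip_tolerance m M (m * \<rho>) H \<epsilon> / (2 * (M * H))) / cosh (sqrt \<bar>K / N\<bar> * (M * H))) powr N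
      * measure \<mm> (box s y 1 b) \<le> measure \<mm> (box t u \<eta> \<epsilon>)"
  proof (rule conelike_contraction[OF conelike_backward pre' _ tmcp(2) N _ _ sigma_finite, where x = "(t, u)" and \<rho> = \<rho>])
    show "tsep ?X p q < \<top>" for p q unfolding r by (rule tsep_finite)
    show "space \<mm> = pts ?X" "sets \<mm> = sets (borel_of (ltop ?X))" unfolding r by (rule mm)+
    have "causal_past ?X (t, u) = causal_future X (t, u)" by (simp add: causal_past_def causal_future_def r)
    then show "causal_past ?X (t, u) \<in> sets \<mm>" using causal_future_borel[of "(t, u)"] mem mm by simp
    show "compactin (ltop ?X) (box s y 1 b)" unfolding r by (rule compactin_box[OF mem(2)])
    show "(t, u) \<in> pts ?X" unfolding r using mem by simp
  next
    fix p assume "p \<in> box s y 1 b"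
    then obtain r w where p: "p = (r, w)" "w \<in> mspace Y" "\<bar>r - s\<bar> \<le> 1" "mdist Y y w \<le> b" by (auto simp: box_def)
    have tr: "2 * M * \<rho> \<le> r - t" "r - t \<le> 2 + 2 * M * \<rho>" using p(3) s by linarith+
    have "0 \<le> 2 * M * \<rho>" using M_pos \<rho> by simp
    then have "t \<le> r" using tr by linarith
    note Fb = F_bounds[OF this]
    have "2 * \<rho> = 2 * M * \<rho> / M" using M_pos by simp
    also have "\<dots> \<le> (r - t) / M" using tr M_pos by (intro divide_right_mono) auto
    finally have 1: "2 * \<rho> \<le> F r - F t" using Fb(1) by linarith
    have "(r - t) / m \<le> H" unfolding H_def using tr m by (intro divide_right_mono) auto
    then have 2: "F r - F t \<le> H" using Fb(2) by linarith
    show "2 * \<rho> \<le> - F (fst (t, u)) - - F (fst p) \<and> - F (fst (t, u)) - - F (fst p) \<le> H \<and> mdist Y (snd p) (snd (t, u)) \<le> \<rho>"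
      using 1 2 d[OF p(2,4)] p(1) by simp
  next
    fix z assume "z \<in> pts ?X" and z: "0 \<le> - F (fst (t, u)) - - F (fst z)" "- F (fst (t, u)) - - F (fst z) \<le> \<epsilon>" "mdist Y (snd z) (snd (t, u)) \<le> \<epsilon>"
    then have zm: "z \<in> pts X" by (simp add: r)
    have le: "t \<le> fst z" using z by simp
    have "(fst z - t) / M \<le> \<epsilon>" using F_bounds(1)[OF le] z(2) by simp
    then have "fst z - t \<le> M * \<epsilon>" using M_pos by (simp add: divide_le_eq mult.commute)
    then show "z \<in> box t u \<eta> \<epsilon>" using z zm le \<epsilon> by (cases z) (auto simp: box_def mdist_commute)
  qed (use mem box_sets box_finite box_positive \<rho> H \<epsilon> b in auto)
  then show ?thesis by (simp add: packing_factor_def Let_def H_def)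
qed

text \<open>Contraction of the past box B to each u in S puts at least q times the measure of B into
  each of the disjoint small boxes, all contained in C. Backward contraction of C into a part of B
  bounds the measure of C by that of B divided by q. The measure of B is positive and
  cancels.\<close>

lemma packing_bound:
  assumes y: "y \<in> mspace Y" and \<rho>: "0 < \<rho>" and \<epsilon>: "0 < \<epsilon>" "\<epsilon> \<le> 1" "M * \<epsilon> \<le> 1"
    and S: "finite S" "S \<subseteq> mspace Y" "\<And>u. u \<in> S \<Longrightarrow> mdist Y y u \<le> \<rho>"
    and sep: "\<And>u v. u \<in> S \<Longrightarrow> v \<in> S \<Longrightarrow> u \<noteq> v \<Longrightarrow> 3 * \<epsilon> \<le> mdist Y u v"
  shows "real (card S) * (packing_factor m M K N (\<rho> + 1) \<epsilon>)\<^sup>2 \<le> 1"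
proof -
  define q where "q = packing_factor m M K N (\<rho> + 1) \<epsilon>"
  have q: "0 < q" using \<rho> \<epsilon> unfolding q_def by (intro packing_factor_pos) auto
  \<comment> \<open>The time difference demanded by both contractions. The radius is \<rho> + 1
    because every point of the unit ball around y must be that close to each u.\<close>
  define s where "s = - (1 + 2 * M * (\<rho> + 1))"
  define B where "B = box s y 1 1"
  define C where "C = box 0 y 1 (\<rho> + 1)"
  have tri: "mdist Y w u \<le> mdist Y y w + mdist Y y u" if "w \<in> mspace Y" "u \<in> mspace Y" for w u
    using mdist_triangle[OF that(1) y that(2)] by (simp add: mdist_commute)
  have Ei: "q * measure \<mm> B \<le> measure \<mm> (box 0 u 1 \<epsilon>)" if u: "u \<in> S" for u
    unfolding q_def B_def
  proof (rule contraction_forward)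
    show "u \<in> mspace Y" using u S by auto
    fix w assume w: "w \<in> mspace Y" "mdist Y y w \<le> 1"
    have "u \<in> mspace Y" using u S by auto
    from tri[OF w(1) this] show "mdist Y w u \<le> \<rho> + 1" using w(2) S(3)[OF u] by linarith
  qed (use y \<rho> \<epsilon> in \<open>auto simp: s_def\<close>)
  have CB: "q * measure \<mm> C \<le> measure \<mm> (box s y 1 \<epsilon>)"
    unfolding q_def C_def
    by (rule contraction_backward) (use y \<rho> \<epsilon> in \<open>auto simp: s_def mdist_commute\<close>)
  have "box s y 1 \<epsilon> \<subseteq> B" using \<epsilon> by (auto simp: B_def box_def)
  then have "measure \<mm> (box s y 1 \<epsilon>) \<le> measure \<mm> B"
    using box_sets[OF y] box_finite[OF y] unfolding B_def by (intro measure_mono_fmeasurable) (auto simp: fmeasurable_def)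
  with CB have CB': "q * measure \<mm> C \<le> measure \<mm> B" by linarith
  have "real (card S) * (q * measure \<mm> B) = (\<Sum>u\<in>S. q * measure \<mm> B)" by simp
  also have "\<dots> \<le> (\<Sum>u\<in>S. measure \<mm> (box 0 u 1 \<epsilon>))" by (intro sum_mono Ei)
  also have "\<dots> = measure \<mm> (\<Union>u\<in>S. box 0 u 1 \<epsilon>)"
  proof (rule measure_finite_Union[symmetric, OF S(1)])
    show "(\<lambda>u. box 0 u 1 \<epsilon>) ` S \<subseteq> sets \<mm>" using S box_sets by auto
    show "emeasure \<mm> (box 0 u 1 \<epsilon>) \<noteq> \<infinity>" if "u \<in> S" for u using less_imp_neq[OF box_finite[of u]] S that by auto
    show "disjoint_family_on (\<lambda>u. box 0 u 1 \<epsilon>) S"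
      unfolding disjoint_family_on_def
    proof (intro ballI impI)
      fix u v assume uv: "u \<in> S" "v \<in> S" "u \<noteq> v"
      have False if pp: "p \<in> box 0 u 1 \<epsilon>" "p \<in> box 0 v 1 \<epsilon>" for p
      proof -
        obtain r w where p: "p = (r, w)" "w \<in> mspace Y" "mdist Y u w \<le> \<epsilon>" "mdist Y v w \<le> \<epsilon>"
          using pp by (cases p) (simp add: box_def)
        have "u \<in> mspace Y" "v \<in> mspace Y" using uv S by auto
        then have "mdist Y u v \<le> 2 * \<epsilon>" using mdist_triangle[of u Y w v] p by (simp add: mdist_commute)
        then show False using sep[OF uv] \<epsilon> by simp
      qed
      then show "box 0 u 1 \<epsilon> \<inter> box 0 v 1 \<epsilon> = {}" by blast
    qed
  qed
  also have "\<dots> \<le> measure \<mm> C"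
  proof (rule measure_mono_fmeasurable)
    show "(\<Union>u\<in>S. box 0 u 1 \<epsilon>) \<subseteq> C"
    proof
      fix p assume "p \<in> (\<Union>u\<in>S. box 0 u 1 \<epsilon>)"
      then obtain u r w where u: "u \<in> S" and p: "p = (r, w)" "w \<in> mspace Y" "\<bar>r\<bar> \<le> 1" "mdist Y u w \<le> \<epsilon>"
        by (auto simp: box_def)
      have "u \<in> mspace Y" using u S by auto
      from mdist_triangle[OF y this p(2)] have "mdist Y y w \<le> \<rho> + 1" using S(3)[OF u] p(4) \<epsilon> by linarith
      then show "p \<in> C" using p by (simp add: C_def box_def)
    qed
    show "(\<Union>u\<in>S. box 0 u 1 \<epsilon>) \<in> sets \<mm>" using S box_sets by (intro sets.finite_UN) auto
    show "C \<in> fmeasurable \<mm>" using box_sets[OF y] box_finite[OF y] by (auto simp: C_def fmeasurable_def)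
  qed
  finally have "real (card S) * (q * measure \<mm> B) \<le> measure \<mm> C" .
  then have "q * (real (card S) * (q * measure \<mm> B)) \<le> q * measure \<mm> C" using q by (intro mult_left_mono) auto
  with CB' have "(real (card S) * q\<^sup>2) * measure \<mm> B \<le> 1 * measure \<mm> B" by (simp add: power2_eq_square algebra_simps)
  moreover have "0 < measure \<mm> B"
  proof -
    have "emeasure \<mm> B = ennreal (measure \<mm> B)"
      using box_finite[OF y, of s 1 1] unfolding B_def by (intro emeasure_eq_ennreal_measure) auto
    then show ?thesis using box_positive[OF y, of 1 1 s] by (simp add: B_def)
  qed
  ultimately show ?thesis unfolding q_def by (meson mult_le_cancel_right_pos)
qed
end

section \<open>Uniform nets of diamonds\<close>

text \<open>A vertex must stay an endpoint of diamonds meeting A however small the mesh becomes,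
  since vertex sets have to increase while diamonds shrink.\<close>

definition approximable :: "'a lorentz_space \<Rightarrow> 'a set \<Rightarrow> 'a \<Rightarrow> bool" where
  "approximable X A g \<longleftrightarrow> (\<forall>e::real>0. \<exists>q\<in>A. (caus X g q \<and> tsep X g q \<le> ennreal e) \<or> (caus X q g \<and> tsep X q g \<le> ennreal e))"

text \<open>Endpoints of diamonds covering \<open>U\<^sub>k\<close> may leave
  \<open>U\<^sub>k\<close> and are only kept in the next set of the cover. Indexing by naturals with
  a bound P allows nets of different spaces to share their indices.\<close>

definition net_enumeration :: "'a covered_space \<Rightarrow> nat \<Rightarrow> nat \<Rightarrow> nat \<Rightarrow> (nat \<Rightarrow> 'a) \<Rightarrow> bool" where
  "net_enumeration Z k l P g \<longleftrightarrow>
     (\<forall>i. g i \<in> snd Z (Suc k) \<and> approximable (fst Z) (snd Z k) (g i)) \<and>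
     (\<forall>x\<in>snd Z k. \<exists>i<P. \<exists>j<P. caus (fst Z) (g i) x \<and> caus (fst Z) x (g j) \<and> tsep (fst Z) (g i) (g j) \<le> ennreal (1 / real l))"

lemma maximal_separated_set:
  fixes P :: nat
  assumes B: "B \<subseteq> mspace Z" and \<eta>: "0 < \<eta>"
    and bound: "\<And>S. finite S \<Longrightarrow> S \<subseteq> B \<Longrightarrow> (\<forall>u\<in>S. \<forall>v\<in>S. u \<noteq> v \<longrightarrow> \<eta> \<le> mdist Z u v) \<Longrightarrow> card S \<le> P"
  shows "\<exists>S. finite S \<and> S \<subseteq> B \<and> card S \<le> P \<and> (\<forall>y\<in>B. \<exists>u\<in>S. mdist Z y u < \<eta>)"
proof -
  define Q where "Q S \<longleftrightarrow> finite S \<and> S \<subseteq> B \<and> (\<forall>u\<in>S. \<forall>v\<in>S. u \<noteq> v \<longrightarrow> \<eta> \<le> mdist Z u v)" for S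
  have "Q {}" by (simp add: Q_def)
  moreover have "card S < Suc P" if "Q S" for S using bound[of S] that by (simp add: Q_def less_Suc_eq_le)
  ultimately obtain S where S: "Q S" and max: "\<And>S'. Q S' \<Longrightarrow> card S' \<le> card S"
    using ex_has_greatest_nat[of Q "{}" card "Suc P"] by (metis less_imp_le)
  have "\<exists>u\<in>S. mdist Z y u < \<eta>" if y: "y \<in> B" for y
  proof (rule ccontr)
    assume "\<not> (\<exists>u\<in>S. mdist Z y u < \<eta>)"
    then have far: "\<eta> \<le> mdist Z y u" if "u \<in> S" for u using that by force
    have "mdist Z y y = 0" using mdist_zero[of y Z y] y B by blast
    then have "y \<notin> S" using far[of y] \<eta> by linarith
    moreover have "Q (insert y S)" using S far y unfolding Q_def by (auto simp: mdist_commute)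
    ultimately show False using max[of "insert y S"] S by (simp add: Q_def)
  qed
  then show ?thesis using S bound unfolding Q_def by (intro exI[of _ S]) auto
qed

context lorentzian_cone
begin

lemma chron_iff:
  assumes "u \<in> mspace Y" "w \<in> mspace Y"
  shows "chron X (s, u) (r, w) \<longleftrightarrow> mdist Y u w < F r - F s"
proof
  assume c: "chron X (s, u) (r, w)"
  have p: "(s, u) \<in> pts X" "(r, w) \<in> pts X" using assms by auto
  have "0 < tsep X (s, u) (r, w)" using pre p c unfolding lorentzian_pre_length_space_def by blast
  then have "0 < M * sqrt ((F r - F s)\<^sup>2 - (mdist Y u w)\<^sup>2)"
    using tsep_upper[of s u r w] by (metis ennreal_less_zero_iff less_le_trans)
  then have "(mdist Y u w)\<^sup>2 < (F r - F s)\<^sup>2" using M_pos by (simp add: zero_less_mult_iff)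
  moreover have "0 \<le> F r - F s" using caus_upper(1)[OF chron_imp_caus[OF p c]] by simp
  ultimately show "mdist Y u w < F r - F s" by (rule power2_less_imp_less)
qed (use chron_real_lower(1)[of "(s, u)" "(r, w)"] assms in auto)

lemma mem_diamond:
  assumes "y \<in> mspace Y"
  shows "(s, w) \<in> chron_diamond X (a, y) (b, y) \<longleftrightarrow> w \<in> mspace Y \<and> mdist Y w y < F s - F a \<and> mdist Y w y < F b - F s"
  using assms chron_iff by (auto simp: chron_diamond_def chron_future_def chron_past_def mdist_commute)

lemma short_gap:
  assumes e: "0 < e" and g: "0 < g" and d: "0 \<le> d"
  obtains \<theta> where "0 < \<theta>" "\<theta> < g" "M * sqrt ((d + \<theta>)\<^sup>2 - d\<^sup>2) \<le> e"
proof -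
  define \<theta> where "\<theta> = min (g / 2) (min 1 ((e / M)\<^sup>2 / (2 * d + 1)))"
  have \<theta>: "0 < \<theta>" "\<theta> < g" "\<theta> \<le> 1" using assms M_pos by (auto simp: \<theta>_def)
  have "\<theta> * (2 * d + 1) \<le> (e / M)\<^sup>2" 
    using d by (subst pos_le_divide_eq[symmetric]) (auto simp: \<theta>_def)
  moreover have "(d + \<theta>)\<^sup>2 - d\<^sup>2 = \<theta> * (2 * d + \<theta>)" by (simp add: power2_eq_square algebra_simps)
  moreover have "\<theta> * (2 * d + \<theta>) \<le> \<theta> * (2 * d + 1)" using \<theta> by (intro mult_left_mono) auto
  ultimately have "(d + \<theta>)\<^sup>2 - d\<^sup>2 \<le> (e / M)\<^sup>2" by linarith
  then have "sqrt ((d + \<theta>)\<^sup>2 - d\<^sup>2) \<le> e / M" using e M_pos by (intro real_le_lsqrt) auto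
  then have "M * sqrt ((d + \<theta>)\<^sup>2 - d\<^sup>2) \<le> e" using M_pos by (simp add: pos_le_divide_eq mult.commute)
  with \<theta> show ?thesis by (rule_tac that)
qed

text \<open>The axis point (q, y) just inside the light cone of (r, w) is reached by an almost null
  segment, so \<tau> is small although the two points may be far apart. The upper bound on the fibre
  distance is what places it below the upper tip.\<close>

lemma approximable_lower:
  assumes mem: "w \<in> mspace Y" "y \<in> mspace Y" and r: "F a \<le> F r" "mdist Y w y < F b - F r"
  shows "approximable X (chron_diamond X (a, y) (b, y)) (r, w)"
  unfolding approximable_def
proof (intro allI impI)
  fix e :: real assume e: "0 < e"
  define d where "d = mdist Y w y"
  have d: "0 \<le> d" by (simp add: d_def)
  obtain \<theta> where \<theta>: "0 < \<theta>" "\<theta> < F b - F r - d" "M * sqrt ((d + \<theta>)\<^sup>2 - d\<^sup>2) \<le> e"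
    using short_gap[OF e _ d, of "F b - F r - d"] r by (auto simp: d_def)
  obtain q where q: "F q = F r + d + \<theta>" using F_surj by blast
  have z: "mdist Y y y = 0" using mdist_zero[OF mem(2,2)] by blast
  have "(q, y) \<in> chron_diamond X (a, y) (b, y)"
    unfolding mem_diamond[OF mem(2)] z using mem r \<theta> q d by linarith
  moreover have "caus X (r, w) (q, y)"
    using chron_real_lower(2)[of "(r, w)" "(q, y)"] mem q \<theta> by (simp add: d_def)
  moreover have "tsep X (r, w) (q, y) \<le> ennreal e"
    by (rule order_trans[OF tsep_upper ennreal_leI]) (use q \<theta>(3) in \<open>simp add: d_def\<close>)
  ultimately show "\<exists>q\<in>chron_diamond X (a, y) (b, y). caus X (r, w) q \<and> tsep X (r, w) q \<le> ennreal e \<or>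
      caus X q (r, w) \<and> tsep X q (r, w) \<le> ennreal e" by blast
qed

lemma approximable_upper:
  assumes mem: "w \<in> mspace Y" "y \<in> mspace Y" and r: "F r \<le> F b" "mdist Y w y < F r - F a"
  shows "approximable X (chron_diamond X (a, y) (b, y)) (r, w)"
  unfolding approximable_def
proof (intro allI impI)
  fix e :: real assume e: "0 < e"
  define d where "d = mdist Y y w"
  have d: "0 \<le> d" by (simp add: d_def)
  obtain \<theta> where \<theta>: "0 < \<theta>" "\<theta> < F r - F a - d" "M * sqrt ((d + \<theta>)\<^sup>2 - d\<^sup>2) \<le> e"
    using short_gap[OF e _ d, of "F r - F a - d"] r by (auto simp: d_def mdist_commute)
  obtain q where q: "F q = F r - d - \<theta>" using F_surj by blast
  have z: "mdist Y y y = 0" using mdist_zero[OF mem(2,2)] by blast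
  have "(q, y) \<in> chron_diamond X (a, y) (b, y)"
    unfolding mem_diamond[OF mem(2)] z using mem r \<theta> q d by linarith
  moreover have "caus X (q, y) (r, w)"
    using chron_real_lower(2)[of "(q, y)" "(r, w)"] mem q \<theta> by (simp add: d_def)
  moreover have "tsep X (q, y) (r, w) \<le> ennreal e"
    by (rule order_trans[OF tsep_upper ennreal_leI]) (use q \<theta>(3) in \<open>simp add: d_def\<close>)
  ultimately show "\<exists>q\<in>chron_diamond X (a, y) (b, y). caus X (r, w) q \<and> tsep X (r, w) q \<le> ennreal e \<or>
      caus X q (r, w) \<and> tsep X q (r, w) \<le> ennreal e" by blast
qed

lemma grid_below:
  fixes A z \<eta> :: real
  assumes "0 < \<eta>" "2 * \<eta> \<le> z"
  obtains j :: nat where "z - 2 * \<eta> \<le> real j * \<eta>" "real j * \<eta> \<le> z - \<eta>"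
proof
  \<comment> \<open>Subtracting 1 leaves a time gap of at least \<eta>, which exceeds the distance
    to the chosen net point and makes the relation strict.\<close>
  define j where "j = nat \<lfloor>z / \<eta>\<rfloor> - 1"
  have "2 \<le> z / \<eta>" using assms by (simp add: pos_le_divide_eq)
  then have "real j = of_int \<lfloor>z / \<eta>\<rfloor> - 1" unfolding j_def by (subst of_nat_diff) (auto, linarith+)
  then have "z / \<eta> - 2 \<le> real j" "real j \<le> z / \<eta> - 1" by linarith+
  then have "(z / \<eta> - 2) * \<eta> \<le> real j * \<eta>" "real j * \<eta> \<le> (z / \<eta> - 1) * \<eta>" using assms by (auto intro!: mult_right_mono)
  then show "z - 2 * \<eta> \<le> real j * \<eta>" "real j * \<eta> \<le> z - \<eta>" using assms by (simp_all add: left_diff_distrib)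
qed

text \<open>Rounds the fibre point to the net and the conformal time down to the grid. Close to the
  lower tip there is no room for this, and the tip itself, j = 0 and v = y, takes over. The error 3
  \<eta> consists of \<eta> from the fibre and 2 \<eta> from time; it decides membership in the next
  diamond.\<close>

lemma lower_vertex:
  assumes mem: "y \<in> mspace Y" "u \<in> mspace Y" "w \<in> mspace Y" and d: "mdist Y w y < F s - F a" "mdist Y w y < F b - F s"
    and u: "mdist Y w u < \<eta>"
  shows "\<exists>(j::nat) r v. v \<in> {u, y} \<and> F r = F a + real j * \<eta> \<and> real j * \<eta> \<le> F b - F a \<and> caus X (r, v) (s, w) \<and> F s - F r \<le> 2 * \<eta> \<and>
    mdist Y v y < F b - F r \<and> mdist Y v y < F r - F a + 3 * \<eta>"
proof -
  have \<eta>: "0 < \<eta>" using u mdist_nonneg[of Y w u] by linarith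
  have pos: "0 \<le> mdist Y w y" by simp
  have ab: "F a < F b" using d pos by linarith
  show ?thesis
  proof (cases "2 * \<eta> \<le> F s - F a")
    case True
    from grid_below[OF \<eta> True] obtain j :: nat where j: "F s - F a - 2 * \<eta> \<le> real j * \<eta>" "real j * \<eta> \<le> F s - F a - \<eta>" .
    obtain r where r: "F r = F a + real j * \<eta>" using F_surj by blast
    have t: "mdist Y u y \<le> mdist Y w u + mdist Y w y" using mdist_triangle[OF mem(2,3,1)] by (simp add: mdist_commute)
    have "caus X (r, u) (s, w)"
      using chron_real_lower(2)[of "(r, u)" "(s, w)"] mem r j u by (simp add: mdist_commute)
    then show ?thesis
      using r j t u d pos \<eta> by (intro exI[of _ j] exI[of _ r] exI[of _ u] conjI) (simp, linarith+)
  next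
    case False
    have z: "mdist Y y y = 0" using mdist_zero[OF mem(1,1)] by blast
    have "caus X (a, y) (s, w)" using chron_real_lower(2)[of "(a, y)" "(s, w)"] mem d by (simp add: mdist_commute)
    then have "y \<in> {u, y} \<and> F a = F a + real 0 * \<eta> \<and> real 0 * \<eta> \<le> F b - F a \<and> caus X (a, y) (s, w) \<and> F s - F a \<le> 2 * \<eta> \<and>
        mdist Y y y < F b - F a \<and> mdist Y y y < F a - F a + 3 * \<eta>"
      unfolding z using False ab \<eta> by simp
    then show ?thesis by blast
  qed
qed

lemma upper_vertex:
  assumes mem: "y \<in> mspace Y" "u \<in> mspace Y" "w \<in> mspace Y" and d: "mdist Y w y < F s - F a" "mdist Y w y < F b - F s"
    and u: "mdist Y w u < \<eta>"
  shows "\<exists>(j::nat) r v. v \<in> {u, y} \<and> F r = F b - real j * \<eta> \<and> real j * \<eta> \<le> F b - F a \<and> caus X (s, w) (r, v) \<and> F r - F s \<le> 2 * \<eta> \<and>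
    mdist Y v y < F r - F a \<and> mdist Y v y < F b - F r + 3 * \<eta>"
proof -
  have \<eta>: "0 < \<eta>" using u mdist_nonneg[of Y w u] by linarith
  have pos: "0 \<le> mdist Y w y" by simp
  have ab: "F a < F b" using d pos by linarith
  show ?thesis
  proof (cases "2 * \<eta> \<le> F b - F s")
    case True
    from grid_below[OF \<eta> True] obtain j :: nat where j: "F b - F s - 2 * \<eta> \<le> real j * \<eta>" "real j * \<eta> \<le> F b - F s - \<eta>" .
    obtain r where r: "F r = F b - real j * \<eta>" using F_surj by blast
    have t: "mdist Y u y \<le> mdist Y w u + mdist Y w y" using mdist_triangle[OF mem(2,3,1)] by (simp add: mdist_commute)
    have "caus X (s, w) (r, u)"
      using chron_real_lower(2)[of "(s, w)" "(r, u)"] mem r j u by simp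
    then show ?thesis
      using r j t u d pos \<eta> by (intro exI[of _ j] exI[of _ r] exI[of _ u] conjI) (simp, linarith+)
  next
    case False
    have z: "mdist Y y y = 0" using mdist_zero[OF mem(1,1)] by blast
    have "caus X (s, w) (b, y)" using chron_real_lower(2)[of "(s, w)" "(b, y)"] mem d by simp
    then have "y \<in> {u, y} \<and> F b = F b - real 0 * \<eta> \<and> real 0 * \<eta> \<le> F b - F a \<and> caus X (s, w) (b, y) \<and> F b - F s \<le> 2 * \<eta> \<and>
        mdist Y y y < F b - F a \<and> mdist Y y y < F b - F b + 3 * \<eta>"
      unfolding z using False ab \<eta> by simp
    then show ?thesis by blast
  qed
qed

text \<open>Lower endpoints come from a grid rising from F a, upper ones from a grid descending from
  F b. The condition 3 \<eta> <= 1 / M keeps them in \<open>U (Suc k)\<close>. Their conformal times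
  differ by at most 4 \<eta>, so \<tau> is at most 4 M \<eta>.\<close>

lemma diamond_net:
  fixes k l J :: nat
  assumes y: "y \<in> mspace Y" and \<eta>: "0 < \<eta>" "3 * \<eta> \<le> 1 / M" "4 * (M * \<eta>) \<le> 1 / real l"
    and S: "finite S" "S \<subseteq> mspace Y" "y \<in> S" and cover: "\<And>w. w \<in> mspace Y \<Longrightarrow> mdist Y y w \<le> real k / m \<Longrightarrow> \<exists>u\<in>S. mdist Y w u < \<eta>"
    and J: "2 * real k / m \<le> real J * \<eta>" and P: "2 * (Suc J * card S) \<le> P"
    and U: "U k = chron_diamond X (t - real k, y) (t + real k, y)"
      "U (Suc k) = chron_diamond X (t - real (Suc k), y) (t + real (Suc k), y)" and k: "1 \<le> k"
  shows "\<exists>g. net_enumeration (X, U) k l P g"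
proof -
  define a b where "a = t - real k" and "b = t + real k"
  define T where "T = inv F"
  have T: "r = T \<sigma>" if "F r = \<sigma>" for r \<sigma>
    using F_surj F_less_iff that by (metis T_def injI inv_f_f less_irrefl linorder_neqE_linordered_idom)
  define E where "E = (\<lambda>(j, u). (T (F a + real j * \<eta>), u)) ` ({..J} \<times> S) \<union> (\<lambda>(j, u). (T (F b - real j * \<eta>), u)) ` ({..J} \<times> S)"
  define G where "G = {p \<in> E. p \<in> U (Suc k) \<and> approximable X (U k) p}"
  have finE: "finite E" using S(1) by (simp add: E_def)
  have "card E \<le> card ({..J} \<times> S) + card ({..J} \<times> S)"
    unfolding E_def using S(1) by (intro order_trans[OF card_Un_le] add_mono card_image_le) auto
  then have cardE: "card E \<le> P" using P by (simp add: card_cartesian_product)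
  have finG: "finite G" "card G \<le> P" using finE cardE card_mono[OF finE, of G] by (auto simp: G_def)
  have ab: "a < b" using k by (simp add: a_def b_def)
  have width: "F b - F a \<le> 2 * real k / m" using F_bounds(2)[of a b] ab by (simp add: a_def b_def)
  have jJ: "j \<le> J" if "real j * \<eta> \<le> F b - F a" for j :: nat
  proof -
    have "real j * \<eta> \<le> real J * \<eta>" using that width J by linarith
    then show ?thesis using \<eta>(1) by simp
  qed
  define a' b' where "a' = t - real (Suc k)" and "b' = t + real (Suc k)"
  have out: "F a' + 3 * \<eta> \<le> F a" "F b + 3 * \<eta> \<le> F b'"
    using F_bounds(1)[of a' a] F_bounds(1)[of b b'] \<eta>(2) by (auto simp: a_def a'_def b_def b'_def)
  have net: "\<exists>p\<in>G. \<exists>q\<in>G. caus X p x \<and> caus X x q \<and> tsep X p q \<le> ennreal (1 / real l)" if x: "x \<in> U k" for x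
  proof -
    obtain s w where sw: "x = (s, w)" by (cases x)
    have w: "w \<in> mspace Y" "mdist Y w y < F s - F a" "mdist Y w y < F b - F s"
      using x mem_diamond[OF y, of s w a b] unfolding U sw a_def b_def by auto
    have "2 * mdist Y y w \<le> 2 * real k / m" using w width by (simp add: mdist_commute)
    then obtain u where u: "u \<in> S" "mdist Y w u < \<eta>" using cover[OF w(1)] by auto
    have uY: "u \<in> mspace Y" using u S by auto
    obtain j r v where p: "v \<in> {u, y}" "F r = F a + real (j::nat) * \<eta>" "real j * \<eta> \<le> F b - F a" "caus X (r, v) (s, w)"
        "F s - F r \<le> 2 * \<eta>" "mdist Y v y < F b - F r" "mdist Y v y < F r - F a + 3 * \<eta>"
      using lower_vertex[OF y uY w u(2)] by blast
    obtain j' r' v' where q: "v' \<in> {u, y}" "F r' = F b - real (j'::nat) * \<eta>" "real j' * \<eta> \<le> F b - F a" "caus X (s, w) (r', v')"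
        "F r' - F s \<le> 2 * \<eta>" "mdist Y v' y < F r' - F a" "mdist Y v' y < F b - F r' + 3 * \<eta>"
      using upper_vertex[OF y uY w u(2)] by blast
    have vS: "v \<in> S" "v' \<in> S" using p(1) q(1) u S by auto
    then have vY: "v \<in> mspace Y" "v' \<in> mspace Y" using S by auto
    have 1: "(r, v) \<in> E" using T[OF p(2)] jJ[OF p(3)] vS unfolding E_def by force
    have 2: "(r', v') \<in> E" using T[OF q(2)] jJ[OF q(3)] vS unfolding E_def by force
    have 3: "(r, v) \<in> U (Suc k)"
      unfolding U mem_diamond[OF y] a'_def[symmetric] b'_def[symmetric] using vY p out \<eta> by linarith
    have 4: "(r', v') \<in> U (Suc k)"
      unfolding U mem_diamond[OF y] a'_def[symmetric] b'_def[symmetric] using vY q out \<eta> by linarith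
    have "0 \<le> real j * \<eta>" "0 \<le> real j' * \<eta>" using \<eta>(1) by auto
    then have 5: "approximable X (U k) (r, v)" "approximable X (U k) (r', v')"
      unfolding U a_def[symmetric] b_def[symmetric]
      using approximable_lower[OF vY(1) y _ p(6), of a] approximable_upper[OF vY(2) y _ q(6), of b] p(2) q(2) by simp_all
    have "r \<le> r'" using caus_upper(1)[OF p(4)] caus_upper(1)[OF q(4)] by simp
    then have "F r \<le> F r'" by simp
    then have "sqrt ((F r' - F r)\<^sup>2 - (mdist Y v v')\<^sup>2) \<le> F r' - F r" by (intro real_le_lsqrt) auto
    also have "\<dots> \<le> 4 * \<eta>" using p(5) q(5) by linarith
    finally have "M * sqrt ((F r' - F r)\<^sup>2 - (mdist Y v v')\<^sup>2) \<le> M * (4 * \<eta>)" using M_pos by (intro mult_left_mono) auto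
    then have "M * sqrt ((F r' - F r)\<^sup>2 - (mdist Y v v')\<^sup>2) \<le> 1 / real l" using \<eta>(3) by linarith
    then have "tsep X (r, v) (r', v') \<le> ennreal (1 / real l)" by (rule order_trans[OF tsep_upper ennreal_leI])
    moreover have "(r, v) \<in> G" "(r', v') \<in> G" using 1 2 3 4 5 by (auto simp: G_def)
    ultimately show ?thesis using p(4) q(4) unfolding sw by blast
  qed
  have "(t, y) \<in> U k"
  proof -
    have "mdist Y y y = 0" using mdist_zero[OF y y] by blast
    then show ?thesis unfolding U mem_diamond[OF y] using y k by (simp del: mdist_zero)
  qed
  then have ne: "G \<noteq> {}" using net by blast
  obtain h where h: "bij_betw h {0..<card G} G" using ex_bij_betw_nat_finite[OF finG(1)] by blast
  \<comment> \<open>Indices beyond the number of grid points repeat a valid vertex, since every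
    value of the enumeration has to be one.\<close>
  define g where "g i = (if i < card G then h i else h 0)" for i
  have pos: "0 < card G" using ne finG by (simp add: card_gt_0_iff)
  have gG: "g i \<in> G" for i using h pos by (auto simp: g_def bij_betw_def)
  have gs: "\<exists>i<P. p = g i" if p: "p \<in> G" for p
  proof -
    obtain i where "i < card G" "p = h i" using h p by (force simp: bij_betw_def)
    then show ?thesis using finG(2) by (intro exI[of _ i]) (simp add: g_def)
  qed
  have "net_enumeration (X, U) k l P g"
    unfolding net_enumeration_def fst_conv snd_conv
  proof (intro conjI allI ballI)
    show "g i \<in> U (Suc k)" "approximable X (U k) (g i)" for i using gG[of i] by (auto simp: G_def)
    fix x assume "x \<in> U k"
    from net[OF this] obtain p q where pq: "p \<in> G" "q \<in> G" "caus X p x \<and> caus X x q \<and> tsep X p q \<le> ennreal (1 / real l)" by blast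
    from gs[OF pq(1)] gs[OF pq(2)] pq(3)
    show "\<exists>i<P. \<exists>j<P. caus X (g i) x \<and> caus X x (g j) \<and> tsep X (g i) (g j) \<le> ennreal (1 / real l)" by blast
  qed
  then show ?thesis by blast
qed

lemma tsep_diamond_bound:
  assumes y: "y \<in> mspace Y" and ab: "a \<le> b" and p: "p \<in> chron_diamond X (a, y) (b, y)" and q: "q \<in> chron_diamond X (a, y) (b, y)"
  shows "tsep X p q \<le> ennreal (M * ((b - a) / m))"
proof -
  obtain s u r w where e: "p = (s, u)" "q = (r, w)" by (cases p, cases q)
  have h: "F a < F s" "F s < F b" "F a < F r" "F r < F b"
    using p q mdist_nonneg[of Y u y] mdist_nonneg[of Y w y] unfolding e mem_diamond[OF y] by linarith+
  then have "\<bar>F r - F s\<bar> \<le> (b - a) / m" using F_bounds(2)[OF ab] by linarith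
  then have "(F r - F s)\<^sup>2 \<le> ((b - a) / m)\<^sup>2" by (metis abs_ge_zero power2_abs power_mono)
  then have "(F r - F s)\<^sup>2 - (mdist Y u w)\<^sup>2 \<le> ((b - a) / m)\<^sup>2" using zero_le_power2[of "mdist Y u w"] by linarith
  then have "sqrt ((F r - F s)\<^sup>2 - (mdist Y u w)\<^sup>2) \<le> (b - a) / m" using ab m by (intro real_le_lsqrt) auto
  then have "M * sqrt ((F r - F s)\<^sup>2 - (mdist Y u w)\<^sup>2) \<le> M * ((b - a) / m)" using M_pos by (intro mult_left_mono) auto
  then show ?thesis unfolding e by (rule order_trans[OF tsep_upper ennreal_leI])
qed
end

text \<open>Chosen so that 4 M \<eta> <= 1 / l, which for l >= 1 also gives 3 \<eta> <= 1 /
  M.\<close>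

definition mesh :: "real \<Rightarrow> nat \<Rightarrow> real" where
  "mesh M l = min 1 (1 / (4 * M * real l))"

text \<open>Two time grids, each multiplied by the packing number of the fibre ball of radius k / m
  plus one for the axis point y. The separation \<eta> is three times the \<epsilon> of the packing
  bound.\<close>

definition net_size :: "real \<Rightarrow> real \<Rightarrow> real \<Rightarrow> real \<Rightarrow> nat \<Rightarrow> nat \<Rightarrow> nat" where
  "net_size m M K N k l =
     2 * (Suc (nat \<lceil>2 * real k / m / mesh M l\<rceil>) * Suc (nat \<lfloor>1 / (packing_factor m M K N (real k / m + 1) (mesh M l / 3))\<^sup>2\<rfloor>))"

lemma (in TMCP_cone) uniform_net:
  fixes k l :: nat
  assumes y: "y \<in> mspace Y" and kl: "1 \<le> k" "1 \<le> l" and U: "\<And>n. 1 \<le> n \<Longrightarrow> U n = chron_diamond X (t - real n, y) (t + real n, y)"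
  shows "\<exists>g. net_enumeration (X, U) k l (net_size m M K N k l) g"
proof -
  define \<eta> where "\<eta> = mesh M l"
  have Ml: "0 < 4 * M * real l" using M_pos kl by simp
  have \<eta>: "0 < \<eta>" "\<eta> \<le> 1" "\<eta> * (4 * M * real l) \<le> 1"
    using Ml by (auto simp: \<eta>_def mesh_def min_le_iff_disj pos_le_divide_eq[symmetric])
  have M4: "4 * (M * \<eta>) \<le> 1 / real l" using \<eta>(3) kl by (simp add: pos_le_divide_eq algebra_simps)
  moreover have "1 / real l \<le> 1" using kl by simp
  ultimately have "4 * (M * \<eta>) \<le> 1" by linarith
  moreover have "0 < M * \<eta>" using M_pos \<eta> by simp
  ultimately have M3: "3 * \<eta> \<le> 1 / M" "M * (\<eta> / 3) \<le> 1" using M_pos by (auto simp: pos_le_divide_eq mult.commute)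
  define q where "q = packing_factor m M K N (real k / m + 1) (\<eta> / 3)"
  have \<rho>: "0 < real k / m" using kl m by simp
  have q: "0 < q" unfolding q_def by (rule packing_factor_pos) (use \<rho> \<eta> in auto)
  define Q where "Q = nat \<lfloor>1 / q\<^sup>2\<rfloor>"
  define B where "B = {w \<in> mspace Y. mdist Y y w \<le> real k / m}"
  have "\<exists>S. finite S \<and> S \<subseteq> B \<and> card S \<le> Q \<and> (\<forall>y\<in>B. \<exists>u\<in>S. mdist Y y u < \<eta>)"
  proof (rule maximal_separated_set[OF _ \<eta>(1)])
    fix S assume S: "finite S" "S \<subseteq> B" "\<forall>u\<in>S. \<forall>v\<in>S. u \<noteq> v \<longrightarrow> \<eta> \<le> mdist Y u v"
    have "real (card S) * (packing_factor m M K N (real k / m + 1) (\<eta> / 3))\<^sup>2 \<le> 1"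
      by (rule packing_bound[OF y \<rho> _ _ M3(2) S(1)]) (use S \<eta> in \<open>auto simp: B_def\<close>)
    then have "real (card S) \<le> 1 / q\<^sup>2" using q by (simp add: q_def pos_le_divide_eq)
    then show "card S \<le> Q" by (simp add: Q_def le_nat_floor)
  qed (auto simp: B_def)
  then obtain S where S: "finite S" "S \<subseteq> B" "card S \<le> Q" "\<And>w. w \<in> B \<Longrightarrow> \<exists>u\<in>S. mdist Y w u < \<eta>" by blast
  define J where "J = nat \<lceil>2 * real k / m / \<eta>\<rceil>"
  show ?thesis
  proof (rule diamond_net[OF y \<eta>(1) M3(1) M4 _ _ _ _ _ _ U[OF kl(1)] U _])
    show "finite (insert y S)" "insert y S \<subseteq> mspace Y" "y \<in> insert y S" using S y by (auto simp: B_def)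
    show "\<exists>u\<in>insert y S. mdist Y w u < \<eta>" if "w \<in> mspace Y" "mdist Y y w \<le> real k / m" for w
      using S(4)[of w] that by (auto simp: B_def)
    have "2 * real k / m / \<eta> \<le> real J" unfolding J_def by (rule real_nat_ceiling_ge)
    then show "2 * real k / m \<le> real J * \<eta>" using \<eta> by (simp only: pos_divide_le_eq)
    have "card (insert y S) \<le> Suc Q" using S(1,3) by (simp add: card_insert_if)
    then show "2 * (Suc J * card (insert y S)) \<le> net_size m M K N k l"
      unfolding net_size_def \<eta>_def[symmetric] q_def[symmetric] Q_def[symmetric] J_def[symmetric]
      by (intro mult_le_mono) auto
  qed (use kl in auto)
qed

section \<open>The limit space\<close>

lemma diagonal_convergent:
  fixes \<Phi> :: "nat \<Rightarrow> nat \<Rightarrow> ennreal"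
  obtains r where "strict_mono r" "\<And>i. convergent (\<lambda>n. \<Phi> i (r n))"
proof -
  interpret subseqs "\<lambda>i s. convergent (\<lambda>n. \<Phi> i (s n))"
  proof
    fix i :: nat and s :: "nat \<Rightarrow> nat"
    obtain l r' where "strict_mono r'" "((\<lambda>n. \<Phi> i (s n)) \<circ> r') \<longlonglongrightarrow> l"
      using compact_complete_linorder[of "\<lambda>n. \<Phi> i (s n)"] by blast
    then show "\<exists>r'. strict_mono r' \<and> convergent (\<lambda>n. \<Phi> i ((s \<circ> r') n))"
      by (auto simp: o_def convergent_def)
  qed
  have "convergent (\<lambda>n. \<Phi> i (diagseq n))" for i
  proof -
    have "convergent (\<lambda>n. \<Phi> i ((diagseq \<circ> (+) (Suc i)) n))"
    proof (rule diagseq_holds)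
      fix r s :: "nat \<Rightarrow> nat" and n assume "strict_mono r" "convergent (\<lambda>j. \<Phi> n (s j))"
      then show "convergent (\<lambda>j. \<Phi> n ((s \<circ> r) j))"
        using convergent_subseq_convergent[of "\<lambda>j. \<Phi> n (s j)" r] by (simp add: o_def)
    qed
    then have "convergent (\<lambda>n. \<Phi> i (diagseq (n + Suc i)))" by (simp add: add.commute)
    then show ?thesis by (rule convergent_ignore_initial_segment[THEN iffD1, of "\<lambda>n. \<Phi> i (diagseq n)" "Suc i"])
  qed
  then show ?thesis using that subseq_diagseq by blast
qed

text \<open>Encoding predicates as sequences of 0 and 1 lets one diagonal argument stabilize them
  together with the values of \<tau>.\<close>

lemma convergent_of_bool_dichotomy:
  assumes "convergent (\<lambda>n. of_bool (Q n) :: ennreal)"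
  shows "eventually Q sequentially \<or> eventually (\<lambda>n. \<not> Q n) sequentially"
proof -
  obtain L where L: "(\<lambda>n. of_bool (Q n) :: ennreal) \<longlonglongrightarrow> L" using assms by (auto simp: convergent_def)
  show ?thesis
  proof (cases "L = 0")
    case True
    then have "eventually (\<lambda>n. of_bool (Q n) < (1 :: ennreal)) sequentially" using order_tendstoD(2)[OF L, of 1] by simp
    then have "eventually (\<lambda>n. \<not> Q n) sequentially" by eventually_elim (auto split: if_splits)
    then show ?thesis ..
  next
    case False
    then have "eventually (\<lambda>n. 0 < (of_bool (Q n) :: ennreal)) sequentially" 
      using order_tendstoD(1)[OF L, of 0] by (simp add: zero_less_iff_neq_zero)
    then have "eventually Q sequentially" by (rule eventually_mono) (simp add: of_bool_def split: if_splits)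
    then show ?thesis ..
  qed
qed

lemma frequently_finite_ball:
  assumes "finite I" "eventually (\<lambda>n. \<exists>i\<in>I. Q i n) A" "A \<noteq> bot"
  shows "\<exists>i\<in>I. frequently (Q i) A"
proof (rule ccontr)
  assume "\<not> (\<exists>i\<in>I. frequently (Q i) A)"
  then have "eventually (\<lambda>n. \<forall>i\<in>I. \<not> Q i n) A" using assms(1) by (auto simp: frequently_def intro: eventually_ball_finite)
  with assms(2) have "eventually (\<lambda>n. False) A" by eventually_elim blast
  then show False using assms(3) by simp
qed

section \<open>Labels naming points in every space of a sequence\<close>

datatype label = Base nat nat nat | Partner nat nat label | Witness nat label label

instance label :: countable by countable_datatype

text \<open>The points \<open>Base k l i\<close> enumerate a net of \<open>U\<^sub>k\<close>. A point \<open>Partner k l a\<close> of \<open>U\<^sub>k\<close> spans a diamond of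
  size \<open>1 / l\<close> with \<open>a\<close>, and \<open>Witness k a b\<close> is a point of \<open>U\<^sub>k\<close> in the diamond of \<open>a\<close> and \<open>b\<close>. Labels for which
  no such point exists name an arbitrary point of \<open>U\<^sub>1\<close>.\<close>

definition some_or :: "'a \<Rightarrow> ('a \<Rightarrow> bool) \<Rightarrow> 'a" where
  "some_or d Q = (if \<exists>x. Q x then SOME x. Q x else d)"

lemma some_or_cases: "Q (some_or d Q) \<or> (some_or d Q = d \<and> \<not> (\<exists>x. Q x))"
  unfolding some_or_def using someI_ex[of Q] by simp

context
  fixes P :: "nat \<Rightarrow> nat \<Rightarrow> nat" and Z :: "'a covered_space"
begin

definition default_point :: 'a where
  "default_point = (SOME p. p \<in> snd Z 1)"

primrec labelled_point :: "label \<Rightarrow> 'a" where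
  "labelled_point (Base k l i) = some_or (\<lambda>_. default_point) (\<lambda>g. 1 \<le> k \<and> 1 \<le> l \<and> net_enumeration Z k l (P k l) g) i"
| "labelled_point (Partner k l a) = some_or default_point (\<lambda>q. 1 \<le> k \<and> q \<in> snd Z k \<and>
     (caus (fst Z) (labelled_point a) q \<and> tsep (fst Z) (labelled_point a) q \<le> ennreal (1 / real l) \<or>
      caus (fst Z) q (labelled_point a) \<and> tsep (fst Z) q (labelled_point a) \<le> ennreal (1 / real l)))"
| "labelled_point (Witness k a b) = some_or default_point (\<lambda>x. 1 \<le> k \<and> x \<in> snd Z k \<and>
     caus (fst Z) (labelled_point a) x \<and> caus (fst Z) x (labelled_point b))"
end

text \<open>An index of the cover valid for all n at once, which bounds \<tau> between two labels
  along the sequence. The maximum with 1 takes care of k = 0, where the label falls back to a point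
  of \<open>U\<^sub>1\<close>.\<close>

fun level :: "label \<Rightarrow> nat" where
  "level (Base k l i) = Suc k"
| "level (Partner k l a) = max 1 k"
| "level (Witness k a b) = max 1 k"

lemma level_pos: "1 \<le> level a"
  by (cases a) auto

text \<open>P and B do not depend on n: the same finitely many labels describe a net in every space,
  and \<tau> between fixed labels stays bounded, hence has finite limits.\<close>

locale netted_sequence =
  fixes Xs :: "nat \<Rightarrow> 'a covered_space" and P :: "nat \<Rightarrow> nat \<Rightarrow> nat" and B :: "nat \<Rightarrow> real"
  assumes covered: "\<And>n. covered_lorentzian_pre_length_space (Xs n)"
    and tsep_refl: "\<And>n p. tsep (fst (Xs n)) p p = 0"
    and nonempty: "\<And>n. snd (Xs n) 1 \<noteq> {}"
    and nets: "\<And>n k l. 1 \<le> k \<Longrightarrow> 1 \<le> l \<Longrightarrow> \<exists>g. net_enumeration (Xs n) k l (P k l) g"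
    and bounded: "\<And>n k p q. 1 \<le> k \<Longrightarrow> p \<in> snd (Xs n) k \<Longrightarrow> q \<in> snd (Xs n) k \<Longrightarrow> tsep (fst (Xs n)) p q \<le> ennreal (B k)"
begin

abbreviation X where "X n \<equiv> fst (Xs n)"
abbreviation U where "U n \<equiv> snd (Xs n)"
abbreviation x where "x n \<equiv> labelled_point P (Xs n)"

lemma pre_length: "lorentzian_pre_length_space (X n)"
  using covered[of n] by (simp add: covered_lorentzian_pre_length_space_def case_prod_beta)

lemma U_mono: "1 \<le> j \<Longrightarrow> j \<le> k \<Longrightarrow> U n j \<subseteq> U n k"
proof (induction k)
  case (Suc k)
  show ?case
  proof (cases "j = Suc k")
    case False
    then have "U n j \<subseteq> U n k" "1 \<le> k" using Suc by auto
    then show ?thesis using covered[of n] by (auto simp: covered_lorentzian_pre_length_space_def case_prod_beta)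
  qed simp
qed simp

lemma U_subset: "1 \<le> k \<Longrightarrow> U n k \<subseteq> pts (X n)"
  using covered[of n] by (auto simp: covered_lorentzian_pre_length_space_def case_prod_beta)

lemma default_mem: "1 \<le> k \<Longrightarrow> default_point (Xs n) \<in> U n k"
  using U_mono[of 1 k n] nonempty[of n] some_in_eq[of "U n 1"] by (auto simp: default_point_def)

lemma labelled_point_net: "1 \<le> k \<Longrightarrow> 1 \<le> l \<Longrightarrow> net_enumeration (Xs n) k l (P k l) (\<lambda>i. x n (Base k l i))"
  using some_or_cases[of "\<lambda>g. 1 \<le> k \<and> 1 \<le> l \<and> net_enumeration (Xs n) k l (P k l) g" "\<lambda>_. default_point (Xs n)"] nets[of k l n]
  by auto

lemma partner_mem: "1 \<le> k \<Longrightarrow> x n (Partner k l a) \<in> U n k"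
  using some_or_cases[of "\<lambda>q. 1 \<le> k \<and> q \<in> U n k \<and>
     (caus (X n) (x n a) q \<and> tsep (X n) (x n a) q \<le> ennreal (1 / real l) \<or>
      caus (X n) q (x n a) \<and> tsep (X n) q (x n a) \<le> ennreal (1 / real l))" "default_point (Xs n)"] default_mem[of k n]
  by auto

lemma witness_mem: "1 \<le> k \<Longrightarrow> x n (Witness k a b) \<in> U n k"
  using some_or_cases[of "\<lambda>y. 1 \<le> k \<and> y \<in> U n k \<and> caus (X n) (x n a) y \<and> caus (X n) y (x n b)" "default_point (Xs n)"] default_mem[of k n]
  by auto

lemma partner_close:
  assumes "1 \<le> k" "1 \<le> l" "approximable (X n) (U n k) (x n a)"
  shows "caus (X n) (x n a) (x n (Partner k l a)) \<and> tsep (X n) (x n a) (x n (Partner k l a)) \<le> ennreal (1 / real l) \<or>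
    caus (X n) (x n (Partner k l a)) (x n a) \<and> tsep (X n) (x n (Partner k l a)) (x n a) \<le> ennreal (1 / real l)"
proof -
  have "\<exists>q\<in>U n k. caus (X n) (x n a) q \<and> tsep (X n) (x n a) q \<le> ennreal (1 / real l) \<or>
      caus (X n) q (x n a) \<and> tsep (X n) q (x n a) \<le> ennreal (1 / real l)"
    using assms unfolding approximable_def by simp
  then show ?thesis
    using assms(1) some_or_cases[of "\<lambda>q. 1 \<le> k \<and> q \<in> U n k \<and>
     (caus (X n) (x n a) q \<and> tsep (X n) (x n a) q \<le> ennreal (1 / real l) \<or>
      caus (X n) q (x n a) \<and> tsep (X n) q (x n a) \<le> ennreal (1 / real l))" "default_point (Xs n)"]
    by auto
qed

lemma witness_between:
  assumes "1 \<le> k" "y \<in> U n k" "caus (X n) (x n a) y" "caus (X n) y (x n b)"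
  shows "caus (X n) (x n a) (x n (Witness k a b)) \<and> caus (X n) (x n (Witness k a b)) (x n b)"
  using assms some_or_cases[of "\<lambda>y. 1 \<le> k \<and> y \<in> U n k \<and> caus (X n) (x n a) y \<and> caus (X n) y (x n b)" "default_point (Xs n)"]
  by auto

lemma level_mem: "x n a \<in> U n (level a)"
proof (cases a)
  case (Base k l i)
  show ?thesis
  proof (cases "1 \<le> k \<and> 1 \<le> l")
    case True
    then show ?thesis using labelled_point_net[of k l n] Base by (simp add: net_enumeration_def)
  next
    case False
    then have "x n a = default_point (Xs n)" using Base by (auto simp: some_or_def)
    then show ?thesis using default_mem[of "Suc k" n] Base by simp
  qed
next
  case (Partner k l b)
  show ?thesis
  proof (cases "1 \<le> k")
    case True
    then show ?thesis using partner_mem[of k n l b] Partner by (simp add: max_def)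
  next
    case False
    then show ?thesis using default_mem[of 1 n] Partner by (simp add: some_or_def)
  qed
next
  case (Witness k b c)
  show ?thesis
  proof (cases "1 \<le> k")
    case True
    then show ?thesis using witness_mem[of k n b c] Witness by (simp add: max_def)
  next
    case False
    then show ?thesis using default_mem[of 1 n] Witness by (simp add: some_or_def)
  qed
qed

lemma x_pts: "x n a \<in> pts (X n)"
  using level_mem[of n a] U_subset[OF level_pos[of a], of n] by blast

lemma tsep_x_bound: "tsep (X n) (x n a) (x n b) \<le> ennreal (B (max (level a) (level b)))"
  by (rule bounded) (use level_mem[of n] level_pos U_mono[of "level a" "max (level a) (level b)" n] U_mono[of "level b" "max (level a) (level b)" n] in \<open>auto simp: le_max_iff_disj\<close>)

lemma caus_refl: "caus (X n) (x n a) (x n a)"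
  using pre_length[of n] x_pts[of n a] by (simp add: lorentzian_pre_length_space_def reflp_on_def)

lemma caus_trans: "caus (X n) (x n a) (x n b) \<Longrightarrow> caus (X n) (x n b) (x n c) \<Longrightarrow> caus (X n) (x n a) (x n c)"
  using pre_length[of n] x_pts[of n a] x_pts[of n b] x_pts[of n c]
  unfolding lorentzian_pre_length_space_def transp_on_def by blast

lemma tsep_triangle: "caus (X n) (x n a) (x n b) \<Longrightarrow> caus (X n) (x n b) (x n c) \<Longrightarrow>
    tsep (X n) (x n a) (x n b) + tsep (X n) (x n b) (x n c) \<le> tsep (X n) (x n a) (x n c)"
  using pre_length[of n] x_pts[of n a] x_pts[of n b] x_pts[of n c]
  unfolding lorentzian_pre_length_space_def by blast

lemma tsep_pos_caus: "0 < tsep (X n) (x n a) (x n b) \<Longrightarrow> caus (X n) (x n a) (x n b)"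
  using pre_length[of n] x_pts[of n a] x_pts[of n b]
  unfolding lorentzian_pre_length_space_def by blast

end

text \<open>The comparison with 1 / l is stabilized separately: a limit at most 1 / l does not make
  the values themselves at most 1 / l, and the nets need the bound in the spaces as well as in the
  limit.\<close>

locale stable_netted_sequence = netted_sequence +
  assumes tsep_convergent: "\<And>a b. convergent (\<lambda>n. tsep (X n) (x n a) (x n b))"
    and caus_stable: "\<And>a b. eventually (\<lambda>n. caus (X n) (x n a) (x n b)) sequentially \<or> eventually (\<lambda>n. \<not> caus (X n) (x n a) (x n b)) sequentially"
    and mem_stable: "\<And>k a. eventually (\<lambda>n. x n a \<in> U n k) sequentially \<or> eventually (\<lambda>n. x n a \<notin> U n k) sequentially"
    and small_stable: "\<And>l a b. eventually (\<lambda>n. tsep (X n) (x n a) (x n b) \<le> ennreal (1 / real l)) sequentially \<or>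
      eventually (\<lambda>n. \<not> tsep (X n) (x n a) (x n b) \<le> ennreal (1 / real l)) sequentially"

lemma (in netted_sequence) stable_subsequence:
  obtains r where "strict_mono r" "stable_netted_sequence (Xs \<circ> r) P B"
proof -
  \<comment> \<open>Countability of labels merges all sequences into one indexed family. A labelled
    point depends on its own space only, so labels keep their meaning along the subsequence.\<close>
  define \<Phi> where "\<Phi> i n = (case from_nat i :: (label \<times> label) \<times> (nat + nat + bool) of
      ((a, b), Inl k) \<Rightarrow> of_bool (x n a \<in> U n k)
    | ((a, b), Inr (Inl l)) \<Rightarrow> of_bool (tsep (X n) (x n a) (x n b) \<le> ennreal (1 / real l))
    | ((a, b), Inr (Inr True)) \<Rightarrow> of_bool (caus (X n) (x n a) (x n b))
    | ((a, b), Inr (Inr False)) \<Rightarrow> tsep (X n) (x n a) (x n b))" for i n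
  obtain r where r: "strict_mono r" "\<And>i. convergent (\<lambda>n. \<Phi> i (r n))" using diagonal_convergent[of \<Phi>] by blast
  have 1: "convergent (\<lambda>n. of_bool (x (r n) a \<in> U (r n) k) :: ennreal)" for a k
    using r(2)[of "to_nat ((a, a), Inl k :: nat + nat + bool)"] by (simp add: \<Phi>_def)
  have 2: "convergent (\<lambda>n. of_bool (tsep (X (r n)) (x (r n) a) (x (r n) b) \<le> ennreal (1 / real l)) :: ennreal)" for a b l
    using r(2)[of "to_nat ((a, b), Inr (Inl l) :: nat + nat + bool)"] by (simp add: \<Phi>_def)
  have 3: "convergent (\<lambda>n. of_bool (caus (X (r n)) (x (r n) a) (x (r n) b)) :: ennreal)" for a b
    using r(2)[of "to_nat ((a, b), Inr (Inr True) :: nat + nat + bool)"] by (simp add: \<Phi>_def)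
  have 4: "convergent (\<lambda>n. tsep (X (r n)) (x (r n) a) (x (r n) b))" for a b
    using r(2)[of "to_nat ((a, b), Inr (Inr False) :: nat + nat + bool)"] by (simp add: \<Phi>_def)
  have "stable_netted_sequence (Xs \<circ> r) P B"
  proof
    show "covered_lorentzian_pre_length_space ((Xs \<circ> r) n)" for n using covered by simp
    show "tsep (fst ((Xs \<circ> r) n)) p p = 0" for n p using tsep_refl by simp
    show "snd ((Xs \<circ> r) n) 1 \<noteq> {}" for n using nonempty by simp
    show "\<exists>g. net_enumeration ((Xs \<circ> r) n) k l (P k l) g" if "1 \<le> k" "1 \<le> l" for n k l using nets[OF that] by simp
    show "tsep (fst ((Xs \<circ> r) n)) p q \<le> ennreal (B k)" if "1 \<le> k" "p \<in> snd ((Xs \<circ> r) n) k" "q \<in> snd ((Xs \<circ> r) n) k" for n k p q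
      using bounded[of k p "r n" q] that by simp
  next
    fix a b
    show "convergent (\<lambda>n. tsep (fst ((Xs \<circ> r) n)) (labelled_point P ((Xs \<circ> r) n) a) (labelled_point P ((Xs \<circ> r) n) b))"
      unfolding o_apply by (rule 4)
    show "(\<forall>\<^sub>F n in sequentially. caus (fst ((Xs \<circ> r) n)) (labelled_point P ((Xs \<circ> r) n) a) (labelled_point P ((Xs \<circ> r) n) b)) \<or>
        (\<forall>\<^sub>F n in sequentially. \<not> caus (fst ((Xs \<circ> r) n)) (labelled_point P ((Xs \<circ> r) n) a) (labelled_point P ((Xs \<circ> r) n) b))"
      unfolding o_apply by (rule convergent_of_bool_dichotomy[OF 3])
    show "(\<forall>\<^sub>F n in sequentially. labelled_point P ((Xs \<circ> r) n) a \<in> snd ((Xs \<circ> r) n) k) \<or>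
        (\<forall>\<^sub>F n in sequentially. labelled_point P ((Xs \<circ> r) n) a \<notin> snd ((Xs \<circ> r) n) k)" for k
      unfolding o_apply by (rule convergent_of_bool_dichotomy[OF 1])
    show "(\<forall>\<^sub>F n in sequentially. tsep (fst ((Xs \<circ> r) n)) (labelled_point P ((Xs \<circ> r) n) a) (labelled_point P ((Xs \<circ> r) n) b) \<le> ennreal (1 / real l)) \<or>
        (\<forall>\<^sub>F n in sequentially. \<not> tsep (fst ((Xs \<circ> r) n)) (labelled_point P ((Xs \<circ> r) n) a) (labelled_point P ((Xs \<circ> r) n) b) \<le> ennreal (1 / real l))" for l
      unfolding o_apply by (rule convergent_of_bool_dichotomy[OF 2])
  qed
  with r(1) show ?thesis by (rule that)
qed

section \<open>Limits of the relations and nets of labels\<close>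

context stable_netted_sequence
begin

definition tsep_limit :: "label \<Rightarrow> label \<Rightarrow> ennreal" where
  "tsep_limit a b = lim (\<lambda>n. tsep (X n) (x n a) (x n b))"

definition caus_limit :: "label \<Rightarrow> label \<Rightarrow> bool" where
  "caus_limit a b \<longleftrightarrow> eventually (\<lambda>n. caus (X n) (x n a) (x n b)) sequentially"

definition cover_limit :: "nat \<Rightarrow> label set" where
  "cover_limit k = {a. eventually (\<lambda>n. x n a \<in> U n k) sequentially}"

definition small_limit :: "nat \<Rightarrow> label \<Rightarrow> label \<Rightarrow> bool" where
  "small_limit l a b \<longleftrightarrow> eventually (\<lambda>n. tsep (X n) (x n a) (x n b) \<le> ennreal (1 / real l)) sequentially"

definition meets :: "nat \<Rightarrow> label \<Rightarrow> label \<Rightarrow> bool" where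
  "meets k a b \<longleftrightarrow> (\<exists>c\<in>cover_limit k. caus_limit a c \<and> caus_limit c b)"

lemma tsep_limit: "(\<lambda>n. tsep (X n) (x n a) (x n b)) \<longlonglongrightarrow> tsep_limit a b"
  unfolding tsep_limit_def using tsep_convergent convergent_LIMSEQ_iff by blast

lemma tsep_limit_finite: "tsep_limit a b < \<top>"
proof -
  have "tsep_limit a b \<le> ennreal (B (max (level a) (level b)))"
    by (rule tendsto_upperbound[OF tsep_limit]) (auto intro: always_eventually tsep_x_bound)
  then show ?thesis using le_less_trans ennreal_less_top by blast
qed

lemma caus_limitI: "frequently (\<lambda>n. caus (X n) (x n a) (x n b)) sequentially \<Longrightarrow> caus_limit a b"
  using caus_stable[of a b] by (auto simp: caus_limit_def frequently_def)

lemma small_limitI: "frequently (\<lambda>n. tsep (X n) (x n a) (x n b) \<le> ennreal (1 / real l)) sequentially \<Longrightarrow> small_limit l a b"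
  using small_stable[of a b l] by (auto simp: small_limit_def frequently_def)

lemma caus_limit_refl: "caus_limit a a"
  by (simp add: caus_limit_def caus_refl)

lemma caus_limit_trans: "caus_limit a b \<Longrightarrow> caus_limit b c \<Longrightarrow> caus_limit a c"
  unfolding caus_limit_def by (auto elim: eventually_elim2 intro: caus_trans)

lemma tsep_limit_triangle:
  assumes "caus_limit a b" "caus_limit b c"
  shows "tsep_limit a b + tsep_limit b c \<le> tsep_limit a c"
proof (rule tendsto_le[OF sequentially_bot tsep_limit tendsto_add[OF tsep_limit tsep_limit]])
  show "eventually (\<lambda>n. tsep (X n) (x n a) (x n b) + tsep (X n) (x n b) (x n c) \<le> tsep (X n) (x n a) (x n c)) sequentially"
    using assms unfolding caus_limit_def by (auto elim: eventually_elim2 intro: tsep_triangle)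
qed

lemma tsep_limit_pos_caus: "0 < tsep_limit a b \<Longrightarrow> caus_limit a b"
  using order_tendstoD(1)[OF tsep_limit, of 0 a b] unfolding caus_limit_def
  by (auto elim!: eventually_mono intro: tsep_pos_caus)

lemma small_limit_le: "small_limit l a b \<Longrightarrow> tsep_limit a b \<le> ennreal (1 / real l)"
  unfolding small_limit_def by (rule tendsto_upperbound[OF tsep_limit]) auto

lemma small_limit_refl: "small_limit l a a"
  by (simp add: small_limit_def tsep_refl)

text \<open>The points in which a diamond meets \<open>U\<^sub>k\<close> vary with n and carry no
  name. The witness label names one of them whenever there is one, and stability turns the frequent
  causal relations into limiting ones.\<close>

lemma meetsI:
  assumes k: "1 \<le> k" and "frequently (\<lambda>n. \<exists>y\<in>U n k. caus (X n) (x n a) y \<and> caus (X n) y (x n b)) sequentially"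
  shows "meets k a b"
proof -
  have f: "frequently (\<lambda>n. caus (X n) (x n a) (x n (Witness k a b)) \<and> caus (X n) (x n (Witness k a b)) (x n b)) sequentially"
    using assms(2) by (rule frequently_elim1) (use witness_between[OF k] in blast)
  have "caus_limit a (Witness k a b)" "caus_limit (Witness k a b) b"
    by (rule caus_limitI, rule frequently_elim1[OF f], blast)+
  moreover have "Witness k a b \<in> cover_limit k" unfolding cover_limit_def using witness_mem[OF k] by simp
  ultimately show ?thesis unfolding meets_def by blast
qed

lemma meets_eventually:
  "meets k a b \<Longrightarrow> eventually (\<lambda>n. \<exists>y\<in>U n k. caus (X n) (x n a) y \<and> caus (X n) y (x n b)) sequentially"
proof -
  assume "meets k a b"
  then obtain c where "c \<in> cover_limit k" "caus_limit a c" "caus_limit c b" by (auto simp: meets_def)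
  then have "eventually (\<lambda>n. x n c \<in> U n k) sequentially" "eventually (\<lambda>n. caus (X n) (x n a) (x n c)) sequentially"
    "eventually (\<lambda>n. caus (X n) (x n c) (x n b)) sequentially" by (auto simp: cover_limit_def caus_limit_def)
  then show ?thesis by eventually_elim blast
qed

text \<open>The unions over j keep old vertices. Partners of scale j are added for base points of
  all scales up to j, so every base vertex has a partner at the current scale l. The last set
  eventually contains every label of the limiting cover, as forward density requires.\<close>

definition vertex_labels :: "nat \<Rightarrow> nat \<Rightarrow> label set" where
  "vertex_labels k l =
     (\<Union>j\<in>{1..l}. Base k j ` {..<P k j}) \<union>
     (\<Union>j\<in>{1..l}. \<Union>j'\<in>{1..j}. (\<lambda>i. Partner k j (Base k j' i)) ` {..<P k j'}) \<union>
     {a \<in> cover_limit k. to_nat a \<le> l}"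

definition net_labels :: "nat \<Rightarrow> nat \<Rightarrow> (label \<times> label) set" where
  "net_labels k l = {(a, b). a \<in> vertex_labels k l \<and> b \<in> vertex_labels k l \<and> small_limit l a b \<and> meets k a b}"

lemma finite_vertex_labels: "finite (vertex_labels k l)"
proof -
  have "finite {a :: label. to_nat a \<le> l}"
    by (rule inj_on_finite[of to_nat _ "{..l}"]) auto
  then show ?thesis unfolding vertex_labels_def by (simp add: finite_subset[OF _ \<open>finite {a :: label. to_nat a \<le> l}\<close>] subset_iff)
qed

lemma finite_net_labels: "finite (net_labels k l)"
  by (rule finite_subset[OF _ finite_cartesian_product[OF finite_vertex_labels finite_vertex_labels]]) (auto simp: net_labels_def)

lemma vertex_labels_mono: "vertex_labels k l \<subseteq> vertex_labels k (Suc l)"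
proof -
  have "{1..l} \<subseteq> {1..Suc l}" by auto
  then show ?thesis unfolding vertex_labels_def by (intro Un_mono UN_mono) auto
qed

text \<open>The degenerate diamond of a with itself has size 0 and is met by the cover in a.\<close>

lemma net_labels_diagonal: "a \<in> vertex_labels k l \<Longrightarrow> a \<in> cover_limit k \<Longrightarrow> (a, a) \<in> net_labels k l"
  using small_limit_refl[of l a] caus_limit_refl[of a] by (auto simp: net_labels_def meets_def)

text \<open>No vertex may be lost when pairs are restricted to small diamonds meeting
  \<open>U\<^sub>k\<close>. Labels of the cover use the degenerate diamond. A base vertex can lie
  outside the cover and is joined to its partner; the time order of the two may vary with n, but one
  order occurs frequently and is then the limiting one.\<close>

lemma vertices_net_labels:
  assumes k: "1 \<le> k"
  shows "vertices (net_labels k l) = vertex_labels k l"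
proof (intro equalityI subsetI)
  fix a assume a: "a \<in> vertex_labels k l"
  have partner_cover: "Partner k j b \<in> cover_limit k" for j b
    unfolding cover_limit_def using partner_mem[OF k] by simp
  from a consider "a \<in> cover_limit k" | j i where "j \<in> {1..l}" "i < P k j" "a = Base k j i"
    unfolding vertex_labels_def using partner_cover by blast
  then show "a \<in> vertices (net_labels k l)"
  proof cases
    case 1
    show ?thesis using net_labels_diagonal[OF a 1] by (force simp: vertices_def)
  next
    case 2
    define b where "b = Partner k l a"
    have "b \<in> (\<Union>j\<in>{1..l}. \<Union>j'\<in>{1..j}. (\<lambda>i. Partner k j (Base k j' i)) ` {..<P k j'})"
      unfolding b_def 2(3) by (rule UN_I[of l], use 2 in simp, rule UN_I[of j]) (use 2 in auto)
    then have b: "b \<in> vertex_labels k l" unfolding vertex_labels_def by blast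
    have l: "1 \<le> l" using 2 by simp
    have "caus (X n) (x n a) (x n b) \<and> tsep (X n) (x n a) (x n b) \<le> ennreal (1 / real l) \<or>
        caus (X n) (x n b) (x n a) \<and> tsep (X n) (x n b) (x n a) \<le> ennreal (1 / real l)" for n
      unfolding b_def by (rule partner_close[OF k l]) (use labelled_point_net[OF k, of j n] 2 in \<open>auto simp: net_enumeration_def\<close>)
    then have "frequently (\<lambda>n. (caus (X n) (x n a) (x n b) \<and> tsep (X n) (x n a) (x n b) \<le> ennreal (1 / real l)) \<or>
        (caus (X n) (x n b) (x n a) \<and> tsep (X n) (x n b) (x n a) \<le> ennreal (1 / real l))) sequentially"
      by (intro eventually_frequently) auto
    then consider
        "frequently (\<lambda>n. caus (X n) (x n a) (x n b) \<and> tsep (X n) (x n a) (x n b) \<le> ennreal (1 / real l)) sequentially"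
      | "frequently (\<lambda>n. caus (X n) (x n b) (x n a) \<and> tsep (X n) (x n b) (x n a) \<le> ennreal (1 / real l)) sequentially"
      unfolding frequently_disj_iff by blast
    then show ?thesis
    proof cases
      case 1
      have "caus_limit a b" by (rule caus_limitI, rule frequently_elim1[OF 1], blast)
      moreover have "small_limit l a b" by (rule small_limitI, rule frequently_elim1[OF 1], blast)
      ultimately have "(a, b) \<in> net_labels k l"
        using a b partner_cover[of l a] caus_limit_refl[of b] unfolding net_labels_def meets_def b_def by auto
      then show ?thesis by (force simp: vertices_def)
    next
      case 2
      have "caus_limit b a" by (rule caus_limitI, rule frequently_elim1[OF 2], blast)
      moreover have "small_limit l b a" by (rule small_limitI, rule frequently_elim1[OF 2], blast)
      ultimately have "(b, a) \<in> net_labels k l"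
        using a b partner_cover[of l a] caus_limit_refl[of b] unfolding net_labels_def meets_def b_def by auto
      then show ?thesis by (force simp: vertices_def)
    qed
  qed
qed (auto simp: vertices_def net_labels_def)

lemma base_covers:
  assumes k: "1 \<le> k" and l: "1 \<le> l" and y: "y \<in> U n k"
  shows "\<exists>a\<in>vertex_labels k l. \<exists>b\<in>vertex_labels k l. caus (X n) (x n a) y \<and> caus (X n) y (x n b) \<and> tsep (X n) (x n a) (x n b) \<le> ennreal (1 / real l)"
proof -
  obtain i j where ij: "i < P k l" "j < P k l" "caus (X n) (x n (Base k l i)) y" "caus (X n) y (x n (Base k l j))"
     "tsep (X n) (x n (Base k l i)) (x n (Base k l j)) \<le> ennreal (1 / real l)"
    using labelled_point_net[OF k l, of n] y unfolding net_enumeration_def by blast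
  have "Base k l i \<in> vertex_labels k l" if "i < P k l" for i using that l unfolding vertex_labels_def by force
  then show ?thesis using ij by blast
qed

definition encode :: "label \<Rightarrow> real" where "encode a = real (to_nat a)"
definition decode :: "real \<Rightarrow> label" where "decode = inv encode"

lemma decode_encode [simp]: "decode (encode a) = a"
  unfolding decode_def by (rule inv_f_f) (auto simp: encode_def inj_def)

text \<open>Labels naming equal points are not identified, which a pre-length space permits. The
  carrier is moved into \<open>real\<close> because \<open>LGH_precompact\<close> prescribes this
  type for limits.\<close>

definition limit_space :: "real lorentz_space" where
  "limit_space = \<lparr>met = metric (range encode, discrete_metric.dd), chron = (\<lambda>p q. 0 < tsep_limit (decode p) (decode q)),
     caus = (\<lambda>p q. caus_limit (decode p) (decode q)), tsep = (\<lambda>p q. tsep_limit (decode p) (decode q))\<rparr>"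

lemma limit_space_simps [simp]:
  "pts limit_space = range encode"
  "chron limit_space p q \<longleftrightarrow> 0 < tsep_limit (decode p) (decode q)"
  "caus limit_space p q \<longleftrightarrow> caus_limit (decode p) (decode q)"
  "tsep limit_space p q = tsep_limit (decode p) (decode q)"
  "ltop limit_space = discrete_topology (range encode)"
  using Metric_space.mspace_metric[OF metric_M_dd, of "range encode"] Metric_space.mdist_metric[OF metric_M_dd, of "range encode"]
  by (simp_all add: limit_space_def mtopology_of_def discrete_metric.mtopology_discrete_metric)

lemma limit_space_pre_length: "lorentzian_pre_length_space limit_space"
  unfolding lorentzian_pre_length_space_def
proof (intro conjI ballI allI impI)
  show "transp_on (pts limit_space) (chron limit_space)"
    unfolding transp_on_def limit_space_simps
  proof (intro ballI impI)
    fix p q r assume *: "0 < tsep_limit (decode p) (decode q)" "0 < tsep_limit (decode q) (decode r)"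
    have "tsep_limit (decode p) (decode q) + tsep_limit (decode q) (decode r) \<le> tsep_limit (decode p) (decode r)"
      by (rule tsep_limit_triangle) (use * tsep_limit_pos_caus in auto)
    then show "0 < tsep_limit (decode p) (decode r)" using *(1) by (metis add_pos_nonneg less_le_trans zero_le)
  qed
  show "transp_on (pts limit_space) (caus limit_space)" unfolding transp_on_def limit_space_simps using caus_limit_trans by blast
  show "reflp_on (pts limit_space) (caus limit_space)" unfolding reflp_on_def limit_space_simps using caus_limit_refl by blast
  show "openin (prod_topology (ltop limit_space) (ltop limit_space)) {z \<in> pts limit_space \<times> pts limit_space. c < tsep limit_space (fst z) (snd z)}" for c
    unfolding limit_space_simps prod_topology_discrete_topology[symmetric] openin_discrete_topology by blast
qed (auto simp: tsep_limit_pos_caus tsep_limit_triangle)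

definition limit_cover :: "nat \<Rightarrow> real set" where
  "limit_cover k = encode ` cover_limit k"

lemma limit_covered: "covered_lorentzian_pre_length_space (limit_space, limit_cover)"
  unfolding covered_lorentzian_pre_length_space_def case_prod_conv
proof (intro conjI allI impI)
  have "a \<in> cover_limit (level a)" for a using level_mem by (simp add: cover_limit_def)
  then have "encode a \<in> (\<Union>k\<in>{1..}. limit_cover k)" for a
    unfolding limit_cover_def by (intro UN_I[of "level a"]) (use level_pos in auto)
  then show "(\<Union>k\<in>{1..}. limit_cover k) = pts limit_space" by (auto simp: limit_cover_def)
  fix k :: nat assume "1 \<le> k"
  then have "U n k \<subseteq> U n (Suc k)" for n by (intro U_mono) auto
  then show "limit_cover k \<subseteq> limit_cover (Suc k)"
    unfolding limit_cover_def cover_limit_def by (intro image_mono) (auto elim!: eventually_mono)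
qed (rule limit_space_pre_length)

text \<open>For large n the point named by c lies in one of finitely many small diamonds of labels.
  One pair of labels therefore occurs frequently, and stability makes its relations hold in the
  limit.\<close>

lemma limit_net:
  assumes k: "1 \<le> k" and l: "1 \<le> l"
  shows "eps_net limit_space (ennreal (1 / real l)) (limit_cover k) (map_prod encode encode ` net_labels k l)"
proof -
  have nonempty: "limit_cover k \<inter> causal_diamond limit_space (encode a) (encode b) \<noteq> {}" if "meets k a b" for a b
  proof -
    obtain c where "c \<in> cover_limit k" "caus_limit a c" "caus_limit c b" using \<open>meets k a b\<close> by (auto simp: meets_def)
    then have "encode c \<in> limit_cover k \<inter> causal_diamond limit_space (encode a) (encode b)"
      by (simp add: limit_cover_def causal_diamond_def causal_future_def causal_past_def)
    then show ?thesis by blast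
  qed
  have cover: "\<exists>(a, b)\<in>net_labels k l. caus_limit a c \<and> caus_limit c b" if c: "c \<in> cover_limit k" for c
  proof -
    let ?Q = "\<lambda>(a, b) n. x n c \<in> U n k \<and> caus (X n) (x n a) (x n c) \<and> caus (X n) (x n c) (x n b) \<and> tsep (X n) (x n a) (x n b) \<le> ennreal (1 / real l)"
    have "eventually (\<lambda>n. \<exists>e\<in>vertex_labels k l \<times> vertex_labels k l. ?Q e n) sequentially"
      using c unfolding cover_limit_def mem_Collect_eq
      by (rule eventually_mono) (use base_covers[OF k l] in fastforce)
    from frequently_finite_ball[OF _ this] obtain a b where ab: "a \<in> vertex_labels k l" "b \<in> vertex_labels k l" "frequently (?Q (a, b)) sequentially"
      using finite_vertex_labels by auto
    have "caus_limit a c" by (rule caus_limitI, rule frequently_elim1[OF ab(3)]) simp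
    moreover have "caus_limit c b" by (rule caus_limitI, rule frequently_elim1[OF ab(3)]) simp
    moreover have "small_limit l a b" by (rule small_limitI, rule frequently_elim1[OF ab(3)]) simp
    ultimately show ?thesis using ab(1,2) c by (auto simp: net_labels_def meets_def)
  qed
  show ?thesis
    unfolding eps_net_def
  proof (intro conjI)
    show "limit_cover k \<subseteq> (\<Union>(p, q)\<in>map_prod encode encode ` net_labels k l. causal_diamond limit_space p q)"
    proof
      fix p assume "p \<in> limit_cover k"
      then obtain c where c: "p = encode c" "c \<in> cover_limit k" by (auto simp: limit_cover_def)
      obtain a b where "(a, b) \<in> net_labels k l" "caus_limit a c" "caus_limit c b" using cover[OF c(2)] by blast
      then show "p \<in> (\<Union>(p, q)\<in>map_prod encode encode ` net_labels k l. causal_diamond limit_space p q)"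
        using c(1) by (force simp: causal_diamond_def causal_future_def causal_past_def)
    qed
  qed (use nonempty small_limit_le in \<open>auto simp: net_labels_def\<close>)
qed

text \<open>\<open>net_labels\<close> is defined by limiting behaviour. Since there are only
  finitely many pairs of vertex labels, for large n it consists exactly of those whose diamond in
  the n-th space is small and meets the cover, and the base points then cover as in
  \<open>base_covers\<close>.\<close>

lemma sequence_net:
  assumes k: "1 \<le> k" and l: "1 \<le> l"
  shows "eventually (\<lambda>n. eps_net (X n) (ennreal (1 / real l)) (U n k) (map_prod (x n) (x n) ` net_labels k l)) sequentially"
proof -
  let ?V = "vertex_labels k l"
  have 1: "eventually (\<lambda>n. \<forall>(a, b)\<in>net_labels k l. tsep (X n) (x n a) (x n b) \<le> ennreal (1 / real l) \<and>
      (\<exists>y\<in>U n k. caus (X n) (x n a) y \<and> caus (X n) y (x n b))) sequentially"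
    by (rule eventually_ball_finite[OF finite_net_labels])
      (auto simp: net_labels_def small_limit_def case_prod_beta intro!: eventually_conj meets_eventually)
  have 2: "eventually (\<lambda>n. \<forall>e\<in>?V \<times> ?V. tsep (X n) (x n (fst e)) (x n (snd e)) \<le> ennreal (1 / real l) \<longrightarrow>
      (\<exists>y\<in>U n k. caus (X n) (x n (fst e)) y \<and> caus (X n) y (x n (snd e))) \<longrightarrow> e \<in> net_labels k l) sequentially"
  proof (rule eventually_ball_finite)
    show "finite (?V \<times> ?V)" using finite_vertex_labels by blast
    show "\<forall>e\<in>?V \<times> ?V. eventually (\<lambda>n. tsep (X n) (x n (fst e)) (x n (snd e)) \<le> ennreal (1 / real l) \<longrightarrow>
      (\<exists>y\<in>U n k. caus (X n) (x n (fst e)) y \<and> caus (X n) y (x n (snd e))) \<longrightarrow> e \<in> net_labels k l) sequentially"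
    proof
      fix e assume e: "e \<in> ?V \<times> ?V"
      consider "e \<in> net_labels k l" | "\<not> small_limit l (fst e) (snd e)" | "\<not> meets k (fst e) (snd e)"
        using e unfolding net_labels_def by force
      then show "eventually (\<lambda>n. tsep (X n) (x n (fst e)) (x n (snd e)) \<le> ennreal (1 / real l) \<longrightarrow>
        (\<exists>y\<in>U n k. caus (X n) (x n (fst e)) y \<and> caus (X n) y (x n (snd e))) \<longrightarrow> e \<in> net_labels k l) sequentially"
      proof cases
        case 2
        then have "eventually (\<lambda>n. \<not> tsep (X n) (x n (fst e)) (x n (snd e)) \<le> ennreal (1 / real l)) sequentially"
          using small_limitI by (auto simp: frequently_def)
        then show ?thesis by (rule eventually_mono) blast
      next
        case 3
        then have "eventually (\<lambda>n. \<not> (\<exists>y\<in>U n k. caus (X n) (x n (fst e)) y \<and> caus (X n) y (x n (snd e)))) sequentially"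
          using meetsI[OF k] unfolding frequently_def by blast
        then show ?thesis by (rule eventually_mono) blast
      qed simp
    qed
  qed
  from 1 2 show ?thesis
  proof eventually_elim
    case (elim n)
    show ?case
      unfolding eps_net_def
    proof (intro conjI)
      show "map_prod (x n) (x n) ` net_labels k l \<subseteq> pts (X n) \<times> pts (X n)" using x_pts by auto
      show "\<forall>(p, q)\<in>map_prod (x n) (x n) ` net_labels k l. tsep (X n) p q \<le> ennreal (1 / real l) \<and> U n k \<inter> causal_diamond (X n) p q \<noteq> {}"
      proof clarify
        fix a b assume "(a, b) \<in> net_labels k l"
        then obtain y where "tsep (X n) (x n a) (x n b) \<le> ennreal (1 / real l)" "y \<in> U n k" "caus (X n) (x n a) y" "caus (X n) y (x n b)"
          using elim(1) by blast
        then show "tsep (X n) (x n a) (x n b) \<le> ennreal (1 / real l) \<and> U n k \<inter> causal_diamond (X n) (x n a) (x n b) \<noteq> {}"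
          using U_subset[OF k, of n] by (auto simp: causal_diamond_def causal_future_def causal_past_def)
      qed
      show "U n k \<subseteq> (\<Union>(p, q)\<in>map_prod (x n) (x n) ` net_labels k l. causal_diamond (X n) p q)"
      proof
        fix y assume y: "y \<in> U n k"
        obtain a b where ab: "a \<in> ?V" "b \<in> ?V" "caus (X n) (x n a) y" "caus (X n) y (x n b)" "tsep (X n) (x n a) (x n b) \<le> ennreal (1 / real l)"
          using base_covers[OF k l y] by blast
        then have "(a, b) \<in> net_labels k l" using elim(2) y by fastforce
        moreover have "y \<in> causal_diamond (X n) (x n a) (x n b)"
          using ab y U_subset[OF k, of n] by (auto simp: causal_diamond_def causal_future_def causal_past_def)
        ultimately show "y \<in> (\<Union>(p, q)\<in>map_prod (x n) (x n) ` net_labels k l. causal_diamond (X n) p q)" by force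
      qed
    qed
  qed
qed

section \<open>Distortion, forward density and convergence\<close>

lemma abs_diff_tendsto: "(\<lambda>n. abs_diff (tsep (X n) (x n a) (x n b)) (tsep_limit a b)) \<longlonglongrightarrow> 0"
proof -
  define s where "s n = enn2real (tsep (X n) (x n a) (x n b))" for n
  define t where "t = enn2real (tsep_limit a b)"
  have st: "\<And>n. tsep (X n) (x n a) (x n b) = ennreal (s n)" "tsep_limit a b = ennreal t"
    using tsep_limit_finite[of a b] le_less_trans[OF tsep_x_bound[of _ a b] ennreal_less_top] by (simp_all add: s_def t_def)
  have pos: "0 \<le> s n \<and> 0 \<le> t" for n by (simp add: s_def t_def)
  have "abs_diff (ennreal (s n)) (ennreal t) = ennreal \<bar>s n - t\<bar>" for n
    using pos[of n] by (cases "t \<le> s n") (auto simp: abs_diff_def ennreal_minus max_def ennreal_neg)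
  moreover have "s \<longlonglongrightarrow> t" 
    using tendsto_enn2real[OF tsep_limit[of a b, unfolded st(2)]] pos unfolding s_def[abs_def] by blast
  then have "(\<lambda>n. ennreal \<bar>s n - t\<bar>) \<longlonglongrightarrow> ennreal \<bar>t - t\<bar>" by (intro tendsto_intros)
  ultimately show ?thesis unfolding st by simp
qed

text \<open>The supremum over a finite correspondence is at most the sum over all pairs of labels, a
  finite sum of null sequences.\<close>

lemma distortion_tendsto:
  assumes V: "finite V"
  shows "(\<lambda>n. distortion (X n) limit_space ((\<lambda>a. (x n a, encode a)) ` V)) \<longlonglongrightarrow> 0"
proof (rule tendsto_sandwich[OF _ _ tendsto_const])
  show "(\<lambda>n. \<Sum>(a, b)\<in>V \<times> V. abs_diff (tsep (X n) (x n a) (x n b)) (tsep_limit a b)) \<longlonglongrightarrow> 0"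
  proof -
    have "(\<lambda>n. \<Sum>e\<in>V \<times> V. abs_diff (tsep (X n) (x n (fst e)) (x n (snd e))) (tsep_limit (fst e) (snd e))) \<longlonglongrightarrow> (\<Sum>e\<in>V \<times> V. 0)"
      by (intro tendsto_sum abs_diff_tendsto)
    then show ?thesis by (simp add: case_prod_beta)
  qed
  show "eventually (\<lambda>n. distortion (X n) limit_space ((\<lambda>a. (x n a, encode a)) ` V)
      \<le> (\<Sum>(a, b)\<in>V \<times> V. abs_diff (tsep (X n) (x n a) (x n b)) (tsep_limit a b))) sequentially"
  proof (intro always_eventually allI)
    fix n
    show "distortion (X n) limit_space ((\<lambda>a. (x n a, encode a)) ` V)
      \<le> (\<Sum>(a, b)\<in>V \<times> V. abs_diff (tsep (X n) (x n a) (x n b)) (tsep_limit a b))"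
      unfolding distortion_def
    proof (rule SUP_least)
      fix e assume "e \<in> (\<lambda>a. (x n a, encode a)) ` V \<times> (\<lambda>a. (x n a, encode a)) ` V"
      then obtain a b where ab: "a \<in> V" "b \<in> V" "e = ((x n a, encode a), (x n b, encode b))" by blast
      have "abs_diff (tsep (X n) (x n a) (x n b)) (tsep_limit a b) \<le>
          (\<Sum>e\<in>V \<times> V. abs_diff (tsep (X n) (x n (fst e)) (x n (snd e))) (tsep_limit (fst e) (snd e)))"
        using member_le_sum[of "(a, b)" "V \<times> V" "\<lambda>e. abs_diff (tsep (X n) (x n (fst e)) (x n (snd e))) (tsep_limit (fst e) (snd e))"] ab V
        by simp
      then show "(\<lambda>((v, w), (v', w')). abs_diff (tsep (X n) v v') (tsep limit_space w w')) e
          \<le> (\<Sum>(a, b)\<in>V \<times> V. abs_diff (tsep (X n) (x n a) (x n b)) (tsep_limit a b))"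
        using ab(3) by (simp add: case_prod_beta)
    qed
  qed
qed simp

lemma vertices_map_prod: "vertices (map_prod h h ` S) = h ` vertices S"
  by (force simp: vertices_def)

lemma limit_forward_dense:
  assumes k: "1 \<le> k"
  shows "forward_dense limit_space (\<Union>l\<in>{1..}. vertices (map_prod encode encode ` net_labels k l)) (limit_cover k)"
  unfolding forward_dense_def
proof
  fix p assume "p \<in> limit_cover k"
  then obtain a where a: "p = encode a" "a \<in> cover_limit k" by (auto simp: limit_cover_def)
  then have "a \<in> vertex_labels k (Suc (to_nat a))" by (simp add: vertex_labels_def)
  then have "p \<in> (\<Union>l\<in>{1..}. vertices (map_prod encode encode ` net_labels k l))"
    unfolding vertices_map_prod vertices_net_labels[OF k] a(1) by (intro UN_I[of "Suc (to_nat a)"]) auto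
  then show "\<exists>v. (\<forall>i::nat. v i \<in> (\<Union>l\<in>{1..}. vertices (map_prod encode encode ` net_labels k l)) \<and>
      caus limit_space (v i) (v (Suc i)) \<and> caus limit_space (v i) p) \<and> limitin (ltop limit_space) v p sequentially"
    using a by (intro exI[of _ "\<lambda>_. p"]) (auto simp: caus_limit_refl)
qed

lemma LGH_converges_limit: "LGH_converges Xs (limit_space, limit_cover)"
  unfolding LGH_converges_def fst_conv snd_conv
proof (rule exI[of _ "\<lambda>n k l. map_prod (x n) (x n) ` net_labels k l"], rule exI[of _ "\<lambda>k l. map_prod encode encode ` net_labels k l"],
    rule exI[of _ "\<lambda>n k l. (\<lambda>a. (x n a, encode a)) ` vertex_labels k l"], intro conjI allI impI)
  fix k l :: nat assume k: "1 \<le> k" and l: "1 \<le> l"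
  note V = vertices_map_prod vertices_net_labels[OF k]
  show "finite (map_prod encode encode ` net_labels k l)" using finite_net_labels by blast
  show "eps_net limit_space (ennreal (1 / real l)) (limit_cover k) (map_prod encode encode ` net_labels k l)" by (rule limit_net[OF k l])
  show "vertices (map_prod encode encode ` net_labels k l) \<subseteq> vertices (map_prod encode encode ` net_labels k (Suc l))"
    unfolding V by (rule image_mono[OF vertex_labels_mono])
  show "(\<lambda>n. distortion (X n) limit_space ((\<lambda>a. (x n a, encode a)) ` vertex_labels k l)) \<longlonglongrightarrow> 0"
    by (rule distortion_tendsto[OF finite_vertex_labels])
  show "\<forall>\<^sub>F n in sequentially.
      finite (map_prod (x n) (x n) ` net_labels k l) \<and>
      eps_net (X n) (ennreal (1 / real l)) (U n k) (map_prod (x n) (x n) ` net_labels k l) \<and>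
      vertices (map_prod (x n) (x n) ` net_labels k l) \<subseteq> vertices (map_prod (x n) (x n) ` net_labels k (Suc l)) \<and>
      correspondence (vertices (map_prod (x n) (x n) ` net_labels k l)) (vertices (map_prod encode encode ` net_labels k l))
        ((\<lambda>a. (x n a, encode a)) ` vertex_labels k l) \<and>
      (\<lambda>a. (x n a, encode a)) ` vertex_labels k l \<subseteq> (\<lambda>a. (x n a, encode a)) ` vertex_labels k (Suc l) \<and>
      matches_diamonds (map_prod (x n) (x n) ` net_labels k l) (map_prod encode encode ` net_labels k l)
        ((\<lambda>a. (x n a, encode a)) ` vertex_labels k l)"
    using sequence_net[OF k l]
  proof eventually_elim
    case (elim n)
    have lab: "a \<in> vertex_labels k l" "b \<in> vertex_labels k l" if "(a, b) \<in> net_labels k l" for a b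
      using that by (auto simp: net_labels_def)
    have c: "correspondence (x n ` vertex_labels k l) (encode ` vertex_labels k l) ((\<lambda>a. (x n a, encode a)) ` vertex_labels k l)"
      unfolding correspondence_def by (auto simp: image_image)
    have m: "matches_diamonds (map_prod (x n) (x n) ` net_labels k l) (map_prod encode encode ` net_labels k l)
        ((\<lambda>a. (x n a, encode a)) ` vertex_labels k l)"
      unfolding matches_diamonds_def using lab by (auto intro!: bexI[of _ "(_, _)"]) 
    show ?case
      unfolding V by (intro conjI finite_imageI finite_net_labels image_mono vertex_labels_mono elim c m)
  qed
qed (rule limit_forward_dense)
end

lemma (in netted_sequence) converging_subsequence:
  "\<exists>r. strict_mono r \<and> (\<exists>Z :: real covered_space. covered_lorentzian_pre_length_space Z \<and> LGH_converges (Xs \<circ> r) Z)"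
proof -
  obtain r where r: "strict_mono r" "stable_netted_sequence (Xs \<circ> r) P B" using stable_subsequence .
  then interpret s: stable_netted_sequence "Xs \<circ> r" P B by simp
  show ?thesis using r(1) s.limit_covered s.LGH_converges_limit by blast
qed

theorem theorem4p16:
  fixes m M k K N :: real
  assumes "0 < m" and "m \<le> M" and "1 < N"
  shows "LGH_precompact
    {(X :: (real \<times> 'a) lorentz_space, U).
       covered_lorentzian_pre_length_space (X, U) \<and>
       (\<exists>(Y :: 'a metric) f.
          length_space Y \<and> continuous_on UNIV f \<and> (\<forall>s. m \<le> f s \<and> f s \<le> M) \<and>
          X = generalized_cone UNIV f Y) \<and>
       globally_hyperbolic X \<and> timelike_non_branching X \<and> regular_lorentzian_length_space X \<and>
       global_TCBA k X \<and>
       (\<exists>\<mm>. radon_measure (ltop X) \<mm> \<and> full_support (ltop X) \<mm> \<and>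
          TMCP_e K N X \<mm> \<and> TMCP_e K N (causal_reversal X) \<mm>) \<and>
       (\<exists>t y. (t, y) \<in> pts X \<and>
          (\<forall>n\<ge>1. U n = chron_diamond X (t - real n, y) (t + real n, y)))}"
  (is "LGH_precompact ?\<C>")
  unfolding LGH_precompact_def
proof (intro allI impI)
  fix Xs :: "nat \<Rightarrow> (real \<times> 'a) covered_space"
  assume Xs: "\<forall>n. Xs n \<in> ?\<C>"
  have props: "covered_lorentzian_pre_length_space Z \<and> (\<forall>p. tsep (fst Z) p p = 0) \<and> snd Z 1 \<noteq> {} \<and>
      (\<forall>k\<ge>1. \<forall>l\<ge>1. \<exists>g. net_enumeration Z k l (net_size m M K N k l) g) \<and>
      (\<forall>k\<ge>1. \<forall>p\<in>snd Z k. \<forall>q\<in>snd Z k. tsep (fst Z) p q \<le> ennreal (M * (2 * real k / m)))"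
    if Z: "Z \<in> ?\<C>" for Z
  proof -
    obtain X U where XU: "Z = (X, U)" by (cases Z)
    from Z obtain Y f \<mm> t y where
      cov: "covered_lorentzian_pre_length_space (X, U)" and Y: "length_space Y" "continuous_on UNIV f" "\<And>s. m \<le> f s" "\<And>s. f s \<le> M"
        and X: "X = generalized_cone UNIV f Y"
      and hyp: "globally_hyperbolic X" and mm: "radon_measure (ltop X) \<mm>" "full_support (ltop X) \<mm>"
        "TMCP_e K N X \<mm>" "TMCP_e K N (causal_reversal X) \<mm>"
      and y: "(t, y) \<in> pts X" and U: "\<And>n. 1 \<le> n \<Longrightarrow> U n = chron_diamond X (t - real n, y) (t + real n, y)"
      unfolding XU by blast
    have pre: "lorentzian_pre_length_space X" using cov by (simp add: covered_lorentzian_pre_length_space_def)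
    interpret TMCP_cone f Y m M \<mm> K N
      using Y assms hyp mm pre unfolding X by unfold_locales auto
    have yY: "y \<in> mspace Y" using y by (simp add: X)
    have U': "U n = chron_diamond (generalized_cone UNIV f Y) (t - real n, y) (t + real n, y)" if "1 \<le> n" for n
      using U[OF that] unfolding X .
    have "(t, y) \<in> U 1"
      unfolding U'[OF order_refl] mem_diamond[OF yY] using yY mdist_zero[OF yY yY] by (simp del: mdist_zero)
    moreover have "tsep X p q \<le> ennreal (M * (2 * real k / m))" if k: "1 \<le> k" and "p \<in> U k" "q \<in> U k" for k p q
      using tsep_diamond_bound[OF yY _ that(2,3)[unfolded U'[OF k]]] unfolding X by simp
    moreover have "\<exists>g. net_enumeration (X, U) k l (net_size m M K N k l) g" if "1 \<le> k" "1 \<le> l" for k l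
      unfolding X by (rule uniform_net[OF yY that U'])
    moreover have "tsep X p p = 0" for p unfolding X by (rule tsep_self)
    ultimately show ?thesis using cov unfolding XU fst_conv snd_conv by blast
  qed
  \<comment> \<open>The bound for \<tau> is M times the conformal height of the k-th diamond, whose
    height in time is 2 k. Together with \<open>net_size\<close> it involves only constants of the
    class.\<close>
  interpret netted_sequence Xs "\<lambda>k l. net_size m M K N k l" "\<lambda>k. M * (2 * real k / m)"
  proof
    fix n
    note p = props[OF Xs[rule_format, of n]]
    show "covered_lorentzian_pre_length_space (Xs n)" using p by (rule conjunct1)
    show "tsep (fst (Xs n)) p p = 0" for p using p by blast
    show "snd (Xs n) 1 \<noteq> {}" using p by simp
    show "\<exists>g. net_enumeration (Xs n) k l (net_size m M K N k l) g" if "1 \<le> k" "1 \<le> l" for k l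
      using p that by simp
    show "tsep (fst (Xs n)) p q \<le> ennreal (M * (2 * real k / m))" if "1 \<le> k" "p \<in> snd (Xs n) k" "q \<in> snd (Xs n) k" for k p q
      using p that by simp
  qed
  show "\<exists>r. strict_mono r \<and> (\<exists>Z :: real covered_space. covered_lorentzian_pre_length_space Z \<and> LGH_converges (Xs \<circ> r) Z)"
    by (rule converging_subsequence)
qed

end
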